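(* The strategy $\mathfrak S$ terminates on every regularly nested schema; that is, for every regularly nested schema $S$, every derivation that starts from the tableau with single node $(S,\emptyset)$ and applies the rules according to $\mathfrak S$ (with the Looping rule instantiated by the relation $\sqsubset$ defined below) is finite.
   Context: Linear expressions are terms built from $0$, successor, $+$, $-$ and integer variables, modulo arithmetic identities; $k.e$ abbreviates $e+\dots+e$. Constraints are first-order formulas of linear integer arithmetic. A constraint $\varphi$ encloses $i$ if there are $e_1,e_2$ not containing $i$ with $\varphi\models e_1\le i\wedge i\le e_2$. Patterns: smallest set containing $\top,\bot$, indexed propositions $p_{e_1,\dots,e_k}$ and their negations, closed under $\wedge,\vee$ and iterations $\bigwedge_{i\mid\varphi}P$, $\bigvee_{i\mid\varphi}P$ ($\varphi$ a constraint enclosing $i$, called the domain; $i$ bound). Literals: indexed propositions and negations; $L^c$ is the complement. Parameters: free variables. A schema $S$ is a pair $P\wedge\varphi_S$ (pattern, constraint) with $\varphi_S$ entailing $n\ge0$ for each parameter, no variable bound twice or both bound and free; $S\wedge\psi$ has constraint $\varphi_S\wedge\psi$. Environments, realization $[S]_\rho$ (iterations expanded into propositional conjunctions/disjunctions over the integers satisfying the domain, $\top$/$\bot$ if empty), interpretations (environment + propositional interpretation) and models are as usual. $L$ always occurs (resp. may occur) in $S$ iff for every (resp. some) environment $\rho$ of $S$, $L\rho$ occurs not under negation in $[S]_\rho$. $L$ is pure in $S$ iff for every environment $\rho$ of $S$, $(L\rho)^c$ does not occur (not under negation) in $[S]_\rho$. $\mathrm{Ctx}(S)$: conjunction of $\varphi_S$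 and all iteration domains of $S$. $S[Q]$ marks an occurrence of $Q$, $S[Q']$ replaces it. $\circledast$ ranges over $\bigwedge$ ($\wedge$, neutral $\top$) and $\bigvee$ ($\vee$, $\bot$). Tableaux: nodes labelled $(S_\alpha,\Lambda_\alpha)$ (schema, finite set of literals), root $\Lambda=\emptyset$; $\bigwedge\Lambda$ is the conjunction of its literals; $\hat S_\alpha$ is the schema with pattern (pattern of $S_\alpha$)$\wedge\bigwedge\Lambda_\alpha$ and constraint $\varphi_{S_\alpha}$. A leaf is closed iff its pattern is $\bot$, its constraint is unsatisfiable, or it is closed by Looping. Rules (applied to a leaf): (Prop-split) $(S,\Lambda)\Rightarrow(S,\Lambda\cup\{p_{\vec e}\})\mid(S,\Lambda\cup\{\neg p_{\vec e}\})$ if $p_{\vec e}$ or $\neg p_{\vec e}$ always occurs in $S$ and neither may occur in $\bigwedge\Lambda\wedge\varphi_S$. (Constraint-split) $(S[\circledast_{i\mid\varphi}P],\Lambda)\Rightarrow(S[\circledast_{i\mid\varphi}P]\wedge\exists i\varphi,\Lambda)\mid(S[\text{neutral}]\wedge\forall i\neg\varphi,\Lambda)$ if $\varphi_S\wedge\forall i\neg\varphi$ satisfiable and the free variables of $\varphi$ other than $i$ are parameters. It is framed if $\circledast_{i\mid\varphi}P$ is framed (see below), non-framed otherwise. (Rewriting) same constraint and $\Lambda$; one subpattern (any position) rewritten by: Algebraic: $\neg\top\to\bot$, $\neg\bot\to\top$, $P\wedge\top\to P$, $P\wedge\bot\to\bot$, $P\vee\top\to\top$, $P\vee\bot\to P$,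 $P\wedge P\to P$, $P\vee P\to P$, $\bigwedge_{i\mid\varphi}\top\to\top$, $\bigvee_{i\mid\varphi}\bot\to\bot$; if $\mathrm{Ctx}(S_1)\wedge\exists i\varphi$ unsatisfiable, $\bigwedge_{i\mid\varphi}P\to\top$, $\bigvee_{i\mid\varphi}P\to\bot$; if $\mathrm{Ctx}(S_1)\Rightarrow\exists i\varphi$ valid and $i$ not in $P$, $\circledast_{i\mid\varphi}P\to P$ ($S_1$ being the schema rewritten). Unfolding: $\circledast_{i\mid\varphi}P\to P\{e/i\}\circ\circledast_{i\mid\varphi\wedge i\neq e}P$ if $\mathrm{Ctx}(S_1)\Rightarrow\varphi\{e/i\}$ valid. Emptiness: $\circledast_{i\mid\varphi}(P[\odot_{i'\mid\varphi'}P'])\to\circledast_{i\mid\varphi\wedge\exists i'\varphi'}(P[\odot_{i'\mid\varphi'}P'])\circ\circledast_{i\mid\varphi\wedge\forall i'\neg\varphi'}(P[\text{neutral of }\odot])$ if $\mathrm{Ctx}(S_1)\wedge\forall i'\neg\varphi'$ satisfiable and $i$ free in $\varphi'$. Prop-simplification: $p_{e_1..e_k}\to\bigwedge_{j\mid(e_1\neq f_1\vee\dots\vee e_k\neq f_k)\wedge j=0}p_{e_1..e_k}$ if $p_{f_1..f_k}\in\Lambda$, and likewise with $\bigvee$ if $\neg p_{f_1..f_k}\in\Lambda$, provided $\mathrm{Ctx}(S_1)\wedge\bigwedge_m e_m=f_m$ satisfiable ($j$ fresh). (Interval) for positive integers $k,l$, $\lhd\in\{<,\le,\ge,>\}$: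 $(S[\circledast_{i\mid\varphi\wedge k.i\lhd e_1\wedge l.i\lhd e_2}P],\Lambda)\Rightarrow(S[\circledast_{i\mid\varphi\wedge k.i\lhd e_1}P]\wedge l.e_1\lhd k.e_2,\Lambda)\mid(S[\circledast_{i\mid\varphi\wedge l.i\lhd e_2}P]\wedge\neg(l.e_1\lhd k.e_2),\Lambda)$, if free variables of $\varphi$ are $i$ or parameters and variables of $e_1,e_2$ are parameters. (Looping, refined) A leaf $\beta$ is closed if there is a node $\alpha$ of the tableau with $\hat S_\beta\sqsubset\hat S_\alpha$, where: $S_1\sqsubset S_2$ iff there exist a constraint-irredundant schema $S_1'$ of $\mathrm{pur}(S_1)$, a constraint-irredundant schema $S_2'$ of $\mathrm{pur}(S_2)$ and an integer $k>0$ with $S_1'=S_2'\{n-k/n\}$ syntactically ($n$ the parameter). Here $\mathrm{pur}(S)$ is $S$ with every literal pure in $S$ replaced (syntactically) by $\top$, and a constraint-irredundant schema of $S$ is any normal form of $S$ under the rules: a constraint $\varphi_1\wedge\dots\wedge\varphi_k$ rewrites to $\varphi_1\wedge\dots\wedge\varphi_{k-1}$ if $\{\varphi_1,\dots,\varphi_{k-1}\}\models\varphi_k$, and an unsatisfiable constraint rewrites to $\bot$. An iteration $\circledast_{i\mid\varphi}P$ is framed iff there are linear expressions $e_1,e_2$ with $\varphi\Leftrightarrow e_1\le i\wedge i\le e_2$; $[e_1..e_2]$ is its frame. A schema is monadic iff all its indexed propositions have exactly one index; framed iff all its iterations are framed; aligned on $[e_1..e_2]$ iff framed with all iterations having frame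 $[e_1..e_2]$; arithmetic iff for every variable $x$ occurring in it, every linear expression occurring in it and containing $x$ is of the form $x+k$ with $k\in\mathbb Z$. A schema is regularly nested iff it has a unique parameter $n$, is monadic, arithmetic, and aligned on $[k..n-l]$ for some $k,l\in\mathbb Z$. Strategy $\mathfrak S$: (1) apply only framed Constraint-split until irreducibility; (2) then apply all other rules except Unfolding until irreducibility, with the restriction that Prop-simplification rewrites $p_{e_1}$ only if $e_1$ contains no variable other than the parameter of the schema; (3) then apply only Unfolding until irreducibility, with the restriction that if the unfolded iteration is framed then $e$ is the upper bound of its frame; then go back to (1). The Looping rule is the refined one above.
   Formalization: Mended rules: Ctx has only φ_S and the enclosing domains; Unfolding needs a satisfiable context; Prop-split only on a proposition written in S; equality in ⊏ is up to equivalence of constraints and AC/idempotence of ∧,∨; occurrence of variables is semantic; Emptiness must be well scoped. *)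

theory Defs
  imports Main "HOL-Library.Multiset"
begin

section \<open>Linear expressions\<close>

datatype lterm = LZero | LSuc lterm | LAdd lterm lterm | LSub lterm lterm | LVar nat

primrec lt_eval :: "(nat \<Rightarrow> int) \<Rightarrow> lterm \<Rightarrow> int" where
  "lt_eval \<rho> LZero = 0"
| "lt_eval \<rho> (LSuc t) = lt_eval \<rho> t + 1"
| "lt_eval \<rho> (LAdd s t) = lt_eval \<rho> s + lt_eval \<rho> t"
| "lt_eval \<rho> (LSub s t) = lt_eval \<rho> s - lt_eval \<rho> t"
| "lt_eval \<rho> (LVar x) = \<rho> x"

primrec lt_subst :: "(nat \<Rightarrow> lterm) \<Rightarrow> lterm \<Rightarrow> lterm" where
  "lt_subst \<sigma> LZero = LZero"
| "lt_subst \<sigma> (LSuc t) = LSuc (lt_subst \<sigma> t)"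
| "lt_subst \<sigma> (LAdd s t) = LAdd (lt_subst \<sigma> s) (lt_subst \<sigma> t)"
| "lt_subst \<sigma> (LSub s t) = LSub (lt_subst \<sigma> s) (lt_subst \<sigma> t)"
| "lt_subst \<sigma> (LVar x) = \<sigma> x"

lemma lt_eval_subst: "lt_eval \<rho> (lt_subst \<sigma> t) = lt_eval (\<lambda>x. lt_eval \<rho> (\<sigma> x)) t"
  by (induction t) auto

text \<open>Linear expressions are terms modulo arithmetic identities.\<close>

quotient_type lexp = lterm / "\<lambda>s t. \<forall>\<rho>. lt_eval \<rho> s = lt_eval \<rho> t"
  by (rule equivpI) (auto simp: reflp_def symp_def transp_def)

lift_definition leval :: "(nat \<Rightarrow> int) \<Rightarrow> lexp \<Rightarrow> int" is lt_eval
  by simp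

lift_definition lsubst :: "(nat \<Rightarrow> lexp) \<Rightarrow> lexp \<Rightarrow> lexp" is lt_subst
  by (simp add: lt_eval_subst)

lift_definition lvar :: "nat \<Rightarrow> lexp" is LVar .

instantiation lexp :: "{zero, one, plus, minus}"
begin
lift_definition zero_lexp :: lexp is LZero .
lift_definition one_lexp :: lexp is "LSuc LZero" .
lift_definition plus_lexp :: "lexp \<Rightarrow> lexp \<Rightarrow> lexp" is LAdd by simp
lift_definition minus_lexp :: "lexp \<Rightarrow> lexp \<Rightarrow> lexp" is LSub by simp
instance ..
end

primrec lmult :: "nat \<Rightarrow> lexp \<Rightarrow> lexp" where
  "lmult 0 e = 0"
| "lmult (Suc k) e = e + lmult k e"

definition lconst :: "int \<Rightarrow> lexp" where
  "lconst c = lmult (nat c) 1 - lmult (nat (- c)) 1"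

text \<open>Occurrence of a variable has to respect arithmetic identities (the expression \<open>x - x\<close> does
  not contain \<open>x\<close>), so it is dependence of the value.\<close>

definition lvars :: "lexp \<Rightarrow> nat set" where
  "lvars e = {x. \<exists>\<rho> v. leval (\<rho>(x := v)) e \<noteq> leval \<rho> e}"

text \<open>Bound variables are de Bruijn indices, both for the quantifiers of constraints and for
  iterations: under a binder, index \<open>0\<close> is the variable bound there and \<open>Suc x\<close> is the variable
  called \<open>x\<close> outside. Hence no variable is bound twice or both bound and free, and
  patterns are identified up to renaming of bound variables.\<close>

definition up :: "nat \<Rightarrow> lexp \<Rightarrow> lexp" where
  "up d = lsubst (\<lambda>x. lvar (x + d))"

text \<open>\<open>down d\<close> leaves the scope of \<open>d\<close> binders. It is only applied to objects that do not contain the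
  \<open>d\<close> bound variables, so the value \<open>0\<close> chosen for them is irrelevant.\<close>

definition down :: "nat \<Rightarrow> nat \<Rightarrow> lexp" where
  "down d x = (if x < d then 0 else lvar (x - d))"

definition inst :: "lexp \<Rightarrow> nat \<Rightarrow> lexp" where
  "inst e = case_nat e lvar"

definition lift_sub :: "(nat \<Rightarrow> lexp) \<Rightarrow> nat \<Rightarrow> lexp" where
  "lift_sub \<sigma> = case_nat (lvar 0) (\<lambda>x. up 1 (\<sigma> x))"


section \<open>Constraints\<close>

datatype fml = FTrue | FFalse | Le lexp lexp | Lt lexp lexp | Eq lexp lexp
  | FNot fml | Conj fml fml | Disj fml fml | FEx fml | FAll fml

primrec sat :: "fml \<Rightarrow> (nat \<Rightarrow> int) \<Rightarrow> bool" where
  "sat FTrue \<rho> \<longleftrightarrow> True"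
| "sat FFalse \<rho> \<longleftrightarrow> False"
| "sat (Le a b) \<rho> \<longleftrightarrow> leval \<rho> a \<le> leval \<rho> b"
| "sat (Lt a b) \<rho> \<longleftrightarrow> leval \<rho> a < leval \<rho> b"
| "sat (Eq a b) \<rho> \<longleftrightarrow> leval \<rho> a = leval \<rho> b"
| "sat (FNot \<phi>) \<rho> \<longleftrightarrow> \<not> sat \<phi> \<rho>"
| "sat (Conj \<phi> \<psi>) \<rho> \<longleftrightarrow> sat \<phi> \<rho> \<and> sat \<psi> \<rho>"
| "sat (Disj \<phi> \<psi>) \<rho> \<longleftrightarrow> sat \<phi> \<rho> \<or> sat \<psi> \<rho>"
| "sat (FEx \<phi>) \<rho> \<longleftrightarrow> (\<exists>v. sat \<phi> (case_nat v \<rho>))"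
| "sat (FAll \<phi>) \<rho> \<longleftrightarrow> (\<forall>v. sat \<phi> (case_nat v \<rho>))"

primrec fsubst :: "(nat \<Rightarrow> lexp) \<Rightarrow> fml \<Rightarrow> fml" where
  "fsubst \<sigma> FTrue = FTrue"
| "fsubst \<sigma> FFalse = FFalse"
| "fsubst \<sigma> (Le a b) = Le (lsubst \<sigma> a) (lsubst \<sigma> b)"
| "fsubst \<sigma> (Lt a b) = Lt (lsubst \<sigma> a) (lsubst \<sigma> b)"
| "fsubst \<sigma> (Eq a b) = Eq (lsubst \<sigma> a) (lsubst \<sigma> b)"
| "fsubst \<sigma> (FNot \<phi>) = FNot (fsubst \<sigma> \<phi>)"
| "fsubst \<sigma> (Conj \<phi> \<psi>) = Conj (fsubst \<sigma> \<phi>) (fsubst \<sigma> \<psi>)"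
| "fsubst \<sigma> (Disj \<phi> \<psi>) = Disj (fsubst \<sigma> \<phi>) (fsubst \<sigma> \<psi>)"
| "fsubst \<sigma> (FEx \<phi>) = FEx (fsubst (lift_sub \<sigma>) \<phi>)"
| "fsubst \<sigma> (FAll \<phi>) = FAll (fsubst (lift_sub \<sigma>) \<phi>)"

primrec flexps :: "fml \<Rightarrow> lexp set" where
  "flexps FTrue = {}"
| "flexps FFalse = {}"
| "flexps (Le a b) = {a, b}"
| "flexps (Lt a b) = {a, b}"
| "flexps (Eq a b) = {a, b}"
| "flexps (FNot \<phi>) = flexps \<phi>"
| "flexps (Conj \<phi> \<psi>) = flexps \<phi> \<union> flexps \<psi>"
| "flexps (Disj \<phi> \<psi>) = flexps \<phi> \<union> flexps \<psi>"
| "flexps (FEx \<phi>) = flexps \<phi>"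
| "flexps (FAll \<phi>) = flexps \<phi>"

definition fshift :: "fml \<Rightarrow> fml" where
  "fshift = fsubst (\<lambda>x. lvar (Suc x))"

definition satisfiable :: "fml \<Rightarrow> bool" where
  "satisfiable \<phi> \<longleftrightarrow> (\<exists>\<rho>. sat \<phi> \<rho>)"

definition entails :: "fml \<Rightarrow> fml \<Rightarrow> bool" where
  "entails \<phi> \<psi> \<longleftrightarrow> (\<forall>\<rho>. sat \<phi> \<rho> \<longrightarrow> sat \<psi> \<rho>)"

definition equivalent :: "fml \<Rightarrow> fml \<Rightarrow> bool" where
  "equivalent \<phi> \<psi> \<longleftrightarrow> (\<forall>\<rho>. sat \<phi> \<rho> \<longleftrightarrow> sat \<psi> \<rho>)"

text \<open>As for linear expressions, the free variables of a constraint are those on which it depends: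
  a vacuous mention as in \<open>i = i\<close> does not count.\<close>

definition ffree :: "fml \<Rightarrow> nat set" where
  "ffree \<phi> = {x. \<exists>\<rho> v. sat \<phi> (\<rho>(x := v)) \<noteq> sat \<phi> \<rho>}"

fun conjuncts :: "fml \<Rightarrow> fml multiset" where
  "conjuncts (Conj \<phi> \<psi>) = conjuncts \<phi> + conjuncts \<psi>"
| "conjuncts \<phi> = {#\<phi>#}"

fun fconj :: "fml list \<Rightarrow> fml" where
  "fconj [] = FTrue"
| "fconj [\<phi>] = \<phi>"
| "fconj (\<phi> # \<phi>s) = Conj \<phi> (fconj \<phi>s)"

fun fdisj :: "fml list \<Rightarrow> fml" where
  "fdisj [] = FFalse"
| "fdisj [\<phi>] = \<phi>"
| "fdisj (\<phi> # \<phi>s) = Disj \<phi> (fdisj \<phi>s)"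

text \<open>The domain of an iteration is a constraint in which index \<open>0\<close> is the iteration variable; the
  frame bounds live outside that binder and so cannot contain it.\<close>

definition encloses :: "fml \<Rightarrow> bool" where
  "encloses \<phi> \<longleftrightarrow>
    (\<exists>e1 e2. entails \<phi> (Conj (Le (up 1 e1) (lvar 0)) (Le (lvar 0) (up 1 e2))))"

definition has_frame :: "fml \<Rightarrow> lexp \<Rightarrow> lexp \<Rightarrow> bool" where
  "has_frame \<phi> e1 e2 \<longleftrightarrow>
    equivalent \<phi> (Conj (Le (up 1 e1) (lvar 0)) (Le (lvar 0) (up 1 e2)))"

definition framed_dom :: "fml \<Rightarrow> bool" where
  "framed_dom \<phi> \<longleftrightarrow> (\<exists>e1 e2. has_frame \<phi> e1 e2)"


section \<open>Patterns and schemata\<close>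

datatype iter_op = BigAnd | BigOr

text \<open>Negation is a constructor of its own because rewriting an indexed proposition below a negation
  yields a negated iteration (removed again by the rules for negated truth constants). The patterns
  one starts with satisfy \<open>is_pattern\<close> below.\<close>

datatype 'p pat = PTop | PBot | Atom 'p "lexp list" | PNeg "'p pat"
  | PAnd "'p pat" "'p pat" | POr "'p pat" "'p pat" | Iter iter_op fml "'p pat"

fun is_pattern :: "'p pat \<Rightarrow> bool" where
  "is_pattern PTop \<longleftrightarrow> True"
| "is_pattern PBot \<longleftrightarrow> True"
| "is_pattern (Atom p es) \<longleftrightarrow> True"
| "is_pattern (PNeg P) \<longleftrightarrow> (\<exists>p es. P = Atom p es)"
| "is_pattern (PAnd P Q) \<longleftrightarrow> is_pattern P \<and> is_pattern Q"
| "is_pattern (POr P Q) \<longleftrightarrow> is_pattern P \<and> is_pattern Q"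
| "is_pattern (Iter q \<phi> P) \<longleftrightarrow> encloses \<phi> \<and> is_pattern P"

primrec neutral :: "iter_op \<Rightarrow> 'p pat" where
  "neutral BigAnd = PTop"
| "neutral BigOr = PBot"

primrec comb :: "iter_op \<Rightarrow> 'p pat \<Rightarrow> 'p pat \<Rightarrow> 'p pat" where
  "comb BigAnd = PAnd"
| "comb BigOr = POr"

primrec psubst :: "'p pat \<Rightarrow> (nat \<Rightarrow> lexp) \<Rightarrow> 'p pat" where
  "psubst PTop \<sigma> = PTop"
| "psubst PBot \<sigma> = PBot"
| "psubst (Atom p es) \<sigma> = Atom p (map (lsubst \<sigma>) es)"
| "psubst (PNeg P) \<sigma> = PNeg (psubst P \<sigma>)"
| "psubst (PAnd P Q) \<sigma> = PAnd (psubst P \<sigma>) (psubst Q \<sigma>)"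
| "psubst (POr P Q) \<sigma> = POr (psubst P \<sigma>) (psubst Q \<sigma>)"
| "psubst (Iter q \<phi> P) \<sigma> = Iter q (fsubst (lift_sub \<sigma>) \<phi>) (psubst P (lift_sub \<sigma>))"

primrec pfree :: "'p pat \<Rightarrow> nat set" where
  "pfree PTop = {}"
| "pfree PBot = {}"
| "pfree (Atom p es) = (\<Union>e\<in>set es. lvars e)"
| "pfree (PNeg P) = pfree P"
| "pfree (PAnd P Q) = pfree P \<union> pfree Q"
| "pfree (POr P Q) = pfree P \<union> pfree Q"
| "pfree (Iter q \<phi> P) = {x. Suc x \<in> ffree \<phi> \<union> pfree P}"

type_synonym 'p schema = "'p pat \<times> fml"

definition params :: "'p schema \<Rightarrow> nat set" where
  "params S = pfree (fst S) \<union> ffree (snd S)"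

definition is_schema :: "'p schema \<Rightarrow> bool" where
  "is_schema S \<longleftrightarrow> is_pattern (fst S) \<and> (\<forall>n\<in>params S. entails (snd S) (Le 0 (lvar n)))"

text \<open>The variables in \<open>X\<close>, seen below \<open>d\<close> iteration binders, are all parameters of \<open>S\<close>.\<close>

definition only_params :: "'p schema \<Rightarrow> nat \<Rightarrow> nat set \<Rightarrow> bool" where
  "only_params S d X \<longleftrightarrow> (\<forall>x\<in>X. d \<le> x \<and> x - d \<in> params S)"


section \<open>Realization and occurrence of literals\<close>

datatype ('p, 'e) lit = LPos 'p "'e list" | LNeg 'p "'e list"

primrec lcompl :: "('p, 'e) lit \<Rightarrow> ('p, 'e) lit" where
  "lcompl (LPos p es) = LNeg p es"
| "lcompl (LNeg p es) = LPos p es"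

definition ground :: "(nat \<Rightarrow> int) \<Rightarrow> ('p, lexp) lit \<Rightarrow> ('p, int) lit" where
  "ground \<rho> = map_lit id (leval \<rho>)"

datatype 'p gprop = TT | FF | GAtom 'p "int list" | GNeg "'p gprop"
  | GAnd "'p gprop" "'p gprop" | GOr "'p gprop" "'p gprop"

fun gbig :: "iter_op \<Rightarrow> 'p gprop list \<Rightarrow> 'p gprop" where
  "gbig BigAnd [] = TT"
| "gbig BigOr [] = FF"
| "gbig q [A] = A"
| "gbig BigAnd (A # B # As) = GAnd A (gbig BigAnd (B # As))"
| "gbig BigOr (A # B # As) = GOr A (gbig BigOr (B # As))"

primrec realize :: "'p pat \<Rightarrow> (nat \<Rightarrow> int) \<Rightarrow> 'p gprop" where
  "realize PTop \<rho> = TT"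
| "realize PBot \<rho> = FF"
| "realize (Atom p es) \<rho> = GAtom p (map (leval \<rho>) es)"
| "realize (PNeg P) \<rho> = GNeg (realize P \<rho>)"
| "realize (PAnd P Q) \<rho> = GAnd (realize P \<rho>) (realize Q \<rho>)"
| "realize (POr P Q) \<rho> = GOr (realize P \<rho>) (realize Q \<rho>)"
| "realize (Iter q \<phi> P) \<rho> =
     gbig q (map (\<lambda>v. realize P (case_nat v \<rho>)) (sorted_list_of_set {v. sat \<phi> (case_nat v \<rho>)}))"

text \<open>The literals occurring not under negation.\<close>

fun glits :: "'p gprop \<Rightarrow> ('p, int) lit set" where
  "glits (GAtom p vs) = {LPos p vs}"
| "glits (GNeg (GAtom p vs)) = {LNeg p vs}"
| "glits (GAnd A B) = glits A \<union> glits B"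
| "glits (GOr A B) = glits A \<union> glits B"
| "glits _ = {}"

definition always_occurs :: "('p, lexp) lit \<Rightarrow> 'p schema \<Rightarrow> bool" where
  "always_occurs L S \<longleftrightarrow> (\<forall>\<rho>. sat (snd S) \<rho> \<longrightarrow> ground \<rho> L \<in> glits (realize (fst S) \<rho>))"

definition may_occur :: "('p, lexp) lit \<Rightarrow> 'p schema \<Rightarrow> bool" where
  "may_occur L S \<longleftrightarrow> (\<exists>\<rho>. sat (snd S) \<rho> \<and> ground \<rho> L \<in> glits (realize (fst S) \<rho>))"

text \<open>Purity of a literal that stands below \<open>d\<close> iteration binders: \<open>\<eta>\<close> extends the environment
  \<open>\<lambda>x. \<eta> (x + d)\<close> of \<open>S\<close> by arbitrary values of the bound variables.\<close>

definition pure_lit :: "'p schema \<Rightarrow> nat \<Rightarrow> ('p, lexp) lit \<Rightarrow> bool" where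
  "pure_lit S d L \<longleftrightarrow> (\<forall>\<eta>. sat (snd S) (\<lambda>x. \<eta> (x + d)) \<longrightarrow>
     lcompl (ground \<eta> L) \<notin> glits (realize (fst S) (\<lambda>x. \<eta> (x + d))))"

fun pur_pat :: "'p schema \<Rightarrow> nat \<Rightarrow> 'p pat \<Rightarrow> 'p pat" where
  "pur_pat S d PTop = PTop"
| "pur_pat S d PBot = PBot"
| "pur_pat S d (Atom p es) = (if pure_lit S d (LPos p es) then PTop else Atom p es)"
| "pur_pat S d (PNeg (Atom p es)) = (if pure_lit S d (LNeg p es) then PTop else PNeg (Atom p es))"
| "pur_pat S d (PNeg P) = PNeg P"
| "pur_pat S d (PAnd P Q) = PAnd (pur_pat S d P) (pur_pat S d Q)"
| "pur_pat S d (POr P Q) = POr (pur_pat S d P) (pur_pat S d Q)"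
| "pur_pat S d (Iter q \<phi> P) = Iter q \<phi> (pur_pat S (Suc d) P)"

definition pur :: "'p schema \<Rightarrow> 'p schema" where
  "pur S = (pur_pat S 0 (fst S), snd S)"


section \<open>Occurrences of subpatterns\<close>

datatype 'p pctx = Hole | CNeg "'p pctx"
  | CAndL "'p pctx" "'p pat" | CAndR "'p pat" "'p pctx"
  | COrL "'p pctx" "'p pat" | COrR "'p pat" "'p pctx"
  | CIter iter_op fml "'p pctx"

primrec plug :: "'p pctx \<Rightarrow> 'p pat \<Rightarrow> 'p pat" where
  "plug Hole R = R"
| "plug (CNeg C) R = PNeg (plug C R)"
| "plug (CAndL C Q) R = PAnd (plug C R) Q"
| "plug (CAndR P C) R = PAnd P (plug C R)"
| "plug (COrL C Q) R = POr (plug C R) Q"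
| "plug (COrR P C) R = POr P (plug C R)"
| "plug (CIter q \<phi> C) R = Iter q \<phi> (plug C R)"

primrec depth :: "'p pctx \<Rightarrow> nat" where
  "depth Hole = 0"
| "depth (CNeg C) = depth C"
| "depth (CAndL C Q) = depth C"
| "depth (CAndR P C) = depth C"
| "depth (COrL C Q) = depth C"
| "depth (COrR P C) = depth C"
| "depth (CIter q \<phi> C) = Suc (depth C)"

text \<open>The constraint context of the hole: \<open>\<phi>\<close> together with the domains of the iterations in whose
  scope the hole lies, as a constraint over the variables visible at the hole. The rewritten
  iteration itself does not contribute its own domain: otherwise every iteration could be treated
  as nonempty and unfolded forever.\<close>

primrec ctx_cons :: "'p pctx \<Rightarrow> fml \<Rightarrow> fml" where
  "ctx_cons Hole \<phi> = \<phi>"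
| "ctx_cons (CNeg C) \<phi> = ctx_cons C \<phi>"
| "ctx_cons (CAndL C Q) \<phi> = ctx_cons C \<phi>"
| "ctx_cons (CAndR P C) \<phi> = ctx_cons C \<phi>"
| "ctx_cons (COrL C Q) \<phi> = ctx_cons C \<phi>"
| "ctx_cons (COrR P C) \<phi> = ctx_cons C \<phi>"
| "ctx_cons (CIter q \<psi> C) \<phi> = ctx_cons C (Conj (fshift \<phi>) \<psi>)"


section \<open>Extension rules\<close>

type_synonym 'p label = "'p schema \<times> ('p, lexp) lit set"

primrec lit_pat :: "('p, lexp) lit \<Rightarrow> 'p pat" where
  "lit_pat (LPos p es) = Atom p es"
| "lit_pat (LNeg p es) = PNeg (Atom p es)"

fun pand :: "'p pat list \<Rightarrow> 'p pat" where
  "pand [] = PTop"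
| "pand [P] = P"
| "pand (P # Ps) = PAnd P (pand Ps)"

definition lits_pat :: "('p, lexp) lit set \<Rightarrow> 'p pat" where
  "lits_pat \<Lambda> = pand (map lit_pat (SOME Ls. distinct Ls \<and> set Ls = \<Lambda>))"

definition hat :: "'p label \<Rightarrow> 'p schema" where
  "hat l = (case l of ((P, \<phi>), \<Lambda>) \<Rightarrow> (PAnd P (lits_pat \<Lambda>), \<phi>))"

text \<open>Besides always occurring, the indexed proposition has to be one that is written in the schema:
  an instance such as \<open>p\<^sub>0\<close> of the body of an iteration over \<open>p\<^sub>i\<close> is no occurrence of \<open>p\<^sub>0\<close>.
  Otherwise \<open>p\<^sub>0\<close>, \<open>p\<^sub>1\<close>, \<open>p\<^sub>2\<close>, ... could be split on successively, as Prop-simplification of \<open>p\<^sub>n\<close>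
  against them keeps raising the lower bound of \<open>n\<close>.\<close>

inductive prop_split :: "'p label \<Rightarrow> 'p label list \<Rightarrow> bool" where
  "\<lbrakk>P = plug C (Atom p (map (up (depth C)) es));
    always_occurs (LPos p es) (P, \<phi>) \<or> always_occurs (LNeg p es) (P, \<phi>);
    \<not> may_occur (LPos p es) (lits_pat \<Lambda>, \<phi>); \<not> may_occur (LNeg p es) (lits_pat \<Lambda>, \<phi>)\<rbrakk>
   \<Longrightarrow> prop_split ((P, \<phi>), \<Lambda>)
         [((P, \<phi>), insert (LPos p es) \<Lambda>), ((P, \<phi>), insert (LNeg p es) \<Lambda>)]"

inductive constraint_split :: "bool \<Rightarrow> 'p label \<Rightarrow> 'p label list \<Rightarrow> bool" for fr where
  "\<lbrakk>P = plug C (Iter q \<psi> Q); d = depth C; fr = framed_dom \<psi>;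
    \<epsilon> = fsubst (down d) (FAll (FNot \<psi>));
    satisfiable (Conj \<phi> \<epsilon>);
    only_params (P, \<phi>) (Suc d) (ffree \<psi> - {0})\<rbrakk>
   \<Longrightarrow> constraint_split fr ((P, \<phi>), \<Lambda>)
         [((P, Conj \<phi> (fsubst (down d) (FEx \<psi>))), \<Lambda>),
          ((plug C (neutral q), Conj \<phi> \<epsilon>), \<Lambda>)]"

text \<open>In the rewrite rules \<open>\<gamma>\<close> is the constraint context of the rewritten occurrence.\<close>

inductive algebraic :: "fml \<Rightarrow> 'p pat \<Rightarrow> 'p pat \<Rightarrow> bool" for \<gamma> where
  "algebraic \<gamma> (PNeg PTop) PBot"
| "algebraic \<gamma> (PNeg PBot) PTop"
| "algebraic \<gamma> (PAnd P PTop) P"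
| "algebraic \<gamma> (PAnd PTop P) P"
| "algebraic \<gamma> (PAnd P PBot) PBot"
| "algebraic \<gamma> (PAnd PBot P) PBot"
| "algebraic \<gamma> (POr P PTop) PTop"
| "algebraic \<gamma> (POr PTop P) PTop"
| "algebraic \<gamma> (POr P PBot) P"
| "algebraic \<gamma> (POr PBot P) P"
| "algebraic \<gamma> (PAnd P P) P"
| "algebraic \<gamma> (POr P P) P"
| "algebraic \<gamma> (Iter q \<phi> (neutral q)) (neutral q)"
| "\<not> satisfiable (Conj \<gamma> (FEx \<phi>)) \<Longrightarrow> algebraic \<gamma> (Iter q \<phi> P) (neutral q)"
| "\<lbrakk>entails \<gamma> (FEx \<phi>); 0 \<notin> pfree P\<rbrakk> \<Longrightarrow> algebraic \<gamma> (Iter q \<phi> P) (psubst P (down 1))"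

text \<open>The context must be consistent: otherwise every iteration below an iteration with an empty
  domain could be unfolded forever. The last premise is the restriction imposed by the
  strategy.\<close>

inductive unfold_iter :: "fml \<Rightarrow> 'p pat \<Rightarrow> 'p pat \<Rightarrow> bool" for \<gamma> where
  "\<lbrakk>satisfiable \<gamma>; entails \<gamma> (fsubst (inst e) \<phi>);
    framed_dom \<phi> \<longrightarrow> (\<exists>e1. has_frame \<phi> e1 e)\<rbrakk>
   \<Longrightarrow> unfold_iter \<gamma> (Iter q \<phi> P)
         (comb q (psubst P (inst e)) (Iter q (Conj \<phi> (FNot (Eq (lvar 0) (up 1 e)))) P))"

text \<open>The last premise says that \<open>\<phi>'\<close> contains none of the variables bound between the two
  iterations, so that it can be moved to the domain of the outer one.\<close>

inductive emptiness :: "fml \<Rightarrow> 'p pat \<Rightarrow> 'p pat \<Rightarrow> bool" for \<gamma> where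
  "\<lbrakk>d = depth C;
    satisfiable (Conj (ctx_cons C (Conj (fshift \<gamma>) \<phi>)) (FAll (FNot \<phi>')));
    Suc d \<in> ffree \<phi>';
    \<forall>x. Suc x \<in> ffree \<phi>' \<longrightarrow> d \<le> x\<rbrakk>
   \<Longrightarrow> emptiness \<gamma> (Iter q \<phi> (plug C (Iter q' \<phi>' P')))
         (comb q
           (Iter q (Conj \<phi> (fsubst (down d) (FEx \<phi>'))) (plug C (Iter q' \<phi>' P')))
           (Iter q (Conj \<phi> (fsubst (down d) (FAll (FNot \<phi>')))) (plug C (neutral q'))))"

text \<open>\<open>fs\<close> are the indices of the literal of \<open>\<Lambda>\<close>, already moved to the scope of the rewritten
  indexed proposition.\<close>

definition simp_iter :: "iter_op \<Rightarrow> 'p \<Rightarrow> lexp list \<Rightarrow> lexp list \<Rightarrow> 'p pat" where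
  "simp_iter q p es fs =
     Iter q (Conj (fdisj (map2 (\<lambda>e f. FNot (Eq (up 1 e) (up 1 f))) es fs)) (Eq (lvar 0) 0))
       (Atom p (map (up 1) es))"

inductive prop_simp ::
  "('p, lexp) lit set \<Rightarrow> nat \<Rightarrow> fml \<Rightarrow> 'p pat \<Rightarrow> 'p pat \<Rightarrow> bool" for \<Lambda> d \<gamma> where
  "\<lbrakk>LPos p fs \<in> \<Lambda>; length es = length fs; fs' = map (up d) fs;
    satisfiable (Conj \<gamma> (fconj (map2 Eq es fs')))\<rbrakk>
   \<Longrightarrow> prop_simp \<Lambda> d \<gamma> (Atom p es) (simp_iter BigAnd p es fs')"
| "\<lbrakk>LNeg p fs \<in> \<Lambda>; length es = length fs; fs' = map (up d) fs;
    satisfiable (Conj \<gamma> (fconj (map2 Eq es fs')))\<rbrakk>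
   \<Longrightarrow> prop_simp \<Lambda> d \<gamma> (Atom p es) (simp_iter BigOr p es fs')"

text \<open>Rewriting other than Unfolding, with the strategy's restriction of Prop-simplification to
  indices without variables other than parameters.\<close>

inductive rewriting :: "'p label \<Rightarrow> 'p label list \<Rightarrow> bool" where
  "algebraic (ctx_cons C \<phi>) P Q
   \<Longrightarrow> rewriting ((plug C P, \<phi>), \<Lambda>) [((plug C Q, \<phi>), \<Lambda>)]"
| "emptiness (ctx_cons C \<phi>) P Q
   \<Longrightarrow> rewriting ((plug C P, \<phi>), \<Lambda>) [((plug C Q, \<phi>), \<Lambda>)]"
| "\<lbrakk>prop_simp \<Lambda> (depth C) (ctx_cons C \<phi>) P Q;
    only_params (plug C P, \<phi>) (depth C) (pfree P)\<rbrakk>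
   \<Longrightarrow> rewriting ((plug C P, \<phi>), \<Lambda>) [((plug C Q, \<phi>), \<Lambda>)]"

inductive unfolding_rule :: "'p label \<Rightarrow> 'p label list \<Rightarrow> bool" where
  "unfold_iter (ctx_cons C \<phi>) P Q
   \<Longrightarrow> unfolding_rule ((plug C P, \<phi>), \<Lambda>) [((plug C Q, \<phi>), \<Lambda>)]"

datatype cmp = CLt | CLe | CGe | CGt

primrec cmp_fml :: "cmp \<Rightarrow> lexp \<Rightarrow> lexp \<Rightarrow> fml" where
  "cmp_fml CLt a b = Lt a b"
| "cmp_fml CLe a b = Le a b"
| "cmp_fml CGe a b = Le b a"
| "cmp_fml CGt a b = Lt b a"

text \<open>Conjunctions in domains are read modulo associativity and commutativity; \<open>M\<close> collects the
  remaining conjuncts. The bounds \<open>e1\<close> and \<open>e2\<close> contain only parameters and are given at top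
  level.\<close>

inductive interval :: "'p label \<Rightarrow> 'p label list \<Rightarrow> bool" where
  "\<lbrakk>P = plug C (Iter q \<psi> Q); d = Suc (depth C); k > 0; l > 0;
    A = cmp_fml c (lmult k (lvar 0)) (up d e1);
    B = cmp_fml c (lmult l (lvar 0)) (up d e2);
    conjuncts \<psi> = M + {#A, B#};
    conjuncts \<psi>1 = M + {#A#}; conjuncts \<psi>2 = M + {#B#};
    \<forall>\<chi>\<in>#M. only_params (P, \<phi>) d (ffree \<chi> - {0});
    lvars e1 \<subseteq> params (P, \<phi>); lvars e2 \<subseteq> params (P, \<phi>);
    \<theta> = cmp_fml c (lmult l e1) (lmult k e2)\<rbrakk>
   \<Longrightarrow> interval ((P, \<phi>), \<Lambda>)
         [((plug C (Iter q \<psi>1 Q), Conj \<phi> \<theta>), \<Lambda>),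
          ((plug C (Iter q \<psi>2 Q), Conj \<phi> (FNot \<theta>)), \<Lambda>)]"


section \<open>Looping\<close>

inductive cons_red :: "fml \<Rightarrow> fml \<Rightarrow> bool" where
  "\<lbrakk>conjuncts \<phi> = add_mset \<chi> (conjuncts \<phi>'); entails \<phi>' \<chi>\<rbrakk> \<Longrightarrow> cons_red \<phi> \<phi>'"
| "\<lbrakk>\<not> satisfiable \<phi>; \<phi> \<noteq> FFalse\<rbrakk> \<Longrightarrow> cons_red \<phi> FFalse"

inductive schema_red :: "'p schema \<Rightarrow> 'p schema \<Rightarrow> bool" where
  "cons_red \<phi> \<phi>' \<Longrightarrow> schema_red (P, \<phi>) (P, \<phi>')"
| "cons_red \<psi> \<psi>' \<Longrightarrow> schema_red (plug C (Iter q \<psi> Q), \<phi>) (plug C (Iter q \<psi>' Q), \<phi>)"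

definition irredundant_of :: "'p schema \<Rightarrow> 'p schema \<Rightarrow> bool" where
  "irredundant_of S S' \<longleftrightarrow> schema_red\<^sup>*\<^sup>* S S' \<and> (\<nexists>S''. schema_red S' S'')"

text \<open>Syntactic identity of schemata. Like linear expressions, constraints are identified when they
  are arithmetically equivalent (Unfolding turns a domain \<open>i \<le> n\<close> into \<open>i \<le> n \<and> i \<noteq> n\<close>, never
  into \<open>i \<le> n - 1\<close>), and finite conjunctions and disjunctions are those of sets of patterns.\<close>

inductive pat_eq :: "'p pat \<Rightarrow> 'p pat \<Rightarrow> bool" where
  refl: "pat_eq P P"
| sym: "pat_eq P Q \<Longrightarrow> pat_eq Q P"
| trans: "pat_eq P Q \<Longrightarrow> pat_eq Q R \<Longrightarrow> pat_eq P R"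
| and_assoc: "pat_eq (PAnd (PAnd P Q) R) (PAnd P (PAnd Q R))"
| and_comm: "pat_eq (PAnd P Q) (PAnd Q P)"
| and_idem: "pat_eq (PAnd P P) P"
| or_assoc: "pat_eq (POr (POr P Q) R) (POr P (POr Q R))"
| or_comm: "pat_eq (POr P Q) (POr Q P)"
| or_idem: "pat_eq (POr P P) P"
| neg: "pat_eq P P' \<Longrightarrow> pat_eq (PNeg P) (PNeg P')"
| conj: "pat_eq P P' \<Longrightarrow> pat_eq Q Q' \<Longrightarrow> pat_eq (PAnd P Q) (PAnd P' Q')"
| disj: "pat_eq P P' \<Longrightarrow> pat_eq Q Q' \<Longrightarrow> pat_eq (POr P Q) (POr P' Q')"
| iter: "equivalent \<phi> \<phi>' \<Longrightarrow> pat_eq P P' \<Longrightarrow> pat_eq (Iter q \<phi> P) (Iter q \<phi>' P')"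

definition schema_eq :: "'p schema \<Rightarrow> 'p schema \<Rightarrow> bool" where
  "schema_eq S T \<longleftrightarrow> pat_eq (fst S) (fst T) \<and> equivalent (snd S) (snd T)"

definition shift_param :: "nat \<Rightarrow> int \<Rightarrow> 'p schema \<Rightarrow> 'p schema" where
  "shift_param n k S =
     (let \<sigma> = lvar(n := lvar n - lconst k) in (psubst (fst S) \<sigma>, fsubst \<sigma> (snd S)))"

definition loops_on :: "'p schema \<Rightarrow> 'p schema \<Rightarrow> bool" (infix \<open>\<sqsubset>\<^sub>l\<close> 50) where
  "S1 \<sqsubset>\<^sub>l S2 \<longleftrightarrow> (\<exists>n S1' S2' k. params S1 = {n} \<and> params S2 = {n} \<and>
     irredundant_of (pur S1) S1' \<and> irredundant_of (pur S2) S2' \<and>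
     k > 0 \<and> schema_eq S1' (shift_param n k S2'))"


section \<open>Tableaux and the strategy\<close>

text \<open>\<open>Looped\<close> is a leaf that has been closed by the Looping rule.\<close>

datatype 'p tableau = Leaf "'p label" | Looped "'p label" | Inner "'p label" "'p tableau list"

fun labels :: "'p tableau \<Rightarrow> 'p label set" where
  "labels (Leaf l) = {l}"
| "labels (Looped l) = {l}"
| "labels (Inner l ts) = insert l (\<Union>t\<in>set ts. labels t)"

definition closed_label :: "'p label \<Rightarrow> bool" where
  "closed_label l \<longleftrightarrow> fst (fst l) = PBot \<or> \<not> satisfiable (snd (fst l))"

datatype phase = Phase1 | Phase2 | Phase3

primrec next_phase :: "phase \<Rightarrow> phase" where
  "next_phase Phase1 = Phase2"
| "next_phase Phase2 = Phase3"
| "next_phase Phase3 = Phase1"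

primrec phase_rule :: "phase \<Rightarrow> 'p label \<Rightarrow> 'p label list \<Rightarrow> bool" where
  "phase_rule Phase1 l ls \<longleftrightarrow> constraint_split True l ls"
| "phase_rule Phase2 l ls \<longleftrightarrow>
     prop_split l ls \<or> constraint_split False l ls \<or> rewriting l ls \<or> interval l ls"
| "phase_rule Phase3 l ls \<longleftrightarrow> unfolding_rule l ls"

text \<open>\<open>N\<close> is the set of labels of all nodes of the tableau.\<close>

inductive apply_at_leaf ::
  "phase \<Rightarrow> 'p label set \<Rightarrow> 'p tableau \<Rightarrow> 'p tableau \<Rightarrow> bool" for ph N where
  expand: "\<lbrakk>\<not> closed_label l; phase_rule ph l ls\<rbrakk>
     \<Longrightarrow> apply_at_leaf ph N (Leaf l) (Inner l (map Leaf ls))"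
| looping: "\<lbrakk>\<not> closed_label l; ph = Phase2; l' \<in> N; hat l \<sqsubset>\<^sub>l hat l'\<rbrakk>
     \<Longrightarrow> apply_at_leaf ph N (Leaf l) (Looped l)"
| inner: "apply_at_leaf ph N t t'
     \<Longrightarrow> apply_at_leaf ph N (Inner l (ts @ t # us)) (Inner l (ts @ t' # us))"

definition apply_phase :: "phase \<Rightarrow> 'p tableau \<Rightarrow> 'p tableau \<Rightarrow> bool" where
  "apply_phase ph T T' \<longleftrightarrow> apply_at_leaf ph (labels T) T T'"

definition irreducible_in :: "phase \<Rightarrow> 'p tableau \<Rightarrow> bool" where
  "irreducible_in ph T \<longleftrightarrow> (\<nexists>T'. apply_phase ph T T')"

text \<open>Every step applies one rule; a phase is left only when the tableau is irreducible in it, and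
  phases in which the tableau is irreducible from the outset are skipped.\<close>

inductive strategy_step :: "phase \<times> 'p tableau \<Rightarrow> phase \<times> 'p tableau \<Rightarrow> bool" where
  stay: "apply_phase ph T T' \<Longrightarrow> strategy_step (ph, T) (ph, T')"
| switch: "\<lbrakk>irreducible_in ph T; ph' = next_phase ph; apply_phase ph' T T'\<rbrakk>
     \<Longrightarrow> strategy_step (ph, T) (ph', T')"
| switch2: "\<lbrakk>irreducible_in ph T; irreducible_in (next_phase ph) T;
      ph' = next_phase (next_phase ph); apply_phase ph' T T'\<rbrakk>
     \<Longrightarrow> strategy_step (ph, T) (ph', T')"

definition infinite_derivation :: "'p schema \<Rightarrow> (nat \<Rightarrow> phase \<times> 'p tableau) \<Rightarrow> bool" where
  "infinite_derivation S D \<longleftrightarrow>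
     D 0 = (Phase1, Leaf (S, {})) \<and> (\<forall>i. strategy_step (D i) (D (Suc i)))"


section \<open>Regularly nested schemata\<close>

primrec monadic :: "'p pat \<Rightarrow> bool" where
  "monadic PTop \<longleftrightarrow> True"
| "monadic PBot \<longleftrightarrow> True"
| "monadic (Atom p es) \<longleftrightarrow> length es = 1"
| "monadic (PNeg P) \<longleftrightarrow> monadic P"
| "monadic (PAnd P Q) \<longleftrightarrow> monadic P \<and> monadic Q"
| "monadic (POr P Q) \<longleftrightarrow> monadic P \<and> monadic Q"
| "monadic (Iter q \<phi> P) \<longleftrightarrow> monadic P"

primrec plexps :: "'p pat \<Rightarrow> lexp set" where
  "plexps PTop = {}"
| "plexps PBot = {}"
| "plexps (Atom p es) = set es"
| "plexps (PNeg P) = plexps P"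
| "plexps (PAnd P Q) = plexps P \<union> plexps Q"
| "plexps (POr P Q) = plexps P \<union> plexps Q"
| "plexps (Iter q \<phi> P) = flexps \<phi> \<union> plexps P"

definition arithmetic :: "'p schema \<Rightarrow> bool" where
  "arithmetic S \<longleftrightarrow>
     (\<forall>e \<in> plexps (fst S) \<union> flexps (snd S). \<forall>x\<in>lvars e. \<exists>k. e = lvar x + lconst k)"

primrec aligned_on :: "'p pat \<Rightarrow> lexp \<Rightarrow> lexp \<Rightarrow> bool" where
  "aligned_on PTop e1 e2 \<longleftrightarrow> True"
| "aligned_on PBot e1 e2 \<longleftrightarrow> True"
| "aligned_on (Atom p es) e1 e2 \<longleftrightarrow> True"
| "aligned_on (PNeg P) e1 e2 \<longleftrightarrow> aligned_on P e1 e2"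
| "aligned_on (PAnd P Q) e1 e2 \<longleftrightarrow> aligned_on P e1 e2 \<and> aligned_on Q e1 e2"
| "aligned_on (POr P Q) e1 e2 \<longleftrightarrow> aligned_on P e1 e2 \<and> aligned_on Q e1 e2"
| "aligned_on (Iter q \<phi> P) e1 e2 \<longleftrightarrow> has_frame \<phi> e1 e2 \<and> aligned_on P (up 1 e1) (up 1 e2)"

definition regularly_nested :: "'p schema \<Rightarrow> bool" where
  "regularly_nested S \<longleftrightarrow> is_schema S \<and> monadic (fst S) \<and> arithmetic S \<and>
     (\<exists>n. params S = {n} \<and>
       (\<exists>k l. aligned_on (fst S) (lconst k) (lvar n - lconst l)))"

end

theory Submission
  imports Defs
begin

text \<open>
  Follow one branch of a derivation. Every pattern on it is
  described by a tree whose iterations run over \<open>lo \<le> i \<le> n - a\<close> for an offset \<open>a\<close>, and the constraint is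
  described by the set \<open>X\<close> of values of the parameter \<open>n\<close> that satisfy it. This set is initially
  bounded or cofinite, because the constraint is a difference constraint.

  Phases 1 and 2 decrease a lexicographic measure. Every unfolding raises an offset, and an iteration is
  only unfolded if \<open>lo + a\<close> is at most some element of \<open>X\<close>; so on an infinite branch \<open>X\<close> is unbounded, hence
  cofinite, Phase 3 is finite as well, and all phases recur forever. At the end of Phase 2 no indexed
  proposition without bound variables is left in the pattern, all iterations are
  nonempty, and the offsets, the constants excluded from \<open>X\<close> and the least element of \<open>X\<close> lie in a
  window of constant width around the largest offset \<open>\<beta>\<close> reached so far. A literal of \<open>\<Lambda>\<close> outside this window is
  pure, because the indices that the pattern still realizes have moved below it. Unfolding
  does not increase the alternation depth of conjunctions and disjunctions, so that after replacing
  \<open>n\<close> by \<open>n + \<beta>\<close> only finitely many schemata remain modulo associativity, commutativity and idempotence. Two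
  of them coincide, and the later one loops on the earlier one.
\<close>

section \<open>Linear expressions and constraints\<close>

text \<open>Phases belong to the whole tableau, whereas the argument lives on one branch: a leaf may
  stay idle while other leaves keep a phase going, so each node only remembers in which phases it
  has been irreducible. Well-foundedness of the extension of branches then lifts to tableaux by the
  multiset ordering on leaves, without Koenig's lemma. Two rules look dangerous but are tame.
  Emptiness needs an inner domain that mentions an outer iteration variable, which alignment
  forbids. Interval compares two bounds that must grow alike with \<open>n\<close>, so its new
  constraint is valid or unsatisfiable and the rule only deletes a conjunct. The main obstacle to
  repetition is that \<open>\<Lambda>\<close> never shrinks; only purity discards its old literals.
  Purity is judged in a schema that contains \<open>\<Lambda>\<close> itself, hence the invariant
  \<open>consistent\<close>, which the side condition of Prop-split preserves.\<close>

lemma lexp_eqI: "(\<And>\<rho>. leval \<rho> e = leval \<rho> f) \<Longrightarrow> e = f"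
  by transfer auto

lemma leval_simps [simp]:
  "leval \<rho> (lvar x) = \<rho> x"
  "leval \<rho> 0 = 0"
  "leval \<rho> 1 = 1"
  "leval \<rho> (a + b) = leval \<rho> a + leval \<rho> b"
  "leval \<rho> (a - b) = leval \<rho> a - leval \<rho> b"
  by (transfer, simp)+

lemma leval_lsubst [simp]: "leval \<rho> (lsubst \<sigma> e) = leval (\<lambda>x. leval \<rho> (\<sigma> x)) e"
proof (transfer)
  fix \<rho> and \<sigma> :: "nat \<Rightarrow> lterm" and e
  show "lt_eval \<rho> (lt_subst \<sigma> e) = lt_eval (\<lambda>x. lt_eval \<rho> (\<sigma> x)) e"
    by (rule lt_eval_subst)
qed

lemma leval_lmult [simp]: "leval \<rho> (lmult k e) = int k * leval \<rho> e"
  by (induction k) (auto simp: algebra_simps)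

lemma leval_lconst [simp]: "leval \<rho> (lconst c) = c"
  by (simp add: lconst_def)

lemma leval_up [simp]: "leval \<rho> (up d e) = leval (\<lambda>x. \<rho> (x + d)) e"
  by (simp add: up_def)

lemma up_0 [simp]: "up 0 e = e"
  by (rule lexp_eqI) simp

lemma up_inject [simp]: "up d e = up d f \<longleftrightarrow> e = f"
proof
  assume eq: "up d e = up d f"
  show "e = f"
  proof (rule lexp_eqI)
    fix \<rho>
    have "leval (\<lambda>x. \<rho> (x - d)) (up d e) = leval (\<lambda>x. \<rho> (x - d)) (up d f)"
      using eq by simp
    then show "leval \<rho> e = leval \<rho> f" by simp
  qed
qed simp

lemma leval_affine: "\<exists>b. \<forall>\<rho> v. leval (\<rho>(x := v)) e = leval (\<rho>(x := 0)) e + b * v"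
proof (transfer fixing: x)
  fix e
  show "\<exists>b. \<forall>\<rho> v. lt_eval (\<rho>(x := v)) e = lt_eval (\<rho>(x := 0)) e + b * v"
  proof (induction e)
    case (LAdd s t)
    then obtain b c where b: "\<And>\<rho> v. lt_eval (\<rho>(x := v)) s = lt_eval (\<rho>(x := 0)) s + b * v"
      and c: "\<And>\<rho> v. lt_eval (\<rho>(x := v)) t = lt_eval (\<rho>(x := 0)) t + c * v" by blast
    show ?case
    proof (intro exI[of _ "b + c"] allI)
      fix \<rho> v
      show "lt_eval (\<rho>(x := v)) (LAdd s t) = lt_eval (\<rho>(x := 0)) (LAdd s t) + (b + c) * v"
        using b[of \<rho> v] c[of \<rho> v] by (simp add: algebra_simps)
    qed
  next
    case (LSub s t)
    then obtain b c where b: "\<And>\<rho> v. lt_eval (\<rho>(x := v)) s = lt_eval (\<rho>(x := 0)) s + b * v"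
      and c: "\<And>\<rho> v. lt_eval (\<rho>(x := v)) t = lt_eval (\<rho>(x := 0)) t + c * v" by blast
    show ?case
    proof (intro exI[of _ "b - c"] allI)
      fix \<rho> v
      show "lt_eval (\<rho>(x := v)) (LSub s t) = lt_eval (\<rho>(x := 0)) (LSub s t) + (b - c) * v"
        using b[of \<rho> v] c[of \<rho> v] by (simp add: algebra_simps)
    qed
  next
    case (LVar y)
    show ?case by (rule exI[of _ "if x = y then 1 else 0"]) auto
  qed (auto intro: exI[of _ 0])
qed

text \<open>Both sides are affine in \<open>x\<close> with a slope that does not depend on the other
  variables, so agreement on a ray fixes slope and intercept. This recovers the bounds of a frame
  from the parameter values for which the frame is nonempty.\<close>

lemma leval_eventually_eq:
  assumes "\<And>\<rho>. \<rho> x \<ge> K \<Longrightarrow> leval \<rho> e = leval \<rho> f"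
  shows "e = f"
proof (rule lexp_eqI)
  fix \<rho>
  obtain b where b: "\<And>\<rho> v. leval (\<rho>(x := v)) e = leval (\<rho>(x := 0)) e + b * v"
    using leval_affine[of x e] by auto
  obtain c where c: "\<And>\<rho> v. leval (\<rho>(x := v)) f = leval (\<rho>(x := 0)) f + c * v"
    using leval_affine[of x f] by auto
  have 1: "leval (\<rho>(x := 0)) e + b * v = leval (\<rho>(x := 0)) f + c * v" if "v \<ge> K" for v
    using assms[of "\<rho>(x := v)"] that b[of \<rho> v] c[of \<rho> v] by simp
  from 1[of K] 1[of "K + 1"] have bc: "b = c" by (simp add: algebra_simps)
  with 1[of K] have "leval (\<rho>(x := 0)) e = leval (\<rho>(x := 0)) f" by simp
  with bc show "leval \<rho> e = leval \<rho> f"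
    using b[of \<rho> "\<rho> x"] c[of \<rho> "\<rho> x"] by simp
qed

text \<open>\<open>lvars\<close> and \<open>ffree\<close> are defined by changing one variable,
  which yields invariance under finitely many changes only. The finite support \<open>V\<close>
  reduces two environments that may differ everywhere to that case.\<close>

lemma agree_by_finite_changes:
  assumes fin: "finite V" and sup: "\<And>\<rho> \<rho>'. (\<And>x. x \<in> V \<Longrightarrow> \<rho> x = \<rho>' x) \<Longrightarrow> g \<rho> = g \<rho>'"
    and one: "\<And>\<rho> x v. x \<notin> U \<Longrightarrow> g (\<rho>(x := v)) = g \<rho>"
    and eq: "\<And>x. x \<in> U \<Longrightarrow> \<rho> x = \<rho>' x"
  shows "g \<rho> = g (\<rho>' :: nat \<Rightarrow> int)"
proof -
  have "finite W \<Longrightarrow> g (\<lambda>x. if x \<in> W then \<rho>' x else \<rho> x) = g \<rho>" for W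
  proof (induction W rule: finite_induct)
    case (insert y W)
    let ?r = "\<lambda>x. if x \<in> W then \<rho>' x else \<rho> x"
    have e: "(\<lambda>x. if x \<in> insert y W then \<rho>' x else \<rho> x) = ?r(y := \<rho>' y)" by auto
    show ?case
    proof (cases "y \<in> U")
      case True
      then have "?r(y := \<rho>' y) = ?r" using eq insert.hyps by auto
      then show ?thesis using e insert.IH by simp
    next
      case False
      then show ?thesis using e one[of y ?r "\<rho>' y"] insert.IH by simp
    qed
  qed simp
  from this[OF fin] have "g (\<lambda>x. if x \<in> V then \<rho>' x else \<rho> x) = g \<rho>" .
  moreover have "g (\<lambda>x. if x \<in> V then \<rho>' x else \<rho> x) = g \<rho>'" by (rule sup) simp
  ultimately show ?thesis by simp
qed

lemma finite_support_pair:
  assumes "\<exists>V. finite V \<and> (\<forall>\<rho> \<rho>'. (\<forall>x\<in>V. \<rho> x = \<rho>' x) \<longrightarrow> f \<rho> = f \<rho>')"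
    and "\<exists>V. finite V \<and> (\<forall>\<rho> \<rho>'. (\<forall>x\<in>V. \<rho> x = \<rho>' x) \<longrightarrow> g \<rho> = g \<rho>')"
    and "\<And>\<rho> \<rho>'. f \<rho> = f \<rho>' \<Longrightarrow> g \<rho> = g \<rho>' \<Longrightarrow> h \<rho> = h \<rho>'"
  shows "\<exists>V. finite V \<and> (\<forall>\<rho> \<rho>'. (\<forall>x\<in>V. \<rho> x = \<rho>' x) \<longrightarrow> h \<rho> = h \<rho>')"
proof -
  obtain U where U: "finite U" "\<And>\<rho> \<rho>'. (\<forall>x\<in>U. \<rho> x = \<rho>' x) \<Longrightarrow> f \<rho> = f \<rho>'"
    using assms(1) by blast
  obtain V where V: "finite V" "\<And>\<rho> \<rho>'. (\<forall>x\<in>V. \<rho> x = \<rho>' x) \<Longrightarrow> g \<rho> = g \<rho>'"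
    using assms(2) by blast
  show ?thesis
    by (intro exI[of _ "U \<union> V"] conjI allI impI assms(3) U(2) V(2)) (use U(1) V(1) in auto)
qed

lemma leval_finite_support: "\<exists>V. finite V \<and> (\<forall>\<rho> \<rho>'. (\<forall>x\<in>V. \<rho> x = \<rho>' x) \<longrightarrow> leval \<rho> e = leval \<rho>' e)"
proof (transfer)
  fix e
  show "\<exists>V. finite V \<and> (\<forall>\<rho> \<rho>'. (\<forall>x\<in>V. \<rho> x = \<rho>' x) \<longrightarrow> lt_eval \<rho> e = lt_eval \<rho>' e)"
  proof (induction e)
    case (LAdd s t)
    then show ?case by (rule finite_support_pair) simp
  next
    case (LSub s t)
    then show ?case by (rule finite_support_pair) simp
  next
    case (LVar y)
    show ?case by (intro exI[of _ "{y}"]) auto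
  qed auto
qed

lemma leval_cong:
  assumes "\<And>x. x \<in> lvars e \<Longrightarrow> \<rho> x = \<rho>' x"
  shows "leval \<rho> e = leval \<rho>' e"
proof -
  obtain V where V: "finite V" "\<And>\<rho> \<rho>'. (\<forall>x\<in>V. \<rho> x = \<rho>' x) \<Longrightarrow> leval \<rho> e = leval \<rho>' e"
    using leval_finite_support[of e] by blast
  have one: "leval (\<rho>(x := v)) e = leval \<rho> e" if "x \<notin> lvars e" for \<rho> x v
    using that unfolding lvars_def by blast
  show ?thesis
    by (rule agree_by_finite_changes[of V "\<lambda>\<rho>. leval \<rho> e" "lvars e"]) (use V assms one in blast)+
qed

lemma sat_finite_support: "\<exists>V. finite V \<and> (\<forall>\<rho> \<rho>'. (\<forall>x\<in>V. \<rho> x = \<rho>' x) \<longrightarrow> sat \<phi> \<rho> = sat \<phi> \<rho>')"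
proof (induction \<phi>)
  case (Le a b)
  show ?case by (rule finite_support_pair[OF leval_finite_support[of a] leval_finite_support[of b]]) simp
next
  case (Lt a b)
  show ?case by (rule finite_support_pair[OF leval_finite_support[of a] leval_finite_support[of b]]) simp
next
  case (Eq a b)
  show ?case by (rule finite_support_pair[OF leval_finite_support[of a] leval_finite_support[of b]]) simp
next
  case (Conj a b)
  then show ?case by (rule finite_support_pair) simp
next
  case (Disj a b)
  then show ?case by (rule finite_support_pair) simp
next
  case (FEx \<phi>)
  then obtain V where V: "finite V" "\<And>\<rho> \<rho>'. (\<forall>x\<in>V. \<rho> x = \<rho>' x) \<Longrightarrow> sat \<phi> \<rho> = sat \<phi> \<rho>'" by blast
  have "sat \<phi> (case_nat v \<rho>) = sat \<phi> (case_nat v \<rho>')"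
    if "\<forall>x\<in>Suc -` V. \<rho> x = \<rho>' x" for \<rho> \<rho>' v
    by (rule V(2)) (use that in \<open>auto split: nat.split\<close>)
  then show ?case using V(1)
    by (intro exI[of _ "Suc -` V"] conjI allI impI finite_vimageI) (simp_all only: sat.simps inj_Suc)
next
  case (FAll \<phi>)
  then obtain V where V: "finite V" "\<And>\<rho> \<rho>'. (\<forall>x\<in>V. \<rho> x = \<rho>' x) \<Longrightarrow> sat \<phi> \<rho> = sat \<phi> \<rho>'" by blast
  have "sat \<phi> (case_nat v \<rho>) = sat \<phi> (case_nat v \<rho>')"
    if "\<forall>x\<in>Suc -` V. \<rho> x = \<rho>' x" for \<rho> \<rho>' v
    by (rule V(2)) (use that in \<open>auto split: nat.split\<close>)
  then show ?case using V(1)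
    by (intro exI[of _ "Suc -` V"] conjI allI impI finite_vimageI) (simp_all only: sat.simps inj_Suc)
qed auto

lemma sat_cong_ffree:
  assumes "\<And>x. x \<in> ffree \<phi> \<Longrightarrow> \<rho> x = \<rho>' x"
  shows "sat \<phi> \<rho> = sat \<phi> \<rho>'"
proof -
  obtain V where V: "finite V" "\<And>\<rho> \<rho>'. (\<forall>x\<in>V. \<rho> x = \<rho>' x) \<Longrightarrow> sat \<phi> \<rho> = sat \<phi> \<rho>'"
    using sat_finite_support[of \<phi>] by blast
  have one: "sat \<phi> (\<rho>(x := v)) = sat \<phi> \<rho>" if "x \<notin> ffree \<phi>" for \<rho> x v
    using that unfolding ffree_def by blast
  show ?thesis
    by (rule agree_by_finite_changes[of V "\<lambda>\<rho>. sat \<phi> \<rho>" "ffree \<phi>"]) (use V assms one in blast)+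
qed

lemma leval_lift_sub: "(\<lambda>x. leval (case_nat v \<rho>) (lift_sub \<sigma> x)) = case_nat v (\<lambda>x. leval \<rho> (\<sigma> x))"
  by (rule ext) (auto simp: lift_sub_def split: nat.split)

lemma sat_fsubst [simp]: "sat (fsubst \<sigma> \<phi>) \<rho> = sat \<phi> (\<lambda>x. leval \<rho> (\<sigma> x))"
  by (induction \<phi> arbitrary: \<sigma> \<rho>) (auto simp: leval_lift_sub)

lemma sat_fshift [simp]: "sat (fshift \<phi>) \<rho> = sat \<phi> (\<lambda>x. \<rho> (Suc x))"
  by (simp add: fshift_def)

lemma sat_conjuncts: "sat \<phi> \<rho> \<longleftrightarrow> (\<forall>\<chi>\<in>#conjuncts \<phi>. sat \<chi> \<rho>)"
  by (induction \<phi> rule: conjuncts.induct) auto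

lemma flexps_conjuncts: "flexps \<phi> = (\<Union>\<chi>\<in>set_mset (conjuncts \<phi>). flexps \<chi>)"
  by (induction \<phi> rule: conjuncts.induct) auto

lemma conjuncts_fsubst: "conjuncts (fsubst \<sigma> \<phi>) = image_mset (fsubst \<sigma>) (conjuncts \<phi>)"
  by (induction \<phi> rule: conjuncts.induct) auto

lemma conjuncts_nonempty [simp]: "conjuncts \<phi> \<noteq> {#}"
  by (induction \<phi> rule: conjuncts.induct) auto

section \<open>Difference constraints\<close>

definition simple_exp :: "lexp \<Rightarrow> bool" where
  "simple_exp e \<longleftrightarrow> (\<exists>x c. e = lvar x + lconst c) \<or> (\<exists>c. e = lconst c)"

definition simple_fml :: "fml \<Rightarrow> bool" where
  "simple_fml \<phi> \<longleftrightarrow> (\<forall>e\<in>flexps \<phi>. simple_exp e)"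

lemma simple_exp_lvar [simp]: "simple_exp (lvar x)"
  unfolding simple_exp_def by (intro disjI1 exI[of _ x] exI[of _ 0] lexp_eqI) simp

lemma simple_exp_add:
  assumes "simple_exp e"
  shows "simple_exp (e + lconst c)"
  using assms unfolding simple_exp_def
proof (elim disjE exE)
  fix x b assume "e = lvar x + lconst b"
  then have "e + lconst c = lvar x + lconst (b + c)" by (intro lexp_eqI) simp
  then show "(\<exists>x c'. e + lconst c = lvar x + lconst c') \<or> (\<exists>c'. e + lconst c = lconst c')" by blast
next
  fix b assume "e = lconst b"
  then have "e + lconst c = lconst (b + c)" by (intro lexp_eqI) simp
  then show "(\<exists>x c'. e + lconst c = lvar x + lconst c') \<or> (\<exists>c'. e + lconst c = lconst c')" by blast
qed

lemma simple_exp_lsubst: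
  assumes "simple_exp e" "\<And>x. simple_exp (\<sigma> x)"
  shows "simple_exp (lsubst \<sigma> e)"
  using assms(1) unfolding simple_exp_def[of e]
proof (elim disjE exE)
  fix x b assume "e = lvar x + lconst b"
  then have "lsubst \<sigma> e = \<sigma> x + lconst b" by (intro lexp_eqI) simp
  then show ?thesis using simple_exp_add[OF assms(2)] by simp
next
  fix b assume "e = lconst b"
  then have "lsubst \<sigma> e = lconst b" by (intro lexp_eqI) simp
  then show ?thesis by (auto simp: simple_exp_def)
qed

lemma simple_exp_up: "simple_exp e \<Longrightarrow> simple_exp (up d e)"
  unfolding up_def by (rule simple_exp_lsubst) auto

lemma simple_exp_lift_sub: "(\<And>x. simple_exp (\<sigma> x)) \<Longrightarrow> simple_exp (lift_sub \<sigma> x)"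
  by (auto simp: lift_sub_def simple_exp_up split: nat.split)

lemma simple_fml_simps [simp]:
  "simple_fml FTrue" "simple_fml FFalse"
  "simple_fml (Le a b) \<longleftrightarrow> simple_exp a \<and> simple_exp b"
  "simple_fml (Lt a b) \<longleftrightarrow> simple_exp a \<and> simple_exp b"
  "simple_fml (Eq a b) \<longleftrightarrow> simple_exp a \<and> simple_exp b"
  "simple_fml (FNot \<phi>) \<longleftrightarrow> simple_fml \<phi>"
  "simple_fml (Conj \<phi> \<psi>) \<longleftrightarrow> simple_fml \<phi> \<and> simple_fml \<psi>"
  "simple_fml (Disj \<phi> \<psi>) \<longleftrightarrow> simple_fml \<phi> \<and> simple_fml \<psi>"
  "simple_fml (FEx \<phi>) \<longleftrightarrow> simple_fml \<phi>"
  "simple_fml (FAll \<phi>) \<longleftrightarrow> simple_fml \<phi>"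
  by (simp_all add: simple_fml_def ball_Un)

lemma simple_fml_fsubst:
  "simple_fml \<phi> \<Longrightarrow> \<forall>x. simple_exp (\<sigma> x) \<Longrightarrow> simple_fml (fsubst \<sigma> \<phi>)"
  by (induction \<phi> arbitrary: \<sigma>) (simp_all add: simple_exp_lsubst simple_exp_lift_sub)

lemma lconst_if_no_vars:
  assumes "lvars e = {}"
  shows "\<exists>c. e = lconst c"
proof
  show "e = lconst (leval (\<lambda>_. 0) e)"
    by (rule lexp_eqI) (simp, rule leval_cong, simp add: assms)
qed

lemma simple_expI: "(\<And>x. x \<in> lvars e \<Longrightarrow> \<exists>k. e = lvar x + lconst k) \<Longrightarrow> simple_exp e"
  using lconst_if_no_vars[of e] unfolding simple_exp_def by blast

text \<open>A back-and-forth argument: environments whose coordinate differences (with \<open>0\<close> as an extra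
  coordinate) agree up to a threshold satisfy the same difference constraints. One quantifier
  halves the threshold.\<close>

definition sim :: "int \<Rightarrow> (nat \<Rightarrow> int) \<Rightarrow> (nat \<Rightarrow> int) \<Rightarrow> bool" where
  "sim M r r' \<longleftrightarrow> r 0 = 0 \<and> r' 0 = 0 \<and>
     (\<forall>x y c. \<bar>c\<bar> \<le> M \<longrightarrow> (r x - r y \<le> c \<longleftrightarrow> r' x - r' y \<le> c))"

lemma sim_sym: "sim M r r' \<Longrightarrow> sim M r' r"
  by (auto simp: sim_def)

lemma sim_mono: "sim M r r' \<Longrightarrow> M' \<le> M \<Longrightarrow> sim M' r r'"
  by (auto simp: sim_def)

lemma bounded_above_attains:
  fixes f :: "nat \<Rightarrow> int"
  assumes "P z0" "\<And>z. P z \<Longrightarrow> f z \<le> B"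
  shows "\<exists>z. P z \<and> (\<forall>z'. P z' \<longrightarrow> f z' \<le> f z)"
proof -
  obtain z where z: "P z" "\<And>y. P y \<Longrightarrow> nat (B - f z) \<le> nat (B - f y)"
    using ex_has_least_nat[of P z0 "\<lambda>z. nat (B - f z)"] assms(1) by blast
  have "f y \<le> f z" if "P y" for y
    using z(2)[OF that] assms(2)[OF that] assms(2)[OF z(1)] by linarith
  then show ?thesis using z(1) by blast
qed

text \<open>If \<open>v\<close> lies within \<open>M + 2\<close> of some coordinate, its distance to
  that coordinate is copied. Otherwise \<open>v'\<close> is put \<open>M + 2\<close> above the image
  of the largest coordinate below \<open>v\<close>, or \<open>M + 2\<close> below the image of the
  least coordinate. In the middle case the coordinates on the two sides of \<open>v\<close> are more
  than \<open>2 * M + 4\<close> apart, which is why the threshold doubles.\<close>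

lemma sim_extend:
  assumes s: "sim (2 * M + 4) (case_nat 0 \<rho>) (case_nat 0 \<rho>')" and M: "M \<ge> 0"
  shows "\<exists>v'. sim M (case_nat 0 (case_nat v \<rho>)) (case_nat 0 (case_nat v' \<rho>'))"
proof -
  define r where "r = case_nat 0 \<rho>"
  define r' where "r' = case_nat 0 \<rho>'"
  have s: "sim (2 * M + 4) r r'" using s by (simp add: r_def r'_def)
  have le: "r x - r y \<le> c \<longleftrightarrow> r' x - r' y \<le> c" if "\<bar>c\<bar> \<le> 2 * M + 4" for x y c
    using s that by (auto simp: sim_def)
  \<comment> \<open>The range \<open>M + 1\<close> instead of \<open>M\<close> allows the
    comparisons to be read backwards: over the integers, \<open>v - r x \<le> c\<close> is the
    negation of \<open>r x - v \<le> - c - 1\<close>.\<close>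
  have "\<exists>v'. \<forall>x c. \<bar>c\<bar> \<le> M + 1 \<longrightarrow> (r x - v \<le> c \<longleftrightarrow> r' x - v' \<le> c)"
  proof (cases "\<exists>z. \<bar>v - r z\<bar> \<le> M + 2")
    case True
    then obtain z where z: "\<bar>v - r z\<bar> \<le> M + 2" ..
    have "r x - v \<le> c \<longleftrightarrow> r' x - (r' z + (v - r z)) \<le> c" if "\<bar>c\<bar> \<le> M + 1" for x c
    proof -
      have "\<bar>c + (v - r z)\<bar> \<le> 2 * M + 4" using z that by linarith
      from le[OF this, of x z] show ?thesis by linarith
    qed
    then show ?thesis by blast
  next
    case False
    then have far: "\<bar>v - r z\<bar> > M + 2" for z by (meson not_le)
    show ?thesis
    proof (cases "\<exists>z. r z < v")
      case True
      then obtain z0 where z0: "r z0 < v" ..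
      obtain z where z: "r z < v" and max: "\<And>z'. r z' < v \<Longrightarrow> r z' \<le> r z"
        using bounded_above_attains[of "\<lambda>z. r z < v" z0 r v] z0 by auto
      have "r x - v \<le> c \<longleftrightarrow> r' x - (r' z + M + 2) \<le> c" if c: "\<bar>c\<bar> \<le> M + 1" for x c
      proof (cases "r x < v")
        case True
        then have "r x - r z \<le> 0" using max by force
        then have "r' x - r' z \<le> 0" using le[of 0 x z] M by auto
        moreover have "r x - v \<le> c" using True far[of x] c by linarith
        ultimately show ?thesis using c by linarith
      next
        case False
        then have "\<not> r x - r z \<le> 2 * M + 4" using far[of x] far[of z] z by linarith
        then have "\<not> r' x - r' z \<le> 2 * M + 4" using le[of "2 * M + 4" x z] M by auto
        moreover have "\<not> r x - v \<le> c" using False far[of x] c by linarith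
        ultimately show ?thesis using c by linarith
      qed
      then show ?thesis by (intro exI[of _ "r' z + M + 2"]) auto
    next
      case none: False
      obtain z where min: "\<And>z'. r z \<le> r z'"
        using bounded_above_attains[of "\<lambda>_. True" 0 "\<lambda>z. - r z" "- v"] none by (auto simp: not_less)
      have "r x - v \<le> c \<longleftrightarrow> r' x - (r' z - M - 2) \<le> c" if c: "\<bar>c\<bar> \<le> M + 1" for x c
      proof -
        have "\<not> r x - v \<le> c" using none far[of x] c by (auto simp: not_less)
        moreover have "\<not> r x - r z \<le> -1" using min[of x] by linarith
        then have "\<not> r' x - r' z \<le> -1" using le[of "-1" x z] M by auto
        ultimately show ?thesis using c by linarith
      qed
      then show ?thesis by (intro exI[of _ "r' z - M - 2"]) auto
    qed
  qed
  then obtain v' where v': "\<And>x c. \<bar>c\<bar> \<le> M + 1 \<Longrightarrow> (r x - v \<le> c \<longleftrightarrow> r' x - v' \<le> c)" by blast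
  have v'2: "v - r x \<le> c \<longleftrightarrow> v' - r' x \<le> c" if "\<bar>c\<bar> \<le> M" for x c
    using v'[of "-c - 1" x] that by linarith
  let ?R = "case_nat 0 (case_nat v \<rho>)" and ?R' = "case_nat 0 (case_nat v' \<rho>')"
  have idx: "(\<exists>y. ?R x = r y \<and> ?R' x = r' y) \<or> (?R x = v \<and> ?R' x = v')" for x
  proof (cases x)
    case 0
    then show ?thesis by (intro disjI1 exI[of _ 0]) (simp add: r_def r'_def)
  next
    case (Suc y)
    then show ?thesis by (cases y) (auto simp: r_def r'_def intro: exI[of _ y])
  qed
  have "?R x - ?R y \<le> c \<longleftrightarrow> ?R' x - ?R' y \<le> c" if c: "\<bar>c\<bar> \<le> M" for x y c
  proof -
    have "\<bar>c\<bar> \<le> 2 * M + 4" "\<bar>c\<bar> \<le> M + 1" using c M by auto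
    note c2 = le[OF this(1)] v'[OF this(2)] v'2[OF c]
    from idx[of x] idx[of y] show ?thesis
    proof (elim disjE exE conjE)
    qed (simp_all only: c2 diff_self)
  qed
  then show ?thesis by (intro exI[of _ v']) (simp add: sim_def)
qed

lemma simple_exp_coord:
  assumes "simple_exp e"
  shows "\<exists>x c. \<forall>\<rho>. leval \<rho> e = case_nat 0 \<rho> x + c"
  using assms unfolding simple_exp_def
proof (elim disjE exE)
  fix x c assume "e = lvar x + lconst c"
  then show ?thesis by (intro exI[of _ "Suc x"] exI[of _ c]) simp
next
  fix c assume "e = lconst c"
  then show ?thesis by (intro exI[of _ 0] exI[of _ c]) simp
qed

lemma sim_atom:
  assumes "simple_exp a" "simple_exp b"
  shows "\<exists>M\<ge>0. \<forall>\<rho> \<rho>'. sim M (case_nat 0 \<rho>) (case_nat 0 \<rho>') \<longrightarrow>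
    (leval \<rho> a \<le> leval \<rho> b \<longleftrightarrow> leval \<rho>' a \<le> leval \<rho>' b) \<and>
    (leval \<rho> b \<le> leval \<rho> a \<longleftrightarrow> leval \<rho>' b \<le> leval \<rho>' a)"
proof -
  obtain x c where a: "\<And>\<rho>. leval \<rho> a = case_nat 0 \<rho> x + c" using simple_exp_coord[OF assms(1)] by blast
  obtain y d where b: "\<And>\<rho>. leval \<rho> b = case_nat 0 \<rho> y + d" using simple_exp_coord[OF assms(2)] by blast
  show ?thesis
  proof (intro exI[of _ "\<bar>d - c\<bar>"] conjI allI impI)
    fix \<rho> \<rho>' assume "sim \<bar>d - c\<bar> (case_nat 0 \<rho>) (case_nat 0 \<rho>')"
    then have s: "\<And>x y e. \<bar>e\<bar> \<le> \<bar>d - c\<bar> \<Longrightarrow> (case_nat 0 \<rho> x - case_nat 0 \<rho> y \<le> e) =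
        (case_nat 0 \<rho>' x - case_nat 0 \<rho>' y \<le> e)"
      by (simp add: sim_def)
    have *: "(u + c \<le> w + d) = (u - w \<le> d - c)" "(w + d \<le> u + c) = (w - u \<le> c - d)" for u w :: int
      by linarith+
    show "(leval \<rho> a \<le> leval \<rho> b) = (leval \<rho>' a \<le> leval \<rho>' b)"
      unfolding a b * by (rule s) simp
    show "(leval \<rho> b \<le> leval \<rho> a) = (leval \<rho>' b \<le> leval \<rho>' a)"
      unfolding a b * by (rule s) simp
  qed simp
qed

lemma sim_sat:
  "simple_fml \<phi> \<Longrightarrow> \<exists>M\<ge>0. \<forall>\<rho> \<rho>'. sim M (case_nat 0 \<rho>) (case_nat 0 \<rho>') \<longrightarrow> sat \<phi> \<rho> = sat \<phi> \<rho>'"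
proof (induction \<phi>)
  case (Le a b)
  then show ?case using sim_atom[of a b] by (auto simp: simple_fml_def)
next
  case (Lt a b)
  then obtain M where "M \<ge> 0" "\<forall>\<rho> \<rho>'. sim M (case_nat 0 \<rho>) (case_nat 0 \<rho>') \<longrightarrow>
    (leval \<rho> a \<le> leval \<rho> b \<longleftrightarrow> leval \<rho>' a \<le> leval \<rho>' b) \<and>
    (leval \<rho> b \<le> leval \<rho> a \<longleftrightarrow> leval \<rho>' b \<le> leval \<rho>' a)"
    using sim_atom[of a b] by (auto simp: simple_fml_def)
  then show ?case by (intro exI[of _ M]) (simp add: less_le_not_le[where 'a = int])
next
  case (Eq a b)
  then obtain M where "M \<ge> 0" "\<forall>\<rho> \<rho>'. sim M (case_nat 0 \<rho>) (case_nat 0 \<rho>') \<longrightarrow>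
    (leval \<rho> a \<le> leval \<rho> b \<longleftrightarrow> leval \<rho>' a \<le> leval \<rho>' b) \<and>
    (leval \<rho> b \<le> leval \<rho> a \<longleftrightarrow> leval \<rho>' b \<le> leval \<rho>' a)"
    using sim_atom[of a b] by (auto simp: simple_fml_def)
  then show ?case by (intro exI[of _ M]) (simp add: order.eq_iff[where 'a = int])
next
  case (Conj a b)
  then obtain M N where M: "M \<ge> 0" "\<And>\<rho> \<rho>'. sim M (case_nat 0 \<rho>) (case_nat 0 \<rho>') \<Longrightarrow> sat a \<rho> = sat a \<rho>'"
    and N: "N \<ge> 0" "\<And>\<rho> \<rho>'. sim N (case_nat 0 \<rho>) (case_nat 0 \<rho>') \<Longrightarrow> sat b \<rho> = sat b \<rho>'"
    by (auto simp: simple_fml_def)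
  have "sat a \<rho> = sat a \<rho>'" "sat b \<rho> = sat b \<rho>'" if "sim (max M N) (case_nat 0 \<rho>) (case_nat 0 \<rho>')" for \<rho> \<rho>'
    by (rule M N, rule sim_mono[OF that], simp)+
  then show ?case using M(1) by (intro exI[of _ "max M N"]) (simp add: max_def)
next
  case (Disj a b)
  then obtain M N where M: "M \<ge> 0" "\<And>\<rho> \<rho>'. sim M (case_nat 0 \<rho>) (case_nat 0 \<rho>') \<Longrightarrow> sat a \<rho> = sat a \<rho>'"
    and N: "N \<ge> 0" "\<And>\<rho> \<rho>'. sim N (case_nat 0 \<rho>) (case_nat 0 \<rho>') \<Longrightarrow> sat b \<rho> = sat b \<rho>'"
    by (auto simp: simple_fml_def)
  have "sat a \<rho> = sat a \<rho>'" "sat b \<rho> = sat b \<rho>'" if "sim (max M N) (case_nat 0 \<rho>) (case_nat 0 \<rho>')" for \<rho> \<rho>'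
    by (rule M N, rule sim_mono[OF that], simp)+
  then show ?case using M(1) by (intro exI[of _ "max M N"]) (simp add: max_def)
next
  case (FEx \<phi>)
  then obtain M where M: "M \<ge> 0" "\<And>\<rho> \<rho>'. sim M (case_nat 0 \<rho>) (case_nat 0 \<rho>') \<Longrightarrow> sat \<phi> \<rho> = sat \<phi> \<rho>'"
    by (auto simp: simple_fml_def)
  have "sat (FEx \<phi>) \<rho> \<Longrightarrow> sat (FEx \<phi>) \<rho>'" if "sim (2 * M + 4) (case_nat 0 \<rho>) (case_nat 0 \<rho>')" for \<rho> \<rho>'
    using sim_extend[OF that M(1)] M(2) unfolding sat.simps by metis
  then have "sat (FEx \<phi>) \<rho> = sat (FEx \<phi>) \<rho>'" if "sim (2 * M + 4) (case_nat 0 \<rho>) (case_nat 0 \<rho>')" for \<rho> \<rho>'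
    using that sim_sym by blast
  then show ?case using M(1) by (intro exI[of _ "2 * M + 4"]) simp
next
  case (FAll \<phi>)
  then obtain M where M: "M \<ge> 0" "\<And>\<rho> \<rho>'. sim M (case_nat 0 \<rho>) (case_nat 0 \<rho>') \<Longrightarrow> sat \<phi> \<rho> = sat \<phi> \<rho>'"
    by (auto simp: simple_fml_def)
  have "\<not> sat (FAll \<phi>) \<rho> \<Longrightarrow> \<not> sat (FAll \<phi>) \<rho>'" if "sim (2 * M + 4) (case_nat 0 \<rho>) (case_nat 0 \<rho>')" for \<rho> \<rho>'
    using sim_extend[OF that M(1)] M(2) unfolding sat.simps by metis
  then have "sat (FAll \<phi>) \<rho> = sat (FAll \<phi>) \<rho>'" if "sim (2 * M + 4) (case_nat 0 \<rho>) (case_nat 0 \<rho>')" for \<rho> \<rho>'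
    using that sim_sym by blast
  then show ?case using M(1) by (intro exI[of _ "2 * M + 4"]) simp
qed (auto simp: simple_fml_def)

text \<open>In these environments the only coordinates are \<open>0\<close> and the value of
  \<open>n\<close>, so all differences are \<open>0\<close>, \<open>v\<close> and
  \<open>- v\<close>. Beyond the threshold of \<open>sim_sat\<close> the constraint cannot tell two
  values of \<open>n\<close> apart.\<close>

lemma simple_fml_eventually_constant:
  assumes "simple_fml \<phi>"
  shows "\<exists>M. \<forall>v\<ge>M. \<forall>w\<ge>M. sat \<phi> ((\<lambda>_. 0)(n := v)) = sat \<phi> ((\<lambda>_. 0)(n := w))"
proof -
  obtain M where M: "M \<ge> 0" "\<And>\<rho> \<rho>'. sim M (case_nat 0 \<rho>) (case_nat 0 \<rho>') \<Longrightarrow> sat \<phi> \<rho> = sat \<phi> \<rho>'"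
    using sim_sat[OF assms] by blast
  have "sat \<phi> ((\<lambda>_. 0)(n := v)) = sat \<phi> ((\<lambda>_. 0)(n := w))" if "v \<ge> M + 1" "w \<ge> M + 1" for v w
  proof (rule M(2))
    have "case_nat 0 ((\<lambda>_. 0)(n := u)) x = (if x = Suc n then u else 0)" for x and u :: int
      by (cases x) auto
    then show "sim M (case_nat 0 ((\<lambda>_. 0)(n := v))) (case_nat 0 ((\<lambda>_. 0)(n := w)))"
      using that M(1) by (auto simp: sim_def)
  qed
  then show ?thesis by blast
qed

section \<open>Trees\<close>

text \<open>A tree \<open>XI q a s T\<close> stands for an iteration whose domain is equivalent to \<open>lo \<le> i \<le> n - a\<close> and has \<open>s\<close>
  conjuncts; counting them makes Interval decrease the tree. A tree \<open>XG q Z T\<close> stands for an iteration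
  created by Prop-simplification, with domain \<open>n \<notin> Z \<and> i = 0\<close>. Indices are \<open>x + c\<close> for a bound variable
  \<open>x\<close> (\<open>IV\<close>), \<open>n + c\<close> (\<open>IP\<close>), and constants (\<open>IC\<close>). The parameter has no de Bruijn index here, so instantiating a
  bound variable only affects the indices.\<close>

datatype idx = IV nat int | IP int | IC int

datatype 'p tree = XL bool | XA 'p idx | XN "'p tree" | XB iter_op "'p tree" "'p tree"
  | XI iter_op int nat "'p tree" | XG iter_op "int set" "'p tree"

primrec isparam :: "idx \<Rightarrow> bool" where
  "isparam (IV x c) \<longleftrightarrow> False"
| "isparam (IP c) \<longleftrightarrow> True"
| "isparam (IC c) \<longleftrightarrow> True"

primrec idx_val :: "int \<Rightarrow> idx \<Rightarrow> int" where
  "idx_val m (IV x c) = 0"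
| "idx_val m (IP c) = m + c"
| "idx_val m (IC c) = c"

primrec iinst :: "nat \<Rightarrow> int \<Rightarrow> idx \<Rightarrow> idx" where
  "iinst j a (IV x c) = (if x < j then IV x c else if x = j then IP (c - a) else IV (x - 1) c)"
| "iinst j a (IP c) = IP c"
| "iinst j a (IC c) = IC c"

primrec tinst :: "nat \<Rightarrow> int \<Rightarrow> 'p tree \<Rightarrow> 'p tree" where
  "tinst j a (XL b) = XL b"
| "tinst j a (XA p i) = XA p (iinst j a i)"
| "tinst j a (XN T) = XN (tinst j a T)"
| "tinst j a (XB q T U) = XB q (tinst j a T) (tinst j a U)"
| "tinst j a (XI q b s T) = XI q b s (tinst (Suc j) a T)"
| "tinst j a (XG q Z T) = XG q Z (tinst (Suc j) a T)"

primrec has_var :: "nat \<Rightarrow> 'p tree \<Rightarrow> bool" where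
  "has_var j (XL b) \<longleftrightarrow> False"
| "has_var j (XA p i) \<longleftrightarrow> (\<exists>c. i = IV j c)"
| "has_var j (XN T) \<longleftrightarrow> has_var j T"
| "has_var j (XB q T U) \<longleftrightarrow> has_var j T \<or> has_var j U"
| "has_var j (XI q b s T) \<longleftrightarrow> has_var (Suc j) T"
| "has_var j (XG q Z T) \<longleftrightarrow> has_var (Suc j) T"

text \<open>What Prop-simplification and the algebraic rules can make of a single indexed proposition without
  bound variables. Only this, or an indexed proposition with a bound variable, occurs below a negation.\<close>

primrec guard_chain :: "'p tree \<Rightarrow> bool" where
  "guard_chain (XL b) \<longleftrightarrow> True"
| "guard_chain (XA p i) \<longleftrightarrow> isparam i"
| "guard_chain (XN T) \<longleftrightarrow> False"
| "guard_chain (XB q T U) \<longleftrightarrow> False"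
| "guard_chain (XI q b s T) \<longleftrightarrow> False"
| "guard_chain (XG q Z T) \<longleftrightarrow> (Z = UNIV \<or> (\<exists>c. Z = {c})) \<and> guard_chain T"

primrec wf_tree :: "'p tree \<Rightarrow> bool" where
  "wf_tree (XL b) \<longleftrightarrow> True"
| "wf_tree (XA p i) \<longleftrightarrow> True"
| "wf_tree (XN T) \<longleftrightarrow> guard_chain T \<or> (\<exists>p i. T = XA p i)"
| "wf_tree (XB q T U) \<longleftrightarrow> wf_tree T \<and> wf_tree U"
| "wf_tree (XI q b s T) \<longleftrightarrow> wf_tree T"
| "wf_tree (XG q Z T) \<longleftrightarrow> (Z = UNIV \<or> (\<exists>c. Z = {c})) \<and> guard_chain T"

primrec isleaf :: "'p tree \<Rightarrow> bool" where
  "isleaf (XL b) \<longleftrightarrow> True"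
| "isleaf (XA p i) \<longleftrightarrow> True"
| "isleaf (XN T) \<longleftrightarrow> False"
| "isleaf (XB q T U) \<longleftrightarrow> False"
| "isleaf (XI q b s T) \<longleftrightarrow> False"
| "isleaf (XG q Z T) \<longleftrightarrow> False"

primrec guard_free :: "'p tree \<Rightarrow> bool" where
  "guard_free (XL b) \<longleftrightarrow> True"
| "guard_free (XA p i) \<longleftrightarrow> True"
| "guard_free (XN T) \<longleftrightarrow> guard_free T"
| "guard_free (XB q T U) \<longleftrightarrow> guard_free T \<and> guard_free U"
| "guard_free (XI q a s T) \<longleftrightarrow> guard_free T"
| "guard_free (XG q Z T) \<longleftrightarrow> False"

definition param_values :: "nat \<Rightarrow> fml \<Rightarrow> int set" where
  "param_values N \<phi> = (\<lambda>\<rho>. \<rho> N) ` {\<rho>. sat \<phi> \<rho>}"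

text \<open>Separates the two kinds of iterations for Interval: the domain made by
  Prop-simplification is a conjunction of a disequality and an equality, so it offers no conjunct
  that Interval could match.\<close>

definition is_cmp :: "fml \<Rightarrow> bool" where
  "is_cmp \<chi> = (case \<chi> of Le a b \<Rightarrow> True | Lt a b \<Rightarrow> True | _ \<Rightarrow> False)"

definition nocmp :: "fml \<Rightarrow> bool" where
  "nocmp \<psi> \<longleftrightarrow> (\<forall>\<chi>\<in>#conjuncts \<psi>. \<not> is_cmp \<chi>)"

lemma is_cmp_fsubst: "is_cmp (fsubst \<sigma> \<chi>) = is_cmp \<chi>"
  by (cases \<chi>) (simp_all add: is_cmp_def)

lemma nocmp_fsubst: "nocmp \<psi> \<Longrightarrow> nocmp (fsubst \<sigma> \<psi>)"
  by (simp add: nocmp_def conjuncts_fsubst is_cmp_fsubst)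

text \<open>The common generalisation of \<open>inst\<close> and \<open>down 1\<close> to positions
  below \<open>j\<close> further binders, which inductions through iterations need.\<close>

definition subi :: "nat \<Rightarrow> lexp \<Rightarrow> nat \<Rightarrow> lexp" where
  "subi j e x = (if x < j then lvar x else if x = j then up j e else lvar (x - 1))"

lemma lift_subi: "lift_sub (subi j e) = subi (Suc j) e"
proof
  fix x show "lift_sub (subi j e) x = subi (Suc j) e x"
    by (rule lexp_eqI) (auto simp: lift_sub_def subi_def split: nat.split)
qed

lemma inst_subi: "inst e = subi 0 e"
  by (rule ext) (auto simp: inst_def subi_def split: nat.split)

lemma down_subi: "down (Suc 0) = subi 0 0"
  by (rule ext) (auto simp: down_def subi_def)

lemma simple_exp_subi: "simple_exp e \<Longrightarrow> \<forall>x. simple_exp (subi j e x)"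
  by (auto simp: subi_def simple_exp_up)

lemma tinst_guard_chain: "guard_chain T \<Longrightarrow> tinst j a T = T"
proof (induction T arbitrary: j)
  case (XA p i)
  then show ?case by (cases i) auto
qed auto

lemma guard_chain_no_var: "guard_chain T \<Longrightarrow> \<not> has_var j T"
  by (induction T arbitrary: j) auto

lemma guard_chain_wf_tree: "guard_chain T \<Longrightarrow> wf_tree T"
  by (cases T) auto

lemma wf_tree_tinst: "wf_tree T \<Longrightarrow> wf_tree (tinst j a T)"
  by (induction T arbitrary: j) (auto simp: tinst_guard_chain)

section \<open>Patterns as trees, for a fixed parameter and a fixed lower bound\<close>

locale frame =
  fixes n :: nat and lo :: int
begin

primrec idx_exp :: "nat \<Rightarrow> idx \<Rightarrow> lexp" where
  "idx_exp d (IV x c) = lvar x + lconst c"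
| "idx_exp d (IP c) = lvar (d + n) + lconst c"
| "idx_exp d (IC c) = lconst c"

definition framed_by :: "nat \<Rightarrow> int \<Rightarrow> fml \<Rightarrow> bool" where
  "framed_by d a \<psi> \<longleftrightarrow> (\<forall>\<rho>. sat \<psi> \<rho> \<longleftrightarrow> lo \<le> \<rho> 0 \<and> \<rho> 0 \<le> \<rho> (Suc (d + n)) - a)"

definition guarded_by :: "nat \<Rightarrow> int set \<Rightarrow> fml \<Rightarrow> bool" where
  "guarded_by d Z \<psi> \<longleftrightarrow> (\<forall>\<rho>. sat \<psi> \<rho> \<longleftrightarrow> \<rho> 0 = 0 \<and> \<rho> (Suc (d + n)) \<notin> Z)"

text \<open>Domains are described by their meaning, since Unfolding and Interval change their
  syntax. Of the syntax only \<open>simple_fml\<close>, the number of conjuncts and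
  \<open>nocmp\<close> are kept, which is what the analysis of Interval depends on.\<close>

inductive rep :: "nat \<Rightarrow> 'p pat \<Rightarrow> 'p tree \<Rightarrow> bool" where
  top: "rep d PTop (XL True)"
| bot: "rep d PBot (XL False)"
| atom: "(\<And>x c. i = IV x c \<Longrightarrow> x < d) \<Longrightarrow> es = [idx_exp d i] \<Longrightarrow> rep d (Atom p es) (XA p i)"
| neg: "rep d P T \<Longrightarrow> rep d (PNeg P) (XN T)"
| conj: "rep d P T \<Longrightarrow> rep d Q U \<Longrightarrow> rep d (PAnd P Q) (XB BigAnd T U)"
| disj: "rep d P T \<Longrightarrow> rep d Q U \<Longrightarrow> rep d (POr P Q) (XB BigOr T U)"
| iterF: "framed_by d a \<psi> \<Longrightarrow> simple_fml \<psi> \<Longrightarrow> s = size (conjuncts \<psi>) \<Longrightarrow> rep (Suc d) P T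
    \<Longrightarrow> rep d (Iter q \<psi> P) (XI q a s T)"
| iterG: "guarded_by d Z \<psi> \<Longrightarrow> nocmp \<psi> \<Longrightarrow> rep (Suc d) P T \<Longrightarrow> rep d (Iter q \<psi> P) (XG q Z T)"

inductive_cases rep_topE: "rep d PTop T"
inductive_cases rep_botE: "rep d PBot T"
inductive_cases rep_atomE: "rep d (Atom p es) T"
inductive_cases rep_negE: "rep d (PNeg P) T"
inductive_cases rep_conjE: "rep d (PAnd P Q) T"
inductive_cases rep_disjE: "rep d (POr P Q) T"
inductive_cases rep_iterE: "rep d (Iter q \<psi> P) T"
lemmas rep_iter_cases = rep_iterE[consumes 1, case_names F G]

inductive_cases rep_XLE: "rep d P (XL b)"
inductive_cases rep_XAE: "rep d P (XA p i)"
inductive_cases rep_XNE: "rep d P (XN T)"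
inductive_cases rep_XBE: "rep d P (XB q T U)"
inductive_cases rep_XIE: "rep d P (XI q a s T)"
inductive_cases rep_XGE: "rep d P (XG q Z T)"

lemma rep_neutral: "rep d (neutral q) (XL (q = BigAnd))"
  by (cases q) (auto intro: rep.intros)

lemma rep_comb: "rep d P T \<Longrightarrow> rep d Q U \<Longrightarrow> rep d (comb q P Q) (XB q T U)"
  by (cases q) (auto intro: rep.intros)

lemma framed_by_fsubst: "framed_by (Suc (j + d)) a \<psi> \<Longrightarrow> framed_by (j + d) a (fsubst (subi (Suc j) e) \<psi>)"
  by (simp add: framed_by_def subi_def)

lemma guarded_by_fsubst: "guarded_by (Suc (j + d)) Z \<psi> \<Longrightarrow> guarded_by (j + d) Z (fsubst (subi (Suc j) e) \<psi>)"
  by (simp add: guarded_by_def subi_def)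

text \<open>The value of \<open>e\<close> is prescribed only if variable \<open>j\<close> occurs. So
  the same lemma serves Unfolding, where \<open>e\<close> is the upper bound \<open>n - a\<close>,
  and the removal of a vacuous iteration, where \<open>e\<close> is the dummy
  \<open>0\<close>.\<close>

lemma rep_subst:
  assumes e: "simple_exp e"
  shows "rep D P T \<Longrightarrow> D = Suc (j + d) \<Longrightarrow> (has_var j T \<Longrightarrow> e = lvar (d + n) - lconst a) \<Longrightarrow>
    rep (j + d) (psubst P (subi j e)) (tinst j a T)"
proof (induction arbitrary: j rule: rep.induct)
  case (atom i D es p)
  show ?case
  proof (cases i)
    case (IV x c)
    consider "x < j" | "x = j" | "x > j" by linarith
    then show ?thesis
    proof cases
      case 1
      have "lsubst (subi j e) (idx_exp D i) = idx_exp (j + d) (IV x c)"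
        using IV 1 by (intro lexp_eqI) (simp add: subi_def)
      with 1 IV atom show ?thesis by (auto intro: rep.atom)
    next
      case 2
      with IV atom.prems(2) have "e = lvar (d + n) - lconst a" by simp
      then have "lsubst (subi j e) (idx_exp D i) = idx_exp (j + d) (IP (c - a))"
        using IV 2 by (intro lexp_eqI) (simp add: subi_def ac_simps)
      with 2 IV atom(2) show ?thesis by (auto intro: rep.atom)
    next
      case 3
      have "lsubst (subi j e) (idx_exp D i) = idx_exp (j + d) (IV (x - 1) c)"
        using IV 3 by (intro lexp_eqI) (simp add: subi_def)
      moreover have "x - 1 < j + d" using atom(1)[OF IV] atom.prems(1) 3 by simp
      ultimately show ?thesis using 3 IV atom(2) by (auto intro: rep.atom)
    qed
  next
    case (IP c)
    have "lsubst (subi j e) (idx_exp D i) = idx_exp (j + d) (IP c)"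
      using IP atom.prems(1) by (intro lexp_eqI) (simp add: subi_def)
    then show ?thesis using IP atom(2) by (auto intro: rep.atom)
  next
    case (IC c)
    have "lsubst (subi j e) (idx_exp D i) = idx_exp (j + d) (IC c)"
      using IC by (intro lexp_eqI) simp
    then show ?thesis using IC atom(2) by (auto intro: rep.atom)
  qed
next
  case (iterF D a' \<psi> s P T q)
  have "rep (Suc j + d) (psubst P (subi (Suc j) e)) (tinst (Suc j) a T)"
    using iterF.prems by (intro iterF.IH) auto
  moreover have "framed_by (j + d) a' (fsubst (subi (Suc j) e) \<psi>)"
    using iterF.hyps(1) iterF.prems(1) by (intro framed_by_fsubst) simp
  moreover have "simple_fml (fsubst (subi (Suc j) e) \<psi>)"
    using iterF.hyps(2) by (rule simple_fml_fsubst[OF _ simple_exp_subi[OF e]])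
  ultimately show ?case using iterF.hyps(3) by (simp add: lift_subi rep.iterF conjuncts_fsubst)
next
  case (iterG D Z \<psi> P T q)
  have "rep (Suc j + d) (psubst P (subi (Suc j) e)) (tinst (Suc j) a T)"
    using iterG.prems by (intro iterG.IH) auto
  moreover have "guarded_by (j + d) Z (fsubst (subi (Suc j) e) \<psi>)"
    using iterG.hyps(1) iterG.prems(1) by (intro guarded_by_fsubst) simp
  moreover have "nocmp (fsubst (subi (Suc j) e) \<psi>)"
    using iterG.hyps(2) by (rule nocmp_fsubst)
  ultimately show ?case by (simp add: lift_subi rep.iterG)
qed (auto intro: rep.intros)

lemma lvars_idx_exp: "lvars (idx_exp d i) = (case i of IV x c \<Rightarrow> {x} | IP c \<Rightarrow> {d + n} | IC c \<Rightarrow> {})"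
proof -
  have "\<exists>\<rho> v. v \<noteq> (\<rho> :: nat \<Rightarrow> int) x" for x by (rule exI[of _ "\<lambda>_. 0"], rule exI[of _ 1]) simp
  then have "lvars (lvar x + lconst c) = {x}" for x c
    unfolding lvars_def by auto
  then show ?thesis by (cases i) (auto simp: lvars_def)
qed

lemma ffree_framed_by: "framed_by d a \<psi> \<Longrightarrow> ffree \<psi> = {0, Suc (d + n)}"
proof -
  assume F: "framed_by d a \<psi>"
  \<comment> \<open>At \<open>r\<close> the frame is the single point \<open>lo\<close>, so that
    moving the iteration variable or the parameter down by one leaves it.\<close>
  define r where "r = (\<lambda>x :: nat. if x = 0 then lo else lo + a :: int)"
  have "sat \<psi> (r(0 := lo - 1)) \<noteq> sat \<psi> r" "sat \<psi> (r(Suc (d + n) := lo + a - 1)) \<noteq> sat \<psi> r"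
    using F by (auto simp: framed_by_def r_def)
  then have "0 \<in> ffree \<psi>" "Suc (d + n) \<in> ffree \<psi>" unfolding ffree_def by blast+
  moreover have "x \<notin> ffree \<psi>" if "x \<noteq> 0" "x \<noteq> Suc (d + n)" for x
    using F that by (auto simp: ffree_def framed_by_def)
  ultimately show ?thesis by blast
qed

lemma ffree_guarded_by: "guarded_by d Z \<psi> \<Longrightarrow> ffree \<psi> \<subseteq> {0, Suc (d + n)}"
  by (auto simp: ffree_def guarded_by_def split: if_splits)

lemma pfree_rep: "rep d P T \<Longrightarrow> x \<in> pfree P \<Longrightarrow> x < d \<or> x = d + n"
proof (induction arbitrary: x rule: rep.induct)
  case (atom i d es p)
  then show ?case by (auto simp: lvars_idx_exp split: idx.splits)
next
  case (iterF d a \<psi> s P T q)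
  then have "Suc x = Suc (d + n) \<or> Suc x \<in> pfree P" by (auto simp: ffree_framed_by)
  then show ?case using iterF.IH[of "Suc x"] by auto
next
  case (iterG d Z \<psi> P T q)
  then have "Suc x = Suc (d + n) \<or> Suc x \<in> pfree P" using ffree_guarded_by[OF iterG.hyps(1)] by auto
  then show ?case using iterG.IH[of "Suc x"] by auto
qed auto

lemma has_var_pfree: "rep d P T \<Longrightarrow> has_var x T \<Longrightarrow> x \<in> pfree P"
  by (induction arbitrary: x rule: rep.induct) (auto simp: lvars_idx_exp)

lemma pfree_has_var: "rep d P T \<Longrightarrow> x \<in> pfree P \<Longrightarrow> x \<noteq> d + n \<Longrightarrow> has_var x T"
proof (induction arbitrary: x rule: rep.induct)
  case (atom i d es p)
  then show ?case by (auto simp: lvars_idx_exp split: idx.splits)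
next
  case (iterF d a \<psi> s P T q)
  then have "Suc x \<in> pfree P" by (auto simp: ffree_framed_by)
  then show ?case using iterF.IH[of "Suc x"] iterF.prems by auto
next
  case (iterG d Z \<psi> P T q)
  then have "Suc x \<in> pfree P" using ffree_guarded_by[OF iterG.hyps(1)] by auto
  then show ?case using iterG.IH[of "Suc x"] iterG.prems by auto
qed auto

text \<open>Projection to the parameter commutes with this conjunction because \<open>\<phi>\<close>
  does not see the bound variable and \<open>\<psi>\<close> sees only it and the parameter: two
  witnesses with the same parameter value can be glued.\<close>

lemma param_values_iter:
  assumes "\<And>\<rho> \<rho>'. \<rho> 0 = \<rho>' 0 \<Longrightarrow> \<rho> (Suc N) = \<rho>' (Suc N) \<Longrightarrow> sat \<psi> \<rho> = sat \<psi> \<rho>'"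
  shows "param_values (Suc N) (Conj (fshift \<phi>) \<psi>) = param_values N \<phi> \<inter> param_values (Suc N) \<psi>"
proof (intro set_eqI iffI)
  fix m assume "m \<in> param_values (Suc N) (Conj (fshift \<phi>) \<psi>)"
  then show "m \<in> param_values N \<phi> \<inter> param_values (Suc N) \<psi>" by (auto simp: param_values_def)
next
  fix m assume "m \<in> param_values N \<phi> \<inter> param_values (Suc N) \<psi>"
  then have "m \<in> param_values N \<phi>" "m \<in> param_values (Suc N) \<psi>" by simp_all
  then obtain \<rho> \<rho>' where r: "m = \<rho> N" "sat \<phi> \<rho>" and r': "m = \<rho>' (Suc N)" "sat \<psi> \<rho>'"
    unfolding param_values_def by blast
  have "sat (Conj (fshift \<phi>) \<psi>) (case_nat (\<rho>' 0) \<rho>)"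
    using r r' assms[of "case_nat (\<rho>' 0) \<rho>" \<rho>'] by simp
  then show "m \<in> param_values (Suc N) (Conj (fshift \<phi>) \<psi>)"
    unfolding param_values_def using r by (intro image_eqI[of _ _ "case_nat (\<rho>' 0) \<rho>"]) auto
qed

lemma param_values_framed_by:
  assumes "framed_by d a \<psi>"
  shows "param_values (Suc (d + n)) (Conj (fshift \<phi>) \<psi>) = param_values (d + n) \<phi> \<inter> {lo + a..}"
proof -
  have "m \<in> param_values (Suc (d + n)) \<psi> \<longleftrightarrow> m \<ge> lo + a" for m
  proof
    assume "m \<ge> lo + a"
    then show "m \<in> param_values (Suc (d + n)) \<psi>" using assms
      unfolding param_values_def framed_by_def by (intro image_eqI[of _ _ "case_nat lo (\<lambda>_. m)"]) auto
  qed (use assms in \<open>auto simp: param_values_def framed_by_def\<close>)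
  then have "param_values (Suc (d + n)) \<psi> = {lo + a..}" by auto
  moreover have "param_values (Suc (d + n)) (Conj (fshift \<phi>) \<psi>) = param_values (d + n) \<phi> \<inter> param_values (Suc (d + n)) \<psi>"
    by (rule param_values_iter) (use assms in \<open>simp add: framed_by_def\<close>)
  ultimately show ?thesis by simp
qed

lemma param_values_guarded_by:
  assumes "guarded_by d Z \<psi>"
  shows "param_values (Suc (d + n)) (Conj (fshift \<phi>) \<psi>) = param_values (d + n) \<phi> - Z"
proof -
  have "m \<in> param_values (Suc (d + n)) \<psi> \<longleftrightarrow> m \<notin> Z" for m
  proof
    assume "m \<notin> Z"
    then show "m \<in> param_values (Suc (d + n)) \<psi>" using assms
      unfolding param_values_def guarded_by_def by (intro image_eqI[of _ _ "case_nat 0 (\<lambda>_. m)"]) auto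
  qed (use assms in \<open>auto simp: param_values_def guarded_by_def\<close>)
  then have "param_values (Suc (d + n)) \<psi> = - Z" by auto
  moreover have "param_values (Suc (d + n)) (Conj (fshift \<phi>) \<psi>) = param_values (d + n) \<phi> \<inter> param_values (Suc (d + n)) \<psi>"
    by (rule param_values_iter) (use assms in \<open>simp add: guarded_by_def\<close>)
  ultimately show ?thesis by auto
qed

text \<open>An over-approximation of the rewriting rules: which of the algebraic rules has been applied is
  irrelevant for the measures, and \<open>Y\<close> is the set of parameter values that satisfy the constraint context.\<close>

inductive simp_step :: "('p \<times> idx) set \<Rightarrow> int set \<Rightarrow> 'p tree \<Rightarrow> 'p tree \<Rightarrow> bool" for M where
  leaf: "\<not> isleaf T \<Longrightarrow> simp_step M Y T (XL b)"
| left: "simp_step M Y (XB q T U) T"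
| right: "simp_step M Y (XB q T U) U"
| vacI: "Y \<subseteq> {lo + a..} \<Longrightarrow> \<not> has_var 0 T \<Longrightarrow> simp_step M Y (XI q a s T) (tinst 0 c T)"
| vacG: "Y \<inter> Z = {} \<Longrightarrow> \<not> has_var 0 T \<Longrightarrow> simp_step M Y (XG q Z T) (tinst 0 c T)"
| simp: "isparam i \<Longrightarrow> (p, j) \<in> M \<Longrightarrow> m \<in> Y \<Longrightarrow> idx_val m i = idx_val m j \<Longrightarrow> Z = {m. idx_val m i = idx_val m j} \<Longrightarrow>
    simp_step M Y (XA p i) (XG q Z (XA p i))"
| int: "simp_step M Y (XI q a (Suc s) T) (XI q a s T)"
| neg: "simp_step M Y T T' \<Longrightarrow> simp_step M Y (XN T) (XN T')"
| bin1: "simp_step M Y T T' \<Longrightarrow> simp_step M Y (XB q T U) (XB q T' U)"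
| bin2: "simp_step M Y U U' \<Longrightarrow> simp_step M Y (XB q T U) (XB q T U')"
| itI: "simp_step M (Y \<inter> {lo + a..}) T T' \<Longrightarrow> simp_step M Y (XI q a s T) (XI q a s T')"
| itG: "simp_step M (Y - Z) T T' \<Longrightarrow> simp_step M Y (XG q Z T) (XG q Z T')"

text \<open>The effect on the pattern of the second conclusion of Constraint-split. \<open>E\<close>
  is the set of parameter values for which the removed iteration is nonempty; it ties the removal to
  the change of \<open>X\<close>.\<close>

inductive cut :: "int set \<Rightarrow> 'p tree \<Rightarrow> 'p tree \<Rightarrow> bool" where
  baseI: "cut {lo + a..} (XI q a s T) (XL b)"
| baseG: "cut (- Z) (XG q Z T) (XL b)"
| neg: "cut E T T' \<Longrightarrow> cut E (XN T) (XN T')"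
| bin1: "cut E T T' \<Longrightarrow> cut E (XB q T U) (XB q T' U)"
| bin2: "cut E U U' \<Longrightarrow> cut E (XB q T U) (XB q T U')"
| itI: "cut E T T' \<Longrightarrow> cut E (XI q a s T) (XI q a s T')"
| itG: "cut E T T' \<Longrightarrow> cut E (XG q Z T) (XG q Z T')"

text \<open>There is no clause for \<open>XG\<close>: no such iteration is left when a phase of
  Unfolding starts. The premise \<open>Y \<noteq> {}\<close> is the consistency of the context, and
  \<open>Y \<subseteq> {lo + a..}\<close> says that \<open>n - a\<close> lies in the domain.\<close>

inductive unfolds :: "int set \<Rightarrow> 'p tree \<Rightarrow> 'p tree \<Rightarrow> bool" where
  base: "Y \<noteq> {} \<Longrightarrow> Y \<subseteq> {lo + a..} \<Longrightarrow>
    unfolds Y (XI q a s T) (XB q (tinst 0 a T) (XI q (a + 1) (Suc s) T))"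
| neg: "unfolds Y T T' \<Longrightarrow> unfolds Y (XN T) (XN T')"
| bin1: "unfolds Y T T' \<Longrightarrow> unfolds Y (XB q T U) (XB q T' U)"
| bin2: "unfolds Y U U' \<Longrightarrow> unfolds Y (XB q T U) (XB q T U')"
| itI: "unfolds (Y \<inter> {lo + a..}) T T' \<Longrightarrow> unfolds Y (XI q a s T) (XI q a s T')"

text \<open>Entering an iteration intersects the admissible parameter values with those that make
  its domain nonempty, in step with \<open>ctx_cons\<close>. The base case ranges over all trees
  \<open>U\<close> because the tree at the hole only emerges in the induction.\<close>

lemma simulate_simp_step:
  assumes "rep d (plug C P) T"
    and base: "\<And>U. rep (d + depth C) P U \<Longrightarrow>
      \<exists>U'. rep (d + depth C) Q U' \<and> simp_step M (param_values (d + depth C + n) (ctx_cons C \<phi>)) U U'"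
  shows "\<exists>T'. rep d (plug C Q) T' \<and> simp_step M (param_values (d + n) \<phi>) T T'"
  using assms
proof (induction C arbitrary: d T \<phi>)
  case Hole
  then show ?case by simp
next
  case (CNeg C)
  then show ?case by (fastforce elim!: rep_negE intro: rep.neg simp_step.neg)
next
  case (CAndL C R)
  then show ?case by (fastforce elim!: rep_conjE intro: rep.conj simp_step.bin1)
next
  case (CAndR R C)
  then show ?case by (fastforce elim!: rep_conjE intro: rep.conj simp_step.bin2)
next
  case (COrL C R)
  then show ?case by (fastforce elim!: rep_disjE intro: rep.disj simp_step.bin1)
next
  case (COrR R C)
  then show ?case by (fastforce elim!: rep_disjE intro: rep.disj simp_step.bin2)
next
  case (CIter q \<psi> C)
  from CIter.prems(1) have "rep d (Iter q \<psi> (plug C P)) T" by simp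
  then show ?case
  proof (cases rule: rep_iter_cases)
    case F: (F a U)
    have "\<exists>T'. rep (Suc d) (plug C Q) T' \<and> simp_step M (param_values (Suc d + n) (Conj (fshift \<phi>) \<psi>)) U T'"
      using CIter.prems(2) F by (intro CIter.IH) auto
    then show ?thesis using F param_values_framed_by[of d a \<psi> \<phi>] by (auto intro!: rep.iterF simp_step.itI)
  next
    case G: (G Z U)
    have "\<exists>T'. rep (Suc d) (plug C Q) T' \<and> simp_step M (param_values (Suc d + n) (Conj (fshift \<phi>) \<psi>)) U T'"
      using CIter.prems(2) G by (intro CIter.IH) auto
    then show ?thesis using G param_values_guarded_by[of d Z \<psi> \<phi>] by (auto intro!: rep.iterG simp_step.itG)
  qed
qed

lemma simulate_unfolds:
  assumes "rep d (plug C P) T" "guard_free T"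
    and base: "\<And>U. rep (d + depth C) P U \<Longrightarrow> guard_free U \<Longrightarrow>
      \<exists>U'. rep (d + depth C) Q U' \<and> unfolds (param_values (d + depth C + n) (ctx_cons C \<phi>)) U U'"
  shows "\<exists>T'. rep d (plug C Q) T' \<and> unfolds (param_values (d + n) \<phi>) T T'"
  using assms
proof (induction C arbitrary: d T \<phi>)
  case Hole
  then show ?case by simp
next
  case (CNeg C)
  then show ?case by (fastforce elim!: rep_negE intro: rep.neg unfolds.neg)
next
  case (CAndL C R)
  then show ?case by (fastforce elim!: rep_conjE intro: rep.conj unfolds.bin1)
next
  case (CAndR R C)
  then show ?case by (fastforce elim!: rep_conjE intro: rep.conj unfolds.bin2)
next
  case (COrL C R)
  then show ?case by (fastforce elim!: rep_disjE intro: rep.disj unfolds.bin1)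
next
  case (COrR R C)
  then show ?case by (fastforce elim!: rep_disjE intro: rep.disj unfolds.bin2)
next
  case (CIter q \<psi> C)
  from CIter.prems(1) have "rep d (Iter q \<psi> (plug C P)) T" by simp
  then show ?case
  proof (cases rule: rep_iter_cases)
    case F: (F a U)
    have "\<exists>T'. rep (Suc d) (plug C Q) T' \<and> unfolds (param_values (Suc d + n) (Conj (fshift \<phi>) \<psi>)) U T'"
      using CIter.prems(2,3) F by (intro CIter.IH) auto
    then show ?thesis using F param_values_framed_by[of d a \<psi> \<phi>] by (auto intro!: rep.iterF unfolds.itI)
  next
    case G: (G Z U)
    then show ?thesis using CIter.prems(2) by simp
  qed
qed

lemma simulate_cut:
  assumes "rep d (plug C P) T"
    and base: "\<And>U. rep (d + depth C) P U \<Longrightarrow>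
      \<exists>U'. rep (d + depth C) Q U' \<and> cut E U U'"
  shows "\<exists>T'. rep d (plug C Q) T' \<and> cut E T T'"
  using assms
proof (induction C arbitrary: d T)
  case Hole
  then show ?case by simp
next
  case (CNeg C)
  then show ?case by (fastforce elim!: rep_negE intro: rep.neg cut.neg)
next
  case (CAndL C R)
  then show ?case by (fastforce elim!: rep_conjE intro: rep.conj cut.bin1)
next
  case (CAndR R C)
  then show ?case by (fastforce elim!: rep_conjE intro: rep.conj cut.bin2)
next
  case (COrL C R)
  then show ?case by (fastforce elim!: rep_disjE intro: rep.disj cut.bin1)
next
  case (COrR R C)
  then show ?case by (fastforce elim!: rep_disjE intro: rep.disj cut.bin2)
next
  case (CIter q \<psi> C)
  from CIter.prems(1) have "rep d (Iter q \<psi> (plug C P)) T" by simp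
  then show ?case
  proof (cases rule: rep_iter_cases)
    case F: (F a U)
    have "\<exists>T'. rep (Suc d) (plug C Q) T' \<and> cut E U T'"
      using CIter.prems(2) F by (intro CIter.IH) auto
    then show ?thesis using F by (auto intro!: rep.iterF cut.itI)
  next
    case G: (G Z U)
    have "\<exists>T'. rep (Suc d) (plug C Q) T' \<and> cut E U T'"
      using CIter.prems(2) G by (intro CIter.IH) auto
    then show ?thesis using G by (auto intro!: rep.iterG cut.itG)
  qed
qed

lemma rep_hole: "rep d (plug C P) T \<Longrightarrow> \<exists>U. rep (d + depth C) P U"
proof (induction C arbitrary: d T)
  case (CIter q \<psi> C)
  from CIter.prems have "rep d (Iter q \<psi> (plug C P)) T" by simp
  then have "\<exists>U. rep (Suc d) (plug C P) U" by (cases rule: rep_iter_cases) auto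
  then show ?case using CIter.IH[of "Suc d"] by auto
qed (auto elim!: rep_negE rep_conjE rep_disjE)

end

section \<open>Simulation of the rules\<close>

primrec param_atoms :: "'p tree \<Rightarrow> ('p \<times> idx) set" where
  "param_atoms (XL b) = {}"
| "param_atoms (XA p i) = (if isparam i then {(p, i)} else {})"
| "param_atoms (XN T) = param_atoms T"
| "param_atoms (XB q T U) = param_atoms T \<union> param_atoms U"
| "param_atoms (XI q b s T) = param_atoms T"
| "param_atoms (XG q Z T) = param_atoms T"

lemma ground_simps [simp]:
  "ground \<rho> (LPos p es) = LPos p (map (leval \<rho>) es)"
  "ground \<rho> (LNeg p es) = LNeg p (map (leval \<rho>) es)"
  by (simp_all add: ground_def)

lemma glits_lit_pat: "glits (realize (lit_pat L) \<rho>) = {ground \<rho> L}"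
  by (cases L) auto

lemma glits_pand: "glits (realize (pand (map lit_pat Ls)) \<rho>) = ground \<rho> ` set Ls"
proof (induction Ls)
  case (Cons L Ls)
  then show ?case by (cases Ls) (auto simp: glits_lit_pat)
qed simp

lemma lits_pat_obtain:
  assumes "finite \<Lambda>"
  obtains Ls where "set Ls = \<Lambda>" "lits_pat \<Lambda> = pand (map lit_pat Ls)"
proof -
  have "\<exists>Ls. distinct Ls \<and> set Ls = \<Lambda>" using finite_distinct_list[OF assms] by blast
  from someI_ex[OF this] show ?thesis using that unfolding lits_pat_def by blast
qed

lemma glits_lits_pat: "finite \<Lambda> \<Longrightarrow> glits (realize (lits_pat \<Lambda>) \<rho>) = ground \<rho> ` \<Lambda>"
  by (metis lits_pat_obtain glits_pand)

context frame
begin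

text \<open>The conditions on \<open>n\<close> on which Constraint-split can branch: for each
  iteration the set of values that make its domain nonempty.\<close>

primrec nodes :: "'p tree \<Rightarrow> int set set" where
  "nodes (XL b) = {}"
| "nodes (XA p i) = {}"
| "nodes (XN T) = nodes T"
| "nodes (XB q T U) = nodes T \<union> nodes U"
| "nodes (XI q a s T) = insert {lo + a..} (nodes T)"
| "nodes (XG q Z T) = insert (- Z) (nodes T)"

definition depn :: "fml \<Rightarrow> bool" where
  "depn \<phi> \<longleftrightarrow> (\<forall>\<rho> \<rho>'. \<rho> n = \<rho>' n \<longrightarrow> sat \<phi> \<rho> = sat \<phi> \<rho>')"

definition lit_atoms :: "('p, lexp) lit set \<Rightarrow> ('p \<times> idx) set" where
  "lit_atoms \<Lambda> = {(p, i). isparam i \<and> (LPos p [idx_exp 0 i] \<in> \<Lambda> \<or> LNeg p [idx_exp 0 i] \<in> \<Lambda>)}"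

definition litform :: "('p, lexp) lit set \<Rightarrow> bool" where
  "litform \<Lambda> \<longleftrightarrow> (\<forall>L\<in>\<Lambda>. \<exists>p i. isparam i \<and> (L = LPos p [idx_exp 0 i] \<or> L = LNeg p [idx_exp 0 i]))"

text \<open>Ensures that a literal of \<open>\<Lambda>\<close> is never impure merely because of
  another literal of \<open>\<Lambda>\<close>.\<close>

definition consistent :: "fml \<Rightarrow> ('p, lexp) lit set \<Rightarrow> bool" where
  "consistent \<phi> \<Lambda> \<longleftrightarrow> (\<forall>p fs gs \<rho>. LPos p fs \<in> \<Lambda> \<longrightarrow> LNeg p gs \<in> \<Lambda> \<longrightarrow> sat \<phi> \<rho> \<longrightarrow>
     map (leval \<rho>) fs \<noteq> map (leval \<rho>) gs)"

fun label_inv :: "'p label \<Rightarrow> 'p tree \<Rightarrow> bool" where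
  "label_inv ((P, \<phi>), \<Lambda>) T \<longleftrightarrow> rep 0 P T \<and> wf_tree T \<and> depn \<phi> \<and> finite \<Lambda> \<and> litform \<Lambda> \<and> consistent \<phi> \<Lambda>"

text \<open>\<open>X - E \<noteq> {}\<close> is the satisfiability premise of Constraint-split; it
  makes the first conclusion a proper restriction of \<open>X\<close>.\<close>

inductive split1 :: "'p tree \<times> int set \<times> ('p \<times> idx) set \<Rightarrow> 'p tree \<times> int set \<times> ('p \<times> idx) set \<Rightarrow> bool" where
  pos: "E \<in> nodes T \<Longrightarrow> X - E \<noteq> {} \<Longrightarrow> split1 (T, X, M) (T, X \<inter> E, M)"
| neg: "E \<in> nodes T \<Longrightarrow> cut E T T' \<Longrightarrow> split1 (T, X, M) (T', X - E, M)"

inductive step2 :: "'p tree \<times> int set \<times> ('p \<times> idx) set \<Rightarrow> 'p tree \<times> int set \<times> ('p \<times> idx) set \<Rightarrow> bool" where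
  rew: "simp_step M X T T' \<Longrightarrow> step2 (T, X, M) (T', X, M)"
| split: "split1 (T, X, M) (T', X', M') \<Longrightarrow> step2 (T, X, M) (T', X', M')"
| psplit: "(p, i) \<in> param_atoms T \<Longrightarrow> (p, i) \<notin> M \<Longrightarrow> step2 (T, X, M) (T, X, insert (p, i) M)"

lemma leval_idx_exp: "isparam i \<Longrightarrow> leval \<rho> (idx_exp d i) = idx_val (\<rho> (d + n)) i"
  by (cases i) auto

lemma up_idx_exp: "isparam i \<Longrightarrow> up d (idx_exp 0 i) = idx_exp d i"
  by (rule lexp_eqI, cases i) (auto simp: ac_simps)

lemma up_idx_exp_1: "isparam i \<Longrightarrow> up (Suc 0) (idx_exp d i) = idx_exp (Suc d) i"
  by (rule lexp_eqI, cases i) (auto simp: ac_simps)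

lemma idx_exp_inj: "isparam i \<Longrightarrow> isparam j \<Longrightarrow> idx_exp 0 i = idx_exp 0 j \<Longrightarrow> i = j"
proof -
  assume a: "isparam i" "isparam j" "idx_exp 0 i = idx_exp 0 j"
  have "idx_val m i = idx_val m j" for m
    using arg_cong[OF a(3), of "leval (\<lambda>_. m)"] a(1,2) by (simp add: leval_idx_exp)
  from this[of 0] this[of 1] show "i = j" using a by (cases i; cases j) auto
qed

lemma rep_hole2: "rep d (plug C P) T \<Longrightarrow>
  \<exists>U. rep (d + depth C) P U \<and> nodes U \<subseteq> nodes T \<and> param_atoms U \<subseteq> param_atoms T"
proof (induction C arbitrary: d T)
  case (CIter q \<psi> C)
  from CIter.prems have "rep d (Iter q \<psi> (plug C P)) T" by simp
  then have "\<exists>U. rep (Suc d) (plug C P) U \<and> nodes U \<subseteq> nodes T \<and> param_atoms U \<subseteq> param_atoms T"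
    by (cases rule: rep_iter_cases) auto
  then obtain U where U: "rep (Suc d) (plug C P) U" "nodes U \<subseteq> nodes T" "param_atoms U \<subseteq> param_atoms T" by blast
  from CIter.IH[OF U(1)] obtain V where "rep (Suc d + depth C) P V" "nodes V \<subseteq> nodes U" "param_atoms V \<subseteq> param_atoms U"
    by blast
  then show ?case using U by (intro exI[of _ V]) auto
next
  case Hole
  then show ?case by auto
next
  case (CNeg C)
  then show ?case by (auto elim!: rep_negE)
next
  case (CAndL C R)
  from CAndL.prems obtain U V where "T = XB BigAnd U V" "rep d (plug C P) U" by (auto elim!: rep_conjE)
  then show ?case using CAndL.IH[of d U] by auto
next
  case (CAndR R C)
  from CAndR.prems obtain U V where "T = XB BigAnd U V" "rep d (plug C P) V" by (auto elim!: rep_conjE)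
  then show ?case using CAndR.IH[of d V] by auto
next
  case (COrL C R)
  from COrL.prems obtain U V where "T = XB BigOr U V" "rep d (plug C P) U" by (auto elim!: rep_disjE)
  then show ?case using COrL.IH[of d U] by auto
next
  case (COrR R C)
  from COrR.prems obtain U V where "T = XB BigOr U V" "rep d (plug C P) V" by (auto elim!: rep_disjE)
  then show ?case using COrR.IH[of d V] by auto
qed

lemma param_values_Conj_depn:
  assumes "\<And>\<rho>. sat \<chi> \<rho> \<longleftrightarrow> \<rho> n \<in> E"
  shows "param_values n (Conj \<phi> \<chi>) = param_values n \<phi> \<inter> E"
  using assms by (auto simp: param_values_def)

lemma depn_Conj:
  assumes "depn \<phi>" "\<And>\<rho>. sat \<chi> \<rho> \<longleftrightarrow> \<rho> n \<in> E"
  shows "depn (Conj \<phi> \<chi>)"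
  unfolding depn_def
proof (intro allI impI)
  fix \<rho> \<rho>' :: "nat \<Rightarrow> int" assume eq: "\<rho> n = \<rho>' n"
  then have "sat \<phi> \<rho> = sat \<phi> \<rho>'" using assms(1) unfolding depn_def by blast
  then show "sat (Conj \<phi> \<chi>) \<rho> = sat (Conj \<phi> \<chi>) \<rho>'" by (simp add: assms(2) eq)
qed

lemma consistent_Conj: "consistent \<phi> \<Lambda> \<Longrightarrow> consistent (Conj \<phi> \<chi>) \<Lambda>"
  by (simp add: consistent_def)

lemma rep_iter_nonempty:
  assumes "rep d (Iter q \<psi> P) T"
  shows "\<exists>E. (\<forall>\<rho>. sat (fsubst (down d) (FEx \<psi>)) \<rho> \<longleftrightarrow> \<rho> n \<in> E) \<and> E \<in> nodes T \<and> (\<forall>b. cut E T (XL b))"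
  using assms
proof (cases rule: rep_iter_cases)
  case (F a U)
  have "sat (fsubst (down d) (FEx \<psi>)) \<rho> \<longleftrightarrow> \<rho> n \<in> {lo + a..}" for \<rho>
  proof -
    have "sat (fsubst (down d) (FEx \<psi>)) \<rho> \<longleftrightarrow> (\<exists>v. lo \<le> v \<and> v \<le> \<rho> n - a)"
      using F by (simp add: framed_by_def down_def lift_sub_def)
    also have "\<dots> \<longleftrightarrow> lo \<le> \<rho> n - a" by (meson order.refl order.trans)
    finally show ?thesis by auto
  qed
  then show ?thesis using F by (intro exI[of _ "{lo + a..}"]) (auto intro: cut.baseI)
next
  case (G Z U)
  have "sat (fsubst (down d) (FEx \<psi>)) \<rho> \<longleftrightarrow> \<rho> n \<in> - Z" for \<rho>
    using G by (simp add: guarded_by_def down_def lift_sub_def)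
  then show ?thesis using G by (intro exI[of _ "- Z"]) (auto intro: cut.baseG)
qed

lemma sat_empty_iff: "sat (fsubst (down d) (FAll (FNot \<psi>))) \<rho> \<longleftrightarrow> \<not> sat (fsubst (down d) (FEx \<psi>)) \<rho>"
  by simp

lemma guard_chain_cut: "cut E T T' \<Longrightarrow> guard_chain T \<Longrightarrow> guard_chain T'"
  by (induction rule: cut.induct) auto

lemma wf_tree_cut: "cut E T T' \<Longrightarrow> wf_tree T \<Longrightarrow> wf_tree T'"
  by (induction rule: cut.induct) (auto simp: guard_chain_cut elim: cut.cases)

lemma simulate_csplit:
  assumes "constraint_split fr l ls" "label_inv l T" "l' \<in> set ls"
  shows "\<exists>T'. label_inv l' T' \<and>
    split1 (T, param_values n (snd (fst l)), lit_atoms (snd l)) (T', param_values n (snd (fst l')), lit_atoms (snd l'))"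
  using assms(1)
proof cases
  case (1 P C q \<psi> Q d \<epsilon> \<phi> \<Lambda>)
  have rep: "rep 0 (plug C (Iter q \<psi> Q)) T" and T: "wf_tree T" "depn \<phi>" "finite \<Lambda>" "litform \<Lambda>" "consistent \<phi> \<Lambda>"
    using assms(2) 1 by auto
  obtain U where U: "rep (depth C) (Iter q \<psi> Q) U" "nodes U \<subseteq> nodes T"
    using rep_hole2[OF rep] by auto
  obtain E where E: "\<And>\<rho>. sat (fsubst (down d) (FEx \<psi>)) \<rho> \<longleftrightarrow> \<rho> n \<in> E" "E \<in> nodes U"
    using rep_iter_nonempty[OF U(1)] 1(4) by blast
  have eps: "sat \<epsilon> \<rho> \<longleftrightarrow> \<rho> n \<in> - E" for \<rho>
    using E(1)[of \<rho>] unfolding 1(6) sat_empty_iff by simp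
  have ET: "E \<in> nodes T" using E U by auto
  from assms(3) 1(2) consider
    "l' = ((P, Conj \<phi> (fsubst (down d) (FEx \<psi>))), \<Lambda>)" | "l' = ((plug C (neutral q), Conj \<phi> \<epsilon>), \<Lambda>)"
    by auto
  then show ?thesis
  proof cases
    case a: 1
    have "\<exists>\<rho>. sat (Conj \<phi> \<epsilon>) \<rho>" using 1(7) unfolding satisfiable_def .
    then have "param_values n \<phi> - E \<noteq> {}" using eps by (auto simp: param_values_def)
    then show ?thesis
      using a 1 rep T ET param_values_Conj_depn[OF E(1)] depn_Conj[OF T(2) E(1)] consistent_Conj[OF T(5)]
      by (intro exI[of _ T]) (auto intro: split1.pos simp del: sat_fsubst fsubst.simps)
  next
    case b: 2
    have "\<exists>T'. rep 0 (plug C (neutral q)) T' \<and> cut E T T'"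
    proof (rule simulate_cut[OF rep])
      fix V assume "rep (0 + depth C) (Iter q \<psi> Q) V"
      then obtain E' where E': "\<And>\<rho>. sat (fsubst (down d) (FEx \<psi>)) \<rho> \<longleftrightarrow> \<rho> n \<in> E'" "\<And>b. cut E' V (XL b)"
        using rep_iter_nonempty[of "depth C" q \<psi> Q V] 1(4) by auto
      \<comment> \<open>The tree met at the hole is not known to be \<open>U\<close>, but both sets
        are read off from the same formula.\<close>
      have "m \<in> E \<longleftrightarrow> m \<in> E'" for m using E(1)[of "\<lambda>_. m"] E'(1)[of "\<lambda>_. m"] by blast
      then have "E = E'" by blast
      then show "\<exists>U'. rep (0 + depth C) (neutral q) U' \<and> cut E V U'" using E'(2) rep_neutral by blast
    qed
    then obtain T' where T': "rep 0 (plug C (neutral q)) T'" "cut E T T'" by blast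
    have "param_values n (Conj \<phi> \<epsilon>) = param_values n \<phi> - E" using param_values_Conj_depn[OF eps] by auto
    then show ?thesis
      using b T' 1 T ET depn_Conj[OF T(2) eps] consistent_Conj[OF T(5)] wf_tree_cut[OF T'(2)]
      by (intro exI[of _ T']) (auto intro: split1.neg)
  qed
qed

lemma simulate_algebraic:
  assumes "algebraic \<gamma> P Q" "rep d P U"
  shows "\<exists>U'. rep d Q U' \<and> simp_step M (param_values (d + n) \<gamma>) U U'"
  using assms
proof (induction rule: algebraic.induct)
  case 1
  then show ?case by (auto elim!: rep_negE intro!: exI[of _ "XL False"] rep.bot simp_step.leaf)
next
  case 2
  then show ?case by (auto elim!: rep_negE intro!: exI[of _ "XL True"] rep.top simp_step.leaf)
next
  case (13 q \<phi>)
  then show ?case using rep_neutral[of d q]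
    by (auto elim!: rep_iterE intro!: exI[of _ "XL (q = BigAnd)"] simp_step.leaf)
next
  case (14 \<phi> q P)
  then show ?case using rep_neutral[of d q]
    by (auto elim!: rep_iterE intro!: exI[of _ "XL (q = BigAnd)"] simp_step.leaf)
next
  case (15 \<phi> P q)
  have sub: "rep d (psubst P (down 1)) (tinst 0 0 V)" "\<not> has_var 0 V" if "rep (Suc d) P V" for V
  proof -
    show *: "\<not> has_var 0 V" using has_var_pfree[OF that] 15(2) by blast
    have "simple_exp (0 :: lexp)" unfolding simple_exp_def by (intro disjI2 exI[of _ 0] lexp_eqI) simp
    from rep_subst[OF this that, of 0 d 0] * show "rep d (psubst P (down 1)) (tinst 0 0 V)"
      by (simp add: down_subi)
  qed
  have ex: "\<exists>v. sat \<phi> (case_nat v \<rho>)" if "sat \<gamma> \<rho>" for \<rho>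
    using 15(1) that by (simp add: entails_def)
  from 15(3) show ?case
  proof (cases rule: rep_iter_cases)
    case (F a V)
    have "param_values (d + n) \<gamma> \<subseteq> {lo + a..}"
      using ex F by (fastforce simp: param_values_def framed_by_def)
    then show ?thesis using F sub by (auto intro!: exI[of _ "tinst 0 0 V"] simp_step.vacI)
  next
    case (G Z V)
    have "param_values (d + n) \<gamma> \<inter> Z = {}"
      using ex G by (fastforce simp: param_values_def guarded_by_def)
    then show ?thesis using G sub by (auto intro!: exI[of _ "tinst 0 0 V"] simp_step.vacG)
  qed
qed (auto elim!: rep_negE rep_conjE rep_disjE rep_topE rep_botE
    intro: rep.top rep.bot simp_step.leaf simp_step.left simp_step.right)

text \<open>Every domain mentions only its own variable and the parameter, whereas Emptiness asks
  for an inner domain that contains the outer iteration variable.\<close>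

lemma emptiness_impossible:
  assumes "emptiness \<gamma> P Q" "rep d P U"
  shows False
  using assms(1)
proof cases
  case (1 d' C \<phi> \<phi>' q q' P')
  have "rep d (plug (CIter q \<phi> C) (Iter q' \<phi>' P')) U" using assms(2) 1 by simp
  from rep_hole[OF this] obtain V where "rep (d + Suc (depth C)) (Iter q' \<phi>' P') V" by auto
  then have "ffree \<phi>' \<subseteq> {0, Suc (d + Suc (depth C) + n)}"
    by (cases rule: rep_iter_cases) (use ffree_framed_by ffree_guarded_by in blast)+
  with 1 show False by auto
qed

lemma simulate_prop_simp:
  assumes "prop_simp \<Lambda> d \<gamma> P Q" "rep d P U" "only_params S d (pfree P)" "litform \<Lambda>"
  shows "\<exists>U'. rep d Q U' \<and> simp_step (lit_atoms \<Lambda>) (param_values (d + n) \<gamma>) U U'"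
proof -
  have *: "\<exists>U'. rep d (simp_iter q p es fs') U' \<and> simp_step (lit_atoms \<Lambda>) (param_values (d + n) \<gamma>) U U'"
    if P: "P = Atom p es" and fs: "LPos p fs \<in> \<Lambda> \<or> LNeg p fs \<in> \<Lambda>" and fs': "fs' = map (up d) fs"
      and sat: "satisfiable (Conj \<gamma> (fconj (map2 Eq es fs')))" for q p es fs fs'
  proof -
    obtain i where i: "U = XA p i" "es = [idx_exp d i]" "\<And>x c. i = IV x c \<Longrightarrow> x < d"
      using assms(2) P by (auto elim: rep_atomE)
    \<comment> \<open>The strategy rewrites only indices built from parameters. Below
      \<open>d\<close> binders these are variables from \<open>d\<close> on, while a bound variable
      is below \<open>d\<close>.\<close>
    have pi: "isparam i"
    proof (cases i)
      case (IV x c)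
      then have "x \<in> pfree P" using P i lvars_idx_exp[of d "IV x c"] by simp
      then have "d \<le> x" using assms(3) by (auto simp: only_params_def)
      with i(3)[OF IV] show ?thesis by simp
    qed auto
    obtain j where j: "isparam j" "fs = [idx_exp 0 j]"
      using assms(4) fs unfolding litform_def by blast
    then have f: "fs' = [idx_exp d j]" using fs' by (simp add: up_idx_exp)
    have M: "(p, j) \<in> lit_atoms \<Lambda>" using j fs by (auto simp: lit_atoms_def)
    from sat obtain \<rho> where r: "sat \<gamma> \<rho>" "leval \<rho> (idx_exp d i) = leval \<rho> (idx_exp d j)"
      unfolding satisfiable_def i(2) f by auto
    let ?Z = "{m. idx_val m i = idx_val m j}"
    let ?\<psi> = "Conj (FNot (Eq (up 1 (idx_exp d i)) (up 1 (idx_exp d j)))) (Eq (lvar 0) 0)"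
    have "guarded_by d ?Z ?\<psi>" by (auto simp: guarded_by_def up_idx_exp_1 pi j leval_idx_exp)
    moreover have "nocmp ?\<psi>" by (simp add: nocmp_def is_cmp_def)
    moreover have "rep (Suc d) (Atom p [up 1 (idx_exp d i)]) (XA p i)"
      by (rule rep.atom) (use pi in \<open>auto simp: up_idx_exp_1\<close>)
    ultimately have "rep d (simp_iter q p es fs') (XG q ?Z (XA p i))"
      unfolding simp_iter_def i(2) f by (simp add: rep.iterG)
    moreover have "simp_step (lit_atoms \<Lambda>) (param_values (d + n) \<gamma>) U (XG q ?Z (XA p i))"
      unfolding i(1) by (rule simp_step.simp[OF pi M, of "\<rho> (d + n)"])
        (use r pi j in \<open>auto simp: param_values_def leval_idx_exp\<close>)
    ultimately show ?thesis by blast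
  qed
  from assms(1) show ?thesis by cases (use * in blast)+
qed

text \<open>Two distinct indices \<open>n + c\<close> never meet, equal ones always do, and
  \<open>n + c\<close> meets a constant at one value. The hypothesis excludes the empty set, so a
  guard is either never satisfied or fails at exactly one value of \<open>n\<close>.\<close>

lemma coincide_set:
  assumes "isparam i" "isparam j" "idx_val m i = idx_val m j"
  shows "{m. idx_val m i = idx_val m j} = UNIV \<or> (\<exists>c. {m. idx_val m i = idx_val m j} = {c})"
proof -
  have "{m. m + c = f} = {f - c}" "{m. f = m + c} = {f - c}" for c f :: int by auto
  then show ?thesis using assms by (cases i; cases j) auto
qed

lemma guard_chain_simp_step: "simp_step M Y T T' \<Longrightarrow> guard_chain T \<Longrightarrow> (\<forall>(p, j)\<in>M. isparam j) \<Longrightarrow> guard_chain T'"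
proof (induction rule: simp_step.induct)
  case (simp i p j m Y Z q)
  then have "isparam i" "isparam j" by auto
  with simp(4,5) coincide_set[of i j m] show ?case by simp
qed (auto simp: tinst_guard_chain)

lemma wf_tree_simp_step: "simp_step M Y T T' \<Longrightarrow> wf_tree T \<Longrightarrow> (\<forall>(p, j)\<in>M. isparam j) \<Longrightarrow> wf_tree T'"
proof (induction rule: simp_step.induct)
  case (simp i p j m Y Z q)
  then have "guard_chain (XG q Z (XA p i))" using guard_chain_simp_step[OF simp_step.simp[of i p j M m Y Z q]] by auto
  then show ?case by (rule guard_chain_wf_tree)
next
  case (neg Y T T')
  then show ?case by (auto simp: guard_chain_simp_step elim: simp_step.cases)
next
  case (itG Y Z T T' q)
  then show ?case using guard_chain_simp_step[OF itG.hyps] by auto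
qed (auto simp: wf_tree_tinst tinst_guard_chain guard_chain_wf_tree)

lemma simulate_rewriting:
  assumes "rewriting l ls" "label_inv l T" "l' \<in> set ls"
  shows "\<exists>T'. label_inv l' T' \<and>
    step2 (T, param_values n (snd (fst l)), lit_atoms (snd l)) (T', param_values n (snd (fst l')), lit_atoms (snd l'))"
proof -
  have *: "\<exists>T'. label_inv ((plug C Q, \<phi>), \<Lambda>) T' \<and> step2 (T, param_values n \<phi>, lit_atoms \<Lambda>) (T', param_values n \<phi>, lit_atoms \<Lambda>)"
    if l: "l = ((plug C P, \<phi>), \<Lambda>)"
      and base: "\<And>U. rep (0 + depth C) P U \<Longrightarrow>
        \<exists>U'. rep (0 + depth C) Q U' \<and> simp_step (lit_atoms \<Lambda>) (param_values (0 + depth C + n) (ctx_cons C \<phi>)) U U'"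
    for C P Q \<phi> \<Lambda>
  proof -
    have rep: "rep 0 (plug C P) T" using assms(2) l by simp
    from simulate_simp_step[OF rep base] obtain T' where T': "rep 0 (plug C Q) T'" "simp_step (lit_atoms \<Lambda>) (param_values n \<phi>) T T'" by auto
    have "\<forall>(p, j)\<in>lit_atoms \<Lambda>. isparam j" by (auto simp: lit_atoms_def)
    with wf_tree_simp_step[OF T'(2)] T' assms(2) l show ?thesis by (intro exI[of _ T']) (auto intro: step2.rew)
  qed
  from assms(1) show ?thesis
  proof cases
    case (1 C \<phi> P Q \<Lambda>)
    have "\<exists>T'. label_inv ((plug C Q, \<phi>), \<Lambda>) T' \<and> step2 (T, param_values n \<phi>, lit_atoms \<Lambda>) (T', param_values n \<phi>, lit_atoms \<Lambda>)"
      by (rule *[OF 1(1)]) (rule simulate_algebraic[OF 1(3)])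
    then show ?thesis using 1 assms(3) by simp
  next
    case (2 C \<phi> P Q \<Lambda>)
    have "rep 0 (plug C P) T" using assms(2) 2 by simp
    then show ?thesis using rep_hole[of 0 C P T] emptiness_impossible[OF 2(3)] by blast
  next
    case (3 \<Lambda> C \<phi> P Q)
    have leaf_states: "litform \<Lambda>" using assms(2) 3 by simp
    have "\<exists>T'. label_inv ((plug C Q, \<phi>), \<Lambda>) T' \<and> step2 (T, param_values n \<phi>, lit_atoms \<Lambda>) (T', param_values n \<phi>, lit_atoms \<Lambda>)"
      by (rule *[OF 3(1)]) (use simulate_prop_simp[OF 3(3) _ 3(4) leaf_states] in simp)
    then show ?thesis using 3 assms(3) by simp
  qed
qed

text \<open>The occurrence has indices of the form \<open>up (depth C) e\<close>, so it cannot
  depend on a bound variable. That neither literal may occur in \<open>\<Lambda>\<close> yields two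
  things: the pair is new in \<open>lit_atoms\<close>, which makes the measure drop, and
  \<open>consistent\<close> survives the insertion.\<close>

lemma simulate_prop_split:
  assumes "prop_split l ls" "label_inv l T" "l' \<in> set ls" "satisfiable (snd (fst l))"
  shows "\<exists>T'. label_inv l' T' \<and>
    step2 (T, param_values n (snd (fst l)), lit_atoms (snd l)) (T', param_values n (snd (fst l')), lit_atoms (snd l'))"
  using assms(1)
proof cases
  case (1 P C p es \<phi> \<Lambda>)
  let ?d = "depth C"
  have rep: "rep 0 (plug C (Atom p (map (up ?d) es))) T" and T: "rep 0 P T" "wf_tree T" "depn \<phi>" "finite \<Lambda>" "litform \<Lambda>" "consistent \<phi> \<Lambda>"
    using assms(2) 1 by auto
  obtain U where U: "rep (0 + ?d) (Atom p (map (up ?d) es)) U" "param_atoms U \<subseteq> param_atoms T"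
    using rep_hole2[OF rep] by auto
  then obtain i where i: "U = XA p i" "map (up ?d) es = [idx_exp ?d i]" "\<And>x c. i = IV x c \<Longrightarrow> x < ?d"
    by (auto elim: rep_atomE)
  then obtain e where e: "es = [e]" "up ?d e = idx_exp ?d i" by auto
  have pi: "isparam i"
  proof (cases i)
    case (IV x c)
    have "leval ((\<lambda>_. 0)(x := 1)) (up ?d e) = leval (\<lambda>_. 0) (up ?d e)"
    proof -
      have "(\<lambda>y. ((\<lambda>_. 0 :: int)(x := 1)) (y + ?d)) = (\<lambda>_. 0)" using i(3)[OF IV] by auto
      then show ?thesis by simp
    qed
    then show ?thesis using e(2) IV by simp
  qed auto
  have "e = idx_exp 0 i" using e(2) up_idx_exp[OF pi, of ?d] by (metis up_inject)
  then have es: "es = [idx_exp 0 i]" using e by simp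
  have occ: "LPos p fs \<in> \<Lambda> \<or> LNeg p fs \<in> \<Lambda> \<Longrightarrow> sat \<phi> \<rho> \<Longrightarrow> map (leval \<rho>) fs \<noteq> map (leval \<rho>) es" for fs \<rho>
    using 1(5,6) glits_lits_pat[OF T(4), of \<rho>] unfolding may_occur_def by force
  have nin: "(p, i) \<notin> lit_atoms \<Lambda>"
  proof
    assume "(p, i) \<in> lit_atoms \<Lambda>"
    then have "LPos p es \<in> \<Lambda> \<or> LNeg p es \<in> \<Lambda>" unfolding es lit_atoms_def by simp
    moreover obtain \<rho> where "sat \<phi> \<rho>" using assms(4) 1 by (auto simp: satisfiable_def)
    ultimately show False using occ[of es] by blast
  qed
  have st: "step2 (T, param_values n \<phi>, lit_atoms \<Lambda>) (T, param_values n \<phi>, insert (p, i) (lit_atoms \<Lambda>))"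
    using U i(1) pi nin by (intro step2.psplit) auto
  have "lit_atoms (insert (LPos p es) \<Lambda>) = insert (p, i) (lit_atoms \<Lambda>)" "lit_atoms (insert (LNeg p es) \<Lambda>) = insert (p, i) (lit_atoms \<Lambda>)"
    unfolding lit_atoms_def es using pi by (auto dest: idx_exp_inj)
  moreover have "litform (insert (LPos p es) \<Lambda>)" "litform (insert (LNeg p es) \<Lambda>)"
    using T(5) pi unfolding litform_def es by auto
  moreover have "consistent \<phi> (insert (LPos p es) \<Lambda>)" "consistent \<phi> (insert (LNeg p es) \<Lambda>)"
    using T(6) occ unfolding consistent_def by (metis insert_iff lit.distinct(1) lit.inject)+
  ultimately show ?thesis using 1 assms(3) st T by (intro exI[of _ T]) auto
qed

lemma framed_by_has_frame: "framed_by d a \<psi> \<Longrightarrow> has_frame \<psi> (lconst lo) (lvar (d + n) - lconst a)"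
  by (simp add: framed_by_def has_frame_def equivalent_def)

text \<open>The strategy speaks of the upper bound of any frame of the domain. For
  \<open>n \<ge> lo + a\<close> the domain is nonempty and its greatest element determines
  \<open>e\<close>; affine expressions that agree on a ray are equal.\<close>

lemma framed_by_frame_unique:
  assumes "framed_by d a \<psi>" "has_frame \<psi> e1 e"
  shows "e = lvar (d + n) - lconst a"
proof (rule leval_eventually_eq[where x = "d + n" and K = "lo + a"])
  fix \<rho> :: "nat \<Rightarrow> int" assume *: "lo + a \<le> \<rho> (d + n)"
  have iff: "lo \<le> v \<and> v \<le> \<rho> (d + n) - a \<longleftrightarrow> leval \<rho> e1 \<le> v \<and> v \<le> leval \<rho> e" for v
    using assms unfolding framed_by_def has_frame_def equivalent_def by (auto dest: spec[of _ "case_nat v \<rho>"])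
  show "leval \<rho> e = leval \<rho> (lvar (d + n) - lconst a)"
    using iff[of "\<rho> (d + n) - a"] iff[of "leval \<rho> e"] * by simp
qed

lemma simulate_unfold_iter:
  assumes "unfold_iter \<gamma> P Q" "rep d P U" "guard_free U"
  shows "\<exists>U'. rep d Q U' \<and> unfolds (param_values (d + n) \<gamma>) U U'"
  using assms(1)
proof cases
  case (1 e \<phi> q R)
  obtain a V where V: "U = XI q a (size (conjuncts \<phi>)) V" "framed_by d a \<phi>" "simple_fml \<phi>" "rep (Suc d) R V"
    using assms(2,3) 1 by (auto elim: rep_iterE)
  have e: "e = lvar (d + n) - lconst a"
    using 1(5) framed_by_has_frame[OF V(2)] framed_by_frame_unique[OF V(2)] unfolding framed_dom_def by blast
  have se: "simple_exp e" unfolding e simple_exp_def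
    by (intro disjI1 exI[of _ "d + n"] exI[of _ "- a"] lexp_eqI) simp
  have "rep d (psubst R (inst e)) (tinst 0 a V)"
    using rep_subst[OF se V(4), of 0 d a] e by (simp add: inst_subi)
  moreover have "rep d (Iter q (Conj \<phi> (FNot (Eq (lvar 0) (up 1 e)))) R) (XI q (a + 1) (Suc (size (conjuncts \<phi>))) V)"
  proof (rule rep.iterF)
    \<comment> \<open>Over the integers, removing the upper bound \<open>n - a\<close> moves it to
      \<open>n - (a + 1)\<close>.\<close>
    show "framed_by d (a + 1) (Conj \<phi> (FNot (Eq (lvar 0) (up 1 e))))"
      unfolding framed_by_def
    proof
      fix \<rho>
      have "sat \<phi> \<rho> \<longleftrightarrow> lo \<le> \<rho> 0 \<and> \<rho> 0 \<le> \<rho> (Suc (d + n)) - a" using V(2) unfolding framed_by_def by blast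
      then show "sat (Conj \<phi> (FNot (Eq (lvar 0) (up 1 e)))) \<rho> \<longleftrightarrow>
          lo \<le> \<rho> 0 \<and> \<rho> 0 \<le> \<rho> (Suc (d + n)) - (a + 1)"
        by (simp add: e) linarith
    qed
  qed (use V se in \<open>auto simp: simple_exp_up\<close>)
  moreover have "param_values (d + n) \<gamma> \<noteq> {}" using 1(3) by (auto simp: param_values_def satisfiable_def)
  moreover have "param_values (d + n) \<gamma> \<subseteq> {lo + a..}"
  proof
    fix m assume "m \<in> param_values (d + n) \<gamma>"
    then obtain \<rho> where "sat \<gamma> \<rho>" "m = \<rho> (d + n)" by (auto simp: param_values_def)
    then have "sat \<phi> (\<lambda>x. leval \<rho> (inst e x))" using 1(4) by (simp add: entails_def)
    then show "m \<in> {lo + a..}" using V(2) \<open>m = _\<close> by (simp add: framed_by_def inst_def e)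
  qed
  ultimately show ?thesis unfolding 1(2) V(1) using rep_comb unfolds.base by blast
qed

lemma guard_chain_unfolds: "unfolds Y T T' \<Longrightarrow> \<not> guard_chain T"
  by (induction rule: unfolds.induct) auto

lemma wf_tree_unfolds: "unfolds Y T T' \<Longrightarrow> wf_tree T \<Longrightarrow> wf_tree T'"
proof (induction rule: unfolds.induct)
  case (neg Y T T')
  then show ?case using guard_chain_unfolds[OF neg.hyps] by (auto elim: unfolds.cases)
qed (auto simp: wf_tree_tinst)

lemma simulate_unfolding:
  assumes "unfolding_rule l ls" "label_inv l T" "l' \<in> set ls" "guard_free T"
  shows "\<exists>T'. label_inv l' T' \<and> unfolds (param_values n (snd (fst l))) T T' \<and> param_values n (snd (fst l')) = param_values n (snd (fst l)) \<and>
    lit_atoms (snd l') = lit_atoms (snd l)"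
  using assms(1)
proof cases
  case (1 C \<phi> P Q \<Lambda>)
  have rep: "rep 0 (plug C P) T" using assms(2) 1 by simp
  have "\<exists>T'. rep 0 (plug C Q) T' \<and> unfolds (param_values (0 + n) \<phi>) T T'"
    by (rule simulate_unfolds[OF rep assms(4)]) (rule simulate_unfold_iter[OF 1(3)])
  then obtain T' where "rep 0 (plug C Q) T'" "unfolds (param_values n \<phi>) T T'" by auto
  then show ?thesis using 1 assms wf_tree_unfolds by (intro exI[of _ T']) auto
qed

end

primrec offsets :: "'p tree \<Rightarrow> int set" where
  "offsets (XL b) = {}"
| "offsets (XA p i) = {}"
| "offsets (XN T) = offsets T"
| "offsets (XB q T U) = offsets T \<union> offsets U"
| "offsets (XI q a s T) = insert a (offsets T)"
| "offsets (XG q Z T) = offsets T"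

primrec anysub :: "('p tree \<Rightarrow> bool) \<Rightarrow> 'p tree \<Rightarrow> bool" where
  "anysub Q (XL b) \<longleftrightarrow> Q (XL b)"
| "anysub Q (XA p i) \<longleftrightarrow> Q (XA p i)"
| "anysub Q (XN T) \<longleftrightarrow> Q (XN T) \<or> anysub Q T"
| "anysub Q (XB q T U) \<longleftrightarrow> Q (XB q T U) \<or> anysub Q T \<or> anysub Q U"
| "anysub Q (XI q a s T) \<longleftrightarrow> Q (XI q a s T) \<or> anysub Q T"
| "anysub Q (XG q Z T) \<longleftrightarrow> Q (XG q Z T) \<or> anysub Q T"

primrec cmpi :: "cmp \<Rightarrow> int \<Rightarrow> int \<Rightarrow> bool" where
  "cmpi CLt x y \<longleftrightarrow> x < y"
| "cmpi CLe x y \<longleftrightarrow> x \<le> y"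
| "cmpi CGe x y \<longleftrightarrow> y \<le> x"
| "cmpi CGt x y \<longleftrightarrow> y < x"

lemma sat_cmp_fml: "sat (cmp_fml c a b) \<rho> \<longleftrightarrow> cmpi c (leval \<rho> a) (leval \<rho> b)"
  by (cases c) auto

lemma cmpi_trans: "cmpi c x y \<Longrightarrow> cmpi c y z \<Longrightarrow> cmpi c x z"
  by (cases c) auto

lemma cmpi_not_trans: "cmpi c x y \<Longrightarrow> \<not> cmpi c z y \<Longrightarrow> cmpi c x z"
  by (cases c) auto

lemma cmpi_shift: "cmpi c (u + x) (u + y) \<longleftrightarrow> cmpi c x y"
  by (cases c) auto

lemma cmpi_unbounded: "cmpi c x y \<Longrightarrow> c \<in> {CLt, CLe} \<Longrightarrow> x \<le> y" "cmpi c x y \<Longrightarrow> c \<in> {CGt, CGe} \<Longrightarrow> y \<le> x"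
  by (cases c; simp)+

lemma is_cmp_cmp_fml: "is_cmp (cmp_fml c a b)"
  by (cases c) (auto simp: is_cmp_def)

lemma flexps_cmp_fml: "flexps (cmp_fml c a b) = {a, b}"
  by (cases c) auto

lemma simple_lmult_lvar:
  assumes "simple_exp (lmult k (lvar x))" "k > 0"
  shows "k = 1"
proof -
  obtain y c where e: "\<And>\<rho>. leval \<rho> (lmult k (lvar x)) = case_nat 0 \<rho> y + c"
    using simple_exp_coord[OF assms(1)] by blast
  have c: "c = 0" using e[of "\<lambda>_. 0"] by (simp split: nat.splits)
  have "int k = case_nat 0 (\<lambda>_. 1) y" using e[of "\<lambda>_. 1"] c by simp
  also have "\<dots> \<le> 1" by (simp split: nat.split)
  finally show ?thesis using assms(2) by simp
qed

lemma simple_up_form: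
  assumes "simple_exp (up D e)" "lvars e \<subseteq> {n}"
  shows "\<exists>u c. (u = 0 \<or> u = 1) \<and> (\<forall>\<rho>. leval \<rho> e = u * \<rho> n + c)"
proof -
  have bck: "leval \<rho> e = leval (\<lambda>y. \<rho> (y - D)) (up D e)" for \<rho> by simp
  from assms(1) consider (var) x c where "up D e = lvar x + lconst c" | (cst) c where "up D e = lconst c"
    unfolding simple_exp_def by blast
  then show ?thesis
  proof cases
    case var
    then have *: "leval \<rho> e = \<rho> (x - D) + c" for \<rho> using bck[of \<rho>] by simp
    have "x - D = n"
    proof (rule ccontr)
      assume "x - D \<noteq> n"
      then have "leval ((\<lambda>_. 0)(x - D := 1)) e = leval (\<lambda>_. 0) e"
        using assms(2) by (intro leval_cong) auto
      then show False using * by simp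
    qed
    then show ?thesis using * by (intro exI[of _ 1] exI[of _ c]) simp
  next
    case cst
    then have "leval \<rho> e = c" for \<rho> using bck[of \<rho>] by simp
    then show ?thesis by (intro exI[of _ 0] exI[of _ c]) simp
  qed
qed

lemma glits_gbig: "glits (gbig q As) = (\<Union>A\<in>set As. glits A)"
  by (induction q As rule: gbig.induct) auto

context frame
begin

lemma ffree_depn: "depn \<phi> \<Longrightarrow> ffree \<phi> \<subseteq> {n}"
proof
  fix x assume d: "depn \<phi>" and x: "x \<in> ffree \<phi>"
  from x obtain \<rho> v where "sat \<phi> (\<rho>(x := v)) \<noteq> sat \<phi> \<rho>" unfolding ffree_def by blast
  then have "(\<rho>(x := v)) n \<noteq> \<rho> n" using d unfolding depn_def by blast
  then show "x \<in> {n}" by (auto split: if_splits)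
qed

lemma params_label_inv: "label_inv ((P, \<phi>), \<Lambda>) T \<Longrightarrow> params (P, \<phi>) \<subseteq> {n}"
  unfolding params_def using pfree_rep[of 0 P T] ffree_depn[of \<phi>] by auto

text \<open>Being a parameter is semantic, so a constraint mentions \<open>n\<close> only if it
  excludes some value. In the applications \<open>-1\<close> is such a value.\<close>

lemma n_in_params: "depn \<phi> \<Longrightarrow> param_values n \<phi> \<noteq> {} \<Longrightarrow> m \<notin> param_values n \<phi> \<Longrightarrow> n \<in> params (P, \<phi>)"
proof -
  assume a: "depn \<phi>" "param_values n \<phi> \<noteq> {}" "m \<notin> param_values n \<phi>"
  then obtain \<rho> where r: "sat \<phi> \<rho>" by (auto simp: param_values_def)
  have "\<not> sat \<phi> (\<rho>(n := m))"
  proof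
    assume "sat \<phi> (\<rho>(n := m))"
    then have "(\<rho>(n := m)) n \<in> param_values n \<phi>" unfolding param_values_def by blast
    then show False using a(3) by simp
  qed
  then have "n \<in> ffree \<phi>" using r unfolding ffree_def by blast
  then show ?thesis by (simp add: params_def)
qed

text \<open>Difference form forces \<open>k = l = 1\<close> and bounds of slope \<open>0\<close> or
  \<open>1\<close> in \<open>n\<close>. Both bounds hold on the whole frame, so upper bounds have
  slope \<open>1\<close> and lower bounds slope \<open>0\<close>. With equal slopes the new
  constraint compares two constants: one conclusion is unsatisfiable, and in the other the deleted
  conjunct follows from the one kept.\<close>

lemma interval_F:
  assumes F: "framed_by d a \<psi>" and S: "simple_fml \<psi>" and kl: "k > 0" "l > 0"
    and A: "A = cmp_fml c (lmult k (lvar 0)) (up (Suc d) e1)"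
    and B: "B = cmp_fml c (lmult l (lvar 0)) (up (Suc d) e2)"
    and \<psi>: "conjuncts \<psi> = M + {#A, B#}" "conjuncts \<psi>1 = M + {#A#}" "conjuncts \<psi>2 = M + {#B#}"
    and e: "lvars e1 \<subseteq> {n}" "lvars e2 \<subseteq> {n}"
    and \<theta>: "\<theta> = cmp_fml c (lmult l e1) (lmult k e2)"
  shows "(\<forall>\<rho>. sat \<theta> \<rho>) \<and> framed_by d a \<psi>1 \<or> (\<forall>\<rho>. \<not> sat \<theta> \<rho>) \<and> framed_by d a \<psi>2"
proof -
  have "A \<in># conjuncts \<psi>" "B \<in># conjuncts \<psi>" using \<psi> by auto
  then have fl: "flexps A \<subseteq> flexps \<psi>" "flexps B \<subseteq> flexps \<psi>" using flexps_conjuncts[of \<psi>] by auto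
  then have "simple_exp (lmult k (lvar 0))" "simple_exp (lmult l (lvar 0))"
    and se: "simple_exp (up (Suc d) e1)" "simple_exp (up (Suc d) e2)"
    using S unfolding simple_fml_def A B flexps_cmp_fml by auto
  then have [simp]: "k = 1" "l = 1" using simple_lmult_lvar kl by auto
  obtain u1 c1 where u1: "u1 = 0 \<or> u1 = 1" "\<And>\<rho>. leval \<rho> e1 = u1 * \<rho> n + c1"
    using simple_up_form[OF se(1) e(1)] by blast
  obtain u2 c2 where u2: "u2 = 0 \<or> u2 = 1" "\<And>\<rho>. leval \<rho> e2 = u2 * \<rho> n + c2"
    using simple_up_form[OF se(2) e(2)] by blast
  have satA: "sat A \<rho> \<longleftrightarrow> cmpi c (\<rho> 0) (u1 * \<rho> (Suc (d + n)) + c1)" for \<rho>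
    unfolding A sat_cmp_fml by (simp add: u1 ac_simps)
  have satB: "sat B \<rho> \<longleftrightarrow> cmpi c (\<rho> 0) (u2 * \<rho> (Suc (d + n)) + c2)" for \<rho>
    unfolding B sat_cmp_fml by (simp add: u2 ac_simps)
  have sp: "sat \<psi> \<rho> \<longleftrightarrow> (\<forall>\<chi>\<in>#M. sat \<chi> \<rho>) \<and> sat A \<rho> \<and> sat B \<rho>"
    "sat \<psi>1 \<rho> \<longleftrightarrow> (\<forall>\<chi>\<in>#M. sat \<chi> \<rho>) \<and> sat A \<rho>" "sat \<psi>2 \<rho> \<longleftrightarrow> (\<forall>\<chi>\<in>#M. sat \<chi> \<rho>) \<and> sat B \<rho>" for \<rho>
    unfolding sat_conjuncts[of \<psi>] sat_conjuncts[of \<psi>1] sat_conjuncts[of \<psi>2] \<psi> by auto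
  \<comment> \<open>A parameter value so large that the frame is nonempty and that a bound of the
    wrong slope fails at one of its ends.\<close>
  define m where "m = \<bar>lo\<bar> + \<bar>a\<bar> + \<bar>c1\<bar> + \<bar>c2\<bar> + 1"
  have "lo \<le> v \<and> v \<le> m - a \<Longrightarrow> cmpi c v (u1 * m + c1) \<and> cmpi c v (u2 * m + c2)" for v
    using F[unfolded framed_by_def, rule_format, of "case_nat v (\<lambda>_. m)"] sp(1)[of "case_nat v (\<lambda>_. m)"]
      satA[of "case_nat v (\<lambda>_. m)"] satB[of "case_nat v (\<lambda>_. m)"] by simp
  from this[of "m - a"] this[of lo]
  have hi: "cmpi c (m - a) (u1 * m + c1)" "cmpi c (m - a) (u2 * m + c2)"
    and low: "cmpi c lo (u1 * m + c1)" "cmpi c lo (u2 * m + c2)"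
    by (auto simp: m_def)
  have u: "u1 = u2"
  proof (cases "c \<in> {CLt, CLe}")
    case True
    then have "m - a \<le> u1 * m + c1" "m - a \<le> u2 * m + c2" using hi cmpi_unbounded(1) by blast+
    then show ?thesis using u1(1) u2(1) by (auto simp: m_def)
  next
    case False
    then have "c \<in> {CGt, CGe}" by (cases c) auto
    then have "u1 * m + c1 \<le> lo" "u2 * m + c2 \<le> lo" using low cmpi_unbounded(2) by blast+
    then show ?thesis using u1(1) u2(1) by (auto simp: m_def)
  qed
  have th: "sat \<theta> \<rho> \<longleftrightarrow> cmpi c c1 c2" for \<rho>
    unfolding \<theta> sat_cmp_fml by (simp add: u1 u2 u cmpi_shift)
  show ?thesis
  proof (cases "cmpi c c1 c2")
    case True
    have "sat A \<rho> \<Longrightarrow> sat B \<rho>" for \<rho>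
      unfolding satA satB u using True cmpi_shift cmpi_trans by blast
    then have "sat \<psi>1 \<rho> = sat \<psi> \<rho>" for \<rho> using sp[of \<rho>] by blast
    then show ?thesis using F th True unfolding framed_by_def by simp
  next
    case False
    have "sat B \<rho> \<Longrightarrow> sat A \<rho>" for \<rho>
      unfolding satA satB u using False cmpi_shift cmpi_not_trans by blast
    then have "sat \<psi>2 \<rho> = sat \<psi> \<rho>" for \<rho> using sp[of \<rho>] by blast
    then show ?thesis using F th False unfolding framed_by_def by simp
  qed
qed

lemma simulate_interval:
  assumes "interval l ls" "label_inv l T" "l' \<in> set ls" "satisfiable (snd (fst l'))"
  shows "\<exists>T'. label_inv l' T' \<and>
    step2 (T, param_values n (snd (fst l)), lit_atoms (snd l)) (T', param_values n (snd (fst l')), lit_atoms (snd l'))"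
  using assms(1)
proof cases
  case (1 P C q \<psi> Q d k l1 A c e1 B e2 M \<psi>1 \<psi>2 \<phi> \<theta> \<Lambda>)
  have rep: "rep 0 (plug C (Iter q \<psi> Q)) T" and T: "wf_tree T" "depn \<phi>" "finite \<Lambda>" "litform \<Lambda>" "consistent \<phi> \<Lambda>"
    and inv: "label_inv ((P, \<phi>), \<Lambda>) T"
    using assms(2) 1 by auto
  have e: "lvars e1 \<subseteq> {n}" "lvars e2 \<subseteq> {n}" using 1 params_label_inv[OF inv] by blast+
  have key: "(\<forall>\<rho>. sat \<theta> \<rho>) \<and> framed_by (depth C) a \<psi>1 \<or> (\<forall>\<rho>. \<not> sat \<theta> \<rho>) \<and> framed_by (depth C) a \<psi>2"
    if "framed_by (depth C) a \<psi>" "simple_fml \<psi>" for a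
    by (rule interval_F[OF that 1(5,6) _ _ 1(9,10,11) e 1(15)]) (use 1 in auto)
  have Fcase: "\<exists>a V. U = XI q a (size (conjuncts \<psi>)) V \<and> framed_by (depth C) a \<psi> \<and> simple_fml \<psi> \<and> rep (Suc (depth C)) Q V"
    if "rep (0 + depth C) (Iter q \<psi> Q) U" for U
  proof -
    have "A \<in># conjuncts \<psi>" using 1 by simp
    then have "\<not> nocmp \<psi>" using is_cmp_cmp_fml 1(7) unfolding nocmp_def by blast
    then show ?thesis using that by (auto elim!: rep_iterE)
  qed
  have fin: "\<exists>T'. label_inv ((plug C (Iter q \<psi>' Q), Conj \<phi> \<chi>), \<Lambda>) T' \<and>
      step2 (T, param_values n \<phi>, lit_atoms \<Lambda>) (T', param_values n (Conj \<phi> \<chi>), lit_atoms \<Lambda>)"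
    if valid: "\<And>\<rho>. sat \<chi> \<rho>" and F': "\<And>a. framed_by (depth C) a \<psi> \<Longrightarrow> simple_fml \<psi> \<Longrightarrow> framed_by (depth C) a \<psi>'"
      and cj: "conjuncts \<psi> = add_mset R (conjuncts \<psi>')" for \<chi> \<psi>' R
  proof -
    have s': "simple_fml \<psi>'" if "simple_fml \<psi>"
      using that flexps_conjuncts[of \<psi>] flexps_conjuncts[of \<psi>'] unfolding simple_fml_def cj by auto
    have "\<exists>T'. rep 0 (plug C (Iter q \<psi>' Q)) T' \<and> simp_step (lit_atoms \<Lambda>) (param_values (0 + n) \<phi>) T T'"
    proof (rule simulate_simp_step[OF rep])
      fix U assume "rep (0 + depth C) (Iter q \<psi> Q) U"
      then obtain a V where V: "U = XI q a (size (conjuncts \<psi>)) V" "framed_by (depth C) a \<psi>" "simple_fml \<psi>"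
        "rep (Suc (depth C)) Q V" using Fcase by blast
      have "rep (0 + depth C) (Iter q \<psi>' Q) (XI q a (size (conjuncts \<psi>')) V)"
        using V F' s' by (auto intro: rep.iterF)
      moreover have "simp_step (lit_atoms \<Lambda>) Y U (XI q a (size (conjuncts \<psi>')) V)" for Y
        unfolding V(1) cj by (simp add: simp_step.int)
      ultimately show "\<exists>U'. rep (0 + depth C) (Iter q \<psi>' Q) U' \<and>
        simp_step (lit_atoms \<Lambda>) (param_values (0 + depth C + n) (ctx_cons C \<phi>)) U U'" by blast
    qed
    then obtain T' where T': "rep 0 (plug C (Iter q \<psi>' Q)) T'" "simp_step (lit_atoms \<Lambda>) (param_values n \<phi>) T T'" by auto
    have v: "sat \<chi> \<rho> \<longleftrightarrow> \<rho> n \<in> UNIV" for \<rho> using valid by simp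
    have "\<forall>(p, j)\<in>lit_atoms \<Lambda>. isparam j" by (auto simp: lit_atoms_def)
    then have "wf_tree T'" using wf_tree_simp_step[OF T'(2) T(1)] by blast
    then show ?thesis
      using T' T depn_Conj[OF T(2) v] consistent_Conj[OF T(5)] param_values_Conj_depn[OF v, of \<phi>]
      by (intro exI[of _ T']) (auto intro: step2.rew)
  qed
  have ex: "\<exists>a. framed_by (depth C) a \<psi> \<and> simple_fml \<psi>"
    using rep_hole[OF rep] Fcase by blast
  from assms(3) 1(2) consider "l' = ((plug C (Iter q \<psi>1 Q), Conj \<phi> \<theta>), \<Lambda>)"
    | "l' = ((plug C (Iter q \<psi>2 Q), Conj \<phi> (FNot \<theta>)), \<Lambda>)" by auto
  then show ?thesis
  proof cases
    case a: 1
    then have "\<exists>\<rho>. sat \<theta> \<rho>" using assms(4) by (auto simp: satisfiable_def)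
    then have "\<And>\<rho>. sat \<theta> \<rho>" "\<And>a. framed_by (depth C) a \<psi> \<Longrightarrow> simple_fml \<psi> \<Longrightarrow> framed_by (depth C) a \<psi>1"
      using key ex by blast+
    then show ?thesis using fin[of \<theta> \<psi>1 B] a 1(1,9,10) by simp
  next
    case b: 2
    then have "\<exists>\<rho>. \<not> sat \<theta> \<rho>" using assms(4) by (auto simp: satisfiable_def)
    then have "\<And>\<rho>. sat (FNot \<theta>) \<rho>" "\<And>a. framed_by (depth C) a \<psi> \<Longrightarrow> simple_fml \<psi> \<Longrightarrow> framed_by (depth C) a \<psi>2"
      using key ex unfolding sat.simps by blast+
    then show ?thesis using fin[of "FNot \<theta>" \<psi>2 A] b 1(1,9,11) by simp
  qed
qed

section \<open>Irreducible leaves\<close>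

inductive sub :: "int set \<Rightarrow> 'p tree \<Rightarrow> int set \<Rightarrow> 'p tree \<Rightarrow> bool" where
  here: "sub Y T Y T"
| neg: "sub Y T Y' U \<Longrightarrow> sub Y (XN T) Y' U"
| bin1: "sub Y T Y' U \<Longrightarrow> sub Y (XB q T S) Y' U"
| bin2: "sub Y T Y' U \<Longrightarrow> sub Y (XB q S T) Y' U"
| itI: "sub (Y \<inter> {lo + a..}) T Y' U \<Longrightarrow> sub Y (XI q a s T) Y' U"
| itG: "sub (Y - Z) T Y' U \<Longrightarrow> sub Y (XG q Z T) Y' U"

lemma sub_subset: "sub Y T Y' U \<Longrightarrow> Y' \<subseteq> Y"
  by (induction rule: sub.induct) auto

lemma sub_wf_tree: "sub Y T Y' U \<Longrightarrow> wf_tree T \<Longrightarrow> wf_tree U"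
proof (induction rule: sub.induct)
  case (neg Y T Y' U)
  then show ?case using guard_chain_wf_tree by auto
next
  case (itG Y Z T Y' U q)
  then show ?case using guard_chain_wf_tree by auto
qed auto

lemma sub_same: "sub Y T Y' U \<Longrightarrow> guard_free T \<Longrightarrow> \<forall>a\<in>offsets T. Y \<subseteq> {lo + a..} \<Longrightarrow> Y' = Y"
proof (induction rule: sub.induct)
  case (itI Y a T Y' U q s)
  then have "Y \<inter> {lo + a..} = Y" by auto
  with itI show ?case by auto
qed auto

lemma sub_anysub: "anysub Q T \<Longrightarrow> \<exists>Y' U. sub Y T Y' U \<and> Q U"
proof (induction T arbitrary: Y)
  case (XL b)
  then show ?case by (auto intro: sub.here)
next
  case (XA p i)
  then show ?case by (auto intro: sub.here)
next
  case (XN T)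
  show ?case
  proof (cases "Q (XN T)")
    case False
    then show ?thesis using XN.IH[of Y] XN.prems by (auto intro: sub.neg)
  qed (auto intro: sub.here)
next
  case (XB q T U)
  show ?case
  proof (cases "Q (XB q T U)")
    case False
    then show ?thesis using XB.IH(1)[of Y] XB.IH(2)[of Y] XB.prems by (auto intro: sub.bin1 sub.bin2)
  qed (auto intro: sub.here)
next
  case (XI q a s T)
  show ?case
  proof (cases "Q (XI q a s T)")
    case False
    then show ?thesis using XI.IH[of "Y \<inter> {lo + a..}"] XI.prems by (auto intro: sub.itI)
  qed (auto intro: sub.here)
next
  case (XG q Z T)
  show ?case
  proof (cases "Q (XG q Z T)")
    case False
    then show ?thesis using XG.IH[of "Y - Z"] XG.prems by (auto intro: sub.itG)
  qed (auto intro: sub.here)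
qed

lemma sub_offsets: "a \<in> offsets T \<Longrightarrow> \<exists>Y' q s V. sub Y T Y' (XI q a s V)"
proof -
  assume "a \<in> offsets T"
  then have "anysub (\<lambda>U. \<exists>q s V. U = XI q a s V) T" by (induction T) auto
  from sub_anysub[OF this] show ?thesis by blast
qed

lemma sub_G: "\<not> guard_free T \<Longrightarrow> \<exists>Y' q Z V. sub Y T Y' (XG q Z V)"
proof -
  assume "\<not> guard_free T"
  then have "anysub (\<lambda>U. \<exists>q Z V. U = XG q Z V) T" by (induction T) auto
  from sub_anysub[OF this] show ?thesis by blast
qed

lemma sub_param_atoms: "(p, i) \<in> param_atoms T \<Longrightarrow> \<exists>Y'. sub Y T Y' (XA p i) \<and> isparam i"
proof -
  assume "(p, i) \<in> param_atoms T"
  then have "anysub (\<lambda>U. U = XA p i \<and> isparam i) T" by (induction T) (auto split: if_splits)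
  from sub_anysub[OF this] show ?thesis by blast
qed

lemma sub_rep:
  "sub Y T Y' U \<Longrightarrow> rep d P T \<Longrightarrow> \<exists>C R. P = plug C R \<and> rep (d + depth C) R U \<and>
    (\<forall>\<phi>. param_values (d + n) \<phi> = Y \<longrightarrow> param_values (d + depth C + n) (ctx_cons C \<phi>) = Y')"
proof (induction arbitrary: d P rule: sub.induct)
  case (here Y T)
  then show ?case by (intro exI[of _ Hole] exI[of _ P]) auto
next
  case (neg Y T Y' U)
  from neg.prems obtain Q where Q: "P = PNeg Q" "rep d Q T" by (auto elim: rep_XNE)
  from neg.IH[OF Q(2)] obtain C R where "Q = plug C R" "rep (d + depth C) R U"
    "\<forall>\<phi>. param_values (d + n) \<phi> = Y \<longrightarrow> param_values (d + depth C + n) (ctx_cons C \<phi>) = Y'" by blast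
  then show ?case using Q by (intro exI[of _ "CNeg C"] exI[of _ R]) auto
next
  case (bin1 Y T Y' U q S)
  from bin1.prems obtain Q Q' where Q: "P = PAnd Q Q' \<or> P = POr Q Q'" "rep d Q T" by (auto elim: rep_XBE)
  from bin1.IH[OF Q(2)] obtain C R where C: "Q = plug C R" "rep (d + depth C) R U"
    "\<forall>\<phi>. param_values (d + n) \<phi> = Y \<longrightarrow> param_values (d + depth C + n) (ctx_cons C \<phi>) = Y'" by blast
  from Q(1) show ?case
  proof
    assume "P = PAnd Q Q'" then show ?thesis using C by (intro exI[of _ "CAndL C Q'"] exI[of _ R]) auto
  next
    assume "P = POr Q Q'" then show ?thesis using C by (intro exI[of _ "COrL C Q'"] exI[of _ R]) auto
  qed
next
  case (bin2 Y T Y' U q S)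
  from bin2.prems obtain Q Q' where Q: "P = PAnd Q' Q \<or> P = POr Q' Q" "rep d Q T" by (auto elim: rep_XBE)
  from bin2.IH[OF Q(2)] obtain C R where C: "Q = plug C R" "rep (d + depth C) R U"
    "\<forall>\<phi>. param_values (d + n) \<phi> = Y \<longrightarrow> param_values (d + depth C + n) (ctx_cons C \<phi>) = Y'" by blast
  from Q(1) show ?case
  proof
    assume "P = PAnd Q' Q" then show ?thesis using C by (intro exI[of _ "CAndR Q' C"] exI[of _ R]) auto
  next
    assume "P = POr Q' Q" then show ?thesis using C by (intro exI[of _ "COrR Q' C"] exI[of _ R]) auto
  qed
next
  case (itI Y a T Y' U q s)
  from itI.prems obtain \<psi> Q where Q: "P = Iter q \<psi> Q" "rep (Suc d) Q T" "framed_by d a \<psi>" by (auto elim: rep_XIE)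
  from itI.IH[OF Q(2)] obtain C R where C: "Q = plug C R" "rep (Suc d + depth C) R U"
    "\<And>\<phi>. param_values (Suc d + n) \<phi> = Y \<inter> {lo + a..} \<Longrightarrow> param_values (Suc d + depth C + n) (ctx_cons C \<phi>) = Y'" by blast
  have "param_values (d + n) \<phi> = Y \<Longrightarrow> param_values (Suc d + depth C + n) (ctx_cons C (Conj (fshift \<phi>) \<psi>)) = Y'" for \<phi>
    using param_values_framed_by[OF Q(3), of \<phi>] by (intro C(3)) simp
  then show ?case using C Q by (intro exI[of _ "CIter q \<psi> C"] exI[of _ R]) auto
next
  case (itG Y Z T Y' U q)
  from itG.prems obtain \<psi> Q where Q: "P = Iter q \<psi> Q" "rep (Suc d) Q T" "guarded_by d Z \<psi>" by (auto elim: rep_XGE)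
  from itG.IH[OF Q(2)] obtain C R where C: "Q = plug C R" "rep (Suc d + depth C) R U"
    "\<And>\<phi>. param_values (Suc d + n) \<phi> = Y - Z \<Longrightarrow> param_values (Suc d + depth C + n) (ctx_cons C \<phi>) = Y'" by blast
  have "param_values (d + n) \<phi> = Y \<Longrightarrow> param_values (Suc d + depth C + n) (ctx_cons C (Conj (fshift \<phi>) \<psi>)) = Y'" for \<phi>
    using param_values_guarded_by[OF Q(3), of \<phi>] by (intro C(3)) simp
  then show ?case using C Q by (intro exI[of _ "CIter q \<psi> C"] exI[of _ R]) auto
qed

text \<open>An admissible value below \<open>lo + a\<close> would make the emptiness of the
  iteration consistent with the constraint, and framed Constraint-split would apply.\<close>

lemma irreducible1:
  assumes irr: "\<nexists>ls. constraint_split True ((P, \<phi>), \<Lambda>) ls" and inv: "label_inv ((P, \<phi>), \<Lambda>) T"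
    and X: "param_values n \<phi> \<subseteq> {0..}" and a: "a \<in> offsets T"
  shows "param_values n \<phi> \<subseteq> {lo + a..}"
proof (rule ccontr)
  assume "\<not> param_values n \<phi> \<subseteq> {lo + a..}"
  then obtain m where m: "m \<in> param_values n \<phi>" "m < lo + a" by (meson atLeast_iff not_le subsetI)
  obtain Y' q s V where "sub (param_values n \<phi>) T Y' (XI q a s V)" using sub_offsets[OF a] by blast
  from sub_rep[OF this, of 0 P] inv obtain C R where C: "P = plug C R" "rep (depth C) R (XI q a s V)" by auto
  then obtain \<psi> Q where R: "R = Iter q \<psi> Q" and F: "framed_by (depth C) a \<psi>" by (auto elim: rep_XIE)
  have fr: "True = framed_dom \<psi>" using framed_by_has_frame[OF F] unfolding framed_dom_def by blast
  obtain \<rho> where r: "sat \<phi> \<rho>" "\<rho> n = m" using m by (auto simp: param_values_def)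
  have "sat (fsubst (down (depth C)) (FAll (FNot \<psi>))) \<rho>"
    using F r m by (simp add: framed_by_def lift_sub_def down_def)
  then have sat: "satisfiable (Conj \<phi> (fsubst (down (depth C)) (FAll (FNot \<psi>))))"
    unfolding satisfiable_def using r by auto
  have "n \<in> params (P, \<phi>)" using inv m X by (intro n_in_params[of \<phi> "-1"]) auto
  then have op: "only_params (P, \<phi>) (Suc (depth C)) (ffree \<psi> - {0})"
    unfolding only_params_def ffree_framed_by[OF F] by auto
  from constraint_split.intros[OF C(1)[unfolded R] HOL.refl fr HOL.refl sat op] irr show False by blast
qed

text \<open>For \<open>n > c\<close> the domain is \<open>{0}\<close>, which forces both bounds to
  be \<open>0\<close>, hence \<open>0\<close> everywhere; but for \<open>n = c\<close> the domain is
  empty. So guards are left to the non-framed splits of the second phase.\<close>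

lemma guarded_by_not_framed: "guarded_by d {c} \<psi> \<Longrightarrow> \<not> framed_dom \<psi>"
proof
  assume G: "guarded_by d {c} \<psi>" and "framed_dom \<psi>"
  then obtain e1 e2 where fr: "has_frame \<psi> e1 e2" unfolding framed_dom_def by blast
  have iff: "v = 0 \<and> \<rho> (d + n) \<noteq> c \<longleftrightarrow> leval \<rho> e1 \<le> v \<and> v \<le> leval \<rho> e2" for v \<rho>
  proof -
    have "sat \<psi> (case_nat v \<rho>) \<longleftrightarrow> v = 0 \<and> \<rho> (d + n) \<noteq> c" using G unfolding guarded_by_def by simp
    moreover have "sat \<psi> (case_nat v \<rho>) \<longleftrightarrow> leval \<rho> e1 \<le> v \<and> v \<le> leval \<rho> e2"
      using fr unfolding has_frame_def equivalent_def by simp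
    ultimately show ?thesis by blast
  qed
  have "leval \<rho> e1 = 0 \<and> leval \<rho> e2 = 0" if "\<rho> (d + n) \<ge> c + 1" for \<rho>
    using iff[of 0 \<rho>] iff[of "leval \<rho> e1" \<rho>] iff[of "leval \<rho> e2" \<rho>] that by auto
  then have "e1 = 0" "e2 = 0"
    using leval_eventually_eq[of "c + 1" "d + n" e1 0] leval_eventually_eq[of "c + 1" "d + n" e2 0] by auto
  then show False using iff[of 0 "\<lambda>_. c"] by simp
qed

text \<open>A nonempty iteration realizes at least the instance of its body at \<open>lo\<close>,
  and an index without bound variables is the same in every instance. The sign \<open>b\<close>
  depends only on the chosen occurrence.\<close>

lemma always_glits:
  assumes "rep d P T" "guard_free T" "wf_tree T" "\<forall>a\<in>offsets T. X \<subseteq> {lo + a..}" "(p, i) \<in> param_atoms T"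
  shows "\<exists>b. \<forall>\<rho>. \<rho> (d + n) \<in> X \<longrightarrow>
    (if b then LPos p [idx_val (\<rho> (d + n)) i] else LNeg p [idx_val (\<rho> (d + n)) i]) \<in> glits (realize P \<rho>)"
  using assms
proof (induction rule: rep.induct)
  case (atom j d es p')
  then have "p' = p" "j = i" "isparam i" by (auto split: if_splits)
  then show ?case using atom.hyps by (intro exI[of _ True]) (simp add: leval_idx_exp)
next
  case (neg d P T)
  then obtain j p' where "T = XA p' j" by (cases T) auto
  with neg have j: "T = XA p i" "isparam i" by (auto split: if_splits)
  then have "P = Atom p [idx_exp d i]" using neg.hyps by (auto elim: rep_XAE)
  then show ?case using j by (intro exI[of _ False]) (simp add: leval_idx_exp)
next
  case (conj d P T Q U)
  from conj.prems(4) have "(p, i) \<in> param_atoms T \<or> (p, i) \<in> param_atoms U" by simp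
  then show ?case
  proof
    assume "(p, i) \<in> param_atoms T"
    then have "\<exists>b. \<forall>\<rho>. \<rho> (d + n) \<in> X \<longrightarrow>
      (if b then LPos p [idx_val (\<rho> (d + n)) i] else LNeg p [idx_val (\<rho> (d + n)) i]) \<in> glits (realize P \<rho>)"
      using conj.prems by (intro conj.IH(1)) auto
    then show ?thesis unfolding realize.simps glits.simps by blast
  next
    assume "(p, i) \<in> param_atoms U"
    then have "\<exists>b. \<forall>\<rho>. \<rho> (d + n) \<in> X \<longrightarrow>
      (if b then LPos p [idx_val (\<rho> (d + n)) i] else LNeg p [idx_val (\<rho> (d + n)) i]) \<in> glits (realize Q \<rho>)"
      using conj.prems by (intro conj.IH(2)) auto
    then show ?thesis unfolding realize.simps glits.simps by blast
  qed
next
  case (disj d P T Q U)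
  from disj.prems(4) have "(p, i) \<in> param_atoms T \<or> (p, i) \<in> param_atoms U" by simp
  then show ?case
  proof
    assume "(p, i) \<in> param_atoms T"
    then have "\<exists>b. \<forall>\<rho>. \<rho> (d + n) \<in> X \<longrightarrow>
      (if b then LPos p [idx_val (\<rho> (d + n)) i] else LNeg p [idx_val (\<rho> (d + n)) i]) \<in> glits (realize P \<rho>)"
      using disj.prems by (intro disj.IH(1)) auto
    then show ?thesis unfolding realize.simps glits.simps by blast
  next
    assume "(p, i) \<in> param_atoms U"
    then have "\<exists>b. \<forall>\<rho>. \<rho> (d + n) \<in> X \<longrightarrow>
      (if b then LPos p [idx_val (\<rho> (d + n)) i] else LNeg p [idx_val (\<rho> (d + n)) i]) \<in> glits (realize Q \<rho>)"
      using disj.prems by (intro disj.IH(2)) auto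
    then show ?thesis unfolding realize.simps glits.simps by blast
  qed
next
  case (iterF d a \<psi> s P T q)
  then obtain b where b: "\<And>\<rho>. \<rho> (Suc d + n) \<in> X \<Longrightarrow>
    (if b then LPos p [idx_val (\<rho> (Suc d + n)) i] else LNeg p [idx_val (\<rho> (Suc d + n)) i]) \<in> glits (realize P \<rho>)"
    by auto
  have "(if b then LPos p [idx_val (\<rho> (d + n)) i] else LNeg p [idx_val (\<rho> (d + n)) i]) \<in> glits (realize (Iter q \<psi> P) \<rho>)"
    if r: "\<rho> (d + n) \<in> X" for \<rho>
  proof -
    have dom: "{v. sat \<psi> (case_nat v \<rho>)} = {lo..\<rho> (d + n) - a}"
      using iterF.hyps(1) unfolding framed_by_def by auto
    have "lo + a \<le> \<rho> (d + n)" using r iterF.prems(3) by auto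
    then have lo: "lo \<in> {lo..\<rho> (d + n) - a}" by simp
    have "(if b then LPos p [idx_val (\<rho> (d + n)) i] else LNeg p [idx_val (\<rho> (d + n)) i]) \<in> glits (realize P (case_nat lo \<rho>))"
      using b[of "case_nat lo \<rho>"] r by (cases b) simp_all
    moreover have "set (map (\<lambda>v. realize P (case_nat v \<rho>)) (sorted_list_of_set {lo..\<rho> (d + n) - a}))
      = (\<lambda>v. realize P (case_nat v \<rho>)) ` {lo..\<rho> (d + n) - a}" by simp
    ultimately show ?thesis using lo unfolding realize.simps glits_gbig dom by blast
  qed
  then show ?case by blast
qed auto

lemma irreducible2:
  assumes irr: "\<nexists>ls. phase_rule Phase2 ((P, \<phi>), \<Lambda>) ls" and inv: "label_inv ((P, \<phi>), \<Lambda>) T"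
    and X: "param_values n \<phi> \<subseteq> {0..}" "param_values n \<phi> \<noteq> {}" and nonempty_on: "\<forall>a\<in>offsets T. param_values n \<phi> \<subseteq> {lo + a..}"
  shows "guard_free T" "param_atoms T = {}"
proof -
  let ?X = "param_values n \<phi>"
  have rep: "rep 0 P T" and T: "wf_tree T" "depn \<phi>" "finite \<Lambda>" "litform \<Lambda>" using inv by auto
  have np: "n \<in> params (P, \<phi>)" using T X by (intro n_in_params[of \<phi> "-1"]) auto
  have norew: "\<nexists>ls. rewriting ((P, \<phi>), \<Lambda>) ls" using irr by simp
  show nG: "guard_free T"
  proof (rule ccontr)
    assume "\<not> guard_free T"
    then obtain Y' q Z V where sub: "sub ?X T Y' (XG q Z V)" using sub_G[of T ?X] by blast
    have Z: "Z = UNIV \<or> (\<exists>c. Z = {c})" and V: "guard_chain V" using sub_wf_tree[OF sub T(1)] by auto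
    from sub_rep[OF sub rep] obtain C R where C: "P = plug C R" "rep (depth C) R (XG q Z V)"
      "param_values (depth C + n) (ctx_cons C \<phi>) = Y'" by auto
    then obtain \<psi> Q where R: "R = Iter q \<psi> Q" and G: "guarded_by (depth C) Z \<psi>" and Q: "rep (Suc (depth C)) Q V"
      by (auto elim: rep_XGE)
    \<comment> \<open>A remaining guard is always reducible: an unsatisfiable one by an algebraic
      rule, one failing at an admissible \<open>c\<close> by non-framed Constraint-split, and one
      failing at an inadmissible \<open>c\<close> by dropping the iteration, whose body does not use
      its variable.\<close>
    from Z show False
    proof (elim disjE exE)
      assume "Z = UNIV"
      then have "\<not> satisfiable (Conj (ctx_cons C \<phi>) (FEx \<psi>))"
        using G by (simp add: satisfiable_def guarded_by_def)
      from rewriting.intros(1)[OF algebraic.intros(14)[OF this, of q Q], of \<Lambda>] show False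
        using norew C R by blast
    next
      fix c assume Zc: "Z = {c}"
      show False
      proof (cases "c \<in> ?X")
        case True
        then obtain \<rho> where r: "sat \<phi> \<rho>" "\<rho> n = c" by (auto simp: param_values_def)
        have fr: "False = framed_dom \<psi>" using guarded_by_not_framed G Zc by blast
        have "sat (fsubst (down (depth C)) (FAll (FNot \<psi>))) \<rho>"
          using G r Zc by (simp add: guarded_by_def lift_sub_def down_def)
        then have sat: "satisfiable (Conj \<phi> (fsubst (down (depth C)) (FAll (FNot \<psi>))))"
          unfolding satisfiable_def using r by auto
        have op: "only_params (P, \<phi>) (Suc (depth C)) (ffree \<psi> - {0})"
          unfolding only_params_def using ffree_guarded_by[OF G] np by auto
        from constraint_split.intros[OF C(1)[unfolded R] HOL.refl fr HOL.refl sat op] irr show False by auto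
      next
        case False
        then have cY: "c \<notin> Y'" using sub_subset[OF sub] by blast
        have "entails (ctx_cons C \<phi>) (FEx \<psi>)"
          unfolding entails_def
        proof (intro allI impI)
          fix \<rho> assume "sat (ctx_cons C \<phi>) \<rho>"
          then have "\<rho> (depth C + n) \<in> Y'" using C(3) by (auto simp: param_values_def)
          then have "sat \<psi> (case_nat 0 \<rho>)" using G Zc cY by (auto simp: guarded_by_def)
          then show "sat (FEx \<psi>) \<rho>" by auto
        qed
        moreover have "0 \<notin> pfree Q" using pfree_has_var[OF Q, of 0] guard_chain_no_var[OF V] by auto
        ultimately have "algebraic (ctx_cons C \<phi>) (Iter q \<psi> Q) (psubst Q (down 1))"
          by (rule algebraic.intros)
        from rewriting.intros(1)[OF this, of \<Lambda>] show False using norew C R by blast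
      qed
    qed
  qed
  show "param_atoms T = {}"
  proof (rule ccontr)
    assume "param_atoms T \<noteq> {}"
    then obtain p i where pi: "(p, i) \<in> param_atoms T" by auto
    then obtain Y' where sub: "sub ?X T Y' (XA p i)" and i: "isparam i"
      using sub_param_atoms[OF pi, of ?X] by blast
    \<comment> \<open>Neither a guard nor a possibly empty iteration surrounds the proposition, so
      its context admits all of \<open>X\<close>. Hence a coincidence with a literal of
      \<open>\<Lambda>\<close> that blocks Prop-split also satisfies the premise of
      Prop-simplification.\<close>
    have Y': "Y' = ?X" using sub_same[OF sub nG nonempty_on] .
    from sub_rep[OF sub rep] obtain C R where C: "P = plug C R" "rep (depth C) R (XA p i)"
      "param_values (depth C + n) (ctx_cons C \<phi>) = ?X" using Y' by auto
    then have R: "R = Atom p [idx_exp (depth C) i]" by (auto elim: rep_XAE)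
    have P: "P = plug C (Atom p (map (up (depth C)) [idx_exp 0 i]))" using C(1) R i by (simp add: up_idx_exp)
    obtain b where b: "\<And>\<rho>. \<rho> n \<in> ?X \<Longrightarrow>
      (if b then LPos p [idx_val (\<rho> n) i] else LNeg p [idx_val (\<rho> n) i]) \<in> glits (realize P \<rho>)"
      using always_glits[OF rep nG T(1) nonempty_on pi] unfolding add_0 by blast
    have inX: "\<rho> n \<in> ?X" if "sat \<phi> \<rho>" for \<rho> using that by (auto simp: param_values_def)
    have alw: "always_occurs (LPos p [idx_exp 0 i]) (P, \<phi>) \<or> always_occurs (LNeg p [idx_exp 0 i]) (P, \<phi>)"
    proof -
      have "(if b then LPos p [idx_val (\<rho> n) i] else LNeg p [idx_val (\<rho> n) i]) \<in> glits (realize P \<rho>)" if "sat \<phi> \<rho>" for \<rho>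
        using b inX[OF that] by blast
      then show ?thesis using i unfolding always_occurs_def by (cases b) (simp_all add: leval_idx_exp)
    qed
    have "\<not> prop_split ((P, \<phi>), \<Lambda>) ls" for ls using irr by simp
    then have "may_occur (LPos p [idx_exp 0 i]) (lits_pat \<Lambda>, \<phi>) \<or> may_occur (LNeg p [idx_exp 0 i]) (lits_pat \<Lambda>, \<phi>)"
      using prop_split.intros[OF P alw] by blast
    then obtain \<rho> where r: "sat \<phi> \<rho>" and
      "LPos p [idx_val (\<rho> n) i] \<in> ground \<rho> ` \<Lambda> \<or> LNeg p [idx_val (\<rho> n) i] \<in> ground \<rho> ` \<Lambda>"
      unfolding may_occur_def using glits_lits_pat[OF T(3)] i by (auto simp: leval_idx_exp)
    then obtain L where L: "L \<in> \<Lambda>" "ground \<rho> L = LPos p [idx_val (\<rho> n) i] \<or> ground \<rho> L = LNeg p [idx_val (\<rho> n) i]"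
      by auto
    then obtain j where j: "isparam j" "L = LPos p [idx_exp 0 j] \<or> L = LNeg p [idx_exp 0 j]" "idx_val (\<rho> n) j = idx_val (\<rho> n) i"
      using T(4) unfolding litform_def by (fastforce simp: leval_idx_exp)
    have "\<rho> n \<in> param_values (depth C + n) (ctx_cons C \<phi>)" using inX[OF r] C(3) by simp
    then obtain \<rho>' where r': "sat (ctx_cons C \<phi>) \<rho>'" "\<rho>' (depth C + n) = \<rho> n" by (auto simp: param_values_def)
    have sat: "satisfiable (Conj (ctx_cons C \<phi>) (fconj (map2 Eq [idx_exp (depth C) i] (map (up (depth C)) [idx_exp 0 j]))))"
      unfolding satisfiable_def using r' i j by (intro exI[of _ \<rho>']) (simp add: up_idx_exp leval_idx_exp del: leval_up)
    have "\<exists>Q. prop_simp \<Lambda> (depth C) (ctx_cons C \<phi>) (Atom p [idx_exp (depth C) i]) Q"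
      using j(2) L(1) prop_simp.intros[OF _ _ HOL.refl sat] by (metis length_Cons)
    then obtain Q where Q: "prop_simp \<Lambda> (depth C) (ctx_cons C \<phi>) R Q" using R by blast
    have "only_params (plug C R, \<phi>) (depth C) (pfree R)"
      unfolding only_params_def R using np i C(1)[unfolded R] by (auto simp: lvars_idx_exp split: idx.splits)
    from rewriting.intros(3)[OF Q this] norew C(1) show False by blast
  qed
qed

lemma irreducible3:
  assumes irr: "\<nexists>ls. unfolding_rule ((P, \<phi>), \<Lambda>) ls" and inv: "label_inv ((P, \<phi>), \<Lambda>) T"
    and sub: "sub (param_values n \<phi>) T Y' (XI q a s V)" and Y': "Y' \<noteq> {}"
  shows "\<not> Y' \<subseteq> {lo + a..}"
proof
  assume le: "Y' \<subseteq> {lo + a..}"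
  have rep: "rep 0 P T" using inv by simp
  from sub_rep[OF sub rep] obtain C R where C: "P = plug C R" "rep (depth C) R (XI q a s V)"
    "param_values (depth C + n) (ctx_cons C \<phi>) = Y'" by auto
  then obtain \<psi> Q where R: "R = Iter q \<psi> Q" and F: "framed_by (depth C) a \<psi>" by (auto elim: rep_XIE)
  let ?e = "lvar (depth C + n) - lconst a"
  have "satisfiable (ctx_cons C \<phi>)" using C(3) Y' by (auto simp: satisfiable_def param_values_def)
  moreover have "entails (ctx_cons C \<phi>) (fsubst (inst ?e) \<psi>)"
    unfolding entails_def
  proof (intro allI impI)
    fix \<rho> assume "sat (ctx_cons C \<phi>) \<rho>"
    then have "\<rho> (depth C + n) \<in> Y'" using C(3) by (auto simp: param_values_def)
    then have "lo + a \<le> \<rho> (depth C + n)" using le by auto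
    then show "sat (fsubst (inst ?e) \<psi>) \<rho>" using F by (simp add: framed_by_def inst_def)
  qed
  moreover have "framed_dom \<psi> \<longrightarrow> (\<exists>e1. has_frame \<psi> e1 ?e)" using framed_by_has_frame[OF F] by blast
  ultimately have "\<exists>Q'. unfold_iter (ctx_cons C \<phi>) R Q'" unfolding R by (blast intro: unfold_iter.intros)
  then show False using unfolding_rule.intros irr C(1) by blast
qed

end

section \<open>Measures\<close>

primrec var_atoms :: "'p tree \<Rightarrow> ('p \<times> int) set" where
  "var_atoms (XL b) = {}"
| "var_atoms (XA p i) = (case i of IV x c \<Rightarrow> {(p, c)} | _ \<Rightarrow> {})"
| "var_atoms (XN T) = var_atoms T"
| "var_atoms (XB q T U) = var_atoms T \<union> var_atoms U"
| "var_atoms (XI q a s T) = var_atoms T"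
| "var_atoms (XG q Z T) = var_atoms T"

primrec gaps :: "'p tree \<Rightarrow> int set set" where
  "gaps (XL b) = {}"
| "gaps (XA p i) = {}"
| "gaps (XN T) = gaps T"
| "gaps (XB q T U) = gaps T \<union> gaps U"
| "gaps (XI q a s T) = gaps T"
| "gaps (XG q Z T) = insert Z (gaps T)"

primrec nesting :: "'p tree \<Rightarrow> nat" where
  "nesting (XL b) = 0"
| "nesting (XA p i) = 0"
| "nesting (XN T) = nesting T"
| "nesting (XB q T U) = max (nesting T) (nesting U)"
| "nesting (XI q a s T) = Suc (nesting T)"
| "nesting (XG q Z T) = nesting T"

text \<open>The depth of alternation between conjunctions and disjunctions below a position of polarity
  \<open>q\<close>. An iteration counts like the binary connective of its unfoldings, so that Unfolding leaves
  this number unchanged.\<close>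

primrec alternation :: "iter_op \<Rightarrow> 'p tree \<Rightarrow> nat" where
  "alternation q (XL b) = 0"
| "alternation q (XA p i) = 0"
| "alternation q (XN T) = 0"
| "alternation q (XB q' T U) = (if q = q' then max (alternation q T) (alternation q U) else Suc (max (alternation q' T) (alternation q' U)))"
| "alternation q (XI q' a s T) = (if q = q' then alternation q T else Suc (alternation q' T))"
| "alternation q (XG q' Z T) = alternation q T"

text \<open>If an iteration can be unfolded at most \<open>B - a\<close> times, each of these unfoldings pays for the copy of the
  body that it creates.\<close>

primrec unfold_weight :: "int \<Rightarrow> 'p tree \<Rightarrow> nat" where
  "unfold_weight B (XL b) = 0"
| "unfold_weight B (XA p i) = 0"
| "unfold_weight B (XN T) = unfold_weight B T"
| "unfold_weight B (XB q T U) = unfold_weight B T + unfold_weight B U"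
| "unfold_weight B (XI q a s T) = Suc (nat (B - a)) * Suc (unfold_weight B T)"
| "unfold_weight B (XG q Z T) = unfold_weight B T"

text \<open>The context of an iteration contains the domains of the iterations around it, so an inner
  iteration can be unfolded further than an outer one, by one step per level of nesting.\<close>

primrec offsets_ok :: "int \<Rightarrow> 'p tree \<Rightarrow> bool" where
  "offsets_ok U (XL b) \<longleftrightarrow> True"
| "offsets_ok U (XA p i) \<longleftrightarrow> True"
| "offsets_ok U (XN T) \<longleftrightarrow> offsets_ok U T"
| "offsets_ok U (XB q T T') \<longleftrightarrow> offsets_ok U T \<and> offsets_ok U T'"
| "offsets_ok U (XI q a s T) \<longleftrightarrow> a + int (nesting T) \<le> U \<and> offsets_ok U T"
| "offsets_ok U (XG q Z T) \<longleftrightarrow> offsets_ok U T"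

lemma finite_param_atoms: "finite (param_atoms T)" and finite_offsets: "finite (offsets T)" and finite_var_atoms: "finite (var_atoms T)"
  by (induction T) (auto split: idx.split)

lemma okUI: "\<forall>a\<in>offsets T. a + int D \<le> U \<Longrightarrow> nesting T \<le> D \<Longrightarrow> offsets_ok U T"
  by (induction T) auto

lemma offsets_ok_offsets: "offsets_ok U T \<Longrightarrow> a \<in> offsets T \<Longrightarrow> a \<le> U"
  by (induction T) auto

lemma alternation_Suc: "alternation q T \<le> Suc (alternation q' T)"
proof (cases "q = q'")
  case False
  then show ?thesis
  proof (induction T)
    case (XB q'' T U)
    then show ?case by (cases "q = q''"; cases "q' = q''") auto
  next
    case (XI q'' a s T)
    then show ?case by (cases "q = q''"; cases "q' = q''") auto
  qed auto
qed simp

lemma tinst_content [simp]: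
  "offsets (tinst j a T) = offsets T" "nesting (tinst j a T) = nesting T" "gaps (tinst j a T) = gaps T"
  "guard_free (tinst j a T) = guard_free T" "unfold_weight B (tinst j a T) = unfold_weight B T" "offsets_ok U (tinst j a T) = offsets_ok U T"
  by (induction T arbitrary: j) auto

lemma alternation_tinst [simp]: "alternation q (tinst j a T) = alternation q T"
  by (induction T arbitrary: j q) auto

lemma var_atoms_tinst: "var_atoms (tinst j a T) \<subseteq> var_atoms T"
proof (induction T arbitrary: j)
  case (XA p i)
  then show ?case by (cases i) auto
next
  case (XB q T U)
  from XB[of j] show ?case by auto
qed auto

lemma param_atoms_tinst: "param_atoms (tinst j a T) \<subseteq> param_atoms T \<union> {(p, IP (c - a)) |p c. (p, c) \<in> var_atoms T}"
proof (induction T arbitrary: j)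
  case (XA p i)
  then show ?case by (cases i) auto
next
  case (XB q T U)
  from XB[of j] show ?case by auto
qed auto

lemma param_atoms_tinst_novar: "\<not> has_var j T \<Longrightarrow> param_atoms (tinst j a T) = param_atoms T"
proof (induction T arbitrary: j)
  case (XA p i)
  then show ?case by (cases i) auto
qed auto

context frame
begin

text \<open>Bounds how often Prop-simplification can still be applied to the proposition in its
  current context.\<close>

definition pot :: "('p \<times> idx) set \<Rightarrow> int set \<Rightarrow> 'p \<Rightarrow> idx \<Rightarrow> nat" where
  "pot M Y p i = (if isparam i then card {j. (p, j) \<in> M \<and> (\<exists>m\<in>Y. idx_val m i = idx_val m j)} else 0)"

text \<open>The factor \<open>6\<close> pays for the iteration that replaces an indexed proposition in Prop-simplification: below it,
  the proposition has lost one of the literals of \<open>M\<close> that it can coincide with.\<close>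

primrec weight :: "('p \<times> idx) set \<Rightarrow> int set \<Rightarrow> int set \<Rightarrow> 'p tree \<Rightarrow> nat" where
  "weight M X Y (XL b) = 1"
| "weight M X Y (XA p i) = 1 + 6 * pot M Y p i"
| "weight M X Y (XN T) = 1 + weight M X Y T"
| "weight M X Y (XB q T U) = 1 + weight M X Y T + weight M X Y U"
| "weight M X Y (XI q a s T) = 1 + s + (if X \<subseteq> {lo + a..} then 0 else 1) + weight M X (Y \<inter> {lo + a..}) T"
| "weight M X Y (XG q Z T) = 3 + (if X \<inter> Z = {} then 0 else 1) + weight M X (Y - Z) T"

lemma finite_pot_set: "finite M \<Longrightarrow> finite {j. (p, j) \<in> M \<and> Q j}"
proof -
  assume "finite M"
  then have "finite (snd ` M)" by simp
  moreover have "{j. (p, j) \<in> M \<and> Q j} \<subseteq> snd ` M" by force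
  ultimately show ?thesis by (rule rev_finite_subset)
qed

lemma pot_mono: "finite M \<Longrightarrow> Y' \<subseteq> Y \<Longrightarrow> pot M Y' p i \<le> pot M Y p i"
  unfolding pot_def by (auto intro!: card_mono finite_pot_set)

lemma weight_mono: "finite M \<Longrightarrow> X' \<subseteq> X \<Longrightarrow> Y' \<subseteq> Y \<Longrightarrow> weight M X' Y' T \<le> weight M X Y T"
proof (induction T arbitrary: Y Y')
  case (XA p i)
  then show ?case using pot_mono[of M Y' Y p i] by simp
next
  case (XN T)
  then show ?case by simp
next
  case (XB q T U)
  from XB.IH(1)[OF XB.prems] XB.IH(2)[OF XB.prems] show ?case by simp
next
  case (XI q a s T)
  have "weight M X' (Y' \<inter> {lo + a..}) T \<le> weight M X (Y \<inter> {lo + a..}) T"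
    using XI.prems by (intro XI.IH) auto
  then show ?case using XI.prems(2) by auto
next
  case (XG q Z T)
  have "weight M X' (Y' - Z) T \<le> weight M X (Y - Z) T"
    using XG.prems by (intro XG.IH) auto
  then show ?case using XG.prems(2) by auto
qed simp

lemma weight_pos: "1 \<le> weight M X Y T"
  by (cases T) auto

lemma weight_nonleaf: "\<not> isleaf T \<Longrightarrow> 1 < weight M X Y T"
  using weight_pos[of M X] by (cases T) (auto simp: Suc_le_eq)

lemma weight_tinst: "\<not> has_var j T \<Longrightarrow> weight M X Y (tinst j c T) = weight M X Y T"
proof (induction T arbitrary: j Y)
  case (XA p i)
  then show ?case by (cases i) (auto simp: pot_def)
qed auto

lemma weight_simp_step: "simp_step M Y T T' \<Longrightarrow> finite M \<Longrightarrow> weight M X Y T' < weight M X Y T"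
proof (induction rule: simp_step.induct)
  case (leaf T Y b)
  then show ?case using weight_nonleaf[of T M X Y] by simp
next
  case (left Y q T U)
  then show ?case by simp
next
  case (right Y q T U)
  then show ?case by simp
next
  case (vacI Y a T q s c)
  then have "Y \<inter> {lo + a..} = Y" by auto
  then show ?case using vacI weight_tinst[of 0 T M X Y c] by simp
next
  case (vacG Y Z T q c)
  then have "Y - Z = Y" by auto
  then show ?case using vacG weight_tinst[of 0 T M X Y c] by simp
next
  case (simp i p j m Y Z q)
  let ?A = "{j. (p, j) \<in> M \<and> (\<exists>m\<in>Y. idx_val m i = idx_val m j)}"
  let ?B = "{j. (p, j) \<in> M \<and> (\<exists>m\<in>Y - Z. idx_val m i = idx_val m j)}"
  have "?B \<subseteq> ?A - {j}" using simp(5) by auto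
  moreover have "finite ?A" using simp.prems by (rule finite_pot_set)
  moreover have "j \<in> ?A" using simp by auto
  ultimately have "card ?B < card ?A"
    by (meson card_Diff1_less card_mono finite_Diff order.strict_trans1)
  then have "pot M (Y - Z) p i < pot M Y p i" using simp(1) by (simp add: pot_def)
  then show ?case by simp
qed auto

lemma weight_cut: "cut E T T' \<Longrightarrow> weight M X Y T' < weight M X Y T"
proof (induction arbitrary: Y rule: cut.induct)
  case (baseI a q s T b)
  then show ?case using weight_nonleaf[of "XI q a s T" M X Y] by simp
next
  case (baseG Z q T b)
  then show ?case using weight_nonleaf[of "XG q Z T" M X Y] by simp
qed auto

text \<open>\<open>weight\<close> charges one unit for every iteration whose nonemptiness does not
  follow from \<open>X\<close>. Restricting \<open>X\<close> to \<open>E\<close> cancels that unit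
  for the iterations with condition \<open>E\<close>, and \<open>X - E \<noteq> {}\<close> says that
  it was charged before.\<close>

lemma weight_split:
  assumes "finite M" "X - E \<noteq> {}"
  shows "E \<in> nodes T \<Longrightarrow> weight M (X \<inter> E) Y T < weight M X Y T"
proof (induction T arbitrary: Y)
  case (XB q T U)
  have "weight M (X \<inter> E) Y T \<le> weight M X Y T" "weight M (X \<inter> E) Y U \<le> weight M X Y U"
    using assms by (auto intro: weight_mono)
  with XB.IH[of Y] XB.prems show ?case by auto
next
  case (XI q a s T)
  have le: "weight M (X \<inter> E) (Y \<inter> {lo + a..}) T \<le> weight M X (Y \<inter> {lo + a..}) T"
    using assms by (auto intro: weight_mono)
  show ?case
  proof (cases "E = {lo + a..}")
    case True
    then show ?thesis using le assms(2) by auto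
  next
    case False
    then show ?thesis using XI.IH[of "Y \<inter> {lo + a..}"] XI.prems by auto
  qed
next
  case (XG q Z T)
  have le: "weight M (X \<inter> E) (Y - Z) T \<le> weight M X (Y - Z) T"
    using assms by (auto intro: weight_mono)
  show ?case
  proof (cases "E = - Z")
    case True
    then have "X \<inter> Z \<noteq> {}" using assms(2) by auto
    then show ?thesis using le True by auto
  next
    case False
    then show ?thesis using XG.IH[of "Y - Z"] XG.prems by auto
  qed
qed auto

lemma param_atoms_simp_step: "simp_step M Y T T' \<Longrightarrow> param_atoms T' \<subseteq> param_atoms T"
  by (induction rule: simp_step.induct) (auto simp: param_atoms_tinst_novar split: if_splits)

lemma param_atoms_cut: "cut E T T' \<Longrightarrow> param_atoms T' \<subseteq> param_atoms T"
  by (induction rule: cut.induct) auto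

text \<open>Prop-split enlarges \<open>M\<close> and may thereby raise \<open>weight\<close>, so the
  number of propositions not yet split on comes first. It never grows in the first two phases
  because neither rewriting nor splitting creates new indices without bound variables.\<close>

definition mu :: "'p tree \<times> int set \<times> ('p \<times> idx) set \<Rightarrow> nat \<times> nat" where
  "mu = (\<lambda>(T, X, M). (card (param_atoms T - M), weight M X X T))"

lemma split1_shape:
  assumes "split1 (T, X, M) (T', X', M')" "finite M"
  shows "X' \<subseteq> X \<and> M' = M \<and> param_atoms T' \<subseteq> param_atoms T \<and> weight M X' X' T' < weight M X X T"
  using assms(1)
proof cases
  case (pos E)
  have "weight M (X \<inter> E) (X \<inter> E) T \<le> weight M (X \<inter> E) X T" using assms(2) by (auto intro: weight_mono)
  then show ?thesis using pos weight_split[OF assms(2) pos(5) pos(4), of X] by auto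
next
  case (neg E)
  have "weight M (X - E) (X - E) T' \<le> weight M X X T'" using assms(2) by (auto intro: weight_mono)
  then show ?thesis using neg weight_cut[OF neg(4), of M X X] param_atoms_cut[OF neg(4)] by auto
qed

lemma step2_mu:
  assumes "step2 S S'" "finite (snd (snd S))"
  shows "(mu S', mu S) \<in> less_than <*lex*> less_than"
  using assms(1)
proof cases
  case (rew M X T T')
  have "card (param_atoms T' - M) \<le> card (param_atoms T - M)"
    using param_atoms_simp_step[OF rew(3)] by (intro card_mono) (auto simp: finite_param_atoms)
  then show ?thesis using rew weight_simp_step[OF rew(3), of X] assms(2) by (auto simp: mu_def)
next
  case (split T X M T' X' M')
  have sh: "X' \<subseteq> X" "M' = M" "param_atoms T' \<subseteq> param_atoms T" "weight M X' X' T' < weight M X X T"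
    using split1_shape[OF split(3)] split assms(2) by auto
  then have "card (param_atoms T' - M) \<le> card (param_atoms T - M)"
    by (intro card_mono) (auto simp: finite_param_atoms)
  then show ?thesis using split sh by (auto simp: mu_def)
next
  case (psplit p i T M X)
  have "card (param_atoms T - insert (p, i) M) < card (param_atoms T - M)"
    using psplit by (intro psubset_card_mono) (auto simp: finite_param_atoms)
  then show ?thesis using psplit by (auto simp: mu_def)
qed

lemma simp_step_var_atoms: "simp_step M Y T T' \<Longrightarrow> var_atoms T' \<subseteq> var_atoms T"
  by (induction rule: simp_step.induct) (auto dest: subsetD[OF var_atoms_tinst])

lemma simp_step_offsets: "simp_step M Y T T' \<Longrightarrow> offsets T' \<subseteq> offsets T"
  by (induction rule: simp_step.induct) auto

lemma simp_step_nesting: "simp_step M Y T T' \<Longrightarrow> nesting T' \<le> nesting T"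
  by (induction rule: simp_step.induct) auto

lemma unfold_weight_mono: "w \<le> w' \<Longrightarrow> Suc k * Suc w \<le> Suc k * Suc w'"
  by (intro mult_le_mono) simp_all

lemma simp_step_unfold_weight: "simp_step M Y T T' \<Longrightarrow> unfold_weight B T' \<le> unfold_weight B T"
proof (induction rule: simp_step.induct)
  case (itI Y a T T' q s)
  then show ?case unfolding unfold_weight.simps by (intro unfold_weight_mono)
qed auto

lemma simp_step_gaps: "simp_step M Y T T' \<Longrightarrow> Z \<in> gaps T' \<Longrightarrow>
  Z \<in> gaps T \<or> (\<exists>p i j. Z = {m. idx_val m i = idx_val m j} \<and> (p, i) \<in> param_atoms T \<and> (p, j) \<in> M)"
proof (induction rule: simp_step.induct)
  case (simp i p j m Y Z' q)
  then have "Z = {m. idx_val m i = idx_val m j} \<and> (p, i) \<in> param_atoms (XA p i) \<and> (p, j) \<in> M" by simp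
  then show ?case by blast
qed auto

lemma simp_step_alternation: "simp_step M Y T T' \<Longrightarrow> alternation q T' \<le> alternation q T"
proof (induction arbitrary: q rule: simp_step.induct)
  case (left Y q' T U)
  then show ?case using alternation_Suc[of q T q'] by (auto simp: le_max_iff_disj)
next
  case (right Y q' T U)
  then show ?case using alternation_Suc[of q U q'] by (auto simp: le_max_iff_disj)
next
  case (vacI Y a T q' s c)
  then show ?case using alternation_Suc[of q T q'] by auto
next
  case (bin1 Y T T' q' U)
  from bin1.IH[of q] bin1.IH[of q'] show ?case by (auto simp: le_max_iff_disj)
next
  case (bin2 Y T T' q' U)
  from bin2.IH[of q] bin2.IH[of q'] show ?case by (auto simp: le_max_iff_disj)
qed auto

lemma cut_content:
  assumes "cut E T T'"
  shows "var_atoms T' \<subseteq> var_atoms T" "offsets T' \<subseteq> offsets T" "nesting T' \<le> nesting T" "gaps T' \<subseteq> gaps T"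
  using assms by (induction rule: cut.induct) auto

lemma cut_unfold_weight: "cut E T T' \<Longrightarrow> unfold_weight B T' \<le> unfold_weight B T"
proof (induction rule: cut.induct)
  case (itI E T T' q a s)
  then show ?case unfolding unfold_weight.simps by (intro unfold_weight_mono)
qed auto

lemma cut_alternation: "cut E T T' \<Longrightarrow> alternation q T' \<le> alternation q T"
proof (induction arbitrary: q rule: cut.induct)
  case (bin1 E T T' q' U)
  from bin1.IH[of q] bin1.IH[of q'] show ?case by (auto simp: le_max_iff_disj)
next
  case (bin2 E T T' q' U)
  from bin2.IH[of q] bin2.IH[of q'] show ?case by (auto simp: le_max_iff_disj)
qed auto

text \<open>The new indices arise from instantiating a bound variable with \<open>n - a\<close>.
  Other iterations may keep the offset \<open>a\<close>, but \<open>a + 1\<close> is certainly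
  present afterwards and can replace \<open>a\<close> in bounds from above.\<close>

lemma unfolds_offsets:
  assumes "unfolds Y T T'"
  shows "\<exists>a\<in>offsets T. a + 1 \<in> offsets T' \<and> offsets T' \<subseteq> insert (a + 1) (offsets T) \<and> offsets T \<subseteq> insert a (offsets T') \<and>
      param_atoms T' \<subseteq> param_atoms T \<union> {(p, IP (c - a)) |p c. (p, c) \<in> var_atoms T}"
  using assms
proof (induction rule: unfolds.induct)
  case (base Y a q s T)
  show ?case using param_atoms_tinst[of 0 a T] by (intro bexI[of _ a]) auto
next
  case (neg Y T T')
  from neg.IH obtain a where "a \<in> offsets T" "a + 1 \<in> offsets T'" "offsets T' \<subseteq> insert (a + 1) (offsets T)"
    "offsets T \<subseteq> insert a (offsets T')" "param_atoms T' \<subseteq> param_atoms T \<union> {(p, IP (c - a)) |p c. (p, c) \<in> var_atoms T}" by blast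
  then show ?case by (intro bexI[of _ a]) auto
next
  case (bin1 Y T T' q U)
  from bin1.IH obtain a where "a \<in> offsets T" "a + 1 \<in> offsets T'" "offsets T' \<subseteq> insert (a + 1) (offsets T)"
    "offsets T \<subseteq> insert a (offsets T')" "param_atoms T' \<subseteq> param_atoms T \<union> {(p, IP (c - a)) |p c. (p, c) \<in> var_atoms T}" by blast
  then show ?case by (intro bexI[of _ a]) auto
next
  case (bin2 Y T T' q U)
  from bin2.IH obtain a where "a \<in> offsets T" "a + 1 \<in> offsets T'" "offsets T' \<subseteq> insert (a + 1) (offsets T)"
    "offsets T \<subseteq> insert a (offsets T')" "param_atoms T' \<subseteq> param_atoms T \<union> {(p, IP (c - a)) |p c. (p, c) \<in> var_atoms T}" by blast
  then show ?case by (intro bexI[of _ a]) auto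
next
  case (itI Y b T T' q s)
  from itI.IH obtain a where "a \<in> offsets T" "a + 1 \<in> offsets T'" "offsets T' \<subseteq> insert (a + 1) (offsets T)"
    "offsets T \<subseteq> insert a (offsets T')" "param_atoms T' \<subseteq> param_atoms T \<union> {(p, IP (c - a)) |p c. (p, c) \<in> var_atoms T}" by blast
  then show ?case by (intro bexI[of _ a]) auto
qed

lemma unfolds_content:
  assumes "unfolds Y T T'"
  shows "var_atoms T' \<subseteq> var_atoms T" "nesting T' \<le> nesting T" "guard_free T \<Longrightarrow> guard_free T'" "gaps T' \<subseteq> gaps T"
  using assms by (induction rule: unfolds.induct) (auto dest: subsetD[OF var_atoms_tinst])

lemma unfolds_alternation: "unfolds Y T T' \<Longrightarrow> alternation q T' \<le> alternation q T"
proof (induction arbitrary: q rule: unfolds.induct)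
  case (bin1 Y T T' q' U)
  from bin1.IH[of q] bin1.IH[of q'] show ?case by (auto simp: le_max_iff_disj)
next
  case (bin2 Y T T' q' U)
  from bin2.IH[of q] bin2.IH[of q'] show ?case by (auto simp: le_max_iff_disj)
qed auto

lemma unfold_weight_unfold: "a < B \<Longrightarrow> Suc (nat (B - (a + 1))) * Suc w + w < Suc (nat (B - a)) * Suc w"
proof -
  assume "a < B"
  then have "nat (B - a) = Suc (nat (B - (a + 1)))" by linarith
  then show ?thesis by simp
qed

text \<open>An unfolding at offset \<open>a\<close> has a witness \<open>y \<in> Y\<close> with
  \<open>lo + a \<le> y \<le> m\<close>. Hence \<open>m - lo + 1\<close> exceeds every offset that
  is unfolded, and each unfolding uses up one of the counted steps.\<close>

lemma unfolds_unfold_weight_bounded: "unfolds Y T T' \<Longrightarrow> Y \<subseteq> {..m} \<Longrightarrow> unfold_weight (m - lo + 1) T' < unfold_weight (m - lo + 1) T"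
proof (induction rule: unfolds.induct)
  case (base Y a q s T)
  then obtain y where "y \<in> Y" "lo + a \<le> y" "y \<le> m" by auto
  then have "a < m - lo + 1" by linarith
  from unfold_weight_unfold[OF this, of "unfold_weight (m - lo + 1) T"] show ?case by simp
next
  case (itI Y a T T' q s)
  then have "unfold_weight (m - lo + 1) T' < unfold_weight (m - lo + 1) T" by auto
  then show ?case by (simp del: mult_Suc)
qed auto

lemma unfolds_unfold_weight_offsets_ok: "unfolds Y T T' \<Longrightarrow> offsets_ok U T \<Longrightarrow> unfold_weight (U + 1) T' < unfold_weight (U + 1) T"
proof (induction rule: unfolds.induct)
  case (base Y a q s T)
  then have "a < U + 1" by simp
  from unfold_weight_unfold[OF this, of "unfold_weight (U + 1) T"] show ?case by simp
next
  case (itI Y a T T' q s)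
  then have "unfold_weight (U + 1) T' < unfold_weight (U + 1) T" by auto
  then show ?case by (simp del: mult_Suc)
qed auto

lemma unfolds_offsets_ok: "unfolds Y T T' \<Longrightarrow> offsets_ok U T \<Longrightarrow> {lo + U - int (nesting T)..} \<subseteq> Y \<Longrightarrow> offsets_ok U T'"
proof (induction rule: unfolds.induct)
  case (base Y a q s T)
  have "lo + U - int (nesting (XI q a s T)) \<in> Y" using base.prems(2) by blast
  then have "lo + a \<le> lo + U - int (nesting T) - 1" using base(2) by force
  then show ?case using base by simp
next
  case (bin1 Y T T' q S)
  have "{lo + U - int (nesting T)..} \<subseteq> {lo + U - int (nesting (XB q T S))..}" by auto
  then have "{lo + U - int (nesting T)..} \<subseteq> Y" using bin1.prems(2) by (rule order.trans)
  with bin1.IH bin1.prems(1) show ?case by simp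
next
  case (bin2 Y T T' q S)
  have "{lo + U - int (nesting T)..} \<subseteq> {lo + U - int (nesting (XB q S T))..}" by auto
  then have "{lo + U - int (nesting T)..} \<subseteq> Y" using bin2.prems(2) by (rule order.trans)
  with bin2.IH bin2.prems(1) show ?case by simp
next
  case (itI Y a T T' q s)
  have "{lo + U - int (nesting T)..} \<subseteq> Y \<inter> {lo + a..}"
    using itI.prems by auto
  then have "offsets_ok U T'" using itI by simp
  moreover have "nesting T' \<le> nesting T" using unfolds_content(2)[OF itI.hyps(1)] .
  ultimately show ?case using itI.prems by simp
qed auto

definition unbdd :: "int set \<Rightarrow> bool" where
  "unbdd Y \<longleftrightarrow> (\<forall>b. \<exists>y\<in>Y. b \<le> y)"

lemma unbdd_Int: "unbdd Y \<Longrightarrow> unbdd (Y \<inter> {c..})"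
  unfolding unbdd_def
proof (intro allI)
  fix b assume "\<forall>b. \<exists>y\<in>Y. b \<le> y"
  then obtain y where "y \<in> Y" "max b c \<le> y" by blast
  then show "\<exists>y\<in>Y \<inter> {c..}. b \<le> y" by (intro bexI[of _ y]) auto
qed

lemma sub_unbdd: "sub Y T Y' U \<Longrightarrow> guard_free T \<Longrightarrow> unbdd Y \<Longrightarrow> unbdd Y'"
  by (induction rule: sub.induct) (auto simp: unbdd_Int)

lemma finite_lit_atoms: "finite \<Lambda> \<Longrightarrow> finite (lit_atoms \<Lambda>)"
proof -
  assume fin: "finite \<Lambda>"
  have "finite {(p, i). isparam i \<and> LPos p [idx_exp 0 i] \<in> \<Lambda>}"
    by (rule inj_on_finite[where f = "\<lambda>(p, i). LPos p [idx_exp 0 i]", OF _ _ fin]) (auto simp: inj_on_def dest: idx_exp_inj)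
  moreover have "finite {(p, i). isparam i \<and> LNeg p [idx_exp 0 i] \<in> \<Lambda>}"
    by (rule inj_on_finite[where f = "\<lambda>(p, i). LNeg p [idx_exp 0 i]", OF _ _ fin]) (auto simp: inj_on_def dest: idx_exp_inj)
  moreover have "lit_atoms \<Lambda> = {(p, i). isparam i \<and> LPos p [idx_exp 0 i] \<in> \<Lambda>} \<union> {(p, i). isparam i \<and> LNeg p [idx_exp 0 i] \<in> \<Lambda>}"
    by (auto simp: lit_atoms_def)
  ultimately show ?thesis by simp
qed

end

section \<open>Rounds of an infinite branch\<close>

lemma no_infinite_descent: "\<not> (\<forall>k::nat. (f (Suc k) :: nat) < f k)"
proof
  assume "\<forall>k. f (Suc k) < f k"
  then have d: "f (Suc k) < f k" for k by blast
  have "f k + k \<le> f 0" for k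
  proof (induction k)
    case (Suc k)
    then show ?case using d[of k] by linarith
  qed simp
  from this[of "Suc (f 0)"] show False by simp
qed

lemma no_frequent_descent:
  assumes mono: "\<And>k. i \<le> k \<Longrightarrow> f (Suc k) \<le> (f k :: nat)"
    and freq: "\<And>k. \<exists>j\<ge>k. f (Suc j) < f j"
  shows False
proof -
  have anti: "f k \<le> f j" if "i \<le> j" "j \<le> k" for j k
    using that(2,1) by (induction k rule: dec_induct) (auto intro: order.trans mono)
  have "\<exists>j\<ge>i. f j + k \<le> f i" for k
  proof (induction k)
    case (Suc k)
    then obtain j where j: "j \<ge> i" "f j + k \<le> f i" by blast
    obtain l where l: "l \<ge> j" "f (Suc l) < f l" using freq by blast
    have "f l \<le> f j" using anti j l by simp
    then show ?case using j l by (intro exI[of _ "Suc l"]) auto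
  qed auto
  from this[of "Suc (f i)"] show False by auto
qed

lemma first_after:
  fixes i :: nat
  assumes "\<exists>j\<ge>i. P j"
  shows "\<exists>k\<ge>i. P k \<and> (\<forall>j. i \<le> j \<longrightarrow> j < k \<longrightarrow> \<not> P j)"
proof -
  define k where "k = (LEAST j. i \<le> j \<and> P j)"
  have "i \<le> k \<and> P k" unfolding k_def by (rule LeastI_ex[of "\<lambda>j. i \<le> j \<and> P j"]) (use assms in blast)
  moreover have "\<not> P j" if "i \<le> j" "j < k" for j
    using not_less_Least[of j "\<lambda>j. i \<le> j \<and> P j"] that unfolding k_def by blast
  ultimately show ?thesis by blast
qed

lemma finite_int_bound: "finite A \<Longrightarrow> \<exists>b\<ge>0. \<forall>x\<in>A. \<bar>f x\<bar> \<le> (b :: int)"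
proof (induction A rule: finite_induct)
  case (insert x A)
  then obtain b where "b \<ge> 0" "\<forall>x\<in>A. \<bar>f x\<bar> \<le> b" by blast
  then show ?case by (intro exI[of _ "max b \<bar>f x\<bar>"]) force
qed auto

lemma split_interval_induct:
  assumes "a \<le> i" "i \<le> b" "Q a" "\<And>j. a \<le> j \<Longrightarrow> j < b \<Longrightarrow> Q j \<Longrightarrow> Q (Suc j)"
  shows "Q (i :: nat)"
  using assms(1,2)
proof (induction i rule: dec_induct)
  case base
  show ?case by (rule assms(3))
next
  case (step j)
  then show ?case using assms(4)[of j] by simp
qed

lemma coincide_singleton:
  assumes "{m. idx_val m i = idx_val m j} = {c}" "isparam i" "isparam j"
  shows "\<exists>f a. (i = IC f \<and> j = IP a \<or> i = IP a \<and> j = IC f) \<and> c = f - a"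
proof -
  have c: "idx_val m i = idx_val m j \<longleftrightarrow> m = c" for m using assms(1) by blast
  show ?thesis
    using c[of c] c[of "c + 1"] assms(2,3) by (cases i; cases j) auto
qed

lemma param_atoms_isparam: "(p, i) \<in> param_atoms T \<Longrightarrow> isparam i"
  by (induction T) (auto split: if_splits)

lemma gaps_guard_free: "guard_free T \<Longrightarrow> gaps T = {}"
  by (induction T) auto

lemma gaps_guard_chain: "guard_chain T \<Longrightarrow> Z \<in> gaps T \<Longrightarrow> Z = UNIV \<or> (\<exists>c. Z = {c})"
  by (induction T) auto

lemma gaps_wf_tree: "wf_tree T \<Longrightarrow> Z \<in> gaps T \<Longrightarrow> Z = UNIV \<or> (\<exists>c. Z = {c})"
  by (induction T) (auto dest: gaps_guard_chain)

context frame
begin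

lemma nodes_cases: "E \<in> nodes T \<Longrightarrow> (\<exists>a\<in>offsets T. E = {lo + a..}) \<or> (\<exists>Z\<in>gaps T. E = - Z)"
  by (induction T) auto

definition nonempty_on :: "'p tree \<Rightarrow> int set \<Rightarrow> bool" where
  "nonempty_on T X \<longleftrightarrow> (\<forall>a\<in>offsets T. X \<subseteq> {lo + a..})"

definition irr3 :: "'p tree \<Rightarrow> int set \<Rightarrow> bool" where
  "irr3 T X \<longleftrightarrow> (\<forall>Y' q a s V. sub X T Y' (XI q a s V) \<longrightarrow> Y' \<noteq> {} \<longrightarrow> \<not> Y' \<subseteq> {lo + a..})"

lemma unbdd_nonempty: "unbdd X \<Longrightarrow> X \<noteq> {}"
  unfolding unbdd_def by auto

lemma not_unbdd: "\<not> unbdd X \<Longrightarrow> \<exists>m. X \<subseteq> {..m}"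
  unfolding unbdd_def by (meson atMost_iff linear subsetI)

lemma unbdd_subset: "unbdd X \<Longrightarrow> \<not> X \<subseteq> {..m}"
  unfolding unbdd_def by (metis atMost_iff subsetD add_le_same_cancel1 order.trans not_one_le_zero)

text \<open>A negative split on a ray or on a cofinite condition would leave \<open>X'\<close>
  bounded. On an unbounded branch only rays are intersected, single values removed, or unsatisfiable
  guards cut.\<close>

lemma split_cases_unbdd:
  assumes sp: "split1 (T, X, M) (T', X', M')" and X': "unbdd X'" and T: "wf_tree T"
  shows "M' = M \<and> (T' = T \<and> (\<exists>a\<in>offsets T. X' = X \<inter> {lo + a..}) \<or>
    T' = T \<and> (\<exists>c. {c} \<in> gaps T \<and> X' = X - {c}) \<or> X' = X \<and> (\<exists>E. cut E T T') \<and> UNIV \<in> gaps T)"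
  using sp
proof cases
  case (pos E)
  from nodes_cases[OF pos(4)] show ?thesis
  proof (elim disjE bexE)
    fix Z assume Z: "Z \<in> gaps T" "E = - Z"
    from gaps_wf_tree[OF T Z(1)] show ?thesis
    proof
      assume "Z = UNIV"
      then show ?thesis using pos Z unbdd_nonempty[OF X'] by simp
    next
      assume "\<exists>c. Z = {c}"
      then show ?thesis using pos Z by (auto simp: Diff_eq)
    qed
  qed (use pos in auto)
next
  case (neg E)
  from nodes_cases[OF neg(3)] show ?thesis
  proof (elim disjE bexE)
    fix a assume "E = {lo + a..}"
    then have "X' \<subseteq> {..lo + a}" using neg by auto
    then show ?thesis using unbdd_subset[OF X'] by blast
  next
    fix Z assume Z: "Z \<in> gaps T" "E = - Z"
    from gaps_wf_tree[OF T Z(1)] show ?thesis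
    proof
      assume "Z = UNIV"
      then show ?thesis using neg Z by auto
    next
      assume "\<exists>c. Z = {c}"
      then obtain c where "Z = {c}" by blast
      then have "X' \<subseteq> {..c}" using neg Z by auto
      then show ?thesis using unbdd_subset[OF X'] by blast
    qed
  qed
qed

lemma step2_shape:
  assumes "step2 (T1, X1, M1) (T2, X2, M2)"
  shows "X2 \<subseteq> X1 \<and> unfold_weight B T2 \<le> unfold_weight B T1 \<and> offsets T2 \<subseteq> offsets T1 \<and> var_atoms T2 \<subseteq> var_atoms T1 \<and> nesting T2 \<le> nesting T1 \<and>
    alternation q T2 \<le> alternation q T1 \<and> param_atoms T2 \<subseteq> param_atoms T1 \<and> M2 \<subseteq> M1 \<union> param_atoms T1"
  using assms
proof cases
  case rew
  then show ?thesis
    using simp_step_unfold_weight[OF rew(3)] simp_step_offsets[OF rew(3)] simp_step_var_atoms[OF rew(3)] simp_step_nesting[OF rew(3)] simp_step_alternation[OF rew(3)] param_atoms_simp_step[OF rew(3)]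
    by auto
next
  case split
  from split(1) show ?thesis
  proof cases
    case pos
    then show ?thesis by auto
  next
    case (neg E)
    then show ?thesis
      using cut_unfold_weight[OF neg(4)] cut_content[OF neg(4)] cut_alternation[OF neg(4)] param_atoms_cut[OF neg(4)] by auto
  qed
qed auto

end

text \<open>One infinite branch with patterns and constraints forgotten. The assumptions
  \<open>ne2\<close>, \<open>ng3\<close>, \<open>blk\<close> and \<open>te\<close> are what
  irreducibility at the ends of the phases contributes; \<open>cof\<close> is the shape of the
  initial constraint.\<close>

locale run = frame n lo for n lo +
  fixes T :: "nat \<Rightarrow> 'p tree" and X :: "nat \<Rightarrow> int set" and M :: "nat \<Rightarrow> ('p \<times> idx) set"
    and ph :: "nat \<Rightarrow> phase"
  assumes s1: "ph i = Phase1 \<Longrightarrow> split1 (T i, X i, M i) (T (Suc i), X (Suc i), M (Suc i))"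
    and s2: "ph i = Phase2 \<Longrightarrow> step2 (T i, X i, M i) (T (Suc i), X (Suc i), M (Suc i))"
    and s3: "ph i = Phase3 \<Longrightarrow> unfolds (X i) (T i) (T (Suc i)) \<and> X (Suc i) = X i \<and> M (Suc i) = M i"
    and finM: "finite (M i)" and Mparam: "(p, j) \<in> M i \<Longrightarrow> isparam j"
    and twfT: "wf_tree (T i)"
    and Xne: "X i \<noteq> {}"
    and cof: "(\<exists>b. X 0 \<subseteq> {..b}) \<or> (\<exists>b. {b..} \<subseteq> X 0)"
    and ne2: "ph i = Phase2 \<Longrightarrow> nonempty_on (T i) (X i)"
    and ng3: "ph i = Phase3 \<Longrightarrow> guard_free (T i)"
    and blk: "ph i = Phase3 \<Longrightarrow> i = 0 \<or> ph (i - 1) \<noteq> Phase3 \<Longrightarrow> nonempty_on (T i) (X i) \<and> param_atoms (T i) = {}"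
    and te: "ph i = Phase3 \<Longrightarrow> ph (Suc i) \<noteq> Phase3 \<Longrightarrow> irr3 (T (Suc i)) (X (Suc i))"
begin

lemma step12: "ph i \<noteq> Phase3 \<Longrightarrow> step2 (T i, X i, M i) (T (Suc i), X (Suc i), M (Suc i))"
  using s1[of i] s2[of i] step2.split by (cases "ph i") auto

lemma shape12:
  assumes "ph i \<noteq> Phase3"
  shows "X (Suc i) \<subseteq> X i" "unfold_weight B (T (Suc i)) \<le> unfold_weight B (T i)" "offsets (T (Suc i)) \<subseteq> offsets (T i)"
    "var_atoms (T (Suc i)) \<subseteq> var_atoms (T i)" "nesting (T (Suc i)) \<le> nesting (T i)" "alternation q (T (Suc i)) \<le> alternation q (T i)"
    "param_atoms (T (Suc i)) \<subseteq> param_atoms (T i)" "M (Suc i) \<subseteq> M i \<union> param_atoms (T i)"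
  using step2_shape[OF step12[OF assms], of B q] by blast+

lemma Xmono: "i \<le> j \<Longrightarrow> X j \<subseteq> X i"
proof (induction j rule: dec_induct)
  case (step j)
  have "X (Suc j) \<subseteq> X j" using shape12(1)[of j] s3[of j] by (cases "ph j = Phase3") auto
  then show ?case using step by blast
qed simp

text \<open>Among the propositions of a branch only indices \<open>n + c\<close> are new; predicate
  symbols, constant indices and shifts of bound variables are inherited from the start. So only the
  constants \<open>c\<close> need the window argument.\<close>

lemma content:
  "var_atoms (T i) \<subseteq> var_atoms (T 0)" "nesting (T i) \<le> nesting (T 0)" "alternation q (T i) \<le> alternation q (T 0)"
  "(p, IC f) \<in> M i \<union> param_atoms (T i) \<Longrightarrow> (p, IC f) \<in> M 0 \<union> param_atoms (T 0)"
  "(p, j) \<in> M i \<union> param_atoms (T i) \<Longrightarrow> p \<in> fst ` (M 0 \<union> param_atoms (T 0)) \<union> fst ` var_atoms (T 0)"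
proof -
  have main: "var_atoms (T i) \<subseteq> var_atoms (T 0) \<and> nesting (T i) \<le> nesting (T 0) \<and> alternation q (T i) \<le> alternation q (T 0) \<and>
    (\<forall>p f. (p, IC f) \<in> M i \<union> param_atoms (T i) \<longrightarrow> (p, IC f) \<in> M 0 \<union> param_atoms (T 0)) \<and>
    (\<forall>p j. (p, j) \<in> M i \<union> param_atoms (T i) \<longrightarrow> p \<in> fst ` (M 0 \<union> param_atoms (T 0)) \<union> fst ` var_atoms (T 0))"
  proof (induction i)
    case 0
    then show ?case by force
  next
    case (Suc i)
    show ?case
    proof (cases "ph i = Phase3")
      case True
      note u = s3[OF True]
      obtain a where a: "param_atoms (T (Suc i)) \<subseteq> param_atoms (T i) \<union> {(p, IP (c - a)) |p c. (p, c) \<in> var_atoms (T i)}"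
        using unfolds_offsets[of "X i" "T i" "T (Suc i)"] u by blast
      have v: "var_atoms (T (Suc i)) \<subseteq> var_atoms (T i)" "nesting (T (Suc i)) \<le> nesting (T i)" "alternation q (T (Suc i)) \<le> alternation q (T i)"
        using unfolds_content[of "X i" "T i" "T (Suc i)"] unfolds_alternation[of "X i" "T i" "T (Suc i)"] u by auto
      have 1: "(p, IC f) \<in> M i \<union> param_atoms (T i)" if "(p, IC f) \<in> M (Suc i) \<union> param_atoms (T (Suc i))" for p f
        using that a u by auto
      have 2: "(p, j) \<in> M i \<union> param_atoms (T i) \<or> p \<in> fst ` var_atoms (T i)" if "(p, j) \<in> M (Suc i) \<union> param_atoms (T (Suc i))" for p j
        using that a u by force
      show ?thesis using Suc v 1 2 by (meson image_mono in_mono order.trans UnCI)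
    next
      case False
      note sh = shape12[OF False]
      have 1: "M (Suc i) \<union> param_atoms (T (Suc i)) \<subseteq> M i \<union> param_atoms (T i)" using sh by blast
      then show ?thesis using Suc sh(4) sh(5) sh(6)[of q] by (meson in_mono order.trans)
    qed
  qed
  show "var_atoms (T i) \<subseteq> var_atoms (T 0)" "nesting (T i) \<le> nesting (T 0)" "alternation q (T i) \<le> alternation q (T 0)"
    "(p, IC f) \<in> M i \<union> param_atoms (T i) \<Longrightarrow> (p, IC f) \<in> M 0 \<union> param_atoms (T 0)"
    "(p, j) \<in> M i \<union> param_atoms (T i) \<Longrightarrow> p \<in> fst ` (M 0 \<union> param_atoms (T 0)) \<union> fst ` var_atoms (T 0)"
    using main by blast+
qed

text \<open>The first two phases, even alternating with each other, decrease \<open>mu\<close> at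
  every step.\<close>

lemma ex_phase3: "\<exists>j\<ge>i. ph j = Phase3"
proof (rule ccontr)
  assume "\<not> ?thesis"
  then have n3: "ph (i + k) \<noteq> Phase3" for k by simp
  define g where "g = (\<lambda>k. mu (T (i + k), X (i + k), M (i + k)))"
  have "(g (Suc k), g k) \<in> less_than <*lex*> less_than" for k
    using step2_mu[OF step12[OF n3[of k]]] finM by (simp add: g_def)
  moreover have "wf (less_than <*lex*> less_than)" by auto
  ultimately show False unfolding wf_iff_no_infinite_down_chain by blast
qed

text \<open>If \<open>m\<close> bounded \<open>X i\<close>, then \<open>unfold_weight\<close> for
  \<open>m - lo + 1\<close> would never grow from there on and would drop at every unfolding, of
  which there are infinitely many by \<open>ex_phase3\<close>.\<close>

lemma unbdd_X: "unbdd (X i)"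
proof (rule ccontr)
  assume "\<not> unbdd (X i)"
  then obtain m where m: "X i \<subseteq> {..m}" using not_unbdd by blast
  let ?f = "\<lambda>k. unfold_weight (m - lo + 1) (T k)"
  have dec: "?f (Suc k) < ?f k" if "i \<le> k" "ph k = Phase3" for k
    using s3[OF that(2)] unfolds_unfold_weight_bounded[of "X k" "T k" "T (Suc k)" m] Xmono[OF that(1)] m by blast
  show False
  proof (rule no_frequent_descent[of i ?f])
    fix k assume "i \<le> k"
    then show "?f (Suc k) \<le> ?f k"
      using dec[of k] shape12(2)[of k] by (cases "ph k = Phase3") auto
  next
    fix k
    obtain j where "j \<ge> max i k" "ph j = Phase3" using ex_phase3 by blast
    then show "\<exists>j\<ge>k. ?f (Suc j) < ?f j" using dec[of j] by (intro exI[of _ j]) auto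
  qed
qed

lemma step12_unbdd:
  assumes "ph i \<noteq> Phase3"
  shows "(X (Suc i) = X i \<and> (\<forall>Z\<in>gaps (T (Suc i)). Z \<in> gaps (T i) \<or>
      (\<exists>p j j'. Z = {m. idx_val m j = idx_val m j'} \<and> (p, j) \<in> param_atoms (T i) \<and> (p, j') \<in> M i))) \<or>
    T (Suc i) = T i \<and> (\<exists>a\<in>offsets (T i). X (Suc i) = X i \<inter> {lo + a..}) \<or>
    T (Suc i) = T i \<and> (\<exists>c. {c} \<in> gaps (T i) \<and> X (Suc i) = X i - {c})"
  using step12[OF assms]
proof cases
  case rew
  then show ?thesis using simp_step_gaps[of "M i" "X i" "T i" "T (Suc i)"] by blast
next
  case split
  from split_cases_unbdd[OF split(1) unbdd_X twfT] show ?thesis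
    using cut_content(4)[of _ "T i" "T (Suc i)"] by blast
next
  case (psplit p i)
  then show ?thesis by auto
qed

lemma cofinite: "\<exists>b. {b..} \<subseteq> X i"
proof (induction i)
  case 0
  show ?case using cof unbdd_subset[OF unbdd_X] by blast
next
  case (Suc i)
  then obtain b where b: "{b..} \<subseteq> X i" by blast
  show ?case
  proof (cases "ph i = Phase3")
    case True
    then show ?thesis using s3 b by auto
  next
    case False
    from step12_unbdd[OF False] show ?thesis
    proof (elim disjE conjE bexE exE)
      fix a assume "X (Suc i) = X i \<inter> {lo + a..}"
      then show ?thesis using b by (intro exI[of _ "max b (lo + a)"]) auto
    next
      fix c assume "X (Suc i) = X i - {c}"
      then show ?thesis using b by (intro exI[of _ "max b (c + 1)"]) auto
    qed (use b in auto)
  qed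
qed

lemma ex_not_phase3: "\<exists>j\<ge>i. ph j \<noteq> Phase3"
proof (rule ccontr)
  assume "\<not> ?thesis"
  then have all3: "ph j = Phase3" if "i \<le> j" for j using that by blast
  obtain b where b: "{b..} \<subseteq> X i" using cofinite by blast
  let ?D = "nesting (T i)"
  obtain A where A: "\<forall>a\<in>offsets (T i). a \<le> A"
    using finite_offsets[of "T i"] by (meson Max_ge)
  \<comment> \<open>Large enough for the current offsets with the slack of
    \<open>offsets_ok\<close>, and for the ray from \<open>lo + U - int ?D\<close> on to lie in
    \<open>X i\<close>.\<close>
  define U where "U = max (b - lo + int ?D) (A + int ?D)"
  have inv: "offsets_ok U (T (i + k)) \<and> nesting (T (i + k)) \<le> ?D \<and> X (i + k) = X i" for k
  proof (induction k)
    case 0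
    have "offsets_ok U (T i)" using A by (intro okUI[of _ ?D]) (auto simp: U_def)
    then show ?case by simp
  next
    case (Suc k)
    note u = s3[OF all3[OF le_add1, of k]]
    have "{lo + U - int (nesting (T (i + k)))..} \<subseteq> {b..}" using Suc by (auto simp: U_def)
    then have "{lo + U - int (nesting (T (i + k)))..} \<subseteq> X (i + k)" using b Suc by (metis order.trans)
    then have "offsets_ok U (T (Suc (i + k)))"
      using unfolds_offsets_ok[of "X (i + k)" "T (i + k)" "T (Suc (i + k))" U] u Suc by blast
    moreover have "nesting (T (Suc (i + k))) \<le> nesting (T (i + k))"
      using unfolds_content(2)[of "X (i + k)" "T (i + k)" "T (Suc (i + k))"] u by simp
    ultimately show ?case using u Suc by simp
  qed
  have "unfold_weight (U + 1) (T (i + Suc k)) < unfold_weight (U + 1) (T (i + k))" for k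
    using unfolds_unfold_weight_offsets_ok[of "X (i + k)" "T (i + k)" "T (Suc (i + k))" U] s3[OF all3[of "i + k"]] inv[of k] by simp
  then show False using no_infinite_descent[of "\<lambda>k. unfold_weight (U + 1) (T (i + k))"] by blast
qed

definition block_start :: "nat \<Rightarrow> bool" where
  "block_start i \<longleftrightarrow> ph i = Phase3 \<and> (i = 0 \<or> ph (i - 1) \<noteq> Phase3)"

lemma ex_block_start: "\<exists>s. block_start s"
proof -
  obtain k where k: "0 \<le> k" "ph k = Phase3" "\<And>j. 0 \<le> j \<Longrightarrow> j < k \<Longrightarrow> ph j \<noteq> Phase3"
    using first_after[OF ex_phase3[of 0]] by blast
  then show ?thesis unfolding block_start_def using k(3)[of "k - 1"] by (intro exI[of _ k]) auto
qed

text \<open>The window invariant at the start of a block of Phase 3. \<open>\<kappa>\<close> bounds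
  how far an index \<open>n + c\<close> of \<open>M\<close> can lie below
  \<open>n - \<beta>\<close>, and \<open>\<delta>\<close> how far above \<open>\<beta>\<close> a
  value can be missing from \<open>X\<close>. \<open>T0\<close> is the start of a ray in an early
  \<open>X\<close>; it is superseded by \<open>\<beta> + \<delta>\<close> once
  \<open>\<beta>\<close> is large.\<close>

definition Q :: "int \<Rightarrow> int \<Rightarrow> int \<Rightarrow> nat \<Rightarrow> int \<Rightarrow> bool" where
  "Q T0 \<kappa> \<delta> i \<beta> \<longleftrightarrow> block_start i \<and> X i \<subseteq> {lo + \<beta>..} \<and> {max T0 (\<beta> + \<delta>)..} \<subseteq> X i \<and> (\<forall>a\<in>offsets (T i). a \<le> \<beta>) \<and>
    (\<forall>p c. (p, IP c) \<in> M i \<longrightarrow> - c \<le> \<beta> + \<kappa>)"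

context
  fixes cm fm T0 \<kappa> \<delta> :: int
  assumes cm: "\<And>p c. (p, c) \<in> var_atoms (T 0) \<Longrightarrow> \<bar>c\<bar> \<le> cm"
    and fm: "\<And>p f. (p, IC f) \<in> M 0 \<union> param_atoms (T 0) \<Longrightarrow> \<bar>f\<bar> \<le> fm"
    and cm0: "0 \<le> cm" "0 \<le> fm" and \<kappa>: "cm \<le> \<kappa>" and \<delta>: "\<delta> = \<kappa> + fm + 1 + \<bar>lo\<bar>"
begin

text \<open>When Unfolding has become irreducible, the context of an iteration of offset
  \<open>a\<close> admits a value below \<open>lo + a\<close>, while \<open>X\<close> lies above
  \<open>lo + \<beta>\<close>; so all offsets have passed \<open>\<beta>\<close>. From above they
  are limited by \<open>offsets_ok\<close>, since \<open>X\<close> contains the ray from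
  \<open>max T0 (\<beta> + \<delta>)\<close> on.\<close>

lemma block3:
  assumes Q: "Q T0 \<kappa> \<delta> s \<beta>" and t: "s < t" "\<And>j. s \<le> j \<Longrightarrow> j < t \<Longrightarrow> ph j = Phase3" "ph t \<noteq> Phase3"
  obtains \<beta>' where "\<beta> < \<beta>'" "\<beta>' \<le> max T0 (\<beta> + \<delta>) - lo + int (nesting (T 0))"
    "offsets (T t) \<subseteq> {\<beta> + 1..\<beta>'}" "\<beta>' \<in> offsets (T t)" "X t = X s" "M t = M s" "guard_free (T t)"
    "\<And>p c. (p, IP c) \<in> param_atoms (T t) \<Longrightarrow> - c \<le> \<beta>' + \<kappa>"
proof -
  define U where "U = max T0 (\<beta> + \<delta>) - lo + int (nesting (T 0))"
  have block_start: "block_start s" and Xs: "X s \<subseteq> {lo + \<beta>..}" "{max T0 (\<beta> + \<delta>)..} \<subseteq> X s" and as: "\<forall>a\<in>offsets (T s). a \<le> \<beta>"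
    using Q by (auto simp: Q_def)
  have start: "param_atoms (T s) = {}" using blk[of s] block_start by (auto simp: block_start_def)
  define inv where "inv = (\<lambda>i. X i = X s \<and> M i = M s \<and> offsets_ok U (T i) \<and> guard_free (T i) \<and>
    (\<forall>p c. (p, IP c) \<in> param_atoms (T i) \<longrightarrow> (\<exists>a\<in>offsets (T i). - c \<le> a + cm)))"
  have "inv t"
  proof (rule split_interval_induct[of s t t])
    have "offsets_ok U (T s)"
      by (rule okUI[of _ "nesting (T 0)"]) (use as content(2)[of s] \<delta> \<kappa> cm0 in \<open>auto simp: U_def\<close>)
    then show "inv s" unfolding inv_def using start ng3[of s] block_start by (simp add: block_start_def)
  next
    fix j assume j: "s \<le> j" "j < t" and inv: "inv j"
    note u = s3[OF t(2)[OF j]]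
    obtain a where a: "a \<in> offsets (T j)" "a + 1 \<in> offsets (T (Suc j))" "offsets (T j) \<subseteq> insert a (offsets (T (Suc j)))"
      "param_atoms (T (Suc j)) \<subseteq> param_atoms (T j) \<union> {(p, IP (c - a)) |p c. (p, c) \<in> var_atoms (T j)}"
      using unfolds_offsets[of "X j" "T j" "T (Suc j)"] u by blast
    have "{lo + U - int (nesting (T j))..} \<subseteq> {max T0 (\<beta> + \<delta>)..}"
      using content(2)[of j] by (auto simp: U_def)
    then have "{lo + U - int (nesting (T j))..} \<subseteq> X j" using Xs(2) inv unfolding inv_def by auto
    then have ok: "offsets_ok U (T (Suc j))"
      using unfolds_offsets_ok[of "X j" "T j" "T (Suc j)" U] u inv unfolding inv_def by blast
    have at: "\<exists>a\<in>offsets (T (Suc j)). - c \<le> a + cm" if pc: "(p, IP c) \<in> param_atoms (T (Suc j))" for p c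
    proof (cases "(p, IP c) \<in> param_atoms (T j)")
      case True
      then obtain b where b: "b \<in> offsets (T j)" "- c \<le> b + cm" using inv unfolding inv_def by blast
      \<comment> \<open>The bounding offset \<open>b\<close> may be the one just raised; then
        \<open>a + 1\<close> takes its place.\<close>
      show ?thesis
      proof (cases "b = a")
        case True
        then show ?thesis using a(2) b(2) by (intro bexI[of _ "a + 1"]) auto
      next
        case False
        then show ?thesis using a(3) b by blast
      qed
    next
      case False
      then obtain c' where c': "c = c' - a" "(p, c') \<in> var_atoms (T j)" using pc a(4) by blast
      then have "\<bar>c'\<bar> \<le> cm" using cm content(1)[of j] by blast
      then show ?thesis using a(2) c' by (intro bexI[of _ "a + 1"]) auto
    qed
    show "inv (Suc j)"
      using u ok at inv unfolds_content(3)[of "X j" "T j" "T (Suc j)"] unfolding inv_def by auto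
  qed (use t in auto)
  then have I: "X t = X s" "M t = M s" "offsets_ok U (T t)" "guard_free (T t)"
    and at: "\<And>p c. (p, IP c) \<in> param_atoms (T t) \<Longrightarrow> \<exists>a\<in>offsets (T t). - c \<le> a + cm"
    unfolding inv_def by auto
  obtain t' where t': "t = Suc t'" using t(1) by (cases t) auto
  then have t3: "ph t' = Phase3" using t by auto
  then have ne: "offsets (T t) \<noteq> {}" using unfolds_offsets[of "X t'" "T t'" "T t"] s3[OF t3] t' by auto
  have irr: "irr3 (T t) (X t)" using te[OF t3] t(3) t' by simp
  have low: "\<beta> + 1 \<le> a" if at: "a \<in> offsets (T t)" for a
  proof -
    obtain Y' q s' V where sub: "sub (X t) (T t) Y' (XI q a s' V)" using sub_offsets[OF at] by blast
    have "Y' \<noteq> {}" using sub_unbdd[OF sub I(4) unbdd_X] by (rule unbdd_nonempty)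
    then have "\<not> Y' \<subseteq> {lo + a..}" using irr sub unfolding irr3_def by blast
    then obtain y where "y \<in> Y'" "y < lo + a" by (meson atLeast_iff not_le subsetI)
    moreover have "y \<in> X s" using sub_subset[OF sub] \<open>y \<in> Y'\<close> I(1) by blast
    ultimately show ?thesis using Xs(1) by force
  qed
  define \<beta>' where "\<beta>' = Max (offsets (T t))"
  have b': "\<beta>' \<in> offsets (T t)" "\<And>a. a \<in> offsets (T t) \<Longrightarrow> a \<le> \<beta>'"
    unfolding \<beta>'_def using ne Max_in[OF finite_offsets[of "T t"]] Max_ge[OF finite_offsets[of "T t"]] by blast+
  show ?thesis
  proof (rule that[of \<beta>'])
    show "\<beta> < \<beta>'" using low[OF b'(1)] by simp
    show "\<beta>' \<le> max T0 (\<beta> + \<delta>) - lo + int (nesting (T 0))" using offsets_ok_offsets[OF I(3) b'(1)] unfolding U_def .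
    show "offsets (T t) \<subseteq> {\<beta> + 1..\<beta>'}" using low b'(2) by auto
    show "- c \<le> \<beta>' + \<kappa>" if "(p, IP c) \<in> param_atoms (T t)" for p c
      using at[OF that] b'(2) \<kappa> by force
  qed (use b' I in auto)
qed

lemma block12:
  assumes t: "t < s'" "\<And>j. t \<le> j \<Longrightarrow> j < s' \<Longrightarrow> ph j \<noteq> Phase3" "ph s' = Phase3" and t3: "block_start s'"
    and b': "\<beta>' \<in> offsets (T t)" "\<And>a. a \<in> offsets (T t) \<Longrightarrow> a \<le> \<beta>'" and nG: "guard_free (T t)"
    and X: "{max T0 (\<beta>' + \<delta>)..} \<subseteq> X t"
    and at: "\<And>p c. (p, IP c) \<in> param_atoms (T t) \<union> M t \<Longrightarrow> - c \<le> \<beta>' + \<kappa>"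
  shows "Q T0 \<kappa> \<delta> s' \<beta>'" "offsets (T s') \<subseteq> offsets (T t)"
proof -
  \<comment> \<open>The last disjunct concerns the iteration of offset \<open>\<beta>'\<close>,
    which may later be rewritten away. As long as the tree is unchanged, it is still there to force
    \<open>X \<subseteq> {lo + \<beta>'..}\<close> when the first phase is over; afterwards the
    bound on \<open>X\<close> persists by itself.\<close>
  define inv where "inv = (\<lambda>i. {max T0 (\<beta>' + \<delta>)..} \<subseteq> X i \<and> offsets (T i) \<subseteq> offsets (T t) \<and>
    (\<forall>p c. (p, IP c) \<in> param_atoms (T i) \<union> M i \<longrightarrow> - c \<le> \<beta>' + \<kappa>) \<and> (\<forall>c. {c} \<in> gaps (T i) \<longrightarrow> c < \<beta>' + \<delta>) \<and>
    (X i \<subseteq> {lo + \<beta>'..} \<or> T i = T t))"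
  have "inv s'"
  proof (rule split_interval_induct[of t s' s'])
    show "inv t" unfolding inv_def using X at gaps_guard_free[OF nG] by auto
  next
    fix j assume j: "t \<le> j" "j < s'" and inv: "inv j"
    note p3 = t(2)[OF j]
    note sh = shape12[OF p3]
    have I: "{max T0 (\<beta>' + \<delta>)..} \<subseteq> X j" "offsets (T j) \<subseteq> offsets (T t)"
      "\<And>p c. (p, IP c) \<in> param_atoms (T j) \<union> M j \<Longrightarrow> - c \<le> \<beta>' + \<kappa>" "\<And>c. {c} \<in> gaps (T j) \<Longrightarrow> c < \<beta>' + \<delta>"
      "X j \<subseteq> {lo + \<beta>'..} \<or> T j = T t"
      using inv unfolding inv_def by blast+
    have as: "offsets (T (Suc j)) \<subseteq> offsets (T t)" using sh(3) I(2) by blast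
    have pa: "\<And>p c. (p, IP c) \<in> param_atoms (T (Suc j)) \<union> M (Suc j) \<Longrightarrow> - c \<le> \<beta>' + \<kappa>"
      using sh(7,8) I(3) by blast
    have newz: "c < \<beta>' + \<delta>" if Z: "{c} = {m. idx_val m i = idx_val m i'}" and i: "(p, i) \<in> param_atoms (T j)" "(p, i') \<in> M j"
      for c p i i'
    proof -
      have "isparam i" using i(1) by (rule param_atoms_isparam)
      then obtain f a where fa: "i = IC f \<and> i' = IP a \<or> i = IP a \<and> i' = IC f" "c = f - a"
        using coincide_singleton[OF Z[symmetric]] Mparam[OF i(2)] by blast
      then have "(p, IC f) \<in> M j \<union> param_atoms (T j)" "(p, IP a) \<in> param_atoms (T j) \<union> M j" using i by auto
      then have "\<bar>f\<bar> \<le> fm" "- a \<le> \<beta>' + \<kappa>" using fm content(4) I(3) by blast+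
      then show ?thesis using fa(2) \<delta> by linarith
    qed
    have XZ: "{max T0 (\<beta>' + \<delta>)..} \<subseteq> X (Suc j) \<and> (\<forall>c. {c} \<in> gaps (T (Suc j)) \<longrightarrow> c < \<beta>' + \<delta>)"
      using step12_unbdd[OF p3]
    proof (elim disjE conjE bexE exE)
      assume "X (Suc j) = X j" and Z: "\<forall>Z\<in>gaps (T (Suc j)). Z \<in> gaps (T j) \<or>
        (\<exists>p i i'. Z = {m. idx_val m i = idx_val m i'} \<and> (p, i) \<in> param_atoms (T j) \<and> (p, i') \<in> M j)"
      then show ?thesis using I(1,4) newz by metis
    next
      fix a assume a: "T (Suc j) = T j" "a \<in> offsets (T j)" "X (Suc j) = X j \<inter> {lo + a..}"
      have "a \<le> \<beta>'" using a(2) I(2) b'(2) by blast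
      then have "lo + a \<le> max T0 (\<beta>' + \<delta>)" using \<delta> \<kappa> cm0 by auto
      then show ?thesis using a I(1,4) by auto
    next
      fix c assume c: "T (Suc j) = T j" "{c} \<in> gaps (T j)" "X (Suc j) = X j - {c}"
      then have "c \<notin> {max T0 (\<beta>' + \<delta>)..}" using I(4)[of c] by auto
      then have "{max T0 (\<beta>' + \<delta>)..} \<subseteq> X (Suc j)" using c(3) I(1) by blast
      then show ?thesis using c(1) I(4) by simp
    qed
    have "X (Suc j) \<subseteq> {lo + \<beta>'..} \<or> T (Suc j) = T t"
    proof (cases "X j \<subseteq> {lo + \<beta>'..}")
      case True
      then show ?thesis using sh(1) by blast
    next
      case False
      then have Tj: "T j = T t" using I(5) by blast
      show ?thesis
      proof (cases "ph j")
        case Phase1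
        from split_cases_unbdd[OF s1[OF Phase1] unbdd_X twfT] gaps_guard_free[OF nG] Tj show ?thesis by auto
      next
        case Phase2
        then have "X j \<subseteq> {lo + \<beta>'..}" using ne2[OF Phase2] b'(1) Tj unfolding nonempty_on_def by auto
        then show ?thesis using False by blast
      next
        case Phase3
        then show ?thesis using p3 by simp
      qed
    qed
    then show "inv (Suc j)" unfolding inv_def using XZ as pa by blast
  qed (use t in auto)
  then have I: "{max T0 (\<beta>' + \<delta>)..} \<subseteq> X s'" "offsets (T s') \<subseteq> offsets (T t)"
      "\<And>p c. (p, IP c) \<in> param_atoms (T s') \<union> M s' \<Longrightarrow> - c \<le> \<beta>' + \<kappa>"
      "X s' \<subseteq> {lo + \<beta>'..} \<or> T s' = T t"
    unfolding inv_def by blast+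
  have "X s' \<subseteq> {lo + \<beta>'..}"
    using I(4) blk[of s'] t3 b'(1) unfolding block_start_def nonempty_on_def by auto
  then show "Q T0 \<kappa> \<delta> s' \<beta>'" unfolding Q_def using I t3 b'(2) by blast
  show "offsets (T s') \<subseteq> offsets (T t)" by (rule I(2))
qed

lemma round:
  assumes "Q T0 \<kappa> \<delta> s \<beta>"
  shows "\<exists>s' \<beta>'. s < s' \<and> \<beta> < \<beta>' \<and> Q T0 \<kappa> \<delta> s' \<beta>' \<and> offsets (T s') \<subseteq> {\<beta> + 1..\<beta>'} \<and>
    \<beta>' \<le> max T0 (\<beta> + \<delta>) - lo + int (nesting (T 0))"
proof -
  have s: "ph s = Phase3" using assms by (simp add: Q_def block_start_def)
  obtain t where t0: "s \<le> t" "ph t \<noteq> Phase3" "\<And>j. s \<le> j \<Longrightarrow> j < t \<Longrightarrow> \<not> ph j \<noteq> Phase3"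
    using first_after[OF ex_not_phase3[of s]] by blast
  then have t: "s \<le> t" "ph t \<noteq> Phase3" "\<And>j. s \<le> j \<Longrightarrow> j < t \<Longrightarrow> ph j = Phase3" by blast+
  then have st: "s < t" using s by (metis le_neq_implies_less)
  obtain s' where s': "t \<le> s'" "ph s' = Phase3" "\<And>j. t \<le> j \<Longrightarrow> j < s' \<Longrightarrow> ph j \<noteq> Phase3"
    using first_after[OF ex_phase3[of t]] by blast
  then have ts: "t < s'" using t(2) by (metis le_neq_implies_less)
  have "ph (s' - 1) \<noteq> Phase3" using s'(3)[of "s' - 1"] ts by auto
  then have block_start: "block_start s'" using s'(2) by (simp add: block_start_def)
  obtain \<beta>' where b: "\<beta> < \<beta>'" "\<beta>' \<le> max T0 (\<beta> + \<delta>) - lo + int (nesting (T 0))"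
    "offsets (T t) \<subseteq> {\<beta> + 1..\<beta>'}" "\<beta>' \<in> offsets (T t)" "X t = X s" "M t = M s" "guard_free (T t)"
    "\<And>p c. (p, IP c) \<in> param_atoms (T t) \<Longrightarrow> - c \<le> \<beta>' + \<kappa>"
    using block3[OF assms st t(3,2)] by blast
  have QX: "{max T0 (\<beta> + \<delta>)..} \<subseteq> X s" and QM: "\<And>p c. (p, IP c) \<in> M s \<Longrightarrow> - c \<le> \<beta> + \<kappa>"
    using assms unfolding Q_def by blast+
  have c1: "{max T0 (\<beta>' + \<delta>)..} \<subseteq> X t"
  proof -
    have "{max T0 (\<beta>' + \<delta>)..} \<subseteq> {max T0 (\<beta> + \<delta>)..}" using b(1) by auto
    then show ?thesis using QX unfolding b(5) by (rule order.trans)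
  qed
  have c2: "- c \<le> \<beta>' + \<kappa>" if "(p, IP c) \<in> param_atoms (T t) \<union> M t" for p c
  proof (cases "(p, IP c) \<in> param_atoms (T t)")
    case True
    then show ?thesis by (rule b(8))
  next
    case False
    then have "(p, IP c) \<in> M s" using that b(6) by blast
    then show ?thesis using QM[of p c] b(1) by linarith
  qed
  have c3: "a \<le> \<beta>'" if "a \<in> offsets (T t)" for a using that b(3) by auto
  have "Q T0 \<kappa> \<delta> s' \<beta>'"
    by (rule block12(1)[OF ts _ s'(2) block_start b(4) _ b(7) c1]) (use s'(3) c2 c3 in blast)+
  moreover have "offsets (T s') \<subseteq> offsets (T t)"
    by (rule block12(2)[OF ts _ s'(2) block_start b(4) _ b(7) c1]) (use s'(3) c2 c3 in blast)+
  ultimately show ?thesis using st ts b by (intro exI[of _ s'] exI[of _ \<beta>']) auto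
qed

end

text \<open>Beyond \<open>T0\<close> a round raises the maximal offset by at most a constant. Hence
  the old \<open>\<beta> + 1\<close>, below which no offset is left, stays within a constant of the
  new \<open>\<beta>\<close>, and one \<open>K\<close> serves all rounds.\<close>

theorem rounds:
  "\<exists>(s :: nat \<Rightarrow> nat) \<beta> K. (\<forall>r. s r < s (Suc r) \<and> \<beta> r < \<beta> (Suc r)) \<and>
    (\<forall>r. block_start (s r) \<and> offsets (T (s r)) \<subseteq> {\<beta> r - K..\<beta> r} \<and> X (s r) \<subseteq> {lo + \<beta> r..} \<and> {\<beta> r + K..} \<subseteq> X (s r) \<and>
      (\<forall>p c. (p, IP c) \<in> M (s r) \<longrightarrow> - c \<le> \<beta> r + K))"
proof -
  obtain cm where cm: "0 \<le> cm" "\<And>p c. (p, c) \<in> var_atoms (T 0) \<Longrightarrow> \<bar>c\<bar> \<le> cm"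
    using finite_int_bound[OF finite_var_atoms[of "T 0"], of snd] by force
  have finA: "finite (M 0 \<union> param_atoms (T 0))" using finM finite_param_atoms by blast
  obtain fm where fm: "0 \<le> fm" "\<And>p f. (p, IC f) \<in> M 0 \<union> param_atoms (T 0) \<Longrightarrow> \<bar>f\<bar> \<le> fm"
    using finite_int_bound[OF finA, of "\<lambda>(p, i). idx_val 0 i"] by force
  obtain s0 where s0: "block_start s0" using ex_block_start by blast
  obtain km where km: "0 \<le> km" "\<And>p c. (p, IP c) \<in> M s0 \<Longrightarrow> \<bar>c\<bar> \<le> km"
    using finite_int_bound[OF finM[of s0], of "\<lambda>(p, i). idx_val 0 i"] by force
  obtain T0 where T0: "{T0..} \<subseteq> X s0" using cofinite by blast
  define \<beta>0 where "\<beta>0 = Max (offsets (T s0))"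
  have ne: "offsets (T s0) \<noteq> {}" using unfolds_offsets[of "X s0" "T s0" "T (Suc s0)"] s3[of s0] s0 by (auto simp: block_start_def)
  have \<beta>0: "\<beta>0 \<in> offsets (T s0)" "\<And>a. a \<in> offsets (T s0) \<Longrightarrow> a \<le> \<beta>0"
    unfolding \<beta>0_def using ne Max_in[OF finite_offsets[of "T s0"]] Max_ge[OF finite_offsets[of "T s0"]] by blast+
  define \<kappa> where "\<kappa> = cm + km + \<bar>\<beta>0\<bar>"
  define \<delta> where "\<delta> = \<kappa> + fm + 1 + \<bar>lo\<bar>"
  have \<kappa>: "cm \<le> \<kappa>" using km(1) by (simp add: \<kappa>_def)
  let ?Q = "Q T0 \<kappa> \<delta>"
  have Q0: "?Q s0 \<beta>0"
  proof -
    have "X s0 \<subseteq> {lo + \<beta>0..}" using blk[of s0] s0 \<beta>0(1) unfolding block_start_def nonempty_on_def by auto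
    moreover have "{max T0 (\<beta>0 + \<delta>)..} \<subseteq> X s0" using T0 by auto
    moreover have "- c \<le> \<beta>0 + \<kappa>" if "(p, IP c) \<in> M s0" for p c
      using km(2)[OF that] cm(1) by (simp add: \<kappa>_def)
    ultimately show ?thesis unfolding Q_def using s0 \<beta>0(2) by blast
  qed
  let ?D = "int (nesting (T 0))"
  have rd: "\<exists>s' \<beta>'. s < s' \<and> \<beta> < \<beta>' \<and> ?Q s' \<beta>' \<and> offsets (T s') \<subseteq> {\<beta> + 1..\<beta>'} \<and>
    \<beta>' \<le> max T0 (\<beta> + \<delta>) - lo + ?D" if "?Q s \<beta>" for s \<beta>
    by (rule round[OF _ _ cm(1) fm(1) \<kappa> \<delta>_def that]) (use cm fm in blast)+
  have "\<exists>f. \<forall>r. ?Q (fst (f r)) (snd (f r)) \<and> (fst (f r) < fst (f (Suc r)) \<and> snd (f r) < snd (f (Suc r)) \<and>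
      offsets (T (fst (f (Suc r)))) \<subseteq> {snd (f r) + 1..snd (f (Suc r))} \<and>
      snd (f (Suc r)) \<le> max T0 (snd (f r) + \<delta>) - lo + ?D)"
  proof (rule dependent_nat_choice)
    show "\<exists>x. ?Q (fst x) (snd x)" using Q0 by (intro exI[of _ "(s0, \<beta>0)"]) simp
  next
    fix x :: "nat \<times> int" and r :: nat
    assume "?Q (fst x) (snd x)"
    then obtain s' \<beta>' where "fst x < s'" "snd x < \<beta>'" "?Q s' \<beta>'" "offsets (T s') \<subseteq> {snd x + 1..\<beta>'}"
      "\<beta>' \<le> max T0 (snd x + \<delta>) - lo + ?D" using rd by blast
    then show "\<exists>y. ?Q (fst y) (snd y) \<and> (fst x < fst y \<and> snd x < snd y \<and>
      offsets (T (fst y)) \<subseteq> {snd x + 1..snd y} \<and> snd y \<le> max T0 (snd x + \<delta>) - lo + ?D)"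
      by (intro exI[of _ "(s', \<beta>')"]) simp
  qed
  then obtain f where f: "\<And>r. ?Q (fst (f r)) (snd (f r))" "\<And>r. fst (f r) < fst (f (Suc r))"
    "\<And>r. snd (f r) < snd (f (Suc r))" "\<And>r. offsets (T (fst (f (Suc r)))) \<subseteq> {snd (f r) + 1..snd (f (Suc r))}"
    "\<And>r. snd (f (Suc r)) \<le> max T0 (snd (f r) + \<delta>) - lo + ?D" by blast
  have grow: "snd (f 0) + int r \<le> snd (f r)" for r
  proof (induction r)
    case (Suc r)
    then show ?case using f(3)[of r] by simp
  qed simp
  define r0 where "r0 = nat (T0 - snd (f 0))"
  have big: "T0 \<le> snd (f (r0 + r))" for r
  proof -
    have "T0 - snd (f 0) \<le> int r0" by (simp add: r0_def)
    then show ?thesis using grow[of "r0 + r"] by simp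
  qed
  have \<delta>0: "0 \<le> \<delta>" using cm km fm by (simp add: \<delta>_def \<kappa>_def)
  define K where "K = \<delta> + \<bar>lo\<bar> + ?D + \<kappa>"
  have K: "\<delta> \<le> K" "\<kappa> \<le> K" "\<delta> - lo + ?D \<le> K"
    using \<delta>0 cm km fm by (auto simp: K_def \<delta>_def \<kappa>_def)
  show ?thesis
  proof (intro exI[of _ "\<lambda>r. fst (f (Suc (r0 + r)))"] exI[of _ "\<lambda>r. snd (f (Suc (r0 + r)))"] exI[of _ K] conjI allI)
    fix r
    let ?i = "Suc (r0 + r)"
    show "fst (f (Suc (r0 + r))) < fst (f (Suc (r0 + Suc r)))" "snd (f (Suc (r0 + r))) < snd (f (Suc (r0 + Suc r)))"
      using f(2,3) by simp_all
    have q: "block_start (fst (f ?i))" "X (fst (f ?i)) \<subseteq> {lo + snd (f ?i)..}" "{max T0 (snd (f ?i) + \<delta>)..} \<subseteq> X (fst (f ?i))"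
      "\<And>p c. (p, IP c) \<in> M (fst (f ?i)) \<Longrightarrow> - c \<le> snd (f ?i) + \<kappa>"
      using f(1)[of ?i] unfolding Q_def by blast+
    show "block_start (fst (f ?i))" "X (fst (f ?i)) \<subseteq> {lo + snd (f ?i)..}" by (rule q)+
    have "snd (f ?i) \<le> snd (f (r0 + r)) + \<delta> - lo + ?D"
      using f(5)[of "r0 + r"] big[of r] \<delta>0 by simp
    then have "snd (f ?i) - K \<le> snd (f (r0 + r)) + 1" using K(3) by linarith
    then show "offsets (T (fst (f ?i))) \<subseteq> {snd (f ?i) - K..snd (f ?i)}" using f(4)[of "r0 + r"] by auto
    have "max T0 (snd (f ?i) + \<delta>) \<le> snd (f ?i) + K" using big[of "Suc r"] K(1) \<delta>0 by simp
    then show "{snd (f ?i) + K..} \<subseteq> X (fst (f ?i))" using q(3) by auto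
    show "(p, IP c) \<in> M (fst (f ?i)) \<longrightarrow> - c \<le> snd (f ?i) + K" for p c
      using q(4)[of p c] K(2) by auto
  qed
qed

end

section \<open>Finiteness modulo associativity, commutativity and idempotence\<close>

definition fin_mod :: "'p pat set \<Rightarrow> bool" where
  "fin_mod S \<longleftrightarrow> (\<exists>R. finite R \<and> (\<forall>P\<in>S. \<exists>Q\<in>R. pat_eq P Q))"

lemma fin_modI: "finite R \<Longrightarrow> (\<And>P. P \<in> S \<Longrightarrow> \<exists>Q\<in>R. pat_eq P Q) \<Longrightarrow> fin_mod S"
  unfolding fin_mod_def by blast

lemma fin_mod_finite: "finite S \<Longrightarrow> fin_mod S"
  by (rule fin_modI[of S]) (auto intro: pat_eq.refl)

lemma fin_mod_subset: "fin_mod S \<Longrightarrow> S' \<subseteq> S \<Longrightarrow> fin_mod S'"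
  unfolding fin_mod_def by blast

lemma fin_mod_Un: "fin_mod S \<Longrightarrow> fin_mod S' \<Longrightarrow> fin_mod (S \<union> S')"
proof -
  assume "fin_mod S" "fin_mod S'"
  then obtain R R' where R: "finite R" "\<forall>P\<in>S. \<exists>Q\<in>R. pat_eq P Q"
    and R': "finite R'" "\<forall>P\<in>S'. \<exists>Q\<in>R'. pat_eq P Q" unfolding fin_mod_def by blast
  then show ?thesis by (intro fin_modI[of "R \<union> R'"]) auto
qed

lemma comb_cong: "pat_eq P P' \<Longrightarrow> pat_eq Q Q' \<Longrightarrow> pat_eq (comb q P Q) (comb q P' Q')"
  by (cases q) (auto intro: pat_eq.conj pat_eq.disj)

lemma comb_assoc: "pat_eq (comb q (comb q P Q) R) (comb q P (comb q Q R))"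
  by (cases q) (auto intro: pat_eq.and_assoc pat_eq.or_assoc)

lemma comb_comm: "pat_eq (comb q P Q) (comb q Q P)"
  by (cases q) (auto intro: pat_eq.and_comm pat_eq.or_comm)

lemma comb_idem: "pat_eq (comb q P P) P"
  by (cases q) (auto intro: pat_eq.and_idem pat_eq.or_idem)

fun cfold :: "iter_op \<Rightarrow> 'p pat list \<Rightarrow> 'p pat" where
  "cfold q [] = PTop"
| "cfold q [P] = P"
| "cfold q (P # Ps) = comb q P (cfold q Ps)"

lemma cfold_Cons: "Ps \<noteq> [] \<Longrightarrow> cfold q (P # Ps) = comb q P (cfold q Ps)"
  by (cases Ps) auto

lemma cfold_absorb: "P \<in> set Ps \<Longrightarrow> pat_eq (comb q P (cfold q Ps)) (cfold q Ps)"
proof (induction Ps)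
  case (Cons R Ps)
  show ?case
  proof (cases "Ps = []")
    case True
    then show ?thesis using Cons by (auto intro: comb_idem)
  next
    case False
    have e: "cfold q (R # Ps) = comb q R (cfold q Ps)" using cfold_Cons[OF False] .
    show ?thesis
    proof (cases "P = R")
      case True
      have "pat_eq (comb q R (comb q R (cfold q Ps))) (comb q (comb q R R) (cfold q Ps))"
        by (rule pat_eq.sym[OF comb_assoc])
      moreover have "pat_eq (comb q (comb q R R) (cfold q Ps)) (comb q R (cfold q Ps))"
        by (rule comb_cong[OF comb_idem pat_eq.refl])
      ultimately show ?thesis unfolding e True by (rule pat_eq.trans)
    next
      case F: False
      then have IH: "pat_eq (comb q P (cfold q Ps)) (cfold q Ps)" using Cons by simp
      have 1: "pat_eq (comb q P (comb q R (cfold q Ps))) (comb q (comb q P R) (cfold q Ps))"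
        by (rule pat_eq.sym[OF comb_assoc])
      have 2: "pat_eq (comb q (comb q P R) (cfold q Ps)) (comb q (comb q R P) (cfold q Ps))"
        by (rule comb_cong[OF comb_comm pat_eq.refl])
      have 3: "pat_eq (comb q (comb q R P) (cfold q Ps)) (comb q R (comb q P (cfold q Ps)))"
        by (rule comb_assoc)
      have 4: "pat_eq (comb q R (comb q P (cfold q Ps))) (comb q R (cfold q Ps))"
        by (rule comb_cong[OF pat_eq.refl IH])
      show ?thesis unfolding e by (rule pat_eq.trans[OF 1 pat_eq.trans[OF 2 pat_eq.trans[OF 3 4]]])
    qed
  qed
qed simp

lemma cfold_append: "Ps \<noteq> [] \<Longrightarrow> Qs \<noteq> [] \<Longrightarrow> pat_eq (comb q (cfold q Ps) (cfold q Qs)) (cfold q (Ps @ Qs))"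
proof (induction Ps)
  case (Cons R Ps)
  show ?case
  proof (cases "Ps = []")
    case True
    then show ?thesis using cfold_Cons[OF Cons.prems(2)] by (simp add: pat_eq.refl)
  next
    case False
    have 1: "pat_eq (comb q (comb q R (cfold q Ps)) (cfold q Qs)) (comb q R (comb q (cfold q Ps) (cfold q Qs)))"
      by (rule comb_assoc)
    have 2: "pat_eq (comb q R (comb q (cfold q Ps) (cfold q Qs))) (comb q R (cfold q (Ps @ Qs)))"
      by (rule comb_cong[OF pat_eq.refl Cons.IH[OF False Cons.prems(2)]])
    from pat_eq.trans[OF 1 2] show ?thesis using False by (simp add: cfold_Cons)
  qed
qed simp

lemma cfold_subset: "Ps \<noteq> [] \<Longrightarrow> set Ps \<subseteq> set Qs \<Longrightarrow> pat_eq (comb q (cfold q Ps) (cfold q Qs)) (cfold q Qs)"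
proof (induction Ps)
  case (Cons R Ps)
  show ?case
  proof (cases "Ps = []")
    case True
    then show ?thesis using cfold_absorb Cons.prems by auto
  next
    case False
    have 1: "pat_eq (comb q (comb q R (cfold q Ps)) (cfold q Qs)) (comb q R (comb q (cfold q Ps) (cfold q Qs)))"
      by (rule comb_assoc)
    have 2: "pat_eq (comb q R (comb q (cfold q Ps) (cfold q Qs))) (comb q R (cfold q Qs))"
      using Cons False by (intro comb_cong[OF pat_eq.refl]) auto
    have 3: "pat_eq (comb q R (cfold q Qs)) (cfold q Qs)" using Cons.prems by (intro cfold_absorb) auto
    show ?thesis unfolding cfold_Cons[OF False] by (rule pat_eq.trans[OF 1 pat_eq.trans[OF 2 3]])
  qed
qed simp

text \<open>Each side absorbs the other, and commutativity joins the two absorptions. A combination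
  is thus determined by the set of its members, and finitely many possible members leave finitely
  many combinations.\<close>

lemma cfold_set_eq:
  assumes "Ps \<noteq> []" "set Ps = set Qs"
  shows "pat_eq (cfold q Ps) (cfold q Qs)"
proof -
  have "Qs \<noteq> []" using assms by auto
  then have "pat_eq (comb q (cfold q Qs) (cfold q Ps)) (cfold q Ps)" using assms by (intro cfold_subset) auto
  moreover have "pat_eq (comb q (cfold q Ps) (cfold q Qs)) (cfold q Qs)" using assms by (intro cfold_subset) auto
  ultimately show ?thesis by (meson pat_eq.sym pat_eq.trans comb_comm)
qed

inductive_set cl :: "iter_op \<Rightarrow> 'p pat set \<Rightarrow> 'p pat set" for q S where
  base: "P \<in> S \<Longrightarrow> P \<in> cl q S"
| step: "P \<in> cl q S \<Longrightarrow> Q \<in> cl q S \<Longrightarrow> comb q P Q \<in> cl q S"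

lemma fin_mod_cl:
  assumes "fin_mod S"
  shows "fin_mod (cl q S)"
proof -
  obtain R where R: "finite R" "\<And>P. P \<in> S \<Longrightarrow> \<exists>Q\<in>R. pat_eq P Q" using assms unfolding fin_mod_def by blast
  define pick where "pick = (\<lambda>A :: 'a pat set. SOME xs. set xs = A)"
  have pick: "set (pick A) = A" if "A \<subseteq> R" for A
  proof -
    have "finite A" using that R(1) by (rule finite_subset)
    then show ?thesis unfolding pick_def using finite_list by (metis (mono_tags, lifting) someI_ex)
  qed
  have ex: "\<exists>xs. xs \<noteq> [] \<and> set xs \<subseteq> R \<and> pat_eq P (cfold q xs)" if "P \<in> cl q S" for P
    using that
  proof induction
    case (base P)
    then obtain Q where "Q \<in> R" "pat_eq P Q" using R(2) by blast
    then show ?case by (intro exI[of _ "[Q]"]) auto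
  next
    case (step P Q)
    then obtain xs ys where xs: "xs \<noteq> []" "set xs \<subseteq> R" "pat_eq P (cfold q xs)"
      and ys: "ys \<noteq> []" "set ys \<subseteq> R" "pat_eq Q (cfold q ys)" by blast
    have "pat_eq (comb q P Q) (cfold q (xs @ ys))"
      using pat_eq.trans[OF comb_cong[OF xs(3) ys(3)] cfold_append[OF xs(1) ys(1)]] .
    then show ?case using xs ys by (intro exI[of _ "xs @ ys"]) auto
  qed
  have "\<exists>Q\<in>(\<lambda>A. cfold q (pick A)) ` Pow R. pat_eq P Q" if m: "P \<in> cl q S" for P
  proof -
    obtain xs where xs: "xs \<noteq> []" "set xs \<subseteq> R" "pat_eq P (cfold q xs)"
      using ex[OF m] by blast
    have "pat_eq (cfold q xs) (cfold q (pick (set xs)))"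
      by (rule cfold_set_eq[OF xs(1)]) (simp add: pick[OF xs(2)])
    then have "pat_eq P (cfold q (pick (set xs)))" by (rule pat_eq.trans[OF xs(3)])
    then show ?thesis using xs(2) by blast
  qed
  then show ?thesis using R(1) by (intro fin_modI[of "(\<lambda>A. cfold q (pick A)) ` Pow R"]) auto
qed

text \<open>\<open>pat_eq\<close> identifies equivalent domains, so one representative domain per
  \<open>a\<close> suffices.\<close>

lemma fin_mod_Iter:
  assumes "fin_mod S" "finite A" "\<And>a \<psi> \<psi>'. a \<in> A \<Longrightarrow> D a \<psi> \<Longrightarrow> D a \<psi>' \<Longrightarrow> equivalent \<psi> \<psi>'"
  shows "fin_mod {Iter q \<psi> P |q \<psi> P. P \<in> S \<and> (\<exists>a\<in>A. D a \<psi>)}"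
proof -
  obtain R where R: "finite R" "\<And>P. P \<in> S \<Longrightarrow> \<exists>Q\<in>R. pat_eq P Q" using assms(1) unfolding fin_mod_def by blast
  define pick where "pick = (\<lambda>a. SOME \<psi>. D a \<psi>)"
  let ?R = "(\<lambda>(q, a, Q). Iter q (pick a) Q) ` ({BigAnd, BigOr} \<times> A \<times> R)"
  show ?thesis
  proof (rule fin_modI[of ?R])
    show "finite ?R" using R(1) assms(2) by simp
    fix P assume "P \<in> {Iter q \<psi> P |q \<psi> P. P \<in> S \<and> (\<exists>a\<in>A. D a \<psi>)}"
    then obtain q \<psi> P' a where P: "P = Iter q \<psi> P'" "P' \<in> S" "a \<in> A" "D a \<psi>" by blast
    obtain Q where Q: "Q \<in> R" "pat_eq P' Q" using R(2) P(2) by blast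
    have "D a (pick a)" unfolding pick_def using P(4) by (rule someI)
    then have "pat_eq P (Iter q (pick a) Q)"
      unfolding P(1) using assms(3)[OF P(3,4)] Q(2) by (intro pat_eq.iter)
    moreover have "Iter q (pick a) Q \<in> ?R" using P(3) Q(1) by (cases q) force+
    ultimately show "\<exists>Q\<in>?R. pat_eq P Q" by blast
  qed
qed

section \<open>Substitution, syntactic identity and irredundant normal forms\<close>

lemma lsubst_lsubst: "lsubst \<tau> (lsubst \<sigma> e) = lsubst (\<lambda>x. lsubst \<tau> (\<sigma> x)) e"
  by (rule lexp_eqI) simp

lemma lift_sub_comp: "lift_sub (\<lambda>x. lsubst \<tau> (\<sigma> x)) = (\<lambda>x. lsubst (lift_sub \<tau>) (lift_sub \<sigma> x))"
proof
  fix x show "lift_sub (\<lambda>x. lsubst \<tau> (\<sigma> x)) x = lsubst (lift_sub \<tau>) (lift_sub \<sigma> x)"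
    by (rule lexp_eqI, cases x) (auto simp: lift_sub_def)
qed

lemma fsubst_fsubst: "fsubst \<tau> (fsubst \<sigma> \<phi>) = fsubst (\<lambda>x. lsubst \<tau> (\<sigma> x)) \<phi>"
  by (induction \<phi> arbitrary: \<sigma> \<tau>) (simp_all add: lsubst_lsubst lift_sub_comp)

lemma psubst_psubst: "psubst (psubst P \<sigma>) \<tau> = psubst P (\<lambda>x. lsubst \<tau> (\<sigma> x))"
  by (induction P arbitrary: \<sigma> \<tau>) (simp_all add: lsubst_lsubst fsubst_fsubst lift_sub_comp)

lemma lsubst_lvar: "lsubst lvar e = e"
  by (rule lexp_eqI) simp

lemma lift_sub_lvar: "lift_sub lvar = lvar"
proof
  fix x show "lift_sub lvar x = lvar x"
    by (rule lexp_eqI, cases x) (auto simp: lift_sub_def)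
qed

lemma fsubst_lvar: "fsubst lvar \<phi> = \<phi>"
  by (induction \<phi>) (simp_all add: lsubst_lvar lift_sub_lvar)

lemma psubst_lvar: "psubst P lvar = P"
  by (induction P) (simp_all add: lsubst_lvar lift_sub_lvar fsubst_lvar map_idI)

lemma pat_eq_psubst: "pat_eq P Q \<Longrightarrow> pat_eq (psubst P \<sigma>) (psubst Q \<sigma>)"
proof (induction arbitrary: \<sigma> rule: pat_eq.induct)
  case (trans P Q R)
  then show ?case by (meson pat_eq.trans)
next
  case (iter \<phi> \<phi>' P P' q)
  then show ?case by (auto simp: equivalent_def intro!: pat_eq.iter)
qed (auto intro: pat_eq.intros)

lemma pat_eq_plug: "pat_eq P Q \<Longrightarrow> pat_eq (plug C P) (plug C Q)"
  by (induction C) (auto intro: pat_eq.intros simp: equivalent_def)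

lemma cons_red_equivalent: "cons_red \<phi> \<phi>' \<Longrightarrow> equivalent \<phi> \<phi>'"
proof (induction rule: cons_red.induct)
  case (1 \<phi> \<chi> \<phi>')
  then have "sat \<phi> \<rho> = sat \<phi>' \<rho>" for \<rho>
    using sat_conjuncts[of \<phi> \<rho>] sat_conjuncts[of \<phi>' \<rho>] by (auto simp: entails_def)
  then show ?case by (simp add: equivalent_def)
qed (auto simp: equivalent_def satisfiable_def)

lemma schema_eq_refl: "schema_eq S S"
  by (simp add: schema_eq_def pat_eq.refl equivalent_def)

lemma schema_eq_sym: "schema_eq S T \<Longrightarrow> schema_eq T S"
  by (auto simp: schema_eq_def equivalent_def intro: pat_eq.sym)

lemma schema_eq_trans: "schema_eq S T \<Longrightarrow> schema_eq T U \<Longrightarrow> schema_eq S U"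
  unfolding schema_eq_def equivalent_def by (meson pat_eq.trans)

lemma schema_red_eq: "schema_red S S' \<Longrightarrow> schema_eq S S'"
proof (induction rule: schema_red.induct)
  case (1 \<phi> \<phi>' P)
  then show ?case using cons_red_equivalent by (simp add: schema_eq_def pat_eq.refl)
next
  case (2 \<psi> \<psi>' C q Q \<phi>)
  have "pat_eq (Iter q \<psi> Q) (Iter q \<psi>' Q)"
    using cons_red_equivalent[OF 2] pat_eq.refl by (rule pat_eq.iter)
  then show ?case by (simp add: schema_eq_def pat_eq_plug equivalent_def)
qed

text \<open>Removing a conjunct saves two units. The extra unit makes the replacement of a single
  unsatisfiable conjunct by \<open>FFalse\<close> a strict decrease too.\<close>

definition csize :: "fml \<Rightarrow> nat" where
  "csize \<phi> = 2 * size (conjuncts \<phi>) + (if \<phi> = FFalse then 0 else 1)"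

primrec psize :: "'p pat \<Rightarrow> nat" where
  "psize PTop = 0"
| "psize PBot = 0"
| "psize (Atom p es) = 0"
| "psize (PNeg P) = psize P"
| "psize (PAnd P Q) = psize P + psize Q"
| "psize (POr P Q) = psize P + psize Q"
| "psize (Iter q \<phi> P) = csize \<phi> + psize P"

lemma cons_red_csize: "cons_red \<phi> \<phi>' \<Longrightarrow> csize \<phi>' < csize \<phi>"
proof (induction rule: cons_red.induct)
  case (1 \<phi> \<chi> \<phi>')
  then show ?case by (simp add: csize_def)
next
  case (2 \<phi>)
  have "size (conjuncts \<phi>) \<noteq> 0" by simp
  then have "1 \<le> size (conjuncts \<phi>)" by linarith
  then show ?case using 2 by (simp add: csize_def)
qed

lemma psize_plug: "psize P < psize Q \<Longrightarrow> psize (plug C P) < psize (plug C Q)"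
  by (induction C) auto

lemma schema_red_size: "schema_red S S' \<Longrightarrow> psize (fst S') + csize (snd S') < psize (fst S) + csize (snd S)"
proof (induction rule: schema_red.induct)
  case (1 \<phi> \<phi>' P)
  then show ?case by (simp add: cons_red_csize)
next
  case (2 \<psi> \<psi>' C q Q \<phi>)
  then show ?case using psize_plug[of "Iter q \<psi>' Q" "Iter q \<psi> Q" C] cons_red_csize[OF 2] by simp
qed

lemma irredundant_exists: "\<exists>S'. irredundant_of S S' \<and> schema_eq S S'"
proof (induction "psize (fst S) + csize (snd S)" arbitrary: S rule: less_induct)
  case less
  show ?case
  proof (cases "\<exists>S1. schema_red S S1")
    case True
    then obtain S1 where S1: "schema_red S S1" by blast
    from less[OF schema_red_size[OF S1]] obtain S' where S': "irredundant_of S1 S'" "schema_eq S1 S'" by blast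
    then have "irredundant_of S S'"
      using S1 unfolding irredundant_of_def by (meson converse_rtranclp_into_rtranclp)
    then show ?thesis using schema_eq_trans[OF schema_red_eq[OF S1] S'(2)] by blast
  next
    case False
    then have "irredundant_of S S" unfolding irredundant_of_def by simp
    then show ?thesis using schema_eq_refl by blast
  qed
qed

lemma schema_eq_shift: "schema_eq S T \<Longrightarrow> schema_eq (shift_param n k S) (shift_param n k T)"
  by (simp add: schema_eq_def shift_param_def Let_def pat_eq_psubst equivalent_def)

text \<open>Looping asks for some normal forms of the two schemata, and every schema is
  \<open>schema_eq\<close> to one of its normal forms; so the choice of normal forms drops
  out.\<close>

lemma loops_onI:
  assumes "params S1 = {n}" "params S2 = {n}" "k > 0" "schema_eq (pur S1) (shift_param n k (pur S2))"
  shows "S1 \<sqsubset>\<^sub>l S2"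
proof -
  obtain S1' where 1: "irredundant_of (pur S1) S1'" "schema_eq (pur S1) S1'" using irredundant_exists by blast
  obtain S2' where 2: "irredundant_of (pur S2) S2'" "schema_eq (pur S2) S2'" using irredundant_exists by blast
  have "schema_eq S1' (shift_param n k S2')"
    by (rule schema_eq_trans[OF schema_eq_sym[OF 1(2)] schema_eq_trans[OF assms(4) schema_eq_shift[OF 2(2)]]])
  then show ?thesis unfolding loops_on_def using assms 1 2 by blast
qed

section \<open>Shifting the parameter, and the finite classes of shifted patterns\<close>

primrec ishift :: "int \<Rightarrow> idx \<Rightarrow> idx" where
  "ishift \<beta> (IV x c) = IV x c"
| "ishift \<beta> (IP c) = IP (c + \<beta>)"
| "ishift \<beta> (IC c) = IC c"

primrec tshift :: "int \<Rightarrow> 'p tree \<Rightarrow> 'p tree" where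
  "tshift \<beta> (XL b) = XL b"
| "tshift \<beta> (XA p i) = XA p (ishift \<beta> i)"
| "tshift \<beta> (XN T) = XN (tshift \<beta> T)"
| "tshift \<beta> (XB q T U) = XB q (tshift \<beta> T) (tshift \<beta> U)"
| "tshift \<beta> (XI q a s T) = XI q (a - \<beta>) s (tshift \<beta> T)"
| "tshift \<beta> (XG q Z T) = XG q Z (tshift \<beta> T)"

lemma isparam_ishift [simp]: "isparam (ishift \<beta> i) = isparam i"
  by (cases i) auto

lemma guard_chain_tshift [simp]: "guard_chain (tshift \<beta> T) = guard_chain T"
  by (induction T) auto

lemma wf_tree_tshift: "wf_tree T \<Longrightarrow> wf_tree (tshift \<beta> T)"
  by (induction T) auto

lemma tshift_content:
  "var_atoms (tshift \<beta> T) = var_atoms T" "guard_free (tshift \<beta> T) = guard_free T" "nesting (tshift \<beta> T) = nesting T"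
  "offsets (tshift \<beta> T) = (\<lambda>a. a - \<beta>) ` offsets T" "param_atoms (tshift \<beta> T) = (\<lambda>(p, i). (p, ishift \<beta> i)) ` param_atoms T"
proof (induction T)
  case (XA p i)
  { case 1 show ?case by (cases i) auto }
qed auto

lemma alternation_tshift: "alternation q (tshift \<beta> T) = alternation q T"
  by (induction T arbitrary: q) auto

context frame
begin

definition ssub :: "nat \<Rightarrow> int \<Rightarrow> nat \<Rightarrow> lexp" where
  "ssub d \<beta> x = (if x = d + n then lvar x + lconst \<beta> else lvar x)"

lemma lift_ssub: "lift_sub (ssub d \<beta>) = ssub (Suc d) \<beta>"
proof
  fix x show "lift_sub (ssub d \<beta>) x = ssub (Suc d) \<beta> x"
    by (rule lexp_eqI, cases x) (auto simp: lift_sub_def ssub_def)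
qed

lemma rep_tshift: "rep d P T \<Longrightarrow> guard_free T \<Longrightarrow> rep d (psubst P (ssub d \<beta>)) (tshift \<beta> T)"
proof (induction rule: rep.induct)
  case (atom i d es p)
  have "lsubst (ssub d \<beta>) (idx_exp d i) = idx_exp d (ishift \<beta> i)"
    by (rule lexp_eqI, cases i) (use atom(1) in \<open>auto simp: ssub_def\<close>)
  then show ?case using atom by (cases i) (auto intro!: rep.atom)
next
  case (iterF d a \<psi> s P T q)
  have "framed_by d (a - \<beta>) (fsubst (ssub (Suc d) \<beta>) \<psi>)"
    using iterF.hyps(1) by (simp add: framed_by_def ssub_def algebra_simps)
  moreover have "simple_fml (fsubst (ssub (Suc d) \<beta>) \<psi>)"
    using iterF.hyps(2) by (rule simple_fml_fsubst) (auto simp: ssub_def simple_exp_add)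
  ultimately show ?case using iterF by (simp add: lift_ssub rep.iterF conjuncts_fsubst)
qed (auto intro: rep.intros)

definition pclass :: "('p \<times> int) set \<Rightarrow> ('p \<times> idx) set \<Rightarrow> int set \<Rightarrow> nat \<Rightarrow> nat \<Rightarrow> nat \<Rightarrow> iter_op \<Rightarrow> 'p pat set" where
  "pclass Vs Ls A d D h q = {P. \<exists>T. rep d P T \<and> guard_free T \<and> wf_tree T \<and> var_atoms T \<subseteq> Vs \<and> param_atoms T \<subseteq> Ls \<and> offsets T \<subseteq> A \<and>
     nesting T \<le> D \<and> alternation q T \<le> h}"

definition leaves :: "('p \<times> int) set \<Rightarrow> ('p \<times> idx) set \<Rightarrow> nat \<Rightarrow> 'p pat set" where
  "leaves Vs Ls d = {PTop, PBot} \<union> (\<lambda>((p, c), x). Atom p [idx_exp d (IV x c)]) ` (Vs \<times> {..<d}) \<union>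
     (\<lambda>(p, i). Atom p [idx_exp d i]) ` Ls"

lemma leaf_in_leaves:
  assumes "rep d P T" "isleaf T" "var_atoms T \<subseteq> Vs" "param_atoms T \<subseteq> Ls"
  shows "P \<in> leaves Vs Ls d"
  using assms
proof (cases rule: rep.cases)
  case (atom i es p)
  show ?thesis
  proof (cases i)
    case (IV x c)
    then have "(p, c) \<in> Vs" "x < d" using atom assms(3) by auto
    then show ?thesis using atom IV unfolding leaves_def by force
  qed (use atom assms(4) in \<open>force simp: leaves_def\<close>)+
qed (auto simp: leaves_def)

lemma framed_by_equivalent: "framed_by d a \<psi> \<Longrightarrow> framed_by d a \<psi>' \<Longrightarrow> equivalent \<psi> \<psi>'"
  by (simp add: framed_by_def equivalent_def)

text \<open>Peels off the connectives \<open>q\<close> at the root. Below them remain literals and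
  constants, combinations by the other connective with smaller \<open>alternation\<close>, and
  iterations over bodies with smaller \<open>nesting\<close>; \<open>B\<close> has to contain
  these.\<close>

lemma pclass_sub_cl:
  assumes "rep d P T" "guard_free T" "wf_tree T" "var_atoms T \<subseteq> Vs" "param_atoms T \<subseteq> Ls" "offsets T \<subseteq> A" "nesting T \<le> D" "alternation q T \<le> h"
    and B1: "leaves Vs Ls d \<union> PNeg ` leaves Vs Ls d \<subseteq> B"
    and B2: "\<And>h' q'. h = Suc h' \<Longrightarrow> pclass Vs Ls A d D h' q' \<subseteq> B"
    and B3: "\<And>D' q'. D = Suc D' \<Longrightarrow>
      {Iter q \<psi> P |q \<psi> P. P \<in> pclass Vs Ls A (Suc d) D' h q' \<and> (\<exists>a\<in>A. framed_by d a \<psi>)} \<subseteq> B"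
  shows "P \<in> cl q B"
  using assms(1-8)
proof (induction T arbitrary: P rule: tree.induct)
  case (XL b)
  then show ?case using leaf_in_leaves[OF XL.prems(1)] B1 by (auto intro: cl.base)
next
  case (XA p i)
  then show ?case using leaf_in_leaves[OF XA.prems(1)] B1 by (auto intro!: cl.base)
next
  case (XN T)
  then obtain P' where P': "P = PNeg P'" "rep d P' T" by (auto elim: rep_XNE)
  have "isleaf T" using XN.prems(2,3) by (cases T) auto
  then have "P' \<in> leaves Vs Ls d" using leaf_in_leaves[OF P'(2)] XN.prems by auto
  then show ?case using P' B1 by (auto intro: cl.base)
next
  case (XB q' T U)
  show ?case
  proof (cases "q' = q")
    case True
    from XB.prems(1) obtain P1 P2 where P: "P = comb q P1 P2" "rep d P1 T" "rep d P2 U"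
      using True by (cases q) (auto elim: rep_XBE)
    have "P1 \<in> cl q B" using XB.prems True by (intro XB.IH(1)[OF P(2)]) auto
    moreover have "P2 \<in> cl q B" using XB.prems True by (intro XB.IH(2)[OF P(3)]) auto
    ultimately show ?thesis unfolding P(1) by (rule cl.step)
  next
    case False
    then obtain h' where h': "h = Suc h'" "max (alternation q' T) (alternation q' U) \<le> h'"
      using XB.prems(8) by (cases h) auto
    then have "P \<in> pclass Vs Ls A d D h' q'"
      unfolding pclass_def using XB.prems by (intro CollectI exI[of _ "XB q' T U"]) simp
    then show ?thesis using B2[OF h'(1)] by (blast intro: cl.base)
  qed
next
  case (XI q' a s T)
  then obtain \<psi> P' where P: "P = Iter q' \<psi> P'" "framed_by d a \<psi>" "rep (Suc d) P' T" by (auto elim: rep_XIE)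
  obtain D' where D': "D = Suc D'" "nesting T \<le> D'" using XI.prems(7) by (cases D) auto
  have "alternation q' T \<le> h" using XI.prems(8) by (auto split: if_splits)
  then have "P' \<in> pclass Vs Ls A (Suc d) D' h q'"
    unfolding pclass_def using XI.prems P D' by (intro CollectI exI[of _ T]) simp
  moreover have "a \<in> A" using XI.prems by simp
  ultimately have "P \<in> B" using B3[OF D'(1), of q'] P by blast
  then show ?case by (rule cl.base)
next
  case (XG q' Z T)
  then show ?case by simp
qed

text \<open>Induction on the nesting, and inside it on the alternation: entering an iteration may
  keep the alternation but lowers the nesting, while changing the connective may keep the nesting
  but lowers the alternation.\<close>

lemma fin_mod_pclass:
  assumes fin: "finite Vs" "finite Ls" "finite A"
  shows "fin_mod (pclass Vs Ls A d D h q)"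
proof (induction D arbitrary: h q d)
  case (0 h q d)
  show ?case
  proof (induction h arbitrary: q d)
    case (0 q d)
    have "finite (leaves Vs Ls d \<union> PNeg ` leaves Vs Ls d)" using fin by (simp add: leaves_def)
    then have "fin_mod (cl q (leaves Vs Ls d \<union> PNeg ` leaves Vs Ls d))" by (intro fin_mod_cl fin_mod_finite)
    then show ?case by (rule fin_mod_subset) (auto simp: pclass_def[of _ _ _ _ 0 0 q] intro: pclass_sub_cl)
  next
    case (Suc h q d)
    let ?B = "leaves Vs Ls d \<union> PNeg ` leaves Vs Ls d \<union> pclass Vs Ls A d 0 h BigAnd \<union> pclass Vs Ls A d 0 h BigOr"
    have "finite (leaves Vs Ls d \<union> PNeg ` leaves Vs Ls d)" using fin by (simp add: leaves_def)
    then have "fin_mod ?B" using Suc by (intro fin_mod_Un) (auto intro: fin_mod_finite)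
    then have f: "fin_mod (cl q ?B)" by (rule fin_mod_cl)
    have b: "pclass Vs Ls A d 0 h q' \<subseteq> ?B" for q' by (cases q') auto
    show ?case
    proof (rule fin_mod_subset[OF f], rule subsetI)
      fix P assume "P \<in> pclass Vs Ls A d 0 (Suc h) q"
      then obtain T where T: "rep d P T" "guard_free T" "wf_tree T" "var_atoms T \<subseteq> Vs" "param_atoms T \<subseteq> Ls" "offsets T \<subseteq> A" "nesting T \<le> 0" "alternation q T \<le> Suc h"
        unfolding pclass_def by blast
      show "P \<in> cl q ?B" by (rule pclass_sub_cl[OF T]) (use b in auto)
    qed
  qed
next
  case (Suc D h q d)
  note outer = Suc
  have it: "fin_mod {Iter q \<psi> P |q \<psi> P. P \<in> pclass Vs Ls A (Suc d) D h q' \<and> (\<exists>a\<in>A. framed_by d a \<psi>)}" for d h q'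
    by (rule fin_mod_Iter[OF outer fin(3)]) (rule framed_by_equivalent)
  show ?case
  proof (induction h arbitrary: q d)
    case (0 q d)
    let ?I = "\<lambda>q'. {Iter q \<psi> P |q \<psi> P. P \<in> pclass Vs Ls A (Suc d) D 0 q' \<and> (\<exists>a\<in>A. framed_by d a \<psi>)}"
    let ?B = "leaves Vs Ls d \<union> PNeg ` leaves Vs Ls d \<union> ?I BigAnd \<union> ?I BigOr"
    have "finite (leaves Vs Ls d \<union> PNeg ` leaves Vs Ls d)" using fin by (simp add: leaves_def)
    then have "fin_mod ?B" by (intro fin_mod_Un it) (auto intro: fin_mod_finite)
    then have f: "fin_mod (cl q ?B)" by (rule fin_mod_cl)
    have b: "?I q' \<subseteq> ?B" for q' by (cases q') auto
    show ?case
    proof (rule fin_mod_subset[OF f], rule subsetI)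
      fix P assume "P \<in> pclass Vs Ls A d (Suc D) 0 q"
      then obtain T where T: "rep d P T" "guard_free T" "wf_tree T" "var_atoms T \<subseteq> Vs" "param_atoms T \<subseteq> Ls" "offsets T \<subseteq> A" "nesting T \<le> Suc D" "alternation q T \<le> 0"
        unfolding pclass_def by blast
      show "P \<in> cl q ?B"
      proof (rule pclass_sub_cl[OF T])
        fix D' q' assume "Suc D = Suc D'"
        then show "{Iter q \<psi> P |q \<psi> P. P \<in> pclass Vs Ls A (Suc d) D' 0 q' \<and> (\<exists>a\<in>A. framed_by d a \<psi>)} \<subseteq> ?B"
          using b[of q'] by simp
      qed auto
    qed
  next
    case (Suc h q d)
    let ?I = "\<lambda>q'. {Iter q \<psi> P |q \<psi> P. P \<in> pclass Vs Ls A (Suc d) D (Suc h) q' \<and> (\<exists>a\<in>A. framed_by d a \<psi>)}"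
    let ?C = "\<lambda>q'. pclass Vs Ls A d (Suc D) h q'"
    let ?B = "leaves Vs Ls d \<union> PNeg ` leaves Vs Ls d \<union> ?I BigAnd \<union> ?I BigOr \<union> ?C BigAnd \<union> ?C BigOr"
    have "finite (leaves Vs Ls d \<union> PNeg ` leaves Vs Ls d)" using fin by (simp add: leaves_def)
    then have "fin_mod ?B" by (intro fin_mod_Un it Suc) (auto intro: fin_mod_finite)
    then have f: "fin_mod (cl q ?B)" by (rule fin_mod_cl)
    have b: "?I q' \<subseteq> ?B" "?C q' \<subseteq> ?B" for q' by (cases q'; auto)+
    show ?case
    proof (rule fin_mod_subset[OF f], rule subsetI)
      fix P assume "P \<in> pclass Vs Ls A d (Suc D) (Suc h) q"
      then obtain T where T: "rep d P T" "guard_free T" "wf_tree T" "var_atoms T \<subseteq> Vs" "param_atoms T \<subseteq> Ls" "offsets T \<subseteq> A" "nesting T \<le> Suc D" "alternation q T \<le> Suc h"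
        unfolding pclass_def by blast
      show "P \<in> cl q ?B"
      proof (rule pclass_sub_cl[OF T])
        fix D' q' assume "Suc D = Suc D'"
        then show "{Iter q \<psi> P |q \<psi> P. P \<in> pclass Vs Ls A (Suc d) D' (Suc h) q' \<and> (\<exists>a\<in>A. framed_by d a \<psi>)} \<subseteq> ?B"
          using b(1)[of q'] by simp
      next
        fix h' q' assume "Suc h = Suc h'"
        then show "pclass Vs Ls A d (Suc D) h' q' \<subseteq> ?B" using b(2)[of q'] by simp
      qed auto
    qed
  qed
qed

end

context frame
begin

section \<open>Looping\<close>

lemma pur_rep:
  "rep d P T \<Longrightarrow> guard_free T \<Longrightarrow> wf_tree T \<Longrightarrow> \<exists>T'. rep d (pur_pat S d P) T' \<and> guard_free T' \<and> wf_tree T' \<and> var_atoms T' \<subseteq> var_atoms T \<and>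
    param_atoms T' \<subseteq> param_atoms T \<and> offsets T' \<subseteq> offsets T \<and> nesting T' \<le> nesting T \<and> (\<forall>q. alternation q T' \<le> alternation q T)"
proof (induction rule: rep.induct)
  case (top d)
  show ?case by (rule exI[of _ "XL True"]) (auto intro: rep.top)
next
  case (bot d)
  show ?case by (rule exI[of _ "XL False"]) (auto intro: rep.bot)
next
  case (atom i d es p)
  show ?case
  proof (cases "pure_lit S d (LPos p es)")
    case True
    then show ?thesis by (intro exI[of _ "XL True"]) (auto intro: rep.top)
  next
    case False
    have "rep d (Atom p es) (XA p i)" using atom by (intro rep.atom)
    then show ?thesis using False by (intro exI[of _ "XA p i"]) auto
  qed
next
  case (neg d P T)
  have r: "rep d (PNeg P) (XN T)" using neg.hyps by (rule rep.neg)
  have "isleaf T" using neg.prems by (cases T) auto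
  then consider p i where "T = XA p i" | b where "T = XL b" by (cases T) auto
  then have "pur_pat S d (PNeg P) = PNeg P \<or> pur_pat S d (PNeg P) = PTop"
    by cases (use neg.hyps in \<open>auto elim!: rep_XAE rep_XLE\<close>)
  then show ?case
  proof
    assume "pur_pat S d (PNeg P) = PNeg P"
    then show ?thesis using r neg.prems by (intro exI[of _ "XN T"]) auto
  next
    assume "pur_pat S d (PNeg P) = PTop"
    then show ?thesis by (intro exI[of _ "XL True"]) (auto intro: rep.top)
  qed
next
  case (conj d P T Q U)
  from conj obtain T' U' where T': "rep d (pur_pat S d P) T'" "guard_free T'" "wf_tree T'" "var_atoms T' \<subseteq> var_atoms T"
    "param_atoms T' \<subseteq> param_atoms T" "offsets T' \<subseteq> offsets T" "nesting T' \<le> nesting T" "\<And>q. alternation q T' \<le> alternation q T"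
    and U': "rep d (pur_pat S d Q) U'" "guard_free U'" "wf_tree U'" "var_atoms U' \<subseteq> var_atoms U"
    "param_atoms U' \<subseteq> param_atoms U" "offsets U' \<subseteq> offsets U" "nesting U' \<le> nesting U" "\<And>q. alternation q U' \<le> alternation q U"
    by auto
  have "alternation q (XB BigAnd T' U') \<le> alternation q (XB BigAnd T U)" for q
    using T'(8)[of q] U'(8)[of q] T'(8)[of BigAnd] U'(8)[of BigAnd] by (auto simp: le_max_iff_disj)
  then show ?case using T' U' by (intro exI[of _ "XB BigAnd T' U'"]) (auto intro: rep.conj)
next
  case (disj d P T Q U)
  from disj obtain T' U' where T': "rep d (pur_pat S d P) T'" "guard_free T'" "wf_tree T'" "var_atoms T' \<subseteq> var_atoms T"
    "param_atoms T' \<subseteq> param_atoms T" "offsets T' \<subseteq> offsets T" "nesting T' \<le> nesting T" "\<And>q. alternation q T' \<le> alternation q T"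
    and U': "rep d (pur_pat S d Q) U'" "guard_free U'" "wf_tree U'" "var_atoms U' \<subseteq> var_atoms U"
    "param_atoms U' \<subseteq> param_atoms U" "offsets U' \<subseteq> offsets U" "nesting U' \<le> nesting U" "\<And>q. alternation q U' \<le> alternation q U"
    by auto
  have "alternation q (XB BigOr T' U') \<le> alternation q (XB BigOr T U)" for q
    using T'(8)[of q] U'(8)[of q] T'(8)[of BigOr] U'(8)[of BigOr] by (auto simp: le_max_iff_disj)
  then show ?case using T' U' by (intro exI[of _ "XB BigOr T' U'"]) (auto intro: rep.disj)
next
  case (iterF d a \<psi> s P T q)
  from iterF obtain T' where T': "rep (Suc d) (pur_pat S (Suc d) P) T'" "guard_free T'" "wf_tree T'" "var_atoms T' \<subseteq> var_atoms T"
    "param_atoms T' \<subseteq> param_atoms T" "offsets T' \<subseteq> offsets T" "nesting T' \<le> nesting T" "\<And>q. alternation q T' \<le> alternation q T"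
    by auto
  have "rep d (pur_pat S d (Iter q \<psi> P)) (XI q a s T')" using iterF.hyps T'(1) by (auto intro: rep.iterF)
  then show ?case using T' by (intro exI[of _ "XI q a s T'"]) auto
next
  case (iterG d Z \<psi> P T q)
  then show ?case by simp
qed

lemma rep_lit:
  "isparam i \<Longrightarrow> rep 0 (Atom p [idx_exp 0 i]) (XA p i)" "isparam i \<Longrightarrow> rep 0 (PNeg (Atom p [idx_exp 0 i])) (XN (XA p i))"
proof -
  show *: "isparam i \<Longrightarrow> rep 0 (Atom p [idx_exp 0 i]) (XA p i)" by (rule rep.atom) auto
  then show "isparam i \<Longrightarrow> rep 0 (PNeg (Atom p [idx_exp 0 i])) (XN (XA p i))" by (intro rep.neg)
qed

definition unpure :: "'p schema \<Rightarrow> ('p, lexp) lit set \<Rightarrow> ('p \<times> idx) set" where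
  "unpure S \<Lambda> = {(p, i). isparam i \<and> (LPos p [idx_exp 0 i] \<in> \<Lambda> \<and> \<not> pure_lit S 0 (LPos p [idx_exp 0 i]) \<or>
     LNeg p [idx_exp 0 i] \<in> \<Lambda> \<and> \<not> pure_lit S 0 (LNeg p [idx_exp 0 i]))}"

lemma pur_lit:
  assumes "litform {L}"
  shows "\<exists>T'. rep 0 (pur_pat S 0 (lit_pat L)) T' \<and> guard_free T' \<and> wf_tree T' \<and> var_atoms T' = {} \<and> offsets T' = {} \<and> nesting T' = 0 \<and>
    alternation BigAnd T' = 0 \<and> param_atoms T' \<subseteq> unpure S {L}"
proof -
  obtain p i where i: "isparam i" and L: "L = LPos p [idx_exp 0 i] \<or> L = LNeg p [idx_exp 0 i]"
    using assms unfolding litform_def by blast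
  have v: "var_atoms (XA p i) = {}" using i by (cases i) auto
  show ?thesis
  proof (cases "pure_lit S 0 L")
    case True
    then show ?thesis using L by (intro exI[of _ "XL True"]) (auto intro: rep.top)
  next
    case False
    from L show ?thesis
    proof
      assume "L = LPos p [idx_exp 0 i]"
      then show ?thesis using False i v rep_lit(1)[OF i, of p]
        by (intro exI[of _ "XA p i"]) (auto simp: unpure_def)
    next
      assume "L = LNeg p [idx_exp 0 i]"
      then show ?thesis using False i v rep_lit(2)[OF i, of p]
        by (intro exI[of _ "XN (XA p i)"]) (auto simp: unpure_def)
    qed
  qed
qed

text \<open>A long conjunction of literals has alternation \<open>0\<close> only when seen from
  \<open>BigAnd\<close>. Measuring from there makes the bound independent of the number of literals
  in \<open>\<Lambda>\<close>.\<close>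

lemma pur_lits:
  assumes "litform (set Ls)"
  shows "\<exists>T'. rep 0 (pur_pat S 0 (pand (map lit_pat Ls))) T' \<and> guard_free T' \<and> wf_tree T' \<and> var_atoms T' = {} \<and> offsets T' = {} \<and> nesting T' = 0 \<and>
    alternation BigAnd T' = 0 \<and> param_atoms T' \<subseteq> unpure S (set Ls)"
  using assms
proof (induction Ls)
  case Nil
  show ?case by (rule exI[of _ "XL True"]) (auto intro: rep.top)
next
  case (Cons L Ls)
  have leaf_states: "litform {L}" "litform (set Ls)" using Cons.prems by (auto simp: litform_def)
  from pur_lit[OF leaf_states(1)] obtain T1 where T1: "rep 0 (pur_pat S 0 (lit_pat L)) T1" "guard_free T1" "wf_tree T1" "var_atoms T1 = {}"
    "offsets T1 = {}" "nesting T1 = 0" "alternation BigAnd T1 = 0" "param_atoms T1 \<subseteq> unpure S {L}" by blast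
  from Cons.IH[OF leaf_states(2)] obtain T2 where T2: "rep 0 (pur_pat S 0 (pand (map lit_pat Ls))) T2" "guard_free T2" "wf_tree T2" "var_atoms T2 = {}"
    "offsets T2 = {}" "nesting T2 = 0" "alternation BigAnd T2 = 0" "param_atoms T2 \<subseteq> unpure S (set Ls)" by blast
  have u: "unpure S {L} \<subseteq> unpure S (set (L # Ls))" "unpure S (set Ls) \<subseteq> unpure S (set (L # Ls))"
    by (auto simp: unpure_def)
  show ?case
  proof (cases Ls)
    case Nil
    then show ?thesis using T1 u by (intro exI[of _ T1]) auto
  next
    case (Cons L' Ls')
    have "rep 0 (pur_pat S 0 (pand (map lit_pat (L # Ls)))) (XB BigAnd T1 T2)"
      using T1(1) T2(1) Cons by (auto intro: rep.conj)
    then show ?thesis using T1 T2 u by (intro exI[of _ "XB BigAnd T1 T2"]) auto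
  qed
qed

text \<open>Every index in the pattern is \<open>x + c\<close> for an iteration variable
  \<open>x\<close>, and \<open>x\<close> is at most \<open>n - a\<close> for the offset
  \<open>a\<close> of its iteration, hence at most \<open>n - \<alpha>\<close>.\<close>

lemma glits_upper:
  "rep d P T \<Longrightarrow> guard_free T \<Longrightarrow> wf_tree T \<Longrightarrow> param_atoms T = {} \<Longrightarrow> \<forall>a\<in>offsets T. \<alpha> \<le> a \<Longrightarrow> \<forall>(p, c)\<in>var_atoms T. c \<le> cm \<Longrightarrow>
    \<forall>x<d. \<rho> x \<le> \<rho> (d + n) - \<alpha> \<Longrightarrow> L \<in> glits (realize P \<rho>) \<Longrightarrow>
    \<exists>p v. (L = LPos p [v] \<or> L = LNeg p [v]) \<and> v \<le> \<rho> (d + n) - \<alpha> + cm"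
proof (induction arbitrary: \<rho> rule: rep.induct)
  case (atom i d es p)
  then obtain x c where i: "i = IV x c" by (cases i) auto
  then have "x < d" "c \<le> cm" using atom by auto
  then have "\<rho> x + c \<le> \<rho> (d + n) - \<alpha> + cm" using atom.prems(6) by force
  then show ?case using atom i by auto
next
  case (neg d P T)
  have "isleaf T" using neg.prems by (cases T) auto
  then consider (A) p i where "T = XA p i" | (B) b where "T = XL b" by (cases T) auto
  then show ?case
  proof cases
    case A
    then obtain x c where i: "i = IV x c" using neg.prems by (cases i) auto
    then have P: "P = Atom p [lvar x + lconst c]" "x < d" using neg.hyps A by (auto elim!: rep_XAE)
    have "c \<le> cm" using neg.prems A i by auto
    then have "\<rho> x + c \<le> \<rho> (d + n) - \<alpha> + cm" using neg.prems(6) P by force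
    then show ?thesis using neg.prems(7) P by auto
  next
    case B
    then show ?thesis using neg by (auto elim!: rep_XLE)
  qed
next
  case (conj d P T Q U)
  from conj.prems(7) have "L \<in> glits (realize P \<rho>) \<or> L \<in> glits (realize Q \<rho>)" by simp
  then show ?case
  proof
    assume "L \<in> glits (realize P \<rho>)"
    then show ?thesis using conj.prems by (intro conj.IH(1)) auto
  next
    assume "L \<in> glits (realize Q \<rho>)"
    then show ?thesis using conj.prems by (intro conj.IH(2)) auto
  qed
next
  case (disj d P T Q U)
  from disj.prems(7) have "L \<in> glits (realize P \<rho>) \<or> L \<in> glits (realize Q \<rho>)" by simp
  then show ?case
  proof
    assume "L \<in> glits (realize P \<rho>)"
    then show ?thesis using disj.prems by (intro disj.IH(1)) auto
  next
    assume "L \<in> glits (realize Q \<rho>)"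
    then show ?thesis using disj.prems by (intro disj.IH(2)) auto
  qed
next
  case (iterF d a \<psi> s P T q)
  have dom: "{v. sat \<psi> (case_nat v \<rho>)} = {lo..\<rho> (d + n) - a}"
    using iterF.hyps(1) unfolding framed_by_def by auto
  obtain v where v: "v \<le> \<rho> (d + n) - a" "L \<in> glits (realize P (case_nat v \<rho>))"
    using iterF.prems(7) unfolding realize.simps glits_gbig dom by auto
  have "\<alpha> \<le> a" using iterF.prems(4) by simp
  then have "\<forall>x<Suc d. case_nat v \<rho> x \<le> case_nat v \<rho> (Suc d + n) - \<alpha>"
    using v(1) iterF.prems(6) by (auto simp: less_Suc_eq_0_disj)
  then have "\<exists>p w. (L = LPos p [w] \<or> L = LNeg p [w]) \<and> w \<le> case_nat v \<rho> (Suc d + n) - \<alpha> + cm"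
    using iterF.prems v(2) by (intro iterF.IH) auto
  then show ?case by simp
next
  case (iterG d Z \<psi> P T q)
  then show ?case by simp
qed auto

text \<open>The complement that makes the literal impure is not an instance of a literal of
  \<open>\<Lambda>\<close>, because of \<open>consistent\<close>. So the pattern realizes it, and
  \<open>glits_upper\<close> bounds \<open>n + c\<close> by
  \<open>n - \<alpha> + cm\<close>.\<close>

lemma unpure_window:
  assumes inv: "label_inv ((P, \<phi>), \<Lambda>) T" and T: "guard_free T" "param_atoms T = {}" "\<forall>a\<in>offsets T. \<alpha> \<le> a" "\<forall>(p, c)\<in>var_atoms T. c \<le> cm"
    and up: "(p, IP c) \<in> unpure (hat ((P, \<phi>), \<Lambda>)) \<Lambda>"
  shows "c \<le> cm - \<alpha>"
proof -
  have rep: "rep 0 P T" and wf_tree: "wf_tree T" and fin: "finite \<Lambda>" and co: "consistent \<phi> \<Lambda>" using inv by auto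
  from up obtain L where L: "L \<in> \<Lambda>" "L = LPos p [idx_exp 0 (IP c)] \<or> L = LNeg p [idx_exp 0 (IP c)]"
    "\<not> pure_lit (hat ((P, \<phi>), \<Lambda>)) 0 L" unfolding unpure_def by blast
  obtain \<eta> where "sat (snd (hat ((P, \<phi>), \<Lambda>))) (\<lambda>x. \<eta> (x + 0))"
    "lcompl (ground \<eta> L) \<in> glits (realize (fst (hat ((P, \<phi>), \<Lambda>))) (\<lambda>x. \<eta> (x + 0)))"
    using L(3) unfolding pure_lit_def by blast
  then have e: "sat \<phi> \<eta>" "lcompl (ground \<eta> L) \<in> glits (realize P \<eta>) \<union> ground \<eta> ` \<Lambda>"
    by (simp_all add: hat_def glits_lits_pat[OF fin])
  have "lcompl (ground \<eta> L) \<notin> ground \<eta> ` \<Lambda>"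
  proof
    assume "lcompl (ground \<eta> L) \<in> ground \<eta> ` \<Lambda>"
    then obtain L' where L': "L' \<in> \<Lambda>" "lcompl (ground \<eta> L) = ground \<eta> L'" by blast
    from L(2) show False
    proof
      assume l: "L = LPos p [idx_exp 0 (IP c)]"
      then obtain gs where "L' = LNeg p gs" "map (leval \<eta>) [idx_exp 0 (IP c)] = map (leval \<eta>) gs"
        using L'(2) by (cases L') auto
      then show False using co L(1) L'(1) l e(1) unfolding consistent_def by blast
    next
      assume l: "L = LNeg p [idx_exp 0 (IP c)]"
      then obtain gs where "L' = LPos p gs" "map (leval \<eta>) gs = map (leval \<eta>) [idx_exp 0 (IP c)]"
        using L'(2) by (cases L') auto
      then show False using co L(1) L'(1) l e(1) unfolding consistent_def by blast
    qed
  qed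
  then have "lcompl (ground \<eta> L) \<in> glits (realize P \<eta>)" using e(2) by blast
  from glits_upper[OF rep T(1) wf_tree T(2-4) _ this]
  obtain p' v where v: "lcompl (ground \<eta> L) = LPos p' [v] \<or> lcompl (ground \<eta> L) = LNeg p' [v]" "v \<le> \<eta> n - \<alpha> + cm"
    by auto
  then have "v = \<eta> n + c" using L(2) by auto
  then show ?thesis using v(2) by simp
qed

lemma class_member:
  assumes inv: "label_inv ((P, \<phi>), \<Lambda>) T" and T: "guard_free T" "param_atoms T = {}" "offsets T \<subseteq> {\<beta> - K..\<beta>}"
    "var_atoms T \<subseteq> Vs" "nesting T \<le> D" "alternation BigAnd T \<le> h"
    and cm: "\<And>p c. (p, c) \<in> Vs \<Longrightarrow> \<bar>c\<bar> \<le> cm"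
    and M: "\<And>p c. (p, IP c) \<in> lit_atoms \<Lambda> \<Longrightarrow> - c \<le> \<beta> + K" "\<And>p i. (p, i) \<in> lit_atoms \<Lambda> \<Longrightarrow> p \<in> Ps"
      "\<And>p f. (p, IC f) \<in> lit_atoms \<Lambda> \<Longrightarrow> (p, IC f) \<in> Fs"
  shows "psubst (fst (pur (hat ((P, \<phi>), \<Lambda>)))) (ssub 0 \<beta>) \<in>
    pclass Vs ((\<lambda>(p, c). (p, IP c)) ` (Ps \<times> {- K..cm + K}) \<union> Fs) {- K..0} 0 D h BigAnd"
proof -
  let ?S = "hat ((P, \<phi>), \<Lambda>)"
  have rep: "rep 0 P T" and wf_tree: "wf_tree T" and fin: "finite \<Lambda>" and leaf_states: "litform \<Lambda>" using inv by auto
  obtain Ls where Ls: "set Ls = \<Lambda>" "lits_pat \<Lambda> = pand (map lit_pat Ls)" using lits_pat_obtain[OF fin] .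
  obtain T1 where T1: "rep 0 (pur_pat ?S 0 P) T1" "guard_free T1" "wf_tree T1" "var_atoms T1 \<subseteq> var_atoms T" "param_atoms T1 \<subseteq> param_atoms T"
    "offsets T1 \<subseteq> offsets T" "nesting T1 \<le> nesting T" "alternation BigAnd T1 \<le> alternation BigAnd T" using pur_rep[OF rep T(1) wf_tree] by blast
  obtain T2 where T2: "rep 0 (pur_pat ?S 0 (lits_pat \<Lambda>)) T2" "guard_free T2" "wf_tree T2" "var_atoms T2 = {}" "offsets T2 = {}"
    "nesting T2 = 0" "alternation BigAnd T2 = 0" "param_atoms T2 \<subseteq> unpure ?S \<Lambda>"
    using pur_lits[of Ls ?S] leaf_states unfolding Ls by blast
  let ?T = "XB BigAnd T1 T2"
  have "fst (pur ?S) = PAnd (pur_pat ?S 0 P) (pur_pat ?S 0 (lits_pat \<Lambda>))"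
    unfolding pur_def by (simp add: hat_def)
  then have "rep 0 (fst (pur ?S)) ?T" using T1(1) T2(1) by (simp add: rep.conj)
  then have R: "rep 0 (psubst (fst (pur ?S)) (ssub 0 \<beta>)) (tshift \<beta> ?T)"
    by (rule rep_tshift) (use T1(2) T2(2) in simp)
  have low: "\<forall>a\<in>offsets T. \<beta> - K \<le> a" using T(3) by auto
  have cT: "\<forall>(p, c)\<in>var_atoms T. c \<le> cm" using T(4) cm by force
  have pa: "param_atoms (tshift \<beta> ?T) \<subseteq> (\<lambda>(p, c). (p, IP c)) ` (Ps \<times> {- K..cm + K}) \<union> Fs"
  proof
    fix x assume "x \<in> param_atoms (tshift \<beta> ?T)"
    then obtain p i where x: "x = (p, ishift \<beta> i)" "(p, i) \<in> unpure ?S \<Lambda>"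
      using T1(5) T(2) T2(8) unfolding tshift_content(5) by auto
    have lm: "(p, i) \<in> lit_atoms \<Lambda>" using x(2) by (auto simp: unpure_def lit_atoms_def)
    show "x \<in> (\<lambda>(p, c). (p, IP c)) ` (Ps \<times> {- K..cm + K}) \<union> Fs"
    proof (cases i)
      case (IV y c)
      then show ?thesis using x(2) by (auto simp: unpure_def)
    next
      case (IP c)
      \<comment> \<open>Impurity bounds \<open>c\<close> from above and the round invariant bounds
        it from below; after the shift by \<open>\<beta>\<close> both bounds are constants.\<close>
      have "c \<le> cm - (\<beta> - K)" using unpure_window[OF inv T(1,2) low cT] x(2) IP by blast
      moreover have "- c \<le> \<beta> + K" using M(1) lm IP by blast
      ultimately have "(p, c + \<beta>) \<in> Ps \<times> {- K..cm + K}" using M(2)[OF lm] by auto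
      then show ?thesis using x(1) IP by force
    next
      case (IC f)
      then show ?thesis using x(1) M(3) lm by auto
    qed
  qed
  have "offsets (tshift \<beta> ?T) \<subseteq> {- K..0}"
    unfolding tshift_content(4) using T1(6) T2(5) T(3) by auto
  then show ?thesis
    unfolding pclass_def using R pa T1 T2 T wf_tree_tshift[of ?T \<beta>]
    by (intro CollectI exI[of _ "tshift \<beta> ?T"]) (auto simp: tshift_content alternation_tshift simp del: tshift.simps)
qed

lemma params_hat:
  assumes inv: "label_inv ((P, \<phi>), \<Lambda>) T" and X: "param_values n \<phi> \<noteq> {}" "param_values n \<phi> \<subseteq> {0..}"
  shows "params (hat ((P, \<phi>), \<Lambda>)) = {n}"
proof -
  have fin: "finite \<Lambda>" and leaf_states: "litform \<Lambda>" and dn: "depn \<phi>" and rep: "rep 0 P T" using inv by auto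
  obtain Ls where Ls: "set Ls = \<Lambda>" "lits_pat \<Lambda> = pand (map lit_pat Ls)" using lits_pat_obtain[OF fin] .
  have "litform (set Ls)" using leaf_states Ls by simp
  then have "pfree (pand (map lit_pat Ls)) \<subseteq> {n}"
  proof (induction Ls)
    case (Cons L Ls)
    then obtain p i where i: "isparam i" and L: "L = LPos p [idx_exp 0 i] \<or> L = LNeg p [idx_exp 0 i]"
      unfolding litform_def by auto
    have "lvars (idx_exp 0 i) \<subseteq> {n}" using i unfolding lvars_idx_exp by (cases i) simp_all
    moreover have "pfree (lit_pat L) = lvars (idx_exp 0 i)" using L by (elim disjE) (simp_all only: lit_pat.simps pfree.simps list.set UN_insert UN_empty Un_empty_right)
    ultimately have 1: "pfree (lit_pat L) \<subseteq> {n}" by simp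
    have "litform (set Ls)" using Cons.prems by (auto simp: litform_def)
    then have 2: "pfree (pand (map lit_pat Ls)) \<subseteq> {n}" by (rule Cons.IH)
    show ?case
    proof (cases Ls)
      case Nil
      then show ?thesis using 1 by simp
    next
      case (Cons L' Ls')
      then show ?thesis using 1 2 by auto
    qed
  qed simp
  then have "pfree (lits_pat \<Lambda>) \<subseteq> {n}" using Ls(2) by simp
  moreover have "pfree P \<subseteq> {n}" using pfree_rep[OF rep] by auto
  moreover have "ffree \<phi> \<subseteq> {n}" using ffree_depn[OF dn] .
  moreover have "n \<in> params (hat ((P, \<phi>), \<Lambda>))"
    unfolding hat_def prod.case by (rule n_in_params[OF dn X(1), of "-1"]) (use X(2) in auto)
  ultimately show ?thesis unfolding params_def hat_def by auto
qed

lemma sat_depn: "depn \<phi> \<Longrightarrow> sat \<phi> \<rho> \<longleftrightarrow> \<rho> n \<in> param_values n \<phi>"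
proof
  assume d: "depn \<phi>" and "\<rho> n \<in> param_values n \<phi>"
  then obtain \<rho>' where "\<rho> n = \<rho>' n" "sat \<phi> \<rho>'" by (auto simp: param_values_def)
  then show "sat \<phi> \<rho>" using d unfolding depn_def by blast
qed (auto simp: param_values_def)

text \<open>Each schema is normalised by its own shift. Undoing the shift by \<open>\<beta>1\<close>
  turns the identity of the normalised schemata into a shift of the second one by
  \<open>\<beta>1 - \<beta>2\<close>.\<close>

lemma loops_shift:
  assumes l1: "label_inv ((P1, \<phi>1), \<Lambda>1) T1" "param_values n \<phi>1 \<noteq> {}" "param_values n \<phi>1 \<subseteq> {0..}"
    and l2: "label_inv ((P2, \<phi>2), \<Lambda>2) T2" "param_values n \<phi>2 \<noteq> {}" "param_values n \<phi>2 \<subseteq> {0..}"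
    and lt: "\<beta>2 < \<beta>1"
    and eq: "pat_eq (psubst (fst (pur (hat ((P1, \<phi>1), \<Lambda>1)))) (ssub 0 \<beta>1))
      (psubst (fst (pur (hat ((P2, \<phi>2), \<Lambda>2)))) (ssub 0 \<beta>2))"
    and X: "\<And>m. m + \<beta>1 \<in> param_values n \<phi>1 \<longleftrightarrow> m + \<beta>2 \<in> param_values n \<phi>2"
  shows "hat ((P1, \<phi>1), \<Lambda>1) \<sqsubset>\<^sub>l hat ((P2, \<phi>2), \<Lambda>2)"
proof (rule loops_onI[where n = n and k = "\<beta>1 - \<beta>2"])
  show "params (hat ((P1, \<phi>1), \<Lambda>1)) = {n}" using params_hat[OF l1] .
  show "params (hat ((P2, \<phi>2), \<Lambda>2)) = {n}" using params_hat[OF l2] .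
  show "0 < \<beta>1 - \<beta>2" using lt by simp
  let ?\<sigma> = "lvar(n := lvar n - lconst (\<beta>1 - \<beta>2))"
  have c: "(\<lambda>x. lsubst (ssub 0 \<gamma>) (ssub 0 \<beta> x)) = ssub 0 (\<beta> + \<gamma>)" for \<beta> \<gamma>
    by (rule ext, rule lexp_eqI) (simp add: ssub_def)
  have 0: "ssub 0 0 = lvar" by (rule ext, rule lexp_eqI) (simp add: ssub_def)
  have s: "ssub 0 (\<beta>2 - \<beta>1) = ?\<sigma>" by (rule ext, rule lexp_eqI) (simp add: ssub_def)
  from pat_eq_psubst[OF eq, of "ssub 0 (- \<beta>1)"]
  have "pat_eq (fst (pur (hat ((P1, \<phi>1), \<Lambda>1)))) (psubst (fst (pur (hat ((P2, \<phi>2), \<Lambda>2)))) ?\<sigma>)"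
    unfolding psubst_psubst c by (simp add: 0 psubst_lvar s)
  moreover have "equivalent \<phi>1 (fsubst ?\<sigma> \<phi>2)"
    unfolding equivalent_def
  proof
    fix \<rho>
    have "sat \<phi>1 \<rho> \<longleftrightarrow> \<rho> n \<in> param_values n \<phi>1" using l1 by (intro sat_depn) simp
    also have "\<dots> \<longleftrightarrow> \<rho> n - (\<beta>1 - \<beta>2) \<in> param_values n \<phi>2" using X[of "\<rho> n - \<beta>1"] by (simp add: algebra_simps)
    also have "\<dots> \<longleftrightarrow> sat \<phi>2 (\<lambda>x. leval \<rho> (?\<sigma> x))" using l2 sat_depn[of \<phi>2 "\<lambda>x. leval \<rho> (?\<sigma> x)"] by simp
    finally show "sat \<phi>1 \<rho> = sat (fsubst ?\<sigma> \<phi>2) \<rho>" by simp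
  qed
  ultimately show "schema_eq (pur (hat ((P1, \<phi>1), \<Lambda>1))) (shift_param n (\<beta>1 - \<beta>2) (pur (hat ((P2, \<phi>2), \<Lambda>2))))"
    unfolding schema_eq_def shift_param_def Let_def by (simp add: pur_def hat_def)
qed

end

context run
begin

lemma run_loops:
  assumes inv: "\<And>i. label_inv (L i) (T i)" and Xeq: "\<And>i. X i = param_values n (snd (fst (L i)))" and Meq: "\<And>i. M i = lit_atoms (snd (L i))"
    and X0: "\<And>i. X i \<subseteq> {0..}"
  shows "\<exists>i j. j \<le> i \<and> block_start i \<and> hat (L i) \<sqsubset>\<^sub>l hat (L j)"
proof -
  obtain s :: "nat \<Rightarrow> nat" and \<beta> K where sb: "\<And>r. s r < s (Suc r)" "\<And>r. \<beta> r < \<beta> (Suc r)"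
    and rd: "\<And>r. block_start (s r)" "\<And>r. offsets (T (s r)) \<subseteq> {\<beta> r - K..\<beta> r}" "\<And>r. X (s r) \<subseteq> {lo + \<beta> r..}"
      "\<And>r. {\<beta> r + K..} \<subseteq> X (s r)" "\<And>r p c. (p, IP c) \<in> M (s r) \<Longrightarrow> - c \<le> \<beta> r + K"
    using rounds by blast
  obtain cm where cm: "\<And>p c. (p, c) \<in> var_atoms (T 0) \<Longrightarrow> \<bar>c\<bar> \<le> cm"
    using finite_int_bound[OF finite_var_atoms[of "T 0"], of snd] by force
  let ?Fs = "M 0 \<union> param_atoms (T 0)"
  let ?Ps = "fst ` (M 0 \<union> param_atoms (T 0)) \<union> fst ` var_atoms (T 0)"
  let ?Ls = "(\<lambda>(p, c). (p, IP c)) ` (?Ps \<times> {- K..cm + K}) \<union> ?Fs"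
  let ?C = "pclass (var_atoms (T 0)) ?Ls {- K..0} 0 (nesting (T 0)) (alternation BigAnd (T 0)) BigAnd"
  define N where "N = (\<lambda>r. psubst (fst (pur (hat (L (s r))))) (ssub 0 (\<beta> r)))"
  have mem: "N r \<in> ?C" for r
  proof -
    obtain P \<phi> \<Lambda> where l: "L (s r) = ((P, \<phi>), \<Lambda>)" by (metis prod.collapse)
    have b: "ph (s r) = Phase3" "s r = 0 \<or> ph (s r - 1) \<noteq> Phase3" using rd(1)[of r] by (auto simp: block_start_def)
    have "guard_free (T (s r))" "param_atoms (T (s r)) = {}" using ng3[OF b(1)] blk[OF b] by auto
    have "var_atoms (T (s r)) \<subseteq> var_atoms (T 0)" "nesting (T (s r)) \<le> nesting (T 0)" "alternation BigAnd (T (s r)) \<le> alternation BigAnd (T 0)"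
      by (rule content)+
    have "offsets (T (s r)) \<subseteq> {\<beta> r - K..\<beta> r}" by (rule rd(2))
    have lm: "lit_atoms \<Lambda> = M (s r)" using Meq[of "s r"] l by simp
    show ?thesis unfolding N_def l
    proof (rule class_member)
      show "label_inv ((P, \<phi>), \<Lambda>) (T (s r))" using inv[of "s r"] l by simp
      show "\<bar>c\<bar> \<le> cm" if "(p, c) \<in> var_atoms (T 0)" for p c using cm that .
      show "- c \<le> \<beta> r + K" if "(p, IP c) \<in> lit_atoms \<Lambda>" for p c using rd(5) that lm by simp
      show "p \<in> ?Ps" if "(p, i) \<in> lit_atoms \<Lambda>" for p i using content(5) that lm by blast
      show "(p, IC f) \<in> ?Fs" if "(p, IC f) \<in> lit_atoms \<Lambda>" for p f using content(4) that lm by blast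
    qed fact+
  qed
  have finC: "fin_mod ?C"
    using finM[of 0] finite_param_atoms[of "T 0"] finite_var_atoms[of "T 0"] by (intro fin_mod_pclass) auto
  then obtain R where R: "finite R" "\<And>P. P \<in> ?C \<Longrightarrow> \<exists>Q\<in>R. pat_eq P Q" unfolding fin_mod_def by blast
  then have "\<forall>r. \<exists>Q. Q \<in> R \<and> pat_eq (N r) Q" using mem by blast
  then obtain g where g: "\<And>r. g r \<in> R" "\<And>r. pat_eq (N r) (g r)" by metis
  \<comment> \<open>After the shift by \<open>\<beta> r\<close>, membership in \<open>X\<close> is
    settled below \<open>lo\<close> and above \<open>K\<close>, so this finite window determines the
    constraint. Together with the class of the pattern it is the datum for the pigeonhole
    principle.\<close>
  define w where "w = (\<lambda>r. {m \<in> {lo..K}. m + \<beta> r \<in> X (s r)})"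
  have "range (\<lambda>r. (g r, w r)) \<subseteq> R \<times> Pow {lo..K}" using g(1) by (auto simp: w_def)
  then have "finite (range (\<lambda>r. (g r, w r)))" by (rule finite_subset) (simp add: R(1))
  then have "\<not> inj (\<lambda>r. (g r, w r))" using finite_imageD infinite_UNIV_nat by blast
  then obtain r r' where rr: "r < r'" "g r = g r'" "w r = w r'"
    unfolding inj_def by (metis linorder_neqE_nat prod.inject)
  have mono: "\<beta> r < \<beta> r'" "s r < s r'" using rr(1) sb by (auto intro: lift_Suc_mono_less)
  have win: "m + \<beta> q \<in> X (s q) \<longleftrightarrow> m \<in> w q \<or> K < m" for m q
  proof -
    have "lo \<le> m" if "m + \<beta> q \<in> X (s q)" using rd(3)[of q] that by auto
    moreover have "m + \<beta> q \<in> X (s q)" if "K < m"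
    proof -
      have "m + \<beta> q \<in> {\<beta> q + K..}" using that by simp
      then show ?thesis using rd(4)[of q] by blast
    qed
    ultimately show ?thesis unfolding w_def by auto
  qed
  obtain P1 \<phi>1 \<Lambda>1 where l1: "L (s r') = ((P1, \<phi>1), \<Lambda>1)" by (metis prod.collapse)
  obtain P2 \<phi>2 \<Lambda>2 where l2: "L (s r) = ((P2, \<phi>2), \<Lambda>2)" by (metis prod.collapse)
  have x1: "X (s r') = param_values n \<phi>1" and x2: "X (s r) = param_values n \<phi>2" using Xeq l1 l2 by auto
  have eq: "pat_eq (N r') (N r)" using g(2)[of r] g(2)[of r'] rr(2) by (metis pat_eq.sym pat_eq.trans)
  have "hat (L (s r')) \<sqsubset>\<^sub>l hat (L (s r))"
    unfolding l1 l2
  proof (rule loops_shift)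
    show "label_inv ((P1, \<phi>1), \<Lambda>1) (T (s r'))" "label_inv ((P2, \<phi>2), \<Lambda>2) (T (s r))" using inv l1 l2 by metis+
    show "param_values n \<phi>1 \<noteq> {}" "param_values n \<phi>1 \<subseteq> {0..}" "param_values n \<phi>2 \<noteq> {}" "param_values n \<phi>2 \<subseteq> {0..}"
      using Xne X0 x1 x2 by metis+
    show "\<beta> r < \<beta> r'" by fact
    show "pat_eq (psubst (fst (pur (hat ((P1, \<phi>1), \<Lambda>1)))) (ssub 0 (\<beta> r')))
      (psubst (fst (pur (hat ((P2, \<phi>2), \<Lambda>2)))) (ssub 0 (\<beta> r)))"
      using eq unfolding N_def l1 l2 .
    show "m + \<beta> r' \<in> param_values n \<phi>1 \<longleftrightarrow> m + \<beta> r \<in> param_values n \<phi>2" for m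
      using win[of m r] win[of m r'] rr(3) unfolding x1 x2 by simp
  qed
  then show ?thesis using mono(2) rd(1)[of r'] by (intro exI[of _ "s r'"] exI[of _ "s r"]) auto
qed

end

section \<open>From derivations to branches\<close>

text \<open>\<open>N\<close> will be the set of labels on the path to the leaf. Looping may use any
  node of the tableau, but the companion found for an infinite branch lies on the branch
  itself.\<close>

definition irr :: "phase \<Rightarrow> 'p label \<Rightarrow> 'p label set \<Rightarrow> bool" where
  "irr p l N \<longleftrightarrow> (\<nexists>ls. phase_rule p l ls) \<and> (p = Phase2 \<longrightarrow> (\<forall>l'\<in>N. \<not> hat l \<sqsubset>\<^sub>l hat l'))"

text \<open>A leaf last expanded in phase \<open>p\<close> and now expanded in phase \<open>p'\<close> has been irreducible in all phases
  passed in between.\<close>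

definition phase_trans :: "phase \<Rightarrow> phase \<Rightarrow> 'p label \<Rightarrow> 'p label set \<Rightarrow> bool" where
  "phase_trans p p' l N \<longleftrightarrow> (\<exists>j. p' = (next_phase ^^ j) p \<and> (\<forall>m<j. irr ((next_phase ^^ m) p) l N))"

lemma phase_trans_same: "phase_trans p p l N"
  unfolding phase_trans_def by (rule exI[of _ 0]) simp

lemma phase_trans_next: "phase_trans p p' l N \<Longrightarrow> irr p' l N \<Longrightarrow> phase_trans p (next_phase p') l N"
proof -
  assume "phase_trans p p' l N" "irr p' l N"
  then obtain j where "p' = (next_phase ^^ j) p" "\<forall>m<j. irr ((next_phase ^^ m) p) l N" unfolding phase_trans_def by blast
  then show ?thesis using \<open>irr p' l N\<close> unfolding phase_trans_def by (intro exI[of _ "Suc j"]) (auto simp: less_Suc_eq)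
qed

lemma next_phase_3: "(next_phase ^^ (j + 3)) p = (next_phase ^^ j) p"
proof -
  have "next_phase (next_phase (next_phase x)) = x" for x by (cases x) auto
  then have "(next_phase ^^ 3) p = p" by (simp add: numeral_3_eq_3)
  then show ?thesis by (simp add: funpow_add)
qed

text \<open>Having passed three phases, the leaf would have been irreducible in \<open>p'\<close>
  itself, in which a rule applies to it.\<close>

lemma phase_trans_cases:
  assumes "phase_trans p p' l N" "phase_rule p' l ls"
  shows "p' = p \<or> p' = next_phase p \<and> irr p l N \<or> p' = next_phase (next_phase p) \<and> irr p l N \<and> irr (next_phase p) l N"
proof -
  obtain j where j: "p' = (next_phase ^^ j) p" "\<And>m. m < j \<Longrightarrow> irr ((next_phase ^^ m) p) l N"
    using assms(1) unfolding phase_trans_def by blast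
  have "j < 3"
  proof (rule ccontr)
    assume "\<not> j < 3"
    then obtain i where i: "j = i + 3" by (metis le_Suc_ex add.commute not_less)
    then have "irr p' l N" using j(2)[of i] j(1) next_phase_3[of i p] by simp
    then show False using assms(2) unfolding irr_def by blast
  qed
  then consider "j = 0" | "j = 1" | "j = 2" by linarith
  then show ?thesis
  proof cases
    case 1
    then show ?thesis using j(1) by simp
  next
    case 2
    then show ?thesis using j(1) j(2)[of 0] by simp
  next
    case 3
    then show ?thesis using j(1) j(2)[of 0] j(2)[of 1] by (simp add: numeral_2_eq_2)
  qed
qed

lemma phase_trans_facts:
  assumes "phase_trans p p' l N" "phase_rule p' l ls"
  shows "p' = Phase2 \<Longrightarrow> p \<noteq> Phase2 \<Longrightarrow> irr Phase1 l N"
    "p' = Phase3 \<Longrightarrow> p \<noteq> Phase3 \<Longrightarrow> irr Phase2 l N"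
    "p' = Phase3 \<Longrightarrow> p = Phase1 \<Longrightarrow> irr Phase1 l N"
    "p = Phase3 \<Longrightarrow> p' \<noteq> Phase3 \<Longrightarrow> irr Phase3 l N"
  using phase_trans_cases[OF assms] by (cases p; cases p'; auto)+

definition branch :: "'p schema \<Rightarrow> (nat \<Rightarrow> 'p label) \<Rightarrow> (nat \<Rightarrow> phase) \<Rightarrow> bool" where
  "branch S L ph \<longleftrightarrow> L 0 = (S, {}) \<and> phase_trans Phase1 (ph 0) (L 0) {L 0} \<and>
     (\<forall>i. \<not> closed_label (L i) \<and> (\<exists>ls. phase_rule (ph i) (L i) ls \<and> L (Suc i) \<in> set ls) \<and>
       phase_trans (ph i) (ph (Suc i)) (L (Suc i)) (L ` {..Suc i}))"

context frame
begin

abbreviation "XX l \<equiv> param_values n (snd (fst l))"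
abbreviation "MM l \<equiv> lit_atoms (snd l)"

text \<open>The facts that the phases completed before a node guarantee for its tree; they supply
  the assumptions \<open>ne2\<close>, \<open>ng3\<close> and \<open>blk\<close> of
  \<open>run\<close>.\<close>

definition good :: "(nat \<Rightarrow> phase) \<Rightarrow> nat \<Rightarrow> 'p label \<Rightarrow> 'p tree \<Rightarrow> bool" where
  "good ph i l T \<longleftrightarrow> label_inv l T \<and> (ph i = Phase2 \<longrightarrow> nonempty_on T (XX l)) \<and> (ph i = Phase3 \<longrightarrow> guard_free T) \<and>
     (ph i = Phase3 \<longrightarrow> i = 0 \<or> ph (i - 1) \<noteq> Phase3 \<longrightarrow> nonempty_on T (XX l) \<and> param_atoms T = {})"

lemma irr1_nonempty_on:
  assumes "irr Phase1 l N" "label_inv l T" "XX l \<subseteq> {0..}"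
  shows "nonempty_on T (XX l)"
proof -
  obtain P \<phi> \<Lambda> where l: "l = ((P, \<phi>), \<Lambda>)" by (metis prod.collapse)
  show ?thesis unfolding nonempty_on_def l
    using irreducible1[of P \<phi> \<Lambda> T] assms unfolding l irr_def by auto
qed

lemma irr2_guard_free:
  assumes "irr Phase2 l N" "label_inv l T" "XX l \<subseteq> {0..}" "XX l \<noteq> {}" "nonempty_on T (XX l)"
  shows "guard_free T \<and> param_atoms T = {}"
proof -
  obtain P \<phi> \<Lambda> where l: "l = ((P, \<phi>), \<Lambda>)" by (metis prod.collapse)
  have "\<nexists>ls. phase_rule Phase2 ((P, \<phi>), \<Lambda>) ls" using assms(1) unfolding l irr_def by blast
  then show ?thesis using irreducible2[of P \<phi> \<Lambda> T] assms(2-5) unfolding l nonempty_on_def by auto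
qed

lemma irr3_irr3:
  assumes "irr Phase3 l N" "label_inv l T"
  shows "irr3 T (XX l)"
proof -
  obtain P \<phi> \<Lambda> where l: "l = ((P, \<phi>), \<Lambda>)" by (metis prod.collapse)
  have "\<nexists>ls. unfolding_rule ((P, \<phi>), \<Lambda>) ls" using assms(1) unfolding l irr_def by simp
  then show ?thesis using irreducible3[of P \<phi> \<Lambda> T] assms(2) unfolding l irr3_def by auto
qed

lemma sim_phase:
  assumes "phase_rule p l ls" "l' \<in> set ls" "label_inv l T" "satisfiable (snd (fst l))" "satisfiable (snd (fst l'))"
    "p = Phase3 \<Longrightarrow> guard_free T"
  shows "\<exists>T'. label_inv l' T' \<and> (p = Phase1 \<longrightarrow> split1 (T, XX l, MM l) (T', XX l', MM l')) \<and>
    (p = Phase2 \<longrightarrow> step2 (T, XX l, MM l) (T', XX l', MM l')) \<and>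
    (p = Phase3 \<longrightarrow> unfolds (XX l) T T' \<and> XX l' = XX l \<and> MM l' = MM l)"
proof (cases p)
  case Phase1
  then have "constraint_split True l ls" using assms(1) by simp
  from simulate_csplit[OF this assms(3,2)] show ?thesis using Phase1 by auto
next
  case Phase2
  then consider "prop_split l ls" | "constraint_split False l ls" | "rewriting l ls" | "interval l ls"
    using assms(1) by auto
  then have "\<exists>T'. label_inv l' T' \<and> step2 (T, XX l, MM l) (T', XX l', MM l')"
  proof cases
    case 1
    then show ?thesis by (rule simulate_prop_split[OF _ assms(3,2,4)])
  next
    case 2
    from simulate_csplit[OF this assms(3,2)] show ?thesis using step2.split by blast
  next
    case 3
    then show ?thesis by (rule simulate_rewriting[OF _ assms(3,2)])
  next
    case 4
    then show ?thesis by (rule simulate_interval[OF _ assms(3,2,5)])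
  qed
  then show ?thesis using Phase2 by auto
next
  case Phase3
  then have "unfolding_rule l ls" using assms(1) by simp
  from simulate_unfolding[OF this assms(3,2) assms(6)[OF Phase3]] show ?thesis using Phase3 by auto
qed

lemma phase_XX_mono:
  assumes "p = Phase1 \<longrightarrow> split1 (T, X, M) (T', X', M')" "p = Phase2 \<longrightarrow> step2 (T, X, M) (T', X', M')"
    "p = Phase3 \<longrightarrow> unfolds X T T' \<and> X' = X \<and> M' = M"
  shows "X' \<subseteq> X"
proof (cases p)
  case Phase1
  then show ?thesis using step2_shape[OF step2.split] assms(1) by blast
next
  case Phase2
  then show ?thesis using step2_shape assms(2) by blast
next
  case Phase3
  then show ?thesis using assms(3) by simp
qed

theorem no_branch:
  assumes br: "branch S L ph" and init: "label_inv (S, {}) T0" and X0: "param_values n (snd S) \<subseteq> {0..}"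
    and cof: "(\<exists>b. param_values n (snd S) \<subseteq> {..b}) \<or> (\<exists>b. {b..} \<subseteq> param_values n (snd S))"
  shows False
proof -
  have L0: "L 0 = (S, {})" and tr0: "phase_trans Phase1 (ph 0) (L 0) {L 0}" and ncl: "\<And>i. \<not> closed_label (L i)"
    and rule: "\<And>i. \<exists>ls. phase_rule (ph i) (L i) ls \<and> L (Suc i) \<in> set ls"
    and trs: "\<And>i. phase_trans (ph i) (ph (Suc i)) (L (Suc i)) (L ` {..Suc i})"
    using br unfolding branch_def by auto
  have sat: "satisfiable (snd (fst (L i)))" for i using ncl[of i] by (simp add: closed_label_def)
  then have Xne: "XX (L i) \<noteq> {}" for i by (auto simp: satisfiable_def param_values_def)
  define Q where "Q = (\<lambda>i T T'. (ph i = Phase1 \<longrightarrow> split1 (T, XX (L i), MM (L i)) (T', XX (L (Suc i)), MM (L (Suc i)))) \<and>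
    (ph i = Phase2 \<longrightarrow> step2 (T, XX (L i), MM (L i)) (T', XX (L (Suc i)), MM (L (Suc i)))) \<and>
    (ph i = Phase3 \<longrightarrow> unfolds (XX (L i)) T T' \<and> XX (L (Suc i)) = XX (L i) \<and> MM (L (Suc i)) = MM (L i)))"
  \<comment> \<open>The simulation lemmas only assert that some next tree exists, so the trees are
    chosen successively along the branch.\<close>
  have "\<exists>T. \<forall>i. (good ph i (L i) (T i) \<and> XX (L i) \<subseteq> {0..}) \<and> Q i (T i) (T (Suc i))"
  proof (rule dependent_nat_choice)
    obtain ls where ls: "phase_rule (ph 0) (L 0) ls" using rule by blast
    note tf = phase_trans_facts[OF tr0 ls]
    have inv: "label_inv (L 0) T0" and X: "XX (L 0) \<subseteq> {0..}" using init X0 L0 by auto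
    have "good ph 0 (L 0) T0"
    proof (cases "ph 0")
      case Phase1
      then show ?thesis using inv by (simp add: good_def)
    next
      case Phase2
      then show ?thesis using inv irr1_nonempty_on[OF tf(1) inv X] by (simp add: good_def)
    next
      case Phase3
      have "nonempty_on T0 (XX (L 0))" using irr1_nonempty_on[OF tf(3) inv X] Phase3 by simp
      then show ?thesis using inv irr2_guard_free[OF tf(2) inv X Xne] Phase3 by (simp add: good_def)
    qed
    then show "\<exists>T. good ph 0 (L 0) T \<and> XX (L 0) \<subseteq> {0..}" using X by blast
  next
    fix T i assume g: "good ph i (L i) T \<and> XX (L i) \<subseteq> {0..}"
    then have inv: "label_inv (L i) T" and ng: "ph i = Phase3 \<Longrightarrow> guard_free T" and ne: "ph i = Phase2 \<Longrightarrow> nonempty_on T (XX (L i))"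
      by (auto simp: good_def)
    obtain ls where ls: "phase_rule (ph i) (L i) ls" "L (Suc i) \<in> set ls" using rule by blast
    obtain T' where T': "label_inv (L (Suc i)) T'" and q: "Q i T T'"
      using sim_phase[OF ls inv sat sat ng] unfolding Q_def by blast
    have Xs: "XX (L (Suc i)) \<subseteq> XX (L i)" using q unfolding Q_def by (intro phase_XX_mono) auto
    then have X: "XX (L (Suc i)) \<subseteq> {0..}" using g by blast
    obtain ls' where ls': "phase_rule (ph (Suc i)) (L (Suc i)) ls'" using rule by blast
    note tf = phase_trans_facts[OF trs ls']
    have ne2: "nonempty_on T' (XX (L (Suc i)))" if "ph i = Phase2"
    proof -
      have "offsets T' \<subseteq> offsets T" using q that step2_shape unfolding Q_def by blast
      then show ?thesis using ne[OF that] Xs unfolding nonempty_on_def by blast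
    qed
    have "good ph (Suc i) (L (Suc i)) T'"
    proof (cases "ph (Suc i)")
      case Phase1
      then show ?thesis using T' by (simp add: good_def)
    next
      case Phase2
      have "nonempty_on T' (XX (L (Suc i)))"
        by (cases "ph i = Phase2") (use ne2 irr1_nonempty_on[OF tf(1)[OF Phase2] T' X] in auto)
      then show ?thesis using T' Phase2 by (simp add: good_def)
    next
      case Phase3
      show ?thesis
      proof (cases "ph i = Phase3")
        case True
        then have "guard_free T'" using q ng[OF True] unfolds_content(3) unfolding Q_def by blast
        then show ?thesis using T' Phase3 True by (simp add: good_def)
      next
        case False
        have "nonempty_on T' (XX (L (Suc i)))"
        proof (cases "ph i")
          case 1: Phase1
          show ?thesis by (rule irr1_nonempty_on[OF tf(3)[OF Phase3 1] T' X])
        next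
          case 2: Phase2
          then show ?thesis by (rule ne2)
        next
          case 3: Phase3
          then show ?thesis using False by simp
        qed
        then show ?thesis using T' Phase3 irr2_guard_free[OF tf(2)[OF Phase3 False] T' X Xne] by (simp add: good_def)
      qed
    qed
    then show "\<exists>T'. (good ph (Suc i) (L (Suc i)) T' \<and> XX (L (Suc i)) \<subseteq> {0..}) \<and> Q i T T'"
      using X q by blast
  qed
  then obtain T where T: "\<And>i. good ph i (L i) (T i)" "\<And>i. XX (L i) \<subseteq> {0..}" "\<And>i. Q i (T i) (T (Suc i))" by blast
  have inv: "label_inv (L i) (T i)" for i using T(1) by (simp add: good_def)
  interpret R: run n lo T "\<lambda>i. XX (L i)" "\<lambda>i. MM (L i)" ph
  proof
    fix i
    obtain P \<phi> \<Lambda> where l: "L i = ((P, \<phi>), \<Lambda>)" by (metis prod.collapse)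
    show "finite (MM (L i))" using inv[of i] l by (simp add: finite_lit_atoms)
    show "wf_tree (T i)" using inv[of i] l by simp
    show "XX (L i) \<noteq> {}" by (rule Xne)
    show "isparam j" if "(p, j) \<in> MM (L i)" for p j using that by (simp add: lit_atoms_def)
    show "(\<exists>b. XX (L 0) \<subseteq> {..b}) \<or> (\<exists>b. {b..} \<subseteq> XX (L 0))" using cof L0 by simp
    show "ph i = Phase3 \<Longrightarrow> ph (Suc i) \<noteq> Phase3 \<Longrightarrow> irr3 (T (Suc i)) (XX (L (Suc i)))"
    proof -
      assume p: "ph i = Phase3" "ph (Suc i) \<noteq> Phase3"
      obtain ls' where ls': "phase_rule (ph (Suc i)) (L (Suc i)) ls'" using rule by blast
      from irr3_irr3[OF phase_trans_facts(4)[OF trs ls' p] inv] show ?thesis .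
    qed
  qed (use T in \<open>auto simp: Q_def good_def\<close>)
  obtain i j where ij: "j \<le> i" "R.block_start i" "hat (L i) \<sqsubset>\<^sub>l hat (L j)"
    using R.run_loops[of L] inv T(2) by blast
  then have p3: "ph i = Phase3" "i = 0 \<or> ph (i - 1) \<noteq> Phase3" by (auto simp: R.block_start_def)
  obtain ls where ls: "phase_rule (ph i) (L i) ls" using rule by blast
  \<comment> \<open>At the start of a block of Phase 3 the leaf has been irreducible in Phase 2,
    where Looping is available; the loop found contradicts this.\<close>
  have "irr Phase2 (L i) (L ` {..i})"
  proof (cases i)
    case 0
    then show ?thesis using phase_trans_facts(2)[OF tr0, of ls] ls p3(1) by simp
  next
    case (Suc k)
    then show ?thesis using phase_trans_facts(2)[OF trs[of k], of ls] ls p3 by simp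
  qed
  then show False using ij unfolding irr_def by auto
qed

lemma initial_rep:
  "is_pattern P \<Longrightarrow> monadic P \<Longrightarrow> \<forall>e\<in>plexps P. \<forall>x\<in>lvars e. \<exists>k. e = lvar x + lconst k \<Longrightarrow>
    aligned_on P (lconst lo) (lvar (d + n) - lconst l) \<Longrightarrow> pfree P \<subseteq> {..<d} \<union> {d + n} \<Longrightarrow>
    \<exists>T. rep d P T \<and> wf_tree T"
proof (induction P arbitrary: d)
  case PTop
  show ?case by (rule exI[of _ "XL True"]) (simp add: rep.top)
next
  case PBot
  show ?case by (rule exI[of _ "XL False"]) (simp add: rep.bot)
next
  case (Atom p es)
  then obtain e where e: "es = [e]" by (auto simp: length_Suc_conv)
  have "\<exists>i. e = idx_exp d i \<and> (\<forall>x c. i = IV x c \<longrightarrow> x < d)"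
  proof (cases "lvars e = {}")
    case True
    then obtain c where "e = lconst c" using lconst_if_no_vars by blast
    then show ?thesis by (intro exI[of _ "IC c"]) simp
  next
    case False
    then obtain x where x: "x \<in> lvars e" by blast
    then obtain c where c: "e = lvar x + lconst c" using Atom.prems(3) e by auto
    have "x < d \<or> x = d + n" using Atom.prems(5) e x by auto
    then show ?thesis
    proof
      assume "x < d"
      then show ?thesis using c by (intro exI[of _ "IV x c"]) simp
    next
      assume "x = d + n"
      then show ?thesis using c by (intro exI[of _ "IP c"]) simp
    qed
  qed
  then obtain i where "e = idx_exp d i" "\<And>x c. i = IV x c \<Longrightarrow> x < d" by blast
  then have "rep d (Atom p es) (XA p i)" using e by (intro rep.atom) auto
  then show ?case by (intro exI[of _ "XA p i"]) simp
next
  case (PNeg P)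
  have "\<exists>T. rep d P T \<and> wf_tree T" using PNeg.prems by (intro PNeg.IH) auto
  then obtain T where T: "rep d P T" by blast
  obtain p es where "P = Atom p es" using PNeg.prems(1) by auto
  then obtain i where "T = XA p i" using T by (auto elim: rep_atomE)
  then show ?case using rep.neg[OF T] by (intro exI[of _ "XN T"]) auto
next
  case (PAnd P Q)
  have "\<exists>T. rep d P T \<and> wf_tree T" using PAnd.prems by (intro PAnd.IH(1)) auto
  moreover have "\<exists>T. rep d Q T \<and> wf_tree T" using PAnd.prems by (intro PAnd.IH(2)) auto
  ultimately show ?case by (meson rep.conj wf_tree.simps(4))
next
  case (POr P Q)
  have "\<exists>T. rep d P T \<and> wf_tree T" using POr.prems by (intro POr.IH(1)) auto
  moreover have "\<exists>T. rep d Q T \<and> wf_tree T" using POr.prems by (intro POr.IH(2)) auto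
  ultimately show ?case by (meson rep.disj wf_tree.simps(4))
next
  case (Iter q \<psi> P)
  have u: "up 1 (lconst lo) = lconst lo" "up 1 (lvar (d + n) - lconst l) = lvar (Suc d + n) - lconst l"
    by (rule lexp_eqI, simp)+
  have "pfree P \<subseteq> {..<Suc d} \<union> {Suc d + n}"
  proof
    fix x assume "x \<in> pfree P"
    then show "x \<in> {..<Suc d} \<union> {Suc d + n}" using Iter.prems(5) by (cases x) auto
  qed
  then have "\<exists>T. rep (Suc d) P T \<and> wf_tree T"
    using Iter.prems u by (intro Iter.IH) auto
  then obtain T where T: "rep (Suc d) P T" "wf_tree T" by blast
  have "framed_by d l \<psi>"
    using Iter.prems(4) unfolding framed_by_def aligned_on.simps has_frame_def equivalent_def by auto
  moreover have "simple_fml \<psi>"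
    unfolding simple_fml_def using Iter.prems(3) by (auto intro!: simple_expI)
  ultimately have "rep d (Iter q \<psi> P) (XI q l (size (conjuncts \<psi>)) T)" using T by (intro rep.iterF) auto
  then show ?case using T by (intro exI[of _ "XI q l (size (conjuncts \<psi>)) T"]) auto
qed

end

lemma regularly_nested_no_branch:
  assumes "regularly_nested S"
  shows "\<not> branch S L ph"
proof
  assume br: "branch S L ph"
  obtain P \<phi> where S: "S = (P, \<phi>)" by (metis prod.collapse)
  obtain n k l where sch: "is_schema S" and mon: "monadic P" and ar: "arithmetic S" and par: "params S = {n}"
    and al: "aligned_on P (lconst k) (lvar n - lconst l)"
    using assms unfolding regularly_nested_def S by auto
  interpret frame n k .
  have dn: "depn \<phi>" unfolding depn_def
  proof (intro allI impI)
    fix \<rho> \<rho>' :: "nat \<Rightarrow> int" assume "\<rho> n = \<rho>' n"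
    then show "sat \<phi> \<rho> = sat \<phi> \<rho>'" using par unfolding params_def S by (intro sat_cong_ffree) auto
  qed
  have "\<exists>T. rep 0 P T \<and> wf_tree T"
  proof (rule initial_rep)
    show "is_pattern P" using sch unfolding is_schema_def S by simp
    show "monadic P" by (rule mon)
    show "\<forall>e\<in>plexps P. \<forall>x\<in>lvars e. \<exists>k. e = lvar x + lconst k" using ar unfolding arithmetic_def S by auto
    show "aligned_on P (lconst k) (lvar (0 + n) - lconst l)" using al by simp
    show "pfree P \<subseteq> {..<0} \<union> {0 + n}" using par unfolding params_def S by auto
  qed
  then obtain T0 where T0: "label_inv (S, {}) T0"
    using dn unfolding S by (auto simp: litform_def consistent_def)
  have X0: "param_values n (snd S) \<subseteq> {0..}"
    using sch par unfolding is_schema_def entails_def param_values_def by auto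
  have sf: "simple_fml \<phi>" unfolding simple_fml_def
    using ar unfolding arithmetic_def S by (auto intro!: simple_expI)
  \<comment> \<open>From \<open>B\<close> on the constraint has a constant truth value, so the
    admissible values are bounded or contain a ray.\<close>
  obtain B where B: "\<And>v w. v \<ge> B \<Longrightarrow> w \<ge> B \<Longrightarrow> sat \<phi> ((\<lambda>_. 0)(n := v)) = sat \<phi> ((\<lambda>_. 0)(n := w))"
    using simple_fml_eventually_constant[OF sf, of n] by blast
  have pr: "m \<in> param_values n \<phi> \<longleftrightarrow> sat \<phi> ((\<lambda>_. 0)(n := m))" for m
    using sat_depn[OF dn, of "(\<lambda>_. 0)(n := m)"] by simp
  have "(\<exists>b. param_values n (snd S) \<subseteq> {..b}) \<or> (\<exists>b. {b..} \<subseteq> param_values n (snd S))"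
  proof (cases "sat \<phi> ((\<lambda>_. 0)(n := B))")
    case True
    have "m \<in> param_values n \<phi>" if "B \<le> m" for m
      unfolding pr using B[OF that order.refl] True by blast
    then have "{B..} \<subseteq> param_values n \<phi>" by (meson atLeast_iff subsetI)
    then show ?thesis unfolding S snd_conv by blast
  next
    case False
    have "m \<le> B" if "m \<in> param_values n \<phi>" for m
    proof (rule ccontr)
      assume "\<not> m \<le> B"
      then have "B \<le> m" by simp
      from B[OF this order.refl] that False show False unfolding pr by blast
    qed
    then have "param_values n \<phi> \<subseteq> {..B}" by (meson atMost_iff subsetI)
    then show ?thesis unfolding S snd_conv by blast
  qed
  then show False using no_branch[OF br T0 X0] by blast
qed

text \<open>A state is a leaf together with the path leading to it, latest node first; every node of the path
  carries the phase in which it was expanded.\<close>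

type_synonym 'p state = "('p label \<times> phase) list \<times> 'p label"

fun lastph :: "('p label \<times> phase) list \<Rightarrow> phase" where
  "lastph [] = Phase1"
| "lastph (x # xs) = snd x"

definition anc :: "'p state \<Rightarrow> 'p label set" where
  "anc x = insert (snd x) (fst ` set (fst x))"

inductive path :: "'p schema \<Rightarrow> 'p state \<Rightarrow> bool" for S where
  root: "path S ([], (S, {}))"
| ext: "path S (pre, l) \<Longrightarrow> \<not> closed_label l \<Longrightarrow> phase_rule p l ls \<Longrightarrow> l' \<in> set ls \<Longrightarrow>
    phase_trans (lastph pre) p l (anc (pre, l)) \<Longrightarrow> path S ((l, p) # pre, l')"

definition lab :: "'p state \<Rightarrow> nat \<Rightarrow> 'p label" where
  "lab x i = (rev (map fst (fst x)) @ [snd x]) ! i"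

definition pha :: "'p state \<Rightarrow> nat \<Rightarrow> phase" where
  "pha x i = rev (map snd (fst x)) ! i"

lemma lab_ext:
  "i \<le> length pre \<Longrightarrow> lab ((l, p) # pre, l') i = lab (pre, l) i"
  "lab ((l, p) # pre, l') (Suc (length pre)) = l'"
  "i < length pre \<Longrightarrow> pha ((l, p) # pre, l') i = pha (pre, l) i"
  "pha ((l, p) # pre, l') (length pre) = p"
  by (auto simp: lab_def pha_def nth_append)

lemma lab_last: "lab (pre, l) (length pre) = l"
  by (simp add: lab_def nth_append)

lemma anc_lab: "anc (pre, l) = lab (pre, l) ` {..length pre}"
proof -
  let ?xs = "rev (map fst pre) @ [l]"
  have "set ?xs = (\<lambda>i. ?xs ! i) ` {..<length ?xs}" by (auto simp: set_conv_nth)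
  then show ?thesis by (simp add: anc_def lab_def lessThan_Suc_atMost)
qed

lemma lastph_pha: "lastph pre = (if pre = [] then Phase1 else pha (pre, l) (length pre - 1))"
  by (cases pre) (auto simp: pha_def nth_append)

lemma path_lab:
  "path S x \<Longrightarrow> lab x 0 = (S, {}) \<and> (\<forall>i<length (fst x). \<not> closed_label (lab x i) \<and>
     (\<exists>ls. phase_rule (pha x i) (lab x i) ls \<and> lab x (Suc i) \<in> set ls) \<and>
     phase_trans (if i = 0 then Phase1 else pha x (i - 1)) (pha x i) (lab x i) (lab x ` {..i}))"
proof (induction rule: path.induct)
  case root
  show ?case by (simp add: lab_def)
next
  case (ext pre l p ls l')
  let ?x = "(pre, l)" and ?y = "((l, p) # pre, l')"
  have im: "lab ?y ` {..i} = lab ?x ` {..i}" if "i \<le> length pre" for i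
    using that by (intro image_cong) (auto simp: lab_ext)
  have "\<not> closed_label (lab ?y i) \<and> (\<exists>ls. phase_rule (pha ?y i) (lab ?y i) ls \<and> lab ?y (Suc i) \<in> set ls) \<and>
     phase_trans (if i = 0 then Phase1 else pha ?y (i - 1)) (pha ?y i) (lab ?y i) (lab ?y ` {..i})"
    if i: "i < length (fst ?y)" for i
  proof (cases "i < length pre")
    case True
    have e: "lab ?y i = lab ?x i" "lab ?y (Suc i) = lab ?x (Suc i)" "pha ?y i = pha ?x i" "lab ?y ` {..i} = lab ?x ` {..i}"
      "(if i = 0 then Phase1 else pha ?y (i - 1)) = (if i = 0 then Phase1 else pha ?x (i - 1))"
      using True im[of i] by (simp_all add: lab_ext)
    show ?thesis unfolding e using ext.IH True unfolding fst_conv by blast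
  next
    case False
    then have ie: "i = length pre" using i by simp
    have "(if i = 0 then Phase1 else pha ?y (i - 1)) = lastph pre"
      using lastph_pha[of pre l] ie by (auto simp: lab_ext)
    then show ?thesis
      using ext.hyps im[of i] ie by (auto simp: lab_ext lab_last anc_lab)
  qed
  moreover have "lab ?y 0 = (S, {})" using ext.IH lab_ext(1)[of 0 pre] by simp
  ultimately show ?case by blast
qed

definition path_rel :: "'p schema \<Rightarrow> ('p state \<times> 'p state) set" where
  "path_rel S = {(((l, p) # pre, l'), (pre, l)) |l p pre l'. path S ((l, p) # pre, l')}"

text \<open>A descending chain extends one path forever. The labels and phases at a fixed distance
  from the root never change again, so the diagonal is an infinite branch.\<close>

lemma wf_path_rel:
  assumes "\<And>L ph. \<not> branch S L ph"
  shows "wf (path_rel S)"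
  unfolding wf_iff_no_infinite_down_chain
proof
  assume "\<exists>f. \<forall>i. (f (Suc i), f i) \<in> path_rel S"
  then obtain f where f: "\<And>i. (f (Suc i), f i) \<in> path_rel S" by blast
  \<comment> \<open>\<open>path_rel\<close> records \<open>path\<close> for the longer state of each
    pair, hence the start at \<open>f 1\<close>.\<close>
  define g where "g = (\<lambda>i. f (Suc i))"
  define N where "N = length (fst (g 0))"
  have path: "path S (g i)" for i using f[of i] unfolding g_def path_rel_def by auto
  have step: "\<exists>l p pre l'. g i = (pre, l) \<and> g (Suc i) = ((l, p) # pre, l')" for i
    using f[of "Suc i"] unfolding g_def path_rel_def by auto
  have len: "length (fst (g i)) = N + i" for i
  proof (induction i)
    case 0
    then show ?case by (simp add: N_def)
  next
    case (Suc i)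
    then show ?case using step[of i] by auto
  qed
  have same1: "lab (g (Suc j)) i = lab (g j) i" if "i \<le> N + j" for i j
    using step[of j] len[of j] that by (auto simp: lab_ext)
  have same2: "pha (g (Suc j)) i = pha (g j) i" if "i < N + j" for i j
    using step[of j] len[of j] that by (auto simp: lab_ext)
  have lab: "lab (g (i + k)) m = lab (g i) m" if "m \<le> N + i" for i k m
    by (induction k) (use that same1 in auto)
  have pha: "pha (g (i + k)) m = pha (g i) m" if "m < N + i" for i k m
    by (induction k) (use that same2 in auto)
  define L where "L = (\<lambda>i. lab (g i) i)"
  define ph where "ph = (\<lambda>i. pha (g (Suc i)) i)"
  have Lg: "lab (g j) m = L m" if "m \<le> j" for j m
    using lab[of m m "j - m"] that by (simp add: L_def)
  have pg: "pha (g j) m = ph m" if "m < j" for j m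
    using pha[of m "Suc m" "j - Suc m"] that by (simp add: ph_def)
  have im: "lab (g j) ` {..m} = L ` {..m}" if "m \<le> j" for j m
    using that by (intro image_cong) (auto simp: Lg)
  have facts: "\<not> closed_label (L i) \<and> (\<exists>ls. phase_rule (ph i) (L i) ls \<and> L (Suc i) \<in> set ls) \<and>
      phase_trans (if i = 0 then Phase1 else ph (i - 1)) (ph i) (L i) (L ` {..i})" for i
  proof -
    have "i < length (fst (g (i + 2)))" using len by simp
    then have "\<not> closed_label (lab (g (i + 2)) i) \<and>
      (\<exists>ls. phase_rule (pha (g (i + 2)) i) (lab (g (i + 2)) i) ls \<and> lab (g (i + 2)) (Suc i) \<in> set ls) \<and>
      phase_trans (if i = 0 then Phase1 else pha (g (i + 2)) (i - 1)) (pha (g (i + 2)) i) (lab (g (i + 2)) i) (lab (g (i + 2)) ` {..i})"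
      using path_lab[OF path[of "i + 2"]] by blast
    moreover have "lab (g (i + 2)) i = L i" "lab (g (i + 2)) (Suc i) = L (Suc i)" "pha (g (i + 2)) i = ph i"
      "lab (g (i + 2)) ` {..i} = L ` {..i}"
      "(if i = 0 then Phase1 else pha (g (i + 2)) (i - 1)) = (if i = 0 then Phase1 else ph (i - 1))"
      using Lg pg im by simp_all
    ultimately show ?thesis by simp
  qed
  have "L 0 = (S, {})" using path_lab[OF path[of 0]] by (simp add: L_def)
  then have "branch S L ph"
    unfolding branch_def using facts facts[of 0] facts[of "Suc i" for i] by (auto simp: atMost_0)
  then show False using assms by blast
qed

section \<open>Tableaux as multisets of leaves\<close>

inductive leaf_states :: "('p label \<times> phase) list \<Rightarrow> 'p tableau \<Rightarrow> 'p state multiset \<Rightarrow> bool" where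
  leaf: "leaf_states pre (Leaf l) {#(pre, l)#}"
| looped: "leaf_states pre (Looped l) {#}"
| inner: "list_all2 (leaf_states ((l, p) # pre)) ts Ms \<Longrightarrow> M = sum_list Ms \<Longrightarrow> leaf_states pre (Inner l ts) M"

inductive_cases leaf_states_leafE: "leaf_states pre (Leaf l) M"
inductive_cases leaf_states_innerE: "leaf_states pre (Inner l ts) M"

text \<open>Closed leaves stay in the multiset but are exempt: no rule touches them, so
  irreducibility of the tableau says nothing about them.\<close>

definition waiting :: "phase \<Rightarrow> 'p state \<Rightarrow> bool" where
  "waiting ph x \<longleftrightarrow> closed_label (snd x) \<or> phase_trans (lastph (fst x)) ph (snd x) (anc x)"

text \<open>A rule replaces a leaf by its children, and Looping replaces it by nothing: in both
  cases one step down in the multiset extension of \<open>path_rel\<close>.\<close>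

lemma leaf_states_step:
  assumes "apply_at_leaf ph N t t'" "leaf_states pre t M" "\<forall>x\<in>#M. path S x \<and> waiting ph x"
  shows "\<exists>K x J. M = add_mset x K \<and> leaf_states pre t' (K + J) \<and> (\<forall>y\<in>#J. (y, x) \<in> path_rel S \<and> path S y \<and> waiting ph y)"
  using assms
proof (induction arbitrary: pre M rule: apply_at_leaf.induct)
  case (expand l ls)
  have M: "M = {#(pre, l)#}" using expand.prems(1) by (auto elim: leaf_states_leafE)
  have "path S (pre, l)" "phase_trans (lastph pre) ph l (anc (pre, l))"
    using expand.prems(2) expand.hyps(1) M by (auto simp: waiting_def)
  then have pa: "path S ((l, ph) # pre, l')" if "l' \<in> set ls" for l'
    using expand.hyps that by (intro path.ext)
  let ?J = "image_mset (\<lambda>l'. ((l, ph) # pre, l')) (mset ls)"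
  have "list_all2 (leaf_states ((l, ph) # pre)) (map Leaf ls) (map (\<lambda>l'. {#((l, ph) # pre, l')#}) ls)"
    by (induction ls) (auto intro: leaf_states.leaf)
  moreover have "?J = sum_list (map (\<lambda>l'. {#((l, ph) # pre, l')#}) ls)"
    by (induction ls) auto
  ultimately have "leaf_states pre (Inner l (map Leaf ls)) ?J" by (rule leaf_states.inner)
  moreover have "\<forall>y\<in>#?J. (y, (pre, l)) \<in> path_rel S \<and> path S y \<and> waiting ph y"
  proof
    fix y assume "y \<in># ?J"
    then obtain l' where l': "l' \<in> set ls" "y = ((l, ph) # pre, l')" by auto
    have "(y, (pre, l)) \<in> path_rel S" unfolding path_rel_def l'(2) using pa[OF l'(1)] by blast
    then show "(y, (pre, l)) \<in> path_rel S \<and> path S y \<and> waiting ph y"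
      using pa[OF l'(1)] l'(2) by (simp add: waiting_def phase_trans_same)
  qed
  ultimately show ?case unfolding M by (intro exI[of _ "{#}"] exI[of _ "(pre, l)"] exI[of _ ?J]) simp
next
  case (looping l l')
  have "M = {#(pre, l)#}" using looping.prems(1) by (auto elim: leaf_states_leafE)
  then show ?case by (intro exI[of _ "{#}"] exI[of _ "(pre, l)"] exI[of _ "{#}"]) (simp add: leaf_states.looped)
next
  case (inner t t' l ts us)
  from inner.prems(1) obtain p Ms where Ms: "list_all2 (leaf_states ((l, p) # pre)) (ts @ t # us) Ms" "M = sum_list Ms"
    by (auto elim: leaf_states_innerE)
  then obtain A m B where AB: "Ms = A @ m # B" "list_all2 (leaf_states ((l, p) # pre)) ts A" "leaf_states ((l, p) # pre) t m"
    "list_all2 (leaf_states ((l, p) # pre)) us B"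
    by (auto simp: list_all2_append1 list_all2_Cons1)
  have "\<forall>x\<in>#m. path S x \<and> waiting ph x" using inner.prems(2) Ms(2) AB(1) by simp
  from inner.IH[OF AB(3) this] obtain K x J where K: "m = add_mset x K" "leaf_states ((l, p) # pre) t' (K + J)"
    "\<forall>y\<in>#J. (y, x) \<in> path_rel S \<and> path S y \<and> waiting ph y" by blast
  let ?K = "sum_list A + K + sum_list B"
  have "list_all2 (leaf_states ((l, p) # pre)) (ts @ t' # us) (A @ (K + J) # B)"
    using AB K(2) by (simp add: list_all2_appendI)
  moreover have "?K + J = sum_list (A @ (K + J) # B)" by simp
  ultimately have "leaf_states pre (Inner l (ts @ t' # us)) (?K + J)" by (rule leaf_states.inner)
  moreover have "M = add_mset x ?K" using Ms(2) AB(1) K(1) by simp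
  ultimately show ?case using K(3) by blast
qed

lemma sum_list_mset_mem: "x \<in># sum_list Ms \<Longrightarrow> \<exists>m\<in>set Ms. x \<in># m"
  by (induction Ms) auto

lemma leaf_states_apply:
  assumes "leaf_states pre0 t M" "x \<in># M" "apply_at_leaf ph N (Leaf (snd x)) t1"
  shows "\<exists>t'. apply_at_leaf ph N t t'"
  using assms
proof (induction rule: leaf_states.induct)
  case (leaf pre l)
  then show ?case by auto
next
  case (inner l p pre ts Ms M)
  have "x \<in># sum_list Ms" using inner.prems(1) inner.hyps by simp
  from sum_list_mset_mem[OF this] obtain m where m: "m \<in> set Ms" "x \<in># m" by blast
  then obtain i where i: "i < length Ms" "Ms ! i = m" by (auto simp: in_set_conv_nth)
  then have il: "i < length ts" using list_all2_lengthD[OF inner.IH] by simp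
  have "\<exists>t'. apply_at_leaf ph N (ts ! i) t'" using list_all2_nthD[OF inner.IH il] i m inner.prems(2) by blast
  then obtain t' where t': "apply_at_leaf ph N (ts ! i) t'" by blast
  have "ts = take i ts @ ts ! i # drop (Suc i) ts" using il by (rule id_take_nth_drop)
  then show ?case using apply_at_leaf.inner[OF t', of l "take i ts" "drop (Suc i) ts"] by metis
qed simp

lemma leaf_states_anc: "leaf_states pre0 t M \<Longrightarrow> x \<in># M \<Longrightarrow> anc x \<subseteq> fst ` set pre0 \<union> labels t"
proof (induction rule: leaf_states.induct)
  case (leaf pre l)
  then show ?case by (auto simp: anc_def)
next
  case (inner l p pre ts Ms M)
  have "x \<in># sum_list Ms" using inner.prems inner.hyps by simp
  from sum_list_mset_mem[OF this] obtain m where m: "m \<in> set Ms" "x \<in># m" by blast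
  then obtain i where i: "i < length Ms" "Ms ! i = m" by (auto simp: in_set_conv_nth)
  then have il: "i < length ts" using list_all2_lengthD[OF inner.IH] by simp
  have "anc x \<subseteq> fst ` set ((l, p) # pre) \<union> labels (ts ! i)" using list_all2_nthD[OF inner.IH il] i m by blast
  moreover have "ts ! i \<in> set ts" using il by simp
  ultimately show ?case by auto
qed simp

text \<open>A rule that applies to a leaf applies to the tableau, and the ancestors of a leaf are
  among the labels offered to Looping. So irreducibility of the tableau descends to every leaf that
  is not closed.\<close>

lemma irreducible_waiting:
  assumes "irreducible_in ph t" "leaf_states [] t M" "x \<in># M" "waiting ph x"
  shows "waiting (next_phase ph) x"
proof (cases "closed_label (snd x)")
  case False
  have "irr ph (snd x) (anc x)"
    unfolding irr_def
  proof (intro conjI notI impI ballI)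
    assume "\<exists>ls. phase_rule ph (snd x) ls"
    then have "\<exists>t1. apply_at_leaf ph (labels t) (Leaf (snd x)) t1" using apply_at_leaf.expand[OF False] by blast
    then show False using leaf_states_apply[OF assms(2,3)] assms(1) unfolding irreducible_in_def apply_phase_def by blast
  next
    fix l' assume p: "ph = Phase2" and l': "l' \<in> anc x" and h: "hat (snd x) \<sqsubset>\<^sub>l hat l'"
    have "l' \<in> labels t" using leaf_states_anc[OF assms(2,3)] l' by auto
    from apply_at_leaf.looping[OF False p this h] show False
      using leaf_states_apply[OF assms(2,3)] assms(1) unfolding irreducible_in_def apply_phase_def by blast
  qed
  then show ?thesis using assms(4) False phase_trans_next unfolding waiting_def by blast
qed (simp add: waiting_def)

lemma strategy_step_mult:
  assumes "strategy_step (ph, t) (ph', t')" "leaf_states [] t M" "\<forall>x\<in>#M. path S x \<and> waiting ph x"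
  shows "\<exists>M'. leaf_states [] t' M' \<and> (\<forall>x\<in>#M'. path S x \<and> waiting ph' x) \<and> (M', M) \<in> mult1 (path_rel S)"
proof -
  have *: "\<exists>M'. leaf_states [] t' M' \<and> (\<forall>x\<in>#M'. path S x \<and> waiting ph' x) \<and> (M', M) \<in> mult1 (path_rel S)"
    if w: "\<forall>x\<in>#M. path S x \<and> waiting ph' x" and ap: "apply_phase ph' t t'"
  proof -
    from leaf_states_step[OF ap[unfolded apply_phase_def] assms(2) w] obtain K x J where K: "M = add_mset x K" "leaf_states [] t' (K + J)"
      "\<forall>y\<in>#J. (y, x) \<in> path_rel S \<and> path S y \<and> waiting ph' y" by blast
    have "(K + J, M) \<in> mult1 (path_rel S)" unfolding mult1_def using K(1,3) by blast
    then show ?thesis using K w by (intro exI[of _ "K + J"]) auto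
  qed
  from assms(1) show ?thesis
  proof cases
    case stay
    then show ?thesis using * assms(3) by blast
  next
    case switch
    then have "\<forall>x\<in>#M. path S x \<and> waiting ph' x" using irreducible_waiting[OF switch(1) assms(2)] assms(3) by blast
    then show ?thesis using * switch by blast
  next
    case switch2
    then have "\<forall>x\<in>#M. path S x \<and> waiting (next_phase ph) x"
      using irreducible_waiting[OF switch2(1) assms(2)] assms(3) by blast
    then have "\<forall>x\<in>#M. path S x \<and> waiting ph' x"
      using irreducible_waiting[OF switch2(2) assms(2)] switch2 by blast
    then show ?thesis using * switch2 by blast
  qed
qed

theorem theorem4:
  fixes S :: "'p schema"
  assumes "regularly_nested S"
  shows "\<nexists>D. infinite_derivation S D"
proof
  assume "\<exists>D. infinite_derivation S D"
  then obtain D where D: "D 0 = (Phase1, Leaf (S, {}))" "\<And>i. strategy_step (D i) (D (Suc i))"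
    unfolding infinite_derivation_def by blast
  have "\<exists>f. \<forall>i. (leaf_states [] (snd (D i)) (f i) \<and> (\<forall>x\<in>#f i. path S x \<and> waiting (fst (D i)) x)) \<and> (f (Suc i), f i) \<in> mult1 (path_rel S)"
  proof (rule dependent_nat_choice)
    show "\<exists>M. leaf_states [] (snd (D 0)) M \<and> (\<forall>x\<in>#M. path S x \<and> waiting (fst (D 0)) x)"
      by (rule exI[of _ "{#([], (S, {}))#}"]) (simp add: D leaf_states.leaf path.root waiting_def phase_trans_same)
  next
    fix M i assume "leaf_states [] (snd (D i)) M \<and> (\<forall>x\<in>#M. path S x \<and> waiting (fst (D i)) x)"
    then show "\<exists>M'. (leaf_states [] (snd (D (Suc i))) M' \<and> (\<forall>x\<in>#M'. path S x \<and> waiting (fst (D (Suc i))) x)) \<and> (M', M) \<in> mult1 (path_rel S)"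
      using strategy_step_mult[of "fst (D i)" "snd (D i)" "fst (D (Suc i))" "snd (D (Suc i))" M S] D(2)[of i] by auto
  qed
  moreover have "wf (mult1 (path_rel S))"
    using wf_path_rel regularly_nested_no_branch[OF assms] by (intro wf_mult1) blast
  ultimately show False unfolding wf_iff_no_infinite_down_chain by blast
qed

end
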